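(* Let $n\geq2$ and let $X=X(\mathcal{H},K,L)$ be the stratum in the Jordan stratification of $\mathrm{PSp}_{2n}/\!/\mathrm{PSp}_{2n}$ corresponding to the Coxeter class $[S_F]$. Then $X$ is normal if and only if $X(\mathcal{H},L)$ is normal and the following holds: whenever $j\in\{0,\dots,n\}$ and $k\in K$ are such that $K^{x_j}=1$ and $N_j\in\hat{S}_F\cap k\hat{S}_F$, one has $k\hat{S}_F=\hat{S}_F$.
   Context: $\Phi$ is the root system of type $C_n$, with basis $\{\alpha_1,\dots,\alpha_n\}$ (Bourbaki numbering), Weyl group $W$, coroot lattice $Q^\vee$, coweight lattice $P^\vee$, $E=Q^\vee\otimes_{\mathbb{Z}}\mathbb{R}$ with direction $V$, $E_{\mathbb{C}}=E+iV$. $\mathcal{H}$ is the set of affine hyperplanes $\{x\in E:\alpha(x)=m\}$, $\alpha\in\Phi$, $m\in\mathbb{Z}$; $\mathcal{W}_{\mathcal{H}}=W\ltimes Q^\vee$. $K=P^\vee/Q^\vee\simeq\mathbb{Z}/2\mathbb{Z}$ and $\mathcal{W}_{\mathcal{H},K}=W\ltimes P^\vee\simeq K\ltimes\mathcal{W}_{\mathcal{H}}$. A flat $L$ is a nonempty intersection of elements of $\mathcal{H}$ ($E$ included), $L_{\mathbb{C}}=L+iV(L)$ with $V(L)$ its direction. $X(\mathcal{H},K,L)=\mathcal{W}_{\mathcal{H},K}L_{\mathbb{C}}/\mathcal{W}_{\mathcal{H},K}$ and $X(\mathcal{H},L)=\mathcal{W}_{\mathcal{H}}L_{\mathbb{C}}/\mathcal{W}_{\mathcal{H}}$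 are closed reduced subvarieties of $E_{\mathbb{C}}/\mathcal{W}_{\mathcal{H},K}\simeq\mathrm{PSp}_{2n}/\!/\mathrm{PSp}_{2n}$ and $E_{\mathbb{C}}/\mathcal{W}_{\mathcal{H}}\simeq\mathrm{Sp}_{2n}/\!/\mathrm{Sp}_{2n}$ (isomorphisms induced by $\exp(2\pi i\,-)$ and Chevalley's isomorphism); they are the quotients $\overline{J}/\!/G$ of closures of semisimple Jordan classes $J=G\cdot(Z(M)^\circ s)^{reg}$, $s$ semisimple, $M=C_G(s)^\circ$, where $reg$ denotes the points whose $G$-orbit has maximal dimension (Jordan stratification). The closed fundamental alcove $\overline{\mathcal{A}}$ is the simplex with vertices $x_0=0$ and $x_i=\omega_i^\vee/d_i$ ($\omega_i^\vee$ fundamental coweights, $\sum_i d_i\alpha_i$ the highest root). $S=\{N_0,\dots,N_n\}$ is the set of reflections in the walls of $\overline{\mathcal{A}}$, $N_i$ in the wall opposite to $x_i$. The nontrivial element of $K$ acts on the vertices by $x_j\mapsto x_{n-j}$, and on $S$ by $N_j\mapsto N_{n-j}$; $K^{x_j}$ is the stabiliser of $x_j$. For a face $F$ of $\overline{\mathcal{A}}$, $S_F$ is the set of reflections in the walls containing $F$, and $\hat{S}_F=S\setminus S_F=\{N_i:x_i\in\overline{F}\}$. The Coxeter class of $S_F$ is $[S_F]=\{S'\subset S: S'=wS_Fw^{-1}\text{ for some }w\in\mathcal{W}_{\mathcal{H}}\}$. The strata $X(\mathcal{H},K,L)$ and $X(\mathcal{H},L)$ correspond to $[S_F]$ when $L$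 is the affine span of $F$. *)

theory Defs
  imports "HOL-Analysis.Analysis" "HOL-Algebra.Generated_Groups" "HOL-Algebra.Bij" "HOL-Algebra.Ring"
begin

section \<open>Rings of fractions and integrally closed domains\<close>

text \<open>
  The fraction \<open>a / s\<close> is the class of \<open>(a, s)\<close> for the relation
  \<open>u (a t - b s) = 0\<close> for some \<open>u \<in> S\<close>; the set \<open>S\<close> is meant to be multiplicative.
\<close>

definition fraction :: "('a, 'm) ring_scheme \<Rightarrow> 'a set \<Rightarrow> 'a \<Rightarrow> 'a \<Rightarrow> ('a \<times> 'a) set" where
  "fraction R S a s =
     {(b, t). b \<in> carrier R \<and> t \<in> S \<and>
        (\<exists>u\<in>S. u \<otimes>\<^bsub>R\<^esub> (a \<otimes>\<^bsub>R\<^esub> t \<ominus>\<^bsub>R\<^esub> b \<otimes>\<^bsub>R\<^esub> s) = \<zero>\<^bsub>R\<^esub>)}"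

definition localization :: "('a, 'm) ring_scheme \<Rightarrow> 'a set \<Rightarrow> ('a \<times> 'a) set ring" where
  "localization R S =
     \<lparr>carrier = {fraction R S a s | a s. a \<in> carrier R \<and> s \<in> S},
      mult = (\<lambda>X Y. \<Union>(a, s)\<in>X. \<Union>(b, t)\<in>Y. fraction R S (a \<otimes>\<^bsub>R\<^esub> b) (s \<otimes>\<^bsub>R\<^esub> t)),
      one = fraction R S \<one>\<^bsub>R\<^esub> \<one>\<^bsub>R\<^esub>,
      zero = fraction R S \<zero>\<^bsub>R\<^esub> \<one>\<^bsub>R\<^esub>,
      add = (\<lambda>X Y. \<Union>(a, s)\<in>X. \<Union>(b, t)\<in>Y.
               fraction R S (a \<otimes>\<^bsub>R\<^esub> t \<oplus>\<^bsub>R\<^esub> b \<otimes>\<^bsub>R\<^esub> s) (s \<otimes>\<^bsub>R\<^esub> t))\<rparr>"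

definition integral_over :: "('a, 'm) ring_scheme \<Rightarrow> 'a set \<Rightarrow> 'a \<Rightarrow> bool" where
  "integral_over B A x \<longleftrightarrow>
     (\<exists>(d::nat) c. (\<forall>i<d. c i \<in> A) \<and>
        x [^]\<^bsub>B\<^esub> d \<oplus>\<^bsub>B\<^esub> (\<Oplus>\<^bsub>B\<^esub>i\<in>{..<d}. c i \<otimes>\<^bsub>B\<^esub> x [^]\<^bsub>B\<^esub> i) = \<zero>\<^bsub>B\<^esub>)"

definition fraction_field :: "('a, 'm) ring_scheme \<Rightarrow> ('a \<times> 'a) set ring" where
  "fraction_field R = localization R (carrier R - {\<zero>\<^bsub>R\<^esub>})"

definition integrally_closed_domain :: "('a, 'm) ring_scheme \<Rightarrow> bool" where
  "integrally_closed_domain R \<longleftrightarrow> domain R \<and>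
     (let D = (\<lambda>a. fraction R (carrier R - {\<zero>\<^bsub>R\<^esub>}) a \<one>\<^bsub>R\<^esub>) ` carrier R in
      \<forall>x\<in>carrier (fraction_field R). integral_over (fraction_field R) D x \<longrightarrow> x \<in> D)"


section \<open>The root system of type \<open>C\<^sub>n\<close>\<close>

text \<open>
  Here \<open>n = CARD('n)\<close>, and the linear order on \<open>'n\<close> serves only to number the standard
  basis \<open>\<epsilon>\<^sub>1, \<dots>, \<epsilon>\<^sub>n\<close>. Both \<open>E\<close> and its direction \<open>V\<close> are \<open>real^'n\<close>; roots are regarded as
  elements of \<open>V\<close> by means of the standard inner product, so \<open>\<alpha>(x)\<close> is \<open>\<alpha> \<bullet> x\<close>.
\<close>

definition eps :: "nat \<Rightarrow> real^'n::{finite,linorder}" where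
  "eps i = axis (sorted_list_of_set UNIV ! (i - 1)) 1"

definition roots :: "(real^'n::{finite,linorder}) set" where
  "roots =
     {c *\<^sub>R eps i | c i. c \<in> {2, -2} \<and> i \<in> {1..CARD('n)}} \<union>
     {c *\<^sub>R eps i + d *\<^sub>R eps j | c d i j. c \<in> {1, -1} \<and> d \<in> {1, -1} \<and>
        i \<in> {1..CARD('n)} \<and> j \<in> {1..CARD('n)} \<and> i \<noteq> j}"

definition simple_root :: "nat \<Rightarrow> real^'n::{finite,linorder}" where
  "simple_root i = (if i < CARD('n) then eps i - eps (i + 1) else 2 *\<^sub>R eps i)"

definition highest_root :: "real^'n::{finite,linorder}" where
  "highest_root = 2 *\<^sub>R eps 1"

definition coroot :: "real^'n \<Rightarrow> real^'n" where
  "coroot \<alpha> = (2 / (\<alpha> \<bullet> \<alpha>)) *\<^sub>R \<alpha>"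

definition coroot_lattice :: "(real^'n::{finite,linorder}) set" where
  "coroot_lattice = {\<Sum>\<alpha>\<in>roots. of_int (m \<alpha>) *\<^sub>R coroot \<alpha> | m :: real^'n::_ \<Rightarrow> int. True}"

definition coweight_lattice :: "(real^'n::{finite,linorder}) set" where
  "coweight_lattice = {v. \<forall>\<alpha>\<in>roots. \<alpha> \<bullet> v \<in> \<int>}"

definition weyl_group :: "(real^'n::{finite,linorder} \<Rightarrow> real^'n::_) set" where
  "weyl_group = generate (BijGroup UNIV) {\<lambda>x. x - (\<alpha> \<bullet> x) *\<^sub>R coroot \<alpha> | \<alpha>. \<alpha> \<in> roots}"

text \<open>
  The group \<open>W \<ltimes> \<Lambda>\<close> of affine transformations of \<open>E\<close>; it is \<open>\<W>\<^sub>\<H>\<close> for the coroot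
  lattice and \<open>\<W>\<^sub>\<H>\<^sub>,\<^sub>K\<close> for the coweight lattice.
\<close>

definition affine_weyl :: "(real^'n::{finite,linorder}) set \<Rightarrow> (real^'n::_ \<Rightarrow> real^'n::_) set" where
  "affine_weyl \<Lambda> = {\<lambda>x. w x + q | w q. w \<in> weyl_group \<and> q \<in> \<Lambda>}"


section \<open>The fundamental alcove, its faces, and the group \<open>K\<close>\<close>

definition fundamental_coweight :: "nat \<Rightarrow> real^'n::{finite,linorder}" where
  "fundamental_coweight i =
     (THE v. \<forall>j\<in>{1..CARD('n)}. simple_root j \<bullet> v = (if j = i then 1 else 0))"

text \<open>
  The coefficient \<open>d\<^sub>i\<close> of \<open>\<alpha>\<^sub>i\<close> in the highest root is its pairing with \<open>\<omega>\<^sub>i\<^sup>\<or>\<close>.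
\<close>

definition vertex :: "nat \<Rightarrow> real^'n::{finite,linorder}" where
  "vertex i = (if i = 0 then 0
     else (1 / ((highest_root :: real^'n::_) \<bullet> fundamental_coweight i)) *\<^sub>R fundamental_coweight i)"

definition closed_alcove :: "(real^'n::{finite,linorder}) set" where
  "closed_alcove = convex hull (vertex ` {0..CARD('n)})"

definition wall :: "nat \<Rightarrow> (real^'n::{finite,linorder}) set" where
  "wall i = affine hull (vertex ` ({0..CARD('n)} - {i}))"

text \<open>The orthogonal reflection \<open>N\<^sub>i\<close> in the wall opposite to \<open>x\<^sub>i\<close>.\<close>

definition wall_reflection :: "nat \<Rightarrow> real^'n::{finite,linorder} \<Rightarrow> real^'n::_" where
  "wall_reflection i x = 2 *\<^sub>R closest_point (wall i) x - x"

definition simple_reflections :: "(real^'n::{finite,linorder} \<Rightarrow> real^'n::_) set" where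
  "simple_reflections = wall_reflection ` {0..CARD('n)}"

text \<open>Faces are relatively open, so that the closed alcove is their disjoint union.\<close>

definition alcove_face :: "(real^'n::{finite,linorder}) set \<Rightarrow> bool" where
  "alcove_face F \<longleftrightarrow> (\<exists>T. T face_of closed_alcove \<and> T \<noteq> {} \<and> F = rel_interior T)"

definition face_reflections ::
    "(real^'n::{finite,linorder}) set \<Rightarrow> (real^'n::_ \<Rightarrow> real^'n::_) set" where
  "face_reflections F = {wall_reflection i | i. i \<in> {0..CARD('n)} \<and> F \<subseteq> wall i}"

definition face_coreflections ::
    "(real^'n::{finite,linorder}) set \<Rightarrow> (real^'n::_ \<Rightarrow> real^'n::_) set" where
  "face_coreflections F = simple_reflections - face_reflections F"

definition conj_set :: "('a \<Rightarrow> 'a) \<Rightarrow> ('a \<Rightarrow> 'a) set \<Rightarrow> ('a \<Rightarrow> 'a) set" where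
  "conj_set g A = (\<lambda>s. g \<circ> s \<circ> inv_into UNIV g) ` A"

definition coxeter_class ::
    "(real^'n::{finite,linorder} \<Rightarrow> real^'n::_) set \<Rightarrow> (real^'n::_ \<Rightarrow> real^'n::_) set set" where
  "coxeter_class A =
     {A'. A' \<subseteq> simple_reflections \<and> (\<exists>w\<in>affine_weyl coroot_lattice. A' = conj_set w A)}"

text \<open>
  \<open>K = P\<^sup>\<or> / Q\<^sup>\<or>\<close> realised inside \<open>\<W>\<^sub>\<H>\<^sub>,\<^sub>K \<simeq> K \<ltimes> \<W>\<^sub>\<H>\<close> as the stabiliser of the
  fundamental alcove, which is how it acts on the vertices and, by conjugation, on \<open>S\<close>.
\<close>

definition alcove_group :: "(real^'n::{finite,linorder} \<Rightarrow> real^'n::_) set" where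
  "alcove_group = {g \<in> affine_weyl coweight_lattice. g ` closed_alcove = closed_alcove}"

definition vertex_stabiliser :: "nat \<Rightarrow> (real^'n::{finite,linorder} \<Rightarrow> real^'n::_) set" where
  "vertex_stabiliser j = {g \<in> alcove_group. g (vertex j) = vertex j}"


section \<open>The quotients of \<open>E\<^sub>\<complex>\<close> and their strata\<close>

text \<open>The point \<open>x + \<i>v\<close> of \<open>E\<^sub>\<complex> = E + \<i>V\<close>.\<close>

definition complex_point :: "real^'n \<Rightarrow> real^'n \<Rightarrow> complex^'n" where
  "complex_point x v = (\<chi> k. Complex (x $ k) (v $ k))"

definition direction :: "(real^'n) set \<Rightarrow> (real^'n) set" where
  "direction L = {x - y | x y. x \<in> L \<and> y \<in> L}"

definition complexify :: "(real^'n) set \<Rightarrow> (complex^'n) set" where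
  "complexify L = {complex_point x v | x v. x \<in> L \<and> v \<in> direction L}"

text \<open>
  The extension of an affine transformation \<open>g\<close> of \<open>E\<close> to \<open>E\<^sub>\<complex>\<close>; its linear part is
  \<open>v \<mapsto> g v - g 0\<close>.
\<close>

definition complex_action :: "(real^'n \<Rightarrow> real^'n) \<Rightarrow> complex^'n \<Rightarrow> complex^'n" where
  "complex_action g z =
     (let x = (\<chi> k. Re (z $ k)); v = (\<chi> k. Im (z $ k)) in complex_point (g x) (g v - g 0))"

definition orbit_of ::
    "(real^'n::{finite,linorder}) set \<Rightarrow> complex^'n::_ \<Rightarrow> (complex^'n::_) set" where
  "orbit_of \<Lambda> z = {complex_action g z | g. g \<in> affine_weyl \<Lambda>}"

text \<open>
  Via \<open>exp(2\<pi>\<i> -)\<close>, \<open>E\<^sub>\<complex> / \<Lambda>\<close> is the torus with cocharacter lattice \<open>\<Lambda>\<close>: its characters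
  are the exponentials of \<open>2\<pi>\<i>\<mu>\<close> with \<open>\<mu>\<close> in the dual lattice, and its regular functions
  are their linear combinations.
\<close>

definition dual_lattice :: "(real^'n) set \<Rightarrow> (real^'n) set" where
  "dual_lattice \<Lambda> = {\<mu>. \<forall>q\<in>\<Lambda>. \<mu> \<bullet> q \<in> \<int>}"

definition torus_character :: "real^'n \<Rightarrow> complex^'n \<Rightarrow> complex" where
  "torus_character \<mu> z = exp (2 * of_real pi * \<i> * (\<Sum>k\<in>UNIV. of_real (\<mu> $ k) * z $ k))"

definition torus_regular :: "(real^'n) set \<Rightarrow> (complex^'n \<Rightarrow> complex) \<Rightarrow> bool" where
  "torus_regular \<Lambda> f \<longleftrightarrow>
     (\<exists>A c. finite A \<and> A \<subseteq> dual_lattice \<Lambda> \<and> f = (\<lambda>z. \<Sum>\<mu>\<in>A. c \<mu> * torus_character \<mu> z))"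

text \<open>
  The points of \<open>E\<^sub>\<complex> / (W \<ltimes> \<Lambda>)\<close> are the orbits. Its regular functions are those whose pullback
  to the torus \<open>T = E\<^sub>\<complex> / \<Lambda>\<close> is regular, that is, the \<open>W\<close>-invariants in \<open>\<complex>[T]\<close>. By Chevalley's
  theorem, this is the affine variety \<open>G//G\<close>, with \<open>G = Sp\<^sub>2\<^sub>n\<close> for the coroot lattice and
  \<open>G = PSp\<^sub>2\<^sub>n\<close> for the coweight lattice.
\<close>

definition quotient_regular ::
    "(real^'n::{finite,linorder}) set \<Rightarrow> ((complex^'n::_) set \<Rightarrow> complex) \<Rightarrow> bool" where
  "quotient_regular \<Lambda> \<phi> \<longleftrightarrow> torus_regular \<Lambda> (\<phi> \<circ> orbit_of \<Lambda>)"

text \<open>The coordinate ring of a closed subset \<open>X\<close>, with its reduced structure.\<close>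

definition coordinate_ring ::
    "(real^'n::{finite,linorder}) set \<Rightarrow> (complex^'n::_) set set \<Rightarrow> ((complex^'n::_) set \<Rightarrow> complex) ring" where
  "coordinate_ring \<Lambda> X =
     \<lparr>carrier = {restrict \<phi> X | \<phi>. quotient_regular \<Lambda> \<phi>},
      mult = (\<lambda>f g. \<lambda>p\<in>X. f p * g p),
      one = (\<lambda>p\<in>X. 1),
      zero = (\<lambda>p\<in>X. 0),
      add = (\<lambda>f g. \<lambda>p\<in>X. f p + g p)\<rparr>"

definition local_ring ::
    "(real^'n::{finite,linorder}) set \<Rightarrow> (complex^'n::_) set set \<Rightarrow> (complex^'n::_) set \<Rightarrow>
     (((complex^'n::_) set \<Rightarrow> complex) \<times> ((complex^'n::_) set \<Rightarrow> complex)) set ring" where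
  "local_ring \<Lambda> X p =
     localization (coordinate_ring \<Lambda> X) {f \<in> carrier (coordinate_ring \<Lambda> X). f p \<noteq> 0}"

definition normal_variety ::
    "(real^'n::{finite,linorder}) set \<Rightarrow> (complex^'n::_) set set \<Rightarrow> bool" where
  "normal_variety \<Lambda> X \<longleftrightarrow> (\<forall>p\<in>X. integrally_closed_domain (local_ring \<Lambda> X p))"

definition stratum ::
    "(real^'n::{finite,linorder}) set \<Rightarrow> (real^'n::_) set \<Rightarrow> (complex^'n::_) set set" where
  "stratum \<Lambda> L =
     orbit_of \<Lambda> ` {complex_action g z | g z. g \<in> affine_weyl \<Lambda> \<and> z \<in> complexify L}"

end

theory Submission
  imports Defs "HOL-Computational_Algebra.Polynomial_Factorial" "HOL-Computational_Algebra.Fundamental_Theorem_Algebra"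
    "HOL-Computational_Algebra.Field_as_Ring" "HOL-Combinatorics.Permutations"
begin

text \<open>
  The functions \<open>x\<^sub>k = cos (2 \<pi> z\<^sub>k)\<close> turn \<open>E\<^sub>\<complex> / (W \<ltimes> \<Lambda>)\<close> into the quotient of \<open>\<complex>\<^sup>n\<close> by the
  symmetric group, together with the global sign \<open>-1\<close> when \<open>\<Lambda>\<close> is the coweight lattice, and the flat
  spanned by the vertices \<open>x\<^sub>i\<close>, \<open>i \<in> I\<close>, into an affine subspace \<open>M\<close> given by equalities
  \<open>x\<^sub>i = x\<^sub>i\<^sub>+\<^sub>1\<close>, where \<open>x\<^sub>0 = -1\<close> and \<open>x\<^sub>n\<^sub>+\<^sub>1 = 1\<close>. The image of \<open>M\<close> is normal iff every polynomial on
  \<open>M\<close> invariant under the stabiliser of \<open>M\<close> is locally a restriction of invariants. For the symmetric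
  group this means that all blocks of equal nonconstant coordinates have the same size: then the
  invariants are generated by power sums, which extend, and otherwise first derivatives at a point with
  all nonconstant coordinates equal give an obstruction. If the sizes agree, adding the sign changes
  nothing near a point \<open>p\<close> of \<open>M\<close> unless \<open>-p\<close> has a permutation in \<open>M\<close>. If \<open>I\<close> is invariant under
  \<open>i \<mapsto> n - i\<close>, the sign stabilises \<open>M\<close> up to a permutation and averaging extends the invariants. If it
  is not, the sum of the coordinates is invariant under the stabiliser of \<open>M\<close>, but it takes opposite
  values at the vertices \<open>x\<^sub>j\<close> and \<open>x\<^sub>n\<^sub>-\<^sub>j\<close>, which have the same image. So \<open>j, n - j \<in> I\<close> is
  possible only for \<open>2 j = n\<close>, and then \<open>p\<close> has \<open>n / 2\<close> coordinates \<open>1\<close> and \<open>n / 2\<close> coordinates \<open>-1\<close>;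
  near such points the two branches \<open>M\<close> and \<open>-M\<close> are separated by an explicit interpolation.
\<close>

section \<open>Polynomial functions\<close>

text \<open>Denominators are the recurring obstacle, so integrality is always stated after clearing
  them: \<open>a / b\<close> is integral when
  \<open>a ^ d + (\<Sum>i<d. c i * a ^ i * b ^ (d - i)) = 0\<close>, and it belongs to the local
  ring at p when \<open>t * a = b * c\<close> for some t not vanishing at p. In this form the
  condition passes from the rings of fractions in the definitions to polynomial functions on M. The
  reduction to extending invariants rests on polynomial rings being integrally closed. This comes
  from one variable: in a direction where the top form of the denominator does not vanish, the
  denominator is monic up to a constant on every parallel line. Division with remainder is then
  polynomial in the base point, and divisibility can be tested line by line. The face enters only
  through its reflections. Conjugate sets of reflections have fixed spaces that differ by an element
  of the affine Weyl group, and such flats have the same image in both quotients; hence one index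
  set I serves the whole Coxeter class.\<close>

inductive_set polyfun :: "'i set \<Rightarrow> (('i \<Rightarrow> complex) \<Rightarrow> complex) set" for J where
  const [intro!]: "(\<lambda>x. c) \<in> polyfun J"
| add [intro]: "f \<in> polyfun J \<Longrightarrow> g \<in> polyfun J \<Longrightarrow> (\<lambda>x. f x + g x) \<in> polyfun J"
| coord_mult: "f \<in> polyfun J \<Longrightarrow> j \<in> J \<Longrightarrow> (\<lambda>x. x j * f x) \<in> polyfun J"

lemma polyfun_coord: "j \<in> J \<Longrightarrow> (\<lambda>x. x j) \<in> polyfun J"
  using polyfun.coord_mult[OF polyfun.const[of 1], of j J] by simp

text \<open>The rules multiply by one coordinate at a time, so that every induction on
  \<open>polyfun\<close> deals with a single linear factor. General products are recovered by a
  double induction.\<close>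

lemma polyfun_mult [intro]:
  assumes "f \<in> polyfun J" "g \<in> polyfun J"
  shows "(\<lambda>x. f x * g x) \<in> polyfun J"
  using assms(1)
proof induction
  case (const c)
  show ?case using assms(2)
  proof induction
    case (add f g) then show ?case using polyfun.add by (fastforce simp: distrib_left)
  next
    case (coord_mult f j) then show ?case using polyfun.coord_mult by (fastforce simp: mult.left_commute)
  qed auto
next
  case (add f h) then show ?case using polyfun.add by (fastforce simp: distrib_right)
next
  case (coord_mult f j) then show ?case using polyfun.coord_mult by (fastforce simp: mult.assoc)
qed

lemma polyfun_uminus [intro]: "f \<in> polyfun J \<Longrightarrow> (\<lambda>x. - f x) \<in> polyfun J"
  using polyfun_mult[OF polyfun.const[of "-1"]] by simp

lemma polyfun_diff [intro]: "f \<in> polyfun J \<Longrightarrow> g \<in> polyfun J \<Longrightarrow> (\<lambda>x. f x - g x) \<in> polyfun J"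
  using polyfun.add[OF _ polyfun_uminus] by simp

lemma polyfun_power [intro]: "f \<in> polyfun J \<Longrightarrow> (\<lambda>x. f x ^ k) \<in> polyfun J"
  by (induction k) auto

lemma polyfun_sum [intro]:
  "(\<And>a. a \<in> A \<Longrightarrow> f a \<in> polyfun J) \<Longrightarrow> (\<lambda>x. \<Sum>a\<in>A. f a x) \<in> polyfun J"
  by (induction A rule: infinite_finite_induct) auto

lemma polyfun_prod [intro]:
  "(\<And>a. a \<in> A \<Longrightarrow> f a \<in> polyfun J) \<Longrightarrow> (\<lambda>x. \<Prod>a\<in>A. f a x) \<in> polyfun J"
  by (induction A rule: infinite_finite_induct) auto

lemma polyfun_compose:
  assumes "f \<in> polyfun J" "\<And>j. j \<in> J \<Longrightarrow> (\<lambda>x. \<phi> x j) \<in> polyfun J'"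
  shows "(\<lambda>x. f (\<phi> x)) \<in> polyfun J'"
  using assms(1) by induction (use assms(2) in auto)

lemma polyfun_cong:
  "f \<in> polyfun J \<Longrightarrow> (\<And>j. j \<in> J \<Longrightarrow> x j = y j) \<Longrightarrow> f x = f y"
  by (induction rule: polyfun.induct) auto

section \<open>One-variable polynomials whose coefficients are polynomial functions\<close>

definition poly_family :: "'i set \<Rightarrow> (('i \<Rightarrow> complex) \<Rightarrow> complex poly) \<Rightarrow> bool" where
  "poly_family J P \<longleftrightarrow> (\<forall>k. (\<lambda>y. coeff (P y) k) \<in> polyfun J) \<and> (\<exists>d. \<forall>y. degree (P y) \<le> d)"

lemma poly_familyI:
  "(\<And>k. (\<lambda>y. coeff (P y) k) \<in> polyfun J) \<Longrightarrow> (\<And>y. degree (P y) \<le> d) \<Longrightarrow> poly_family J P"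
  unfolding poly_family_def by blast

lemma poly_family_const: "f \<in> polyfun J \<Longrightarrow> poly_family J (\<lambda>y. [:f y:])"
proof (rule poly_familyI[where d = 0])
  fix k assume "f \<in> polyfun J"
  then show "(\<lambda>y. coeff [:f y:] k) \<in> polyfun J" by (cases k) auto
qed auto

lemma poly_family_add:
  assumes "poly_family J P" "poly_family J Q"
  shows "poly_family J (\<lambda>y. P y + Q y)"
proof -
  obtain d e where "\<And>y. degree (P y) \<le> d" "\<And>y. degree (Q y) \<le> e"
    using assms unfolding poly_family_def by blast
  then have "degree (P y + Q y) \<le> max d e" for y
    by (meson degree_add_le max.coboundedI1 max.coboundedI2)
  then show ?thesis
    using assms by (intro poly_familyI) (auto simp: poly_family_def)
qed

lemma poly_family_mult:
  assumes "poly_family J P" "poly_family J Q"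
  shows "poly_family J (\<lambda>y. P y * Q y)"
proof -
  obtain d e where de: "\<And>y. degree (P y) \<le> d" "\<And>y. degree (Q y) \<le> e"
    using assms unfolding poly_family_def by blast
  then have "degree (P y * Q y) \<le> d + e" for y
    by (meson add_mono degree_mult_le order_trans)
  then show ?thesis
    using assms by (intro poly_familyI) (auto simp: poly_family_def coeff_mult intro!: polyfun_sum polyfun_mult)
qed

lemma poly_family_linear:
  "f \<in> polyfun J \<Longrightarrow> g \<in> polyfun J \<Longrightarrow> poly_family J (\<lambda>y. [:f y, g y:])"
proof (rule poly_familyI[where d = 1])
  fix k assume "f \<in> polyfun J" "g \<in> polyfun J"
  then show "(\<lambda>y. coeff [:f y, g y:] k) \<in> polyfun J"
    by (cases k; cases "k - 1") auto
qed auto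

lemma poly_family_prod:
  "(\<And>a. a \<in> A \<Longrightarrow> poly_family J (P a)) \<Longrightarrow> poly_family J (\<lambda>y. \<Prod>a\<in>A. P a y)"
proof (induction A rule: infinite_finite_induct)
  case (insert a A)
  then show ?case by (simp add: poly_family_mult)
qed (use poly_family_const[OF polyfun.const[of 1]] in \<open>auto simp: one_pCons\<close>)

text \<open>The degree bound that is uniform in y turns the value into a sum over a fixed finite
  range of exponents. Polynomial coefficients alone would leave the number of terms depending on
  y.\<close>

lemma poly_family_eval:
  assumes "poly_family J P" "f \<in> polyfun J"
  shows "(\<lambda>y. poly (P y) (f y)) \<in> polyfun J"
proof -
  obtain d where d: "\<And>y. degree (P y) \<le> d"
    using assms unfolding poly_family_def by blast
  have "poly (P y) (f y) = (\<Sum>k\<le>d. coeff (P y) k * f y ^ k)" for y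
    unfolding poly_altdef using d[of y]
    by (intro sum.mono_neutral_left) (auto simp: coeff_eq_0 not_le)
  then show ?thesis
    using assms by (auto simp: poly_family_def intro!: polyfun_sum polyfun_mult)
qed

definition line_family ::
    "'i set \<Rightarrow> (('i \<Rightarrow> complex) \<Rightarrow> complex) \<Rightarrow> ('i \<Rightarrow> complex) \<Rightarrow> (('i \<Rightarrow> complex) \<Rightarrow> complex poly) \<Rightarrow> bool" where
  "line_family J f v P \<longleftrightarrow> poly_family J P \<and> (\<forall>y t. f (\<lambda>j. y j + t * v j) = poly (P y) t)"

lemma polyfun_line:
  assumes "f \<in> polyfun J"
  shows "\<exists>P. line_family J f v P"
  unfolding line_family_def
  using assms
proof induction
  case (const c)
  show ?case by (rule exI[of _ "\<lambda>y. [:c:]"]) (auto intro: poly_family_const)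
next
  case (add f g)
  then obtain P Q where "poly_family J P" "\<forall>y t. f (\<lambda>j. y j + t * v j) = poly (P y) t"
    "poly_family J Q" "\<forall>y t. g (\<lambda>j. y j + t * v j) = poly (Q y) t" by blast
  then show ?case by (intro exI[of _ "\<lambda>y. P y + Q y"]) (auto intro: poly_family_add)
next
  case (coord_mult f j)
  then obtain P where "poly_family J P" "\<forall>y t. f (\<lambda>j. y j + t * v j) = poly (P y) t" by blast
  then show ?case using coord_mult
    by (intro exI[of _ "\<lambda>y. [:y j, v j:] * P y"])
      (intro conjI poly_family_mult poly_family_linear polyfun_coord allI; auto simp: algebra_simps)
qed

text \<open>On the line through x and y both functions become nonzero polynomials in one variable,
  whose product has a nonzero value somewhere. Hence polynomial functions form a domain, for every
  index set.\<close>

lemma polyfun_nonzero_mult: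
  assumes "f \<in> polyfun J" "g \<in> polyfun J" "f x \<noteq> 0" "g y \<noteq> 0"
  shows "\<exists>z. f z * g z \<noteq> 0"
proof -
  define v where "v = (\<lambda>j. y j - x j)"
  obtain P Q where P: "\<And>t. f (\<lambda>j. x j + t * v j) = poly (P x) t"
    and Q: "\<And>t. g (\<lambda>j. x j + t * v j) = poly (Q x) t"
    using polyfun_line[OF assms(1), of v] polyfun_line[OF assms(2), of v]
    unfolding line_family_def by metis
  have "poly (P x) 0 \<noteq> 0" "poly (Q x) 1 \<noteq> 0"
    using P[of 0] Q[of 1] assms by (auto simp: v_def)
  then have "P x * Q x \<noteq> 0" by auto
  then obtain t where "poly (P x * Q x) t \<noteq> 0"
    using poly_all_0_iff_0 by blast
  then show ?thesis using P Q by (metis poly_mult)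
qed

text \<open>Homogeneity of degree k expressed on lines: restricted to a line with direction v, a
  form of degree k has degree at most k, and its coefficient of \<open>t ^ k\<close> is the value at
  v, whatever the base point.\<close>

definition polyform :: "'i set \<Rightarrow> nat \<Rightarrow> (('i \<Rightarrow> complex) \<Rightarrow> complex) \<Rightarrow> bool" where
  "polyform J k f \<longleftrightarrow> (\<forall>y v. \<exists>p. degree p \<le> k \<and> coeff p k = f v \<and> (\<forall>t. f (\<lambda>j. y j + t * v j) = poly p t))"

lemma polyform_zero: "polyform J k (\<lambda>x. 0)"
  unfolding polyform_def by (auto intro!: exI[of _ 0])

lemma polyform_add:
  assumes "polyform J k f" "polyform J k g"
  shows "polyform J k (\<lambda>x. f x + g x)"
  unfolding polyform_def
proof (intro allI)
  fix y v
  obtain p q where "degree p \<le> k \<and> coeff p k = f v \<and> (\<forall>t. f (\<lambda>j. y j + t * v j) = poly p t)"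
    "degree q \<le> k \<and> coeff q k = g v \<and> (\<forall>t. g (\<lambda>j. y j + t * v j) = poly q t)"
    using assms unfolding polyform_def by metis
  then show "\<exists>p. degree p \<le> k \<and> coeff p k = f v + g v \<and>
    (\<forall>t. f (\<lambda>j. y j + t * v j) + g (\<lambda>j. y j + t * v j) = poly p t)"
    by (intro exI[of _ "p + q"]) (auto simp: degree_add_le)
qed

lemma polyform_coord_mult:
  assumes "polyform J k f"
  shows "polyform J (Suc k) (\<lambda>x. x j * f x)"
  unfolding polyform_def
proof (intro allI)
  fix y v
  obtain p where "degree p \<le> k \<and> coeff p k = f v \<and> (\<forall>t. f (\<lambda>j. y j + t * v j) = poly p t)"
    using assms unfolding polyform_def by metis
  moreover from this have "degree ([:y j, v j:] * p) \<le> Suc k"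
    by (intro order_trans[OF degree_mult_le]) auto
  ultimately show "\<exists>p. degree p \<le> Suc k \<and> coeff p (Suc k) = v j * f v \<and>
    (\<forall>t. (y j + t * v j) * f (\<lambda>j. y j + t * v j) = poly p t)"
    by (intro exI[of _ "[:y j, v j:] * p"]) (auto simp: coeff_eq_0 algebra_simps)
qed

lemma polyfun_sum_forms:
  assumes "f \<in> polyfun J"
  shows "\<exists>d F. (\<forall>k. polyform J k (F k)) \<and> (\<forall>x. f x = (\<Sum>k\<le>d. F k x))"
proof -
  \<comment> \<open>The vanishing of \<open>F k\<close> above d is carried through the induction so
    that sums of different lengths can be padded to a common one.\<close>
  have "\<exists>d F. (\<forall>k. polyform J k (F k)) \<and> (\<forall>k>d. \<forall>x. F k x = 0) \<and> (\<forall>x. f x = (\<Sum>k\<le>d. F k x))"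
    using assms
  proof induction
    case (const c)
    have "polyform J 0 (\<lambda>x. c)" unfolding polyform_def by (auto intro!: exI[of _ "[:c:]"])
    then show ?case
      by (intro exI[of _ 0] exI[of _ "\<lambda>k x. if k = 0 then c else 0"])
        (auto simp: polyform_zero split: if_splits)
  next
    case (add f g)
    then obtain d F e G where *: "\<And>k. polyform J k (F k)" "\<forall>k>d. \<forall>x. F k x = 0" "\<forall>x. f x = (\<Sum>k\<le>d. F k x)"
      "\<And>k. polyform J k (G k)" "\<forall>k>e. \<forall>x. G k x = 0" "\<forall>x. g x = (\<Sum>k\<le>e. G k x)"
      by metis
    have "f x = (\<Sum>k\<le>max d e. F k x)" "g x = (\<Sum>k\<le>max d e. G k x)" for x
      using * by (auto intro!: sum.mono_neutral_left simp: not_less[symmetric])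
    then show ?case using *
      by (intro exI[of _ "max d e"] exI[of _ "\<lambda>k x. F k x + G k x"])
        (auto simp: sum.distrib polyform_add)
  next
    case (coord_mult f j)
    then obtain d F where *: "\<And>k. polyform J k (F k)" "\<forall>k>d. \<forall>x. F k x = 0" "\<forall>x. f x = (\<Sum>k\<le>d. F k x)"
      by metis
    define G where "G k = (case k of 0 \<Rightarrow> (\<lambda>x. 0) | Suc k \<Rightarrow> (\<lambda>x. x j * F k x))" for k
    have "polyform J k (G k)" for k
      using * by (auto simp: G_def polyform_zero polyform_coord_mult split: nat.split)
    moreover have "\<forall>k>Suc d. \<forall>x. G k x = 0" using * by (auto simp: G_def split: nat.split)
    moreover have "x j * f x = (\<Sum>k\<le>Suc d. G k x)" for x
      unfolding sum.atMost_Suc_shift using * by (simp add: G_def sum_distrib_left)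
    ultimately show ?case by blast
  qed
  then show ?thesis by blast
qed

text \<open>The direction \<open>v\<close> is one on which the homogeneous part of top degree does not vanish.\<close>

lemma polyfun_monic_direction:
  assumes "f \<in> polyfun J" "f x \<noteq> 0"
  shows "\<exists>v c m P. c \<noteq> 0 \<and> line_family J f v P \<and> (\<forall>y. degree (P y) = m \<and> coeff (P y) m = c)"
proof -
  \<comment> \<open>The decomposition into forms is taken as short as possible: its top form cannot
    vanish identically, since it could then be dropped.\<close>
  define Q where "Q d \<longleftrightarrow> (\<exists>F. (\<forall>k. polyform J k (F k)) \<and> (\<forall>x. f x = (\<Sum>k\<le>d. F k x)))" for d
  obtain m where m: "Q m" "\<And>k. k < m \<Longrightarrow> \<not> Q k"
    using polyfun_sum_forms[OF assms(1)] exists_least_iff[of Q] unfolding Q_def by metis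
  then obtain F where F: "\<And>k. polyform J k (F k)" "\<And>x. f x = (\<Sum>k\<le>m. F k x)"
    unfolding Q_def by blast
  have "\<exists>v. F m v \<noteq> 0"
  proof (rule ccontr)
    assume "\<not> ?thesis"
    then have Fm: "F m v = 0" for v by blast
    show False
    proof (cases m)
      case 0 then show False using F(2)[of x] assms Fm by simp
    next
      case (Suc k)
      then have "Q k" unfolding Q_def using F Fm by (intro exI[of _ F]) auto
      then show False using m Suc by blast
    qed
  qed
  then obtain v where v: "F m v \<noteq> 0" by blast
  obtain P where line: "line_family J f v P"
    using polyfun_line[OF assms(1)] by blast
  then have P: "\<And>y t. f (\<lambda>j. y j + t * v j) = poly (P y) t"
    by (simp add: line_family_def)
  have deg: "degree (P y) = m" "coeff (P y) m = F m v" for y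
  proof -
    have "\<forall>k. \<exists>p. degree p \<le> k \<and> coeff p k = F k v \<and> (\<forall>t. F k (\<lambda>j. y j + t * v j) = poly p t)"
      using F(1) unfolding polyform_def by blast
    then obtain p where p: "\<And>k. degree (p k) \<le> k" "\<And>k. coeff (p k) k = F k v"
      "\<And>k t. F k (\<lambda>j. y j + t * v j) = poly (p k) t" by metis
    have "poly (P y) = poly (\<Sum>k\<le>m. p k)"
      using F(2) p(3) by (auto simp: poly_sum fun_eq_iff simp flip: P)
    then have *: "P y = (\<Sum>k\<le>m. p k)" by (simp add: poly_eq_poly_eq_iff)
    then have "degree (P y) \<le> m" using p(1) by (auto intro!: degree_sum_le intro: order_trans)
    moreover have "coeff (P y) m = (\<Sum>k\<le>m. if k = m then F m v else 0)"
      unfolding * coeff_sum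
      by (intro sum.cong) (auto simp: p intro!: coeff_eq_0 le_less_trans[OF p(1)])
    then have "coeff (P y) m = F m v" by simp
    ultimately show "degree (P y) = m" "coeff (P y) m = F m v" using v by (metis le_antisym le_degree)+
  qed
  show ?thesis using v line deg by blast
qed

text \<open>The leading coefficient of \<open>G y\<close> is a nonzero constant, so long division
  never divides by a function of y and the quotient keeps polynomial coefficients.\<close>

lemma poly_family_division:
  assumes G: "poly_family J G" "\<And>y. degree (G y) = m" "\<And>y. coeff (G y) m = c" "c \<noteq> 0"
    and P: "poly_family J P"
  shows "\<exists>Q R. poly_family J Q \<and> (\<forall>y. P y = Q y * G y + R y \<and> (R y = 0 \<or> degree (R y) < m))"
proof -
  have "\<exists>Q R. poly_family J Q \<and> (\<forall>y. P y = Q y * G y + R y \<and> (R y = 0 \<or> degree (R y) < m))"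
    if "poly_family J P" "\<And>y. degree (P y) < d" for d P
    using that
  proof (induction d arbitrary: P)
    case (Suc d)
    show ?case
    proof (cases "d < m")
      case True
      then have "degree (P y) < m" for y using Suc.prems(2)[of y] by simp
      moreover have "poly_family J (\<lambda>_. 0)"
        using poly_family_const[OF polyfun.const[of 0], of J] by simp
      ultimately show ?thesis
        by (intro exI[of _ "\<lambda>_. 0"] exI[of _ P]) simp
    next
      case False
      define T where "T y = monom (coeff (P y) d / c) (d - m)" for y
      have "poly_family J T"
      proof (rule poly_familyI)
        show "degree (T y) \<le> d - m" for y unfolding T_def by (rule degree_monom_le)
        have "(\<lambda>y. coeff (P y) d * inverse c) \<in> polyfun J"
          using Suc.prems(1) by (auto simp: poly_family_def)
        then show "(\<lambda>y. coeff (T y) k) \<in> polyfun J" for k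
          by (cases "k = d - m") (auto simp: T_def divide_inverse)
      qed
      define P' where "P' y = P y - T y * G y" for y
      have P': "poly_family J P'"
        using poly_family_add[OF Suc.prems(1) poly_family_mult[OF poly_family_mult[OF
          poly_family_const[of "\<lambda>_. -1", OF polyfun.const] \<open>poly_family J T\<close>] G(1)]]
        by (simp add: P'_def[abs_def])
      have "degree (P' y) < Suc d" for y
      proof -
        have "degree (T y * G y) \<le> (d - m) + m"
          unfolding T_def using G(2) by (intro order_trans[OF degree_mult_le] add_mono degree_monom_le) auto
        then show ?thesis unfolding P'_def
          using Suc.prems(2)[of y] False by (simp add: less_Suc_eq_le degree_diff_le)
      qed
      moreover have "coeff (P' y) d = 0" for y
        using False G(3,4) by (simp add: P'_def T_def coeff_monom_mult)
      ultimately have lt: "P' y = 0 \<or> degree (P' y) < d" for y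
        by (metis less_antisym leading_coeff_0_iff)
      have eq: "P y = Q y * G y + T y * G y + R y" if "P' y = Q y * G y + R y" for y Q R
        using that by (simp add: P'_def diff_eq_eq add_ac)
      show ?thesis
      proof (cases "d = 0")
        \<comment> \<open>The zero polynomial has degree 0 by convention, so at d = 0 the degree
          cannot drop further; instead \<open>P' y\<close> itself is zero and the division is
          exact.\<close>
        case True
        then have "P y = T y * G y" for y using lt[of y] by (simp add: P'_def)
        then show ?thesis using \<open>poly_family J T\<close>
          by (intro exI[of _ T] exI[of _ "\<lambda>_. 0"]) simp
      next
        case False
        then have "degree (P' y) < d" for y using lt[of y] by auto
        then obtain Q R where QR: "poly_family J Q \<and> (\<forall>y. P' y = Q y * G y + R y \<and> (R y = 0 \<or> degree (R y) < m))"
          using Suc.IH[OF P'] by meson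
        then have "poly_family J (\<lambda>y. Q y + T y)" using \<open>poly_family J T\<close> by (simp add: poly_family_add)
        moreover have "P y = (Q y + T y) * G y + R y" for y
          using eq[of y Q R] QR by (simp add: distrib_right)
        ultimately show ?thesis using QR by (intro exI[of _ "\<lambda>y. Q y + T y"] exI[of _ R]) simp
      qed
    qed
  qed auto
  note this[OF P]
  moreover obtain d where "\<And>y. degree (P y) \<le> d" using P unfolding poly_family_def by blast
  then have "degree (P y) < Suc d" for y by (simp add: less_Suc_eq_le)
  ultimately show ?thesis by blast
qed

text \<open>Dividing the relation by \<open>g ^ d\<close>, with g the gcd, leaves the same relation
  between coprime polynomials. The reduced denominator then divides a power of the reduced
  numerator, so it is a unit.\<close>

lemma poly_integral_imp_dvd:
  fixes p q :: "complex poly"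
  assumes "q \<noteq> 0" "p ^ d + (\<Sum>i<d. c i * p ^ i * q ^ (d - i)) = 0"
  shows "q dvd p"
proof -
  define g where "g = gcd p q"
  have "g \<noteq> 0" using assms by (auto simp: g_def)
  obtain p' q' where pq: "p = p' * g" "q = q' * g" and cop: "coprime p' q'"
    unfolding g_def using gcd_coprime_exists[of p q] \<open>g \<noteq> 0\<close> g_def by auto
  have "g ^ d * (p' ^ d + (\<Sum>i<d. c i * p' ^ i * q' ^ (d - i)))
      = p ^ d + (\<Sum>i<d. c i * p ^ i * q ^ (d - i))"
  proof -
    have "g ^ d * (c i * p' ^ i * q' ^ (d - i)) = c i * p ^ i * q ^ (d - i)" if "i < d" for i
    proof -
      have "g ^ d = g ^ i * g ^ (d - i)" using that by (simp flip: power_add)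
      then show ?thesis by (simp add: pq power_mult_distrib mult_ac)
    qed
    then have "(\<Sum>i<d. g ^ d * (c i * p' ^ i * q' ^ (d - i))) = (\<Sum>i<d. c i * p ^ i * q ^ (d - i))"
      by (intro sum.cong) auto
    then show ?thesis by (simp add: distrib_left sum_distrib_left pq(1) power_mult_distrib mult.commute)
  qed
  then have "p' ^ d = - (\<Sum>i<d. c i * p' ^ i * q' ^ (d - i))"
    using assms \<open>g \<noteq> 0\<close> by (simp add: eq_neg_iff_add_eq_0)
  moreover have "q' dvd (\<Sum>i<d. c i * p' ^ i * q' ^ (d - i))"
    by (intro dvd_sum dvd_mult dvd_power) auto
  ultimately have "q' dvd p' ^ d" by simp
  then have "is_unit q'" using cop
    by (meson coprime_commute coprime_power_right_iff coprime_common_divisor dvd_refl coprime_absorb_left coprime_power_left_iff)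
  then have "q' dvd p'" by (rule unit_imp_dvd)
  then show ?thesis using pq by simp
qed

text \<open>In a direction where b is monic up to a constant, the one-variable case shows that b
  divides a on each parallel line. The remainder of the uniform division therefore vanishes, and its
  quotient, evaluated at \<open>t = 0\<close>, is the required function.\<close>

theorem polyfun_integrally_closed:
  assumes a: "a \<in> polyfun J" and b: "b \<in> polyfun J" "b x\<^sub>0 \<noteq> 0"
    and c: "\<And>i. i < d \<Longrightarrow> c i \<in> polyfun J"
    and eq: "\<And>x. a x ^ d + (\<Sum>i<d. c i x * a x ^ i * b x ^ (d - i)) = 0"
  shows "\<exists>h\<in>polyfun J. \<forall>x. a x = b x * h x"
proof -
  obtain v e m G where G': "e \<noteq> 0" "line_family J b v G" "\<And>y. degree (G y) = m" "\<And>y. coeff (G y) m = e"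
    using polyfun_monic_direction[OF b] by blast
  then have G: "poly_family J G" "\<And>y t. b (\<lambda>j. y j + t * v j) = poly (G y) t"
    by (simp_all add: line_family_def)
  obtain P where "line_family J a v P"
    using polyfun_line[OF a] by blast
  then have P: "poly_family J P" "\<And>y t. a (\<lambda>j. y j + t * v j) = poly (P y) t"
    by (simp_all add: line_family_def)
  obtain Q R where Q: "poly_family J Q"
    and QR: "\<And>y. P y = Q y * G y + R y" "\<And>y. R y = 0 \<or> degree (R y) < m"
    using poly_family_division[OF G(1) G'(3,4,1) P(1)] by blast
  have "G y dvd P y" for y
  proof -
    have "\<forall>i. \<exists>P. i < d \<longrightarrow> line_family J (c i) v P"
      using polyfun_line[OF c] by blast
    then obtain C where "\<forall>i. i < d \<longrightarrow> line_family J (c i) v (C i)"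
      by (rule choice[THEN exE])
    then have C: "\<And>i t. i < d \<Longrightarrow> c i (\<lambda>j. y j + t * v j) = poly (C i y) t"
      by (simp add: line_family_def)
    have "poly (P y ^ d + (\<Sum>i<d. C i y * P y ^ i * G y ^ (d - i))) t = 0" for t
      using eq[of "\<lambda>j. y j + t * v j"] by (simp add: P G C poly_sum)
    then have "P y ^ d + (\<Sum>i<d. C i y * P y ^ i * G y ^ (d - i)) = 0"
      using poly_all_0_iff_0 by blast
    moreover have "G y \<noteq> 0" using G'(1) G'(4)[of y] by auto
    ultimately show ?thesis by (rule poly_integral_imp_dvd[rotated])
  qed
  then have "G y dvd R y" for y using QR(1)[of y] by (metis dvd_add_right_iff dvd_triv_right)
  then have R: "R y = 0" for y
    using QR(2)[of y] G'(3)[of y] by (metis dvd_imp_degree_le leD)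
  have "a y = b y * poly (Q y) 0" for y
    using P(2)[of y 0] G(2)[of y 0] QR(1)[of y] R by simp
  then show ?thesis
    using poly_family_eval[OF Q polyfun.const[of 0]] by (intro bexI[of _ "\<lambda>y. poly (Q y) 0"] allI)
qed

section \<open>Images of subspaces in a finite quotient\<close>

text \<open>The set \<open>M\<close> is a coordinate subspace (\<open>\<pi>\<close> is a polynomial retraction onto it), \<open>invs\<close> is the
  coordinate ring of the quotient by \<open>\<Gamma>\<close>, and \<open>normal_at p\<close> says that the local ring of the image of
  \<open>M\<close> at the image of \<open>p\<close> is integrally closed. The normalization of that image is the quotient of
  \<open>M\<close> by its setwise stabiliser in \<open>\<Gamma>\<close>, whose regular functions are the \<open>stable\<close> ones.\<close>

locale quotient_image =
  fixes J :: "'i set" and \<Gamma> :: "(('i \<Rightarrow> complex) \<Rightarrow> ('i \<Rightarrow> complex)) set"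
    and M :: "('i \<Rightarrow> complex) set" and \<pi> :: "('i \<Rightarrow> complex) \<Rightarrow> ('i \<Rightarrow> complex)"
  assumes finite_\<Gamma>: "finite \<Gamma>"
    and id_\<Gamma>: "id \<in> \<Gamma>"
    and comp_\<Gamma>: "g \<in> \<Gamma> \<Longrightarrow> h \<in> \<Gamma> \<Longrightarrow> g \<circ> h \<in> \<Gamma>"
    and inverse_\<Gamma>: "g \<in> \<Gamma> \<Longrightarrow> \<exists>h\<in>\<Gamma>. g \<circ> h = id \<and> h \<circ> g = id"
    and polyfun_\<Gamma>: "g \<in> \<Gamma> \<Longrightarrow> j \<in> J \<Longrightarrow> (\<lambda>x. g x j) \<in> polyfun J"
    and polyfun_\<pi>: "j \<in> J \<Longrightarrow> (\<lambda>x. \<pi> x j) \<in> polyfun J"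
    and \<pi>_in: "\<pi> x \<in> M"
    and \<pi>_id: "x \<in> M \<Longrightarrow> \<pi> x = x"
    \<comment> \<open>Polynomial functions see only the coordinates in J, so a failure of
      \<open>g x\<close> to lie in M has to be visible in one of these coordinates.\<close>
    and in_M: "x \<in> M \<Longrightarrow> g \<in> \<Gamma> \<Longrightarrow> (\<And>j. j \<in> J \<Longrightarrow> \<pi> (g x) j = g x j) \<Longrightarrow> g x \<in> M"
begin

definition invs :: "(('i \<Rightarrow> complex) \<Rightarrow> complex) set" where
  "invs = {f \<in> polyfun J. \<forall>g\<in>\<Gamma>. \<forall>x. f (g x) = f x}"

definition stable :: "(('i \<Rightarrow> complex) \<Rightarrow> complex) \<Rightarrow> bool" where
  "stable h \<longleftrightarrow> (\<forall>g\<in>\<Gamma>. g ` M = M \<longrightarrow> (\<forall>x\<in>M. h (g x) = h x))"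

definition normal_at :: "('i \<Rightarrow> complex) \<Rightarrow> bool" where
  "normal_at p \<longleftrightarrow> (\<forall>a\<in>invs. \<forall>b\<in>invs. (\<exists>x\<in>M. b x \<noteq> 0) \<longrightarrow>
     (\<exists>d c. (\<forall>i<d. c i \<in> invs) \<and> (\<forall>x\<in>M. a x ^ d + (\<Sum>i<d. c i x * a x ^ i * b x ^ (d - i)) = 0)) \<longrightarrow>
     (\<exists>t\<in>invs. \<exists>c\<in>invs. t p \<noteq> 0 \<and> (\<forall>x\<in>M. t x * a x = b x * c x)))"

lemma invsD: "f \<in> invs \<Longrightarrow> f \<in> polyfun J" "f \<in> invs \<Longrightarrow> g \<in> \<Gamma> \<Longrightarrow> f (g x) = f x"
  by (auto simp: invs_def)

lemma invsI: "f \<in> polyfun J \<Longrightarrow> (\<And>g x. g \<in> \<Gamma> \<Longrightarrow> f (g x) = f x) \<Longrightarrow> f \<in> invs"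
  by (auto simp: invs_def)

lemma invs_const [intro!]: "(\<lambda>x. c) \<in> invs"
  by (auto simp: invs_def)

lemma invs_add [intro]: "f \<in> invs \<Longrightarrow> g \<in> invs \<Longrightarrow> (\<lambda>x. f x + g x) \<in> invs"
  by (auto simp: invs_def)

lemma invs_diff [intro]: "f \<in> invs \<Longrightarrow> g \<in> invs \<Longrightarrow> (\<lambda>x. f x - g x) \<in> invs"
  by (auto simp: invs_def)

lemma invs_mult [intro]: "f \<in> invs \<Longrightarrow> g \<in> invs \<Longrightarrow> (\<lambda>x. f x * g x) \<in> invs"
  by (auto simp: invs_def)

lemma inj_\<Gamma>: "g \<in> \<Gamma> \<Longrightarrow> inj g"
  using inverse_\<Gamma> by (metis inj_on_id inj_on_imageI2)

lemma polyfun_comp: "f \<in> polyfun J \<Longrightarrow> g \<in> \<Gamma> \<Longrightarrow> (\<lambda>x. f (g x)) \<in> polyfun J"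
  using polyfun_compose polyfun_\<Gamma> by metis

lemma polyfun_comp_\<pi>: "f \<in> polyfun J \<Longrightarrow> (\<lambda>x. f (\<pi> x)) \<in> polyfun J"
  using polyfun_compose polyfun_\<pi> by metis

lemma bij_betw_comp_\<Gamma>: "g \<in> \<Gamma> \<Longrightarrow> bij_betw (\<lambda>h. h \<circ> g) \<Gamma> \<Gamma>"
proof -
  assume g: "g \<in> \<Gamma>"
  obtain g' where "g' \<in> \<Gamma>" "g \<circ> g' = id" "g' \<circ> g = id" using inverse_\<Gamma>[OF g] by blast
  then show ?thesis
    using g by (intro bij_betw_byWitness[where f' = "\<lambda>h. h \<circ> g'"]) (auto simp: comp_assoc comp_\<Gamma>)
qed

lemma sum_\<Gamma>_comp: "g \<in> \<Gamma> \<Longrightarrow> (\<Sum>h\<in>\<Gamma>. F (h \<circ> g)) = (\<Sum>h\<in>\<Gamma>. F h)"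
  by (rule sum.reindex_bij_betw[OF bij_betw_comp_\<Gamma>])

lemma prod_\<Gamma>_comp: "g \<in> \<Gamma> \<Longrightarrow> (\<Prod>h\<in>\<Gamma>. F (h \<circ> g)) = (\<Prod>h\<in>\<Gamma>. F h)"
  by (rule prod.reindex_bij_betw[OF bij_betw_comp_\<Gamma>])

lemma invs_average:
  assumes "f \<in> polyfun J"
  shows "(\<lambda>x. \<Sum>g\<in>\<Gamma>. f (g x)) \<in> invs"
proof (rule invsI)
  show "(\<lambda>x. \<Sum>g\<in>\<Gamma>. f (g x)) \<in> polyfun J"
    by (intro polyfun_sum polyfun_comp[OF assms])
  show "(\<Sum>h\<in>\<Gamma>. f (h (g x))) = (\<Sum>h\<in>\<Gamma>. f (h x))" if "g \<in> \<Gamma>" for g x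
    using sum_\<Gamma>_comp[OF that, of "\<lambda>h. f (h x)"] by simp
qed

lemma nonzero_mult_M:
  assumes "f \<in> polyfun J" "g \<in> polyfun J" "\<exists>x\<in>M. f x \<noteq> 0" "\<exists>x\<in>M. g x \<noteq> 0"
  shows "\<exists>x\<in>M. f x * g x \<noteq> 0"
proof -
  obtain x y where "f (\<pi> x) \<noteq> 0" "g (\<pi> y) \<noteq> 0" using assms(3,4) \<pi>_id by metis
  then show ?thesis
    using polyfun_nonzero_mult[OF polyfun_comp_\<pi>[OF assms(1)] polyfun_comp_\<pi>[OF assms(2)]] \<pi>_in by blast
qed

lemma nonzero_prod_M:
  assumes "finite A" "\<And>a. a \<in> A \<Longrightarrow> f a \<in> polyfun J" "\<And>a. a \<in> A \<Longrightarrow> \<exists>x\<in>M. f a x \<noteq> 0"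
  shows "\<exists>x\<in>M. (\<Prod>a\<in>A. f a x) \<noteq> 0"
  using assms
proof (induction A)
  case empty
  then show ?case using \<pi>_in by auto
next
  case (insert a A)
  then show ?case
    using nonzero_mult_M[of "f a" "\<lambda>x. \<Prod>a\<in>A. f a x"] by auto
qed

lemma mult_eq_0_M:
  assumes "f \<in> polyfun J" "g \<in> polyfun J" "\<And>x. x \<in> M \<Longrightarrow> f x * g x = 0" "\<exists>x\<in>M. f x \<noteq> 0" "x \<in> M"
  shows "g x = 0"
  using nonzero_mult_M[OF assms(1,2,4)] assms(3,5) by blast

text \<open>Pulled back along \<pi>, the relation lives in the whole polynomial ring, where integral
  closedness yields h. Stability follows because a and b are invariant and b is not a zero divisor
  on M.\<close>

lemma integral_imp_stable_quotient:
  assumes "a \<in> invs" "b \<in> invs" "\<exists>x\<in>M. b x \<noteq> 0" "\<And>i. i < d \<Longrightarrow> c i \<in> invs"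
    and "\<And>x. x \<in> M \<Longrightarrow> a x ^ d + (\<Sum>i<d. c i x * a x ^ i * b x ^ (d - i)) = 0"
  shows "\<exists>h\<in>polyfun J. stable h \<and> (\<forall>x\<in>M. a x = b x * h x)"
proof -
  obtain x\<^sub>0 where x\<^sub>0: "b (\<pi> x\<^sub>0) \<noteq> 0" using assms(3) \<pi>_id by metis
  have "\<exists>h\<in>polyfun J. \<forall>x. a (\<pi> x) = b (\<pi> x) * h x"
  proof (rule polyfun_integrally_closed[where x\<^sub>0 = x\<^sub>0 and c = "\<lambda>i x. c i (\<pi> x)" and d = d])
    show "(\<lambda>x. a (\<pi> x)) \<in> polyfun J" "(\<lambda>x. b (\<pi> x)) \<in> polyfun J"
      "\<And>i. i < d \<Longrightarrow> (\<lambda>x. c i (\<pi> x)) \<in> polyfun J"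
      using assms by (auto intro!: polyfun_comp_\<pi> dest: invsD(1))
  qed (use x\<^sub>0 assms(5) \<pi>_in in auto)
  then obtain h where h: "h \<in> polyfun J" "\<And>x. a (\<pi> x) = b (\<pi> x) * h x" by blast
  then have hM: "a x = b x * h x" if "x \<in> M" for x using \<pi>_id[OF that] by metis
  have "stable h"
    unfolding stable_def
  proof (intro ballI impI)
    fix g x assume g: "g \<in> \<Gamma>" "g ` M = M" and x: "x \<in> M"
    have "b y * (h (g y) - h y) = 0" if "y \<in> M" for y
    proof -
      have "g y \<in> M" using g that by blast
      then have "b y * h (g y) = b y * h y"
        using hM[OF that] hM[of "g y"] invsD(2)[OF assms(1) g(1)] invsD(2)[OF assms(2) g(1)] by metis
      then show ?thesis by (simp only: right_diff_distrib diff_self)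
    qed
    then have "h (g x) - h x = 0"
      using mult_eq_0_M[of b "\<lambda>y. h (g y) - h y" x] assms(2,3) h(1) g(1) x
      by (auto dest: invsD(1) simp: polyfun_comp polyfun_diff)
    then show "h (g x) = h x" by simp
  qed
  then show ?thesis using h(1) hM by blast
qed

lemma image_M_eq:
  assumes "g \<in> \<Gamma>" "M \<subseteq> g ` M"
  shows "g ` M = M"
proof -
  have "(g ^^ k) \<in> \<Gamma>" for k
    by (induction k) (simp_all only: funpow.simps id_\<Gamma> comp_\<Gamma>[OF assms(1)])
  then have "\<not> inj (\<lambda>k. g ^^ k)"
    using finite_\<Gamma> by (metis finite_subset image_subsetI infinite_UNIV_nat finite_imageD)
  then obtain i j where "g ^^ i = g ^^ j" "i < j"
    unfolding inj_def by (metis linorder_neqE_nat)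
  then obtain k where ik: "g ^^ i = g ^^ (i + k)" "k > 0"
    using less_imp_add_positive by blast
  have "inj (g ^^ i)" using inj_\<Gamma>[OF assms(1)] by (rule inj_fn)
  then have "(g ^^ k) x = x" for x
    using fun_cong[OF ik(1), of x] by (simp add: funpow_add inj_eq)
  then have k: "g ^^ k = id" by (simp add: fun_eq_iff)
  have "M \<subseteq> (g ^^ j) ` M" for j
  proof (induction j)
    case (Suc j)
    have "M \<subseteq> g ` M" by (fact assms(2))
    also have "\<dots> \<subseteq> g ` (g ^^ j) ` M" using Suc by (rule image_mono)
    also have "\<dots> = (g ^^ Suc j) ` M" by (simp only: funpow.simps image_comp)
    finally show ?case .
  qed auto
  from image_mono[OF this[of "k - 1"]] have "g ` M \<subseteq> g ` (g ^^ (k - 1)) ` M" .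
  also have "\<dots> = (g ^^ Suc (k - 1)) ` M" by (simp only: funpow.simps image_comp)
  also have "\<dots> = M" using ik(2) k by simp
  finally show ?thesis using assms(2) by blast
qed

text \<open>The separating polynomial is a coordinate of the defect of \<pi> from the identity,
  composed with the inverse of g. It vanishes on the image of M under g, and not at a point of M
  whose inverse image leaves M.\<close>

lemma separate_image:
  assumes "g \<in> \<Gamma>" "g ` M \<noteq> M"
  shows "\<exists>f\<in>polyfun J. (\<forall>x\<in>M. f (g x) = 0) \<and> (\<exists>x\<in>M. f x \<noteq> 0)"
proof -
  obtain q where q: "q \<in> M" "q \<notin> g ` M" using image_M_eq[OF assms(1)] assms(2) by auto
  obtain g' where g': "g' \<in> \<Gamma>" "g \<circ> g' = id" "g' \<circ> g = id" using inverse_\<Gamma>[OF assms(1)] by blast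
  then have gg': "g (g' x) = x" "g' (g x) = x" for x by (metis comp_apply id_apply)+
  have "g' q \<notin> M" using q(2) gg'(1) by (metis imageI)
  then have "\<not> (\<forall>j\<in>J. \<pi> (g' q) j = g' q j)" using in_M[OF q(1) g'(1)] by auto
  then obtain j where j: "j \<in> J" "\<pi> (g' q) j \<noteq> g' q j" by auto
  have "(\<lambda>x. \<pi> (g' x) j - g' x j) \<in> polyfun J"
    using polyfun_comp[OF polyfun_\<pi>[OF j(1)] g'(1)] polyfun_\<Gamma>[OF g'(1) j(1)] by (rule polyfun_diff)
  then show ?thesis
    using j(2) q(1) by (intro bexI[of _ "\<lambda>x. \<pi> (g' x) j - g' x j"]) (auto simp: gg' \<pi>_id)
qed

text \<open>Averaging h over \<Gamma> would mix in its values on the other translates of M. A weight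
  r that vanishes on these translates and is invariant under the stabiliser H removes them: on M the
  averages of \<open>h * r\<close> and of r are \<open>card H\<close> times \<open>h * r\<close> and
  r, so their quotient is h.\<close>

lemma stable_is_quotient:
  assumes h: "h \<in> polyfun J" "stable h"
  obtains a b where "a \<in> invs" "b \<in> invs" "\<exists>x\<in>M. b x \<noteq> 0" "\<And>x. x \<in> M \<Longrightarrow> a x = b x * h x"
proof -
  define H where "H = {g \<in> \<Gamma>. g ` M = M}"
  have fin: "finite H" using finite_\<Gamma> by (simp add: H_def)
  have "\<forall>g\<in>\<Gamma> - H. \<exists>f. f \<in> polyfun J \<and> (\<forall>x\<in>M. f (g x) = 0) \<and> (\<exists>x\<in>M. f x \<noteq> 0)"
    using separate_image unfolding H_def by blast
  from bchoice[OF this] obtain f where f': "\<forall>g\<in>\<Gamma> - H. f g \<in> polyfun J \<and>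
      (\<forall>x\<in>M. f g (g x) = 0) \<and> (\<exists>x\<in>M. f g x \<noteq> 0)" ..
  have f: "f g \<in> polyfun J" "\<exists>x\<in>M. f g x \<noteq> 0" "x \<in> M \<Longrightarrow> f g (g x) = 0" if "g \<in> \<Gamma> - H" for g x
    using f'[rule_format, OF that] by simp_all
  define s where "s x = (\<Prod>g\<in>\<Gamma> - H. f g x)" for x
  have s: "s \<in> polyfun J" "\<exists>x\<in>M. s x \<noteq> 0"
    unfolding s_def[abs_def] using f(1,2) finite_\<Gamma> by (auto intro!: nonzero_prod_M simp del: prod_zero_iff)
  have s0: "s (g x) = 0" if "g \<in> \<Gamma> - H" "x \<in> M" for g x
    unfolding s_def using f(3)[OF that] that finite_\<Gamma> by (intro prod_zero) auto
  define r where "r x = (\<Prod>g\<in>H. s (g x))" for x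
  have "\<exists>x\<in>M. s (g x) \<noteq> 0" if "g \<in> H" for g
    using s(2) that unfolding H_def by (metis (mono_tags, lifting) imageE mem_Collect_eq)
  moreover have "(\<lambda>x. s (g x)) \<in> polyfun J" if "g \<in> H" for g
    using that by (intro polyfun_comp[OF s(1)]) (simp add: H_def)
  ultimately have r: "r \<in> polyfun J" "\<exists>x\<in>M. r x \<noteq> 0"
    unfolding r_def[abs_def] using fin polyfun_prod[of H "\<lambda>g x. s (g x)"] nonzero_prod_M[of H "\<lambda>g x. s (g x)"]
    by simp_all
  have r0: "r (g x) = 0" if g: "g \<in> \<Gamma> - H" and x: "x \<in> M" for g x
  proof -
    have "s (id (g x)) = 0" using s0[OF g x] by simp
    moreover have "id \<in> H" using id_\<Gamma> by (auto simp: H_def)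
    ultimately show ?thesis unfolding r_def using fin by (meson prod_zero)
  qed
  have compH: "k \<circ> g \<in> H" if "k \<in> H" "g \<in> H" for k g
    using that comp_\<Gamma> unfolding H_def by (simp only: mem_Collect_eq image_comp[symmetric] simp_thms)
  have rH: "r (g x) = r x" if g: "g \<in> H" for g x
  proof -
    obtain g' where g': "g' \<in> \<Gamma>" "g \<circ> g' = id" "g' \<circ> g = id" using inverse_\<Gamma>[of g] g by (auto simp: H_def)
    then have "g' ` M = M" using g unfolding H_def by (metis (mono_tags, lifting) image_comp image_id id_apply mem_Collect_eq)
    then have g'H: "g' \<in> H" using g' by (simp add: H_def)
    have "bij_betw (\<lambda>k. k \<circ> g) H H"
      using g g' g'H by (intro bij_betw_byWitness[where f' = "\<lambda>k. k \<circ> g'"]) (auto simp: comp_assoc compH)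
    from prod.reindex_bij_betw[OF this, of "\<lambda>k. s (k x)"] show ?thesis by (simp add: r_def)
  qed
  have avg: "(\<Sum>g\<in>\<Gamma>. F (g x) * r (g x)) = of_nat (card H) * (F x * r x)"
    if "x \<in> M" "\<And>g. g \<in> H \<Longrightarrow> F (g x) = F x" for x F
  proof -
    have "(\<Sum>g\<in>\<Gamma>. F (g x) * r (g x)) = (\<Sum>g\<in>H. F (g x) * r (g x))"
      using finite_\<Gamma> r0 that(1) by (intro sum.mono_neutral_right) (auto simp: H_def)
    also have "\<dots> = (\<Sum>g\<in>H. F x * r x)" using rH that by (intro sum.cong) auto
    finally show ?thesis by simp
  qed
  have "card H \<noteq> 0" using fin id_\<Gamma> by (auto simp: H_def)
  show ?thesis
  proof
    show "(\<lambda>x. \<Sum>g\<in>\<Gamma>. h (g x) * r (g x)) \<in> invs"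
      using h r by (intro invs_average) auto
    show "(\<lambda>x. \<Sum>g\<in>\<Gamma>. 1 * r (g x)) \<in> invs"
      using h r by (intro invs_average) auto
    have "(\<Sum>g\<in>\<Gamma>. 1 * r (g x)) = of_nat (card H) * r x" if "x \<in> M" for x
      using avg[OF that, of "\<lambda>_. 1"] by simp
    moreover have "(\<Sum>g\<in>\<Gamma>. h (g x) * r (g x)) = of_nat (card H) * (h x * r x)" if "x \<in> M" for x
      using h(2) that by (intro avg) (auto simp: stable_def H_def)
    ultimately show "\<exists>x\<in>M. (\<Sum>g\<in>\<Gamma>. 1 * r (g x)) \<noteq> 0"
      "\<And>x. x \<in> M \<Longrightarrow> (\<Sum>g\<in>\<Gamma>. h (g x) * r (g x)) = (\<Sum>g\<in>\<Gamma>. 1 * r (g x)) * h x"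
      using \<open>card H \<noteq> 0\<close> r(2) by auto
  qed
qed

text \<open>The equation is \<open>\<Prod>\<^sub>g (h - h \<circ> g) = 0\<close>.\<close>

lemma stable_quotient_integral:
  assumes h: "h \<in> polyfun J"
  obtains d c where "\<And>i. i < d \<Longrightarrow> c i \<in> invs" "\<And>x. h x ^ d + (\<Sum>i<d. c i x * h x ^ i) = 0"
proof -
  define P where "P x = (\<Prod>g\<in>\<Gamma>. [:- h (g x), 1:])" for x
  have "(\<lambda>x. - h (g x)) \<in> polyfun J" if "g \<in> \<Gamma>" for g
    using polyfun_comp[OF h that] by (rule polyfun_uminus)
  then have "poly_family J P"
    unfolding P_def[abs_def] by (auto intro!: poly_family_prod poly_family_linear)
  moreover have "P (g x) = P x" if "g \<in> \<Gamma>" for g x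
    unfolding P_def using prod_\<Gamma>_comp[OF that, of "\<lambda>k. [:- h (k x), 1:]"] by simp
  ultimately have "(\<lambda>x. coeff (P x) i) \<in> invs" for i
    by (intro invsI) (auto simp: poly_family_def)
  moreover have "h x ^ card \<Gamma> + (\<Sum>i<card \<Gamma>. coeff (P x) i * h x ^ i) = 0" for x
  proof -
    have deg: "degree (P x) = card \<Gamma>" unfolding P_def by (simp add: degree_prod_eq_sum_degree)
    have lead: "coeff (P x) (card \<Gamma>) = 1"
      unfolding deg[symmetric] unfolding P_def by (simp add: lead_coeff_prod)
    have "poly (P x) (h x) = (\<Prod>g\<in>\<Gamma>. h x - h (g x))"
      unfolding P_def by (simp add: poly_prod)
    also have "\<dots> = 0" using finite_\<Gamma> id_\<Gamma> by (intro prod_zero) (auto intro!: bexI[of _ id])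
    finally show ?thesis
      unfolding poly_altdef deg using lead by (simp add: lessThan_Suc_atMost[symmetric] add.commute)
  qed
  ultimately show ?thesis by (intro that[of "card \<Gamma>" "\<lambda>i x. coeff (P x) i"])
qed

text \<open>The stable functions are exactly the integral elements among the quotients of
  invariants: quotients that are integral are stable polynomials, and conversely a stable polynomial
  is a quotient of invariants and satisfies a monic equation with invariant coefficients. Normality
  at p then says that each of them has an invariant denominator not vanishing at p.\<close>

theorem normal_at_iff:
  "normal_at p \<longleftrightarrow>
    (\<forall>h\<in>polyfun J. stable h \<longrightarrow> (\<exists>t\<in>invs. \<exists>c\<in>invs. t p \<noteq> 0 \<and> (\<forall>x\<in>M. t x * h x = c x)))"
proof
  assume n: "normal_at p"
  show "\<forall>h\<in>polyfun J. stable h \<longrightarrow> (\<exists>t\<in>invs. \<exists>c\<in>invs. t p \<noteq> 0 \<and> (\<forall>x\<in>M. t x * h x = c x))"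
  proof (intro ballI impI)
    fix h assume h: "h \<in> polyfun J" "stable h"
    obtain a b where ab: "a \<in> invs" "b \<in> invs" "\<exists>x\<in>M. b x \<noteq> 0" "\<And>x. x \<in> M \<Longrightarrow> a x = b x * h x"
      using stable_is_quotient[OF h] by blast
    obtain d c where c: "\<And>i. i < d \<Longrightarrow> c i \<in> invs" "\<And>x. h x ^ d + (\<Sum>i<d. c i x * h x ^ i) = 0"
      using stable_quotient_integral[OF h(1)] by blast
    have rel: "a x ^ d + (\<Sum>i<d. c i x * a x ^ i * b x ^ (d - i)) = 0" if "x \<in> M" for x
    proof -
      have "c i x * a x ^ i * b x ^ (d - i) = b x ^ d * (c i x * h x ^ i)" if "i < d" for i
      proof -
        have "b x ^ d = b x ^ i * b x ^ (d - i)" using that by (simp flip: power_add)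
        then show ?thesis using ab(4)[OF \<open>x \<in> M\<close>] by (simp add: power_mult_distrib)
      qed
      then have "a x ^ d + (\<Sum>i<d. c i x * a x ^ i * b x ^ (d - i))
          = b x ^ d * h x ^ d + (\<Sum>i<d. b x ^ d * (c i x * h x ^ i))"
        using ab(4)[OF that] by (intro arg_cong2[where f = "(+)"] sum.cong) (auto simp: power_mult_distrib)
      also have "\<dots> = b x ^ d * (h x ^ d + (\<Sum>i<d. c i x * h x ^ i))"
        by (simp only: distrib_left sum_distrib_left)
      finally show ?thesis using c(2) by simp
    qed
    have "\<exists>d c. (\<forall>i<d. c i \<in> invs) \<and> (\<forall>x\<in>M. a x ^ d + (\<Sum>i<d. c i x * a x ^ i * b x ^ (d - i)) = 0)"
      by (intro exI[of _ d] exI[of _ c] conjI allI impI ballI c(1) rel)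
    from n[unfolded normal_at_def, THEN bspec, OF ab(1), THEN bspec, OF ab(2), THEN mp, OF ab(3), THEN mp, OF this]
    obtain t e where te: "t \<in> invs" "e \<in> invs" "t p \<noteq> 0" "\<And>x. x \<in> M \<Longrightarrow> t x * a x = b x * e x"
      by blast
    have "t x * h x - e x = 0" if "x \<in> M" for x
    proof (rule mult_eq_0_M[where f = b and g = "\<lambda>x. t x * h x - e x"])
      show "b \<in> polyfun J" "(\<lambda>x. t x * h x - e x) \<in> polyfun J"
        using ab te h by (auto dest!: invsD(1) intro!: polyfun_diff polyfun_mult)
      show "b x * (t x * h x - e x) = 0" if "x \<in> M" for x
        using te(4)[OF that] ab(4)[OF that] by (simp add: algebra_simps)
    qed (use ab that in auto)
    then show "\<exists>t\<in>invs. \<exists>c\<in>invs. t p \<noteq> 0 \<and> (\<forall>x\<in>M. t x * h x = c x)"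
      using te by (intro bexI[of _ t] bexI[of _ e]) auto
  qed
next
  assume *: "\<forall>h\<in>polyfun J. stable h \<longrightarrow> (\<exists>t\<in>invs. \<exists>c\<in>invs. t p \<noteq> 0 \<and> (\<forall>x\<in>M. t x * h x = c x))"
  show "normal_at p"
    unfolding normal_at_def
  proof (intro ballI impI)
    fix a b assume ab: "a \<in> invs" "b \<in> invs" "\<exists>x\<in>M. b x \<noteq> 0"
      and "\<exists>d c. (\<forall>i<d. c i \<in> invs) \<and> (\<forall>x\<in>M. a x ^ d + (\<Sum>i<d. c i x * a x ^ i * b x ^ (d - i)) = 0)"
    then obtain d c where "\<And>i. i < d \<Longrightarrow> c i \<in> invs"
      "\<And>x. x \<in> M \<Longrightarrow> a x ^ d + (\<Sum>i<d. c i x * a x ^ i * b x ^ (d - i)) = 0" by blast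
    from integral_imp_stable_quotient[OF ab this]
    obtain h where h: "h \<in> polyfun J" "stable h" "\<And>x. x \<in> M \<Longrightarrow> a x = b x * h x"
      by blast
    from *[THEN bspec, OF h(1), THEN mp, OF h(2)]
    obtain t e where te: "t \<in> invs" "e \<in> invs" "t p \<noteq> 0" "\<forall>x\<in>M. t x * h x = e x"
      by blast
    have "t x * a x = b x * e x" if "x \<in> M" for x
      using te(4)[THEN bspec, OF that] h(3)[OF that] by (simp add: mult.left_commute)
    then show "\<exists>t\<in>invs. \<exists>c\<in>invs. t p \<noteq> 0 \<and> (\<forall>x\<in>M. t x * a x = b x * c x)"
      by (intro bexI[of _ t] bexI[of _ e] conjI ballI te(1-3))
  qed
qed

end

section \<open>Symmetric polynomials\<close>

definition monomial :: "'i set \<Rightarrow> ('i \<Rightarrow> nat) \<Rightarrow> ('i \<Rightarrow> complex) \<Rightarrow> complex" where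
  "monomial S \<alpha> x = (\<Prod>j\<in>S. x j ^ \<alpha> j)"

text \<open>A list of terms may repeat an exponent, so sums are concatenations and no coefficients
  need to be collected.\<close>

lemma polyfun_monomials:
  assumes "f \<in> polyfun S" "finite S"
  shows "\<exists>L. \<forall>x. f x = (\<Sum>(c, \<alpha>)\<leftarrow>L. c * monomial S \<alpha> x)"
  using assms(1)
proof induction
  case (const c)
  show ?case by (rule exI[of _ "[(c, \<lambda>_. 0)]"]) (simp add: monomial_def)
next
  case (add f g)
  then obtain L L' where "\<forall>x. f x = (\<Sum>(c, \<alpha>)\<leftarrow>L. c * monomial S \<alpha> x)"
    "\<forall>x. g x = (\<Sum>(c, \<alpha>)\<leftarrow>L'. c * monomial S \<alpha> x)" by blast
  then show ?case by (intro exI[of _ "L @ L'"]) simp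
next
  case (coord_mult f j)
  then obtain L where L: "\<forall>x. f x = (\<Sum>(c, \<alpha>)\<leftarrow>L. c * monomial S \<alpha> x)" by blast
  have mono: "monomial S (\<alpha>(j := Suc (\<alpha> j))) x = x j * monomial S \<alpha> x" for \<alpha> x
  proof -
    have "(\<Prod>k\<in>S - {j}. x k ^ (\<alpha>(j := Suc (\<alpha> j))) k) = (\<Prod>k\<in>S - {j}. x k ^ \<alpha> k)"
      by (intro prod.cong) auto
    then show ?thesis
      unfolding monomial_def prod.remove[OF assms(2) coord_mult(2)] by (simp add: mult.assoc)
  qed
  have "x j * (\<Sum>(c, \<alpha>)\<leftarrow>L. c * monomial S \<alpha> x)
      = (\<Sum>(c, \<alpha>)\<leftarrow>map (\<lambda>(c, \<alpha>). (c, \<alpha>(j := Suc (\<alpha> j)))) L. c * monomial S \<alpha> x)" for x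
    by (induction L) (auto simp: mono distrib_left mult.left_commute simp del: fun_upd_apply)
  with L show ?case
    by (intro exI[of _ "map (\<lambda>(c, \<alpha>). (c, \<alpha>(j := Suc (\<alpha> j)))) L"]) simp
qed

definition distinct_lists :: "'i set \<Rightarrow> nat \<Rightarrow> 'i list set" where
  "distinct_lists S m = {ys. length ys = m \<and> distinct ys \<and> set ys \<subseteq> S}"

lemma finite_distinct_lists [simp]:
  assumes "finite S"
  shows "finite (distinct_lists S m)"
proof (rule finite_subset)
  show "distinct_lists S m \<subseteq> {ys. set ys \<subseteq> S \<and> length ys = m}"
    by (auto simp: distinct_lists_def)
qed (rule finite_lists_length_eq[OF assms])

lemma distinct_lists_0: "distinct_lists S 0 = {[]}"
  by (auto simp: distinct_lists_def)

lemma sum_distinct_lists_Suc: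
  assumes "finite S"
  shows "(\<Sum>ys\<in>distinct_lists S (Suc m). F ys) = (\<Sum>ys\<in>distinct_lists S m. \<Sum>y\<in>S - set ys. F (y # ys))"
proof -
  have "(\<Sum>ys\<in>distinct_lists S m. \<Sum>y\<in>S - set ys. F (y # ys))
      = (\<Sum>(ys, y)\<in>(SIGMA ys:distinct_lists S m. S - set ys). F (y # ys))"
    using assms by (intro sum.Sigma) auto
  also have "\<dots> = (\<Sum>ys\<in>distinct_lists S (Suc m). F ys)"
    by (rule sum.reindex_bij_witness[where i = "\<lambda>ys. (tl ys, hd ys)" and j = "\<lambda>(ys, y). y # ys"])
      (auto simp: distinct_lists_def length_Suc_conv)
  finally show ?thesis by simp
qed

text \<open>The augmented monomial symmetric function: the exponents are distributed over distinct
  variables in all ordered ways, without dividing by the symmetries among equal exponents.\<close>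

definition assignment_sum :: "'i set \<Rightarrow> nat list \<Rightarrow> ('i \<Rightarrow> complex) \<Rightarrow> complex" where
  "assignment_sum S as x = (\<Sum>ys\<in>distinct_lists S (length as). \<Prod>i<length as. x (ys ! i) ^ (as ! i))"

text \<open>Letting \<open>y\<close> range over all of \<open>S\<close> overcounts exactly the cases \<open>y = ys ! i\<close>.\<close>

lemma assignment_sum_Cons:
  assumes "finite S"
  shows "assignment_sum S (a # as) x =
    (\<Sum>y\<in>S. x y ^ a) * assignment_sum S as x - (\<Sum>i<length as. assignment_sum S (as[i := as ! i + a]) x)"
proof -
  let ?P = "\<lambda>as ys. \<Prod>i<length as. x (ys ! i) ^ (as ! i)"
  have upd: "?P (as[i := as ! i + a]) ys = x (ys ! i) ^ a * ?P as ys" if "i < length as" for i ys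
  proof -
    have i: "i \<in> {..<length as}" using that by simp
    have "(\<Prod>k\<in>{..<length as} - {i}. x (ys ! k) ^ (as[i := as ! i + a] ! k))
        = (\<Prod>k\<in>{..<length as} - {i}. x (ys ! k) ^ (as ! k))"
      by (intro prod.cong) auto
    then show ?thesis
      using that by (simp add: prod.remove[OF finite_lessThan i] power_add mult_ac)
  qed
  have "assignment_sum S (a # as) x =
      (\<Sum>ys\<in>distinct_lists S (length as). \<Sum>y\<in>S - set ys. x y ^ a * ?P as ys)"
    unfolding assignment_sum_def using assms
    by (simp add: sum_distinct_lists_Suc prod.lessThan_Suc_shift del: prod.lessThan_Suc)
  also have "\<dots> = (\<Sum>ys\<in>distinct_lists S (length as).
      (\<Sum>y\<in>S. x y ^ a) * ?P as ys - (\<Sum>i<length as. ?P (as[i := as ! i + a]) ys))"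
  proof (intro sum.cong refl)
    fix ys assume ys: "ys \<in> distinct_lists S (length as)"
    then have "(\<Sum>y\<in>S - set ys. x y ^ a) = (\<Sum>y\<in>S. x y ^ a) - (\<Sum>y\<in>set ys. x y ^ a)"
      using assms by (intro sum_diff) (auto simp: distinct_lists_def)
    also have "(\<Sum>y\<in>set ys. x y ^ a) = (\<Sum>i<length as. x (ys ! i) ^ a)"
      using ys sum.reindex_bij_betw[OF bij_betw_nth[of ys "{..<length as}" "set ys"], of "\<lambda>y. x y ^ a"]
      by (auto simp: distinct_lists_def)
    finally show "(\<Sum>y\<in>S - set ys. x y ^ a * ?P as ys) =
      (\<Sum>y\<in>S. x y ^ a) * ?P as ys - (\<Sum>i<length as. ?P (as[i := as ! i + a]) ys)"
      using upd by (simp add: sum_distrib_right[symmetric] left_diff_distrib)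
  qed
  also have "\<dots> = (\<Sum>y\<in>S. x y ^ a) * assignment_sum S as x -
      (\<Sum>ys\<in>distinct_lists S (length as). \<Sum>i<length as. ?P (as[i := as ! i + a]) ys)"
    by (simp add: assignment_sum_def sum_subtractf sum_distrib_left)
  also have "(\<Sum>ys\<in>distinct_lists S (length as). \<Sum>i<length as. ?P (as[i := as ! i + a]) ys)
      = (\<Sum>i<length as. assignment_sum S (as[i := as ! i + a]) x)"
    by (subst sum.swap) (simp add: assignment_sum_def)
  finally show ?thesis .
qed

text \<open>Applying a permutation to a fixed enumeration of S gives an ordering of S without
  repetition. This map is injective and both sides have \<open>fact (card S)\<close> elements, so
  the sum over permutations is a sum over such orderings.\<close>

lemma sum_permutes_monomial:
  assumes "finite S"
  obtains as where "\<And>x. (\<Sum>\<tau> | \<tau> permutes S. monomial S \<alpha> (x \<circ> \<tau>)) = assignment_sum S as x"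
proof -
  obtain rs where rs: "set rs = S" "distinct rs" using finite_distinct_list[OF assms] by blast
  let ?r = "length rs"
  have r: "card S = ?r" using rs distinct_card by blast
  have inj: "inj_on (\<lambda>\<tau>. map \<tau> rs) {\<tau>. \<tau> permutes S}"
  proof (rule inj_onI)
    fix \<tau> \<tau>' assume *: "\<tau> \<in> {\<tau>. \<tau> permutes S}" "\<tau>' \<in> {\<tau>. \<tau> permutes S}" "map \<tau> rs = map \<tau>' rs"
    then have "\<tau> s = \<tau>' s" for s
      using rs(1) by (cases "s \<in> S") (auto simp: permutes_not_in)
    then show "\<tau> = \<tau>'" by blast
  qed
  have sub: "(\<lambda>\<tau>. map \<tau> rs) ` {\<tau>. \<tau> permutes S} \<subseteq> distinct_lists S ?r"
    using rs by (auto simp: distinct_lists_def distinct_map permutes_in_image permutes_inj_on)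
  have "card (distinct_lists S ?r) = fact ?r"
    unfolding distinct_lists_def using card_lists_distinct_length_eq[OF assms, of ?r] r
    by (simp add: fact_prod)
  then have "(\<lambda>\<tau>. map \<tau> rs) ` {\<tau>. \<tau> permutes S} = distinct_lists S ?r"
    using sub inj assms r by (intro card_subset_eq) (auto simp: card_image card_permutations)
  with inj have bij: "bij_betw (\<lambda>\<tau>. map \<tau> rs) {\<tau>. \<tau> permutes S} (distinct_lists S ?r)"
    by (simp add: bij_betw_def)
  have mono: "monomial S \<alpha> (x \<circ> \<tau>) = (\<Prod>i<?r. x (map \<tau> rs ! i) ^ (map \<alpha> rs ! i))" for x \<tau>
    unfolding monomial_def using prod.reindex_bij_betw[OF bij_betw_nth[OF rs(2) refl rs(1)[symmetric]],
      of "\<lambda>j. x (\<tau> j) ^ \<alpha> j"] by simp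
  show ?thesis
  proof
    show "(\<Sum>\<tau> | \<tau> permutes S. monomial S \<alpha> (x \<circ> \<tau>)) = assignment_sum S (map \<alpha> rs) x" for x
      unfolding assignment_sum_def mono
      using sum.reindex_bij_betw[OF bij, of "\<lambda>ys. \<Prod>i<?r. x (ys ! i) ^ (map \<alpha> rs ! i)"] by simp
  qed
qed

text \<open>A symmetric f is its own average, hence a combination of symmetrized monomials; the
  recursion for \<open>assignment_sum\<close> reduces these to power sums, as each of its terms has
  one exponent fewer. The algebra A is kept abstract so that it can consist of the functions that
  extend from M to invariants.\<close>

theorem symmetric_in_power_sum_algebra:
  assumes f: "f \<in> polyfun S" and S: "finite S"
    and sym: "\<And>\<tau> x. \<tau> permutes S \<Longrightarrow> f (x \<circ> \<tau>) = f x"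
    and const: "\<And>c. (\<lambda>x. c) \<in> A"
    and add: "\<And>f g. f \<in> A \<Longrightarrow> g \<in> A \<Longrightarrow> (\<lambda>x. f x + g x) \<in> A"
    and mult: "\<And>f g. f \<in> A \<Longrightarrow> g \<in> A \<Longrightarrow> (\<lambda>x. f x * g x) \<in> A"
    and psum: "\<And>k. (\<lambda>x. \<Sum>j\<in>S. x j ^ k) \<in> A"
  shows "f \<in> A"
proof -
  have sumA: "(\<lambda>x. \<Sum>i\<in>K. F i x) \<in> A" if "\<And>i. i \<in> K \<Longrightarrow> F i \<in> A" for F :: "nat \<Rightarrow> _" and K
    using that by (induction K rule: infinite_finite_induct) (auto simp: const add)
  have diff: "(\<lambda>x. f x - g x) \<in> A" if "f \<in> A" "g \<in> A" for f g
    using add[OF that(1) mult[OF const[of "-1"] that(2)]] by simp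
  have asg: "assignment_sum S as \<in> A" for as
  proof (induction "length as" arbitrary: as)
    case 0
    have "assignment_sum S [] = (\<lambda>x. 1)"
      by (simp add: assignment_sum_def distinct_lists_0 fun_eq_iff)
    then show ?case using 0 const by simp
  next
    case (Suc m)
    then obtain a bs where as: "as = a # bs" "length bs = m" by (cases as) auto
    have "(\<lambda>x. (\<Sum>y\<in>S. x y ^ a) * assignment_sum S bs x
        - (\<Sum>i<length bs. assignment_sum S (bs[i := bs ! i + a]) x)) \<in> A"
      using Suc.hyps(1) as(2) by (intro diff mult psum sumA) auto
    then show ?case unfolding as(1) assignment_sum_Cons[OF S, abs_def] .
  qed
  obtain L where L: "\<And>x. f x = (\<Sum>(c, \<alpha>)\<leftarrow>L. c * monomial S \<alpha> x)"
    using polyfun_monomials[OF f S] by blast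
  let ?P = "{\<tau>. \<tau> permutes S}"
  have mon: "(\<lambda>x. \<Sum>\<tau>\<in>?P. monomial S \<alpha> (x \<circ> \<tau>)) \<in> A" for \<alpha>
    by (rule sum_permutes_monomial[OF S, of \<alpha>]) (simp add: asg ext)
  have "(\<lambda>x. \<Sum>(c, \<alpha>)\<leftarrow>L'. c * (\<Sum>\<tau>\<in>?P. monomial S \<alpha> (x \<circ> \<tau>))) \<in> A" for L'
  proof (induction L')
    case Nil show ?case using const by simp
  next
    case (Cons p L')
    obtain c \<alpha> where p: "p = (c, \<alpha>)" by fastforce
    show ?case using add[OF mult[OF const[of c] mon[of \<alpha>]] Cons.IH] by (simp add: p o_def)
  qed
  moreover have "(\<Sum>(c, \<alpha>)\<leftarrow>L'. c * (\<Sum>\<tau>\<in>?P. monomial S \<alpha> (x \<circ> \<tau>)))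
      = (\<Sum>\<tau>\<in>?P. \<Sum>(c, \<alpha>)\<leftarrow>L'. c * monomial S \<alpha> (x \<circ> \<tau>))" for L' x
  proof (induction L')
    case (Cons p L')
    then show ?case by (cases p) (simp add: sum.distrib sum_distrib_left)
  qed simp
  ultimately have "(\<lambda>x. \<Sum>\<tau>\<in>?P. f (x \<circ> \<tau>)) \<in> A"
    unfolding L by simp
  from mult[OF const[of "1 / of_nat (card ?P)"] this]
  have "(\<lambda>x. 1 / of_nat (card ?P) * (\<Sum>\<tau>\<in>?P. f (x \<circ> \<tau>))) \<in> A" .
  moreover have "card ?P \<noteq> 0" using S by (simp add: card_permutations)
  moreover have "(\<Sum>\<tau>\<in>?P. f (x \<circ> \<tau>)) = of_nat (card ?P) * f x" for x
    using sym by simp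
  ultimately show ?thesis by simp
qed

section \<open>First derivatives of polynomial functions\<close>

definition has_gradient ::
    "(('i \<Rightarrow> complex) \<Rightarrow> complex) \<Rightarrow> 'i set \<Rightarrow> ('i \<Rightarrow> complex) \<Rightarrow> ('i \<Rightarrow> complex) \<Rightarrow> bool" where
  "has_gradient f J y D \<longleftrightarrow>
    (\<forall>v. ((\<lambda>s. f (\<lambda>j. y j + s * v j)) has_field_derivative (\<Sum>j\<in>J. D j * v j)) (at 0))"

lemma polyfun_gradient:
  assumes "f \<in> polyfun J" "finite J"
  shows "\<exists>D. has_gradient f J y D"
  using assms(1)
proof induction
  case (const c)
  show ?case by (rule exI[of _ "\<lambda>_. 0"]) (simp add: has_gradient_def)
next
  case (add f g)
  then obtain D D' where D: "has_gradient f J y D" "has_gradient g J y D'" by blast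
  have "has_gradient (\<lambda>x. f x + g x) J y (\<lambda>j. D j + D' j)"
    unfolding has_gradient_def
  proof
    fix v
    show "((\<lambda>s. f (\<lambda>j. y j + s * v j) + g (\<lambda>j. y j + s * v j)) has_field_derivative
      (\<Sum>j\<in>J. (D j + D' j) * v j)) (at 0)"
      using DERIV_add[OF D(1)[unfolded has_gradient_def, rule_format, of v]
        D(2)[unfolded has_gradient_def, rule_format, of v]]
      by (simp add: distrib_right sum.distrib)
  qed
  then show ?case by blast
next
  case (coord_mult f k)
  then obtain D where D: "has_gradient f J y D" by blast
  have "has_gradient (\<lambda>x. x k * f x) J y (\<lambda>j. y k * D j + (if j = k then f y else 0))"
    unfolding has_gradient_def
  proof
    fix v
    have "((\<lambda>s. y k + s * v k) has_field_derivative v k) (at 0)"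
      by (auto intro!: derivative_eq_intros)
    from DERIV_mult[OF this D[unfolded has_gradient_def, rule_format, of v]]
    have "((\<lambda>s. (y k + s * v k) * f (\<lambda>j. y j + s * v j)) has_field_derivative
        (v k * f y + (\<Sum>j\<in>J. D j * v j) * y k)) (at 0)" by simp
    moreover have "(\<Sum>j\<in>J. (y k * D j + (if j = k then f y else 0)) * v j)
        = (\<Sum>j\<in>J. D j * v j) * y k + (\<Sum>j\<in>J. if j = k then f y * v j else 0)"
      unfolding sum_distrib_right sum.distrib[symmetric] by (intro sum.cong) (auto simp: algebra_simps)
    ultimately show "((\<lambda>s. (y k + s * v k) * f (\<lambda>j. y j + s * v j)) has_field_derivative
      (\<Sum>j\<in>J. (y k * D j + (if j = k then f y else 0)) * v j)) (at 0)"
      using coord_mult(2) assms(2) by (simp add: mult.commute add.commute)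
  qed
  then show ?case by blast
qed

section \<open>Flats in cosine coordinates\<close>

text \<open>In the coordinates \<open>x\<^sub>k = cos (2 \<pi> z\<^sub>k)\<close>, the affine Weyl group acts by permutations; the half-integral
  translations contribute a common sign. With the conventions \<open>x\<^sub>0 = -1\<close> and \<open>x\<^sub>k = 1\<close> for \<open>k > n\<close>, that is
  \<open>z\<^sub>0 = 1/2\<close> and \<open>z\<^sub>k = 0\<close>, every wall of the alcove becomes \<open>x\<^sub>i = x\<^sub>i\<^sub>+\<^sub>1\<close>; \<open>flat n I\<close> is the flat spanned by
  the vertices with index in \<open>I\<close>.\<close>

definition signed_perm :: "nat \<Rightarrow> (nat \<Rightarrow> nat) \<Rightarrow> complex \<Rightarrow> (nat \<Rightarrow> complex) \<Rightarrow> (nat \<Rightarrow> complex)" where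
  "signed_perm n \<sigma> e x = (\<lambda>k. if k \<in> {1..n} then e * x (\<sigma> k) else x k)"

definition signed_perms :: "nat \<Rightarrow> complex set \<Rightarrow> ((nat \<Rightarrow> complex) \<Rightarrow> (nat \<Rightarrow> complex)) set" where
  "signed_perms n E = {signed_perm n \<sigma> e | \<sigma> e. \<sigma> permutes {1..n} \<and> e \<in> E}"

definition flat :: "nat \<Rightarrow> nat set \<Rightarrow> (nat \<Rightarrow> complex) set" where
  "flat n I = {x. x 0 = -1 \<and> (\<forall>k>n. x k = 1) \<and> (\<forall>i\<in>{0..n} - I. x i = x (Suc i))}"

text \<open>Since a flat identifies \<open>x k\<close> with \<open>x (Suc k)\<close> exactly for k
  outside I, a coordinate is tied to the one at the next element of I: blocks end at elements of I,
  and the coordinates in I other than the least one are free.\<close>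

definition next_in :: "nat set \<Rightarrow> nat \<Rightarrow> nat" where
  "next_in I k = Min {i \<in> I. k \<le> i}"

definition flat_proj :: "nat set \<Rightarrow> (nat \<Rightarrow> complex) \<Rightarrow> (nat \<Rightarrow> complex)" where
  "flat_proj I x = (\<lambda>k. if k \<le> Min I then -1 else if k > Max I then 1 else x (next_in I k))"

lemma signed_permI: "\<sigma> permutes {1..n} \<Longrightarrow> e \<in> E \<Longrightarrow> signed_perm n \<sigma> e \<in> signed_perms n E"
  by (auto simp: signed_perms_def)

lemma signed_permE:
  assumes "g \<in> signed_perms n E"
  obtains \<sigma> e where "g = signed_perm n \<sigma> e" "\<sigma> permutes {1..n}" "e \<in> E"
  using assms by (auto simp: signed_perms_def)

lemma signed_perm_comp:
  assumes "\<sigma> permutes {1..n}"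
  shows "signed_perm n \<sigma> e \<circ> signed_perm n \<tau> d = signed_perm n (\<tau> \<circ> \<sigma>) (e * d)"
  using permutes_in_image[OF assms] by (auto simp: signed_perm_def fun_eq_iff)

lemma signed_perm_id: "signed_perm n id 1 = id"
  by (auto simp: signed_perm_def fun_eq_iff)

locale alcove_flat =
  fixes n :: nat and I :: "nat set"
  assumes I: "I \<subseteq> {0..n}" "I \<noteq> {}"
begin

abbreviation "lo \<equiv> Min I"
abbreviation "hi \<equiv> Max I"
abbreviation "M \<equiv> flat n I"
abbreviation "\<rho> \<equiv> next_in I"

lemma finite_I: "finite I" using I finite_subset by blast

lemma lo_hi: "lo \<in> I" "hi \<in> I" "lo \<le> hi" "hi \<le> n" "i \<in> I \<Longrightarrow> lo \<le> i" "i \<in> I \<Longrightarrow> i \<le> hi"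
  using finite_I I by auto

lemma next_in:
  assumes "k \<le> hi"
  shows "\<rho> k \<in> I" "k \<le> \<rho> k" "i \<in> I \<Longrightarrow> k \<le> i \<Longrightarrow> \<rho> k \<le> i"
proof -
  have *: "finite {i \<in> I. k \<le> i}" "{i \<in> I. k \<le> i} \<noteq> {}" using assms lo_hi finite_I by auto
  show "\<rho> k \<in> I" "k \<le> \<rho> k" using Min_in[OF *] by (auto simp: next_in_def)
  show "\<rho> k \<le> i" if "i \<in> I" "k \<le> i" using Min_le[OF *(1), of i] that by (auto simp: next_in_def)
qed

lemma next_in_id: "i \<in> I \<Longrightarrow> \<rho> i = i"
  using next_in[of i] lo_hi by (metis le_antisym order_refl)

lemma next_in_Suc:
  assumes "k \<notin> I"
  shows "\<rho> k = \<rho> (Suc k)"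
proof -
  have "{i \<in> I. k \<le> i} = {i \<in> I. Suc k \<le> i}" using assms by (auto simp: Suc_le_eq le_less)
  then show ?thesis by (simp add: next_in_def)
qed

lemma next_in_gt: "lo < k \<Longrightarrow> k \<le> hi \<Longrightarrow> \<rho> k \<in> I - {lo}"
  using next_in[of k] by auto

lemma flat_low: "x \<in> M \<Longrightarrow> k \<le> lo \<Longrightarrow> x k = -1"
proof (induction k)
  case (Suc k)
  then have "k \<in> {0..n} - I" using lo_hi(3,4) lo_hi(5)[of k] by auto
  then show ?case using Suc by (auto simp: flat_def)
qed (simp add: flat_def)

lemma flat_high: "x \<in> M \<Longrightarrow> hi < k \<Longrightarrow> x k = 1"
proof (induction "Suc n - k" arbitrary: k)
  case 0
  then show ?case by (auto simp: flat_def)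
next
  case (Suc m)
  then have "k \<in> {0..n} - I" using lo_hi(6)[of k] by auto
  moreover have "x (Suc k) = 1" using Suc by (intro Suc.hyps(1)) auto
  ultimately show ?case using Suc by (auto simp: flat_def)
qed

lemma flat_next: "x \<in> M \<Longrightarrow> k \<le> hi \<Longrightarrow> x k = x (\<rho> k)"
proof (induction "hi - k" arbitrary: k)
  case 0
  then have "k = hi" by simp
  then show ?case using next_in_id[OF lo_hi(2)] by simp
next
  case (Suc m)
  show ?case
  proof (cases "k \<in> I")
    case True then show ?thesis by (simp only: next_in_id)
  next
    case False
    then have "x k = x (Suc k)" using Suc lo_hi by (auto simp: flat_def)
    also have "\<dots> = x (\<rho> (Suc k))" using Suc by (intro Suc.hyps(1)) auto
    finally show ?thesis using next_in_Suc[OF False] by simp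
  qed
qed

lemma flat_proj_in: "flat_proj I x \<in> M"
proof -
  have "flat_proj I x i = flat_proj I x (Suc i)" if i: "i \<in> {0..n} - I" for i
  proof -
    have "i \<noteq> lo" "i \<noteq> hi" using i lo_hi by auto
    then consider "i < lo" | "lo < i" "i < hi" | "hi < i" by linarith
    then show ?thesis
      using i lo_hi(3) next_in_Suc[of i] by cases (auto simp: flat_proj_def)
  qed
  then show ?thesis using lo_hi(3,4) by (auto simp: flat_def flat_proj_def)
qed

lemma flat_proj_id:
  assumes "x \<in> M"
  shows "flat_proj I x = x"
proof
  fix k
  show "flat_proj I x k = x k"
    using flat_low[OF assms, of k] flat_high[OF assms, of k] flat_next[OF assms, of k]
    by (cases "k \<le> lo"; cases "hi < k") (simp_all add: flat_proj_def)
qed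

lemma flat_proj_simps:
  "k \<le> lo \<Longrightarrow> flat_proj I x k = -1" "hi < k \<Longrightarrow> flat_proj I x k = 1"
  "lo < k \<Longrightarrow> k \<le> hi \<Longrightarrow> flat_proj I x k = x (\<rho> k)"
  using lo_hi(3) by (auto simp: flat_proj_def)

lemma polyfun_flat_proj: "(\<lambda>x. flat_proj I x k) \<in> polyfun (I - {lo})"
proof -
  consider "k \<le> lo" | "lo < k" "k \<le> hi" | "hi < k" by linarith
  then show ?thesis
    by cases (auto simp: flat_proj_simps intro!: polyfun_coord next_in_gt)
qed

lemma polyfun_mono: "f \<in> polyfun A \<Longrightarrow> A \<subseteq> B \<Longrightarrow> f \<in> polyfun B"
  by (rule polyfun_compose[of f A "\<lambda>x. x" B]) (auto intro!: polyfun_coord)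

lemma quotient_image:
  assumes E: "finite E" "1 \<in> E" "\<And>e d. e \<in> E \<Longrightarrow> d \<in> E \<Longrightarrow> e * d \<in> E" "\<And>e. e \<in> E \<Longrightarrow> e * e = 1"
  shows "quotient_image {1..n} (signed_perms n E) M (flat_proj I)"
proof
  have "signed_perms n E = (\<lambda>(\<sigma>, e). signed_perm n \<sigma> e) ` ({\<sigma>. \<sigma> permutes {1..n}} \<times> E)"
    by (auto simp: signed_perms_def)
  then show "finite (signed_perms n E)" using E(1) by (simp add: finite_permutations)
  show "id \<in> signed_perms n E"
    using signed_permI[OF permutes_id E(2)] by (simp add: signed_perm_id)
  show "g \<circ> h \<in> signed_perms n E" if "g \<in> signed_perms n E" "h \<in> signed_perms n E" for g h
    using that E(3) by (elim signed_permE) (auto simp: signed_perm_comp intro!: signed_permI permutes_compose)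
  show "\<exists>h\<in>signed_perms n E. g \<circ> h = id \<and> h \<circ> g = id" if "g \<in> signed_perms n E" for g
  proof -
    obtain \<sigma> e where g: "g = signed_perm n \<sigma> e" "\<sigma> permutes {1..n}" "e \<in> E"
      using \<open>g \<in> signed_perms n E\<close> by (rule signed_permE)
    show ?thesis
      using g permutes_inv[OF g(2)] permutes_inv_o[OF g(2)] E(4)
      by (intro bexI[of _ "signed_perm n (inv_into UNIV \<sigma>) e"]) (auto simp: signed_perm_comp signed_perm_id intro!: signed_permI)
  qed
  show "(\<lambda>x. g x j) \<in> polyfun {1..n}" if "g \<in> signed_perms n E" "j \<in> {1..n}" for g j
  proof -
    obtain \<sigma> e where g: "g = signed_perm n \<sigma> e" "\<sigma> permutes {1..n}" using \<open>g \<in> signed_perms n E\<close> by (rule signed_permE)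
    have "\<sigma> j \<in> {1..n}" using permutes_in_image[OF g(2)] that(2) by blast
    then show ?thesis
      using that(2) by (auto simp: g signed_perm_def intro!: polyfun_mult polyfun_coord)
  qed
  have "I - {lo} \<subseteq> {1..n}" using I(1) lo_hi(5) by fastforce
  then show "(\<lambda>x. flat_proj I x j) \<in> polyfun {1..n}" for j
    by (rule polyfun_mono[OF polyfun_flat_proj])
  show "flat_proj I x \<in> M" "x \<in> M \<Longrightarrow> flat_proj I x = x" for x
    by (rule flat_proj_in, rule flat_proj_id)
  show "g x \<in> M" if "x \<in> M" "g \<in> signed_perms n E" "\<And>j. j \<in> {1..n} \<Longrightarrow> flat_proj I (g x) j = g x j" for g x
  proof -
    have "flat_proj I (g x) k = g x k" for k
    proof (cases "k \<in> {1..n}")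
      case False
      then have "k = 0 \<or> k > n" by auto
      moreover have "g x k = x k" using that(2) False by (elim signed_permE) (auto simp: signed_perm_def)
      ultimately show ?thesis
        using lo_hi(4) flat_low[OF that(1), of 0] flat_high[OF that(1), of k]
        by (elim disjE) (simp_all add: flat_proj_simps)
    qed (use that(3) in auto)
    then have "flat_proj I (g x) = g x" by (rule ext)
    with flat_proj_in[of "g x"] show ?thesis by (simp only:)
  qed
qed

sublocale sp: quotient_image "{1..n}" "signed_perms n {1}" "flat n I" "flat_proj I"
  by (rule quotient_image) auto

sublocale psp: quotient_image "{1..n}" "signed_perms n {1, -1}" "flat n I" "flat_proj I"
  by (rule quotient_image) auto

text \<open>On \<open>M\<close> the coordinates in \<open>block r\<close> coincide with \<open>x\<^sub>r\<close>, and the other coordinates are constant.\<close>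

definition block :: "nat \<Rightarrow> nat set" where
  "block r = {k. lo < k \<and> k \<le> hi \<and> \<rho> k = r}"

text \<open>The size is a parameter and not a function of I, because a flat that is a single vertex
  has no free coordinates and then every d is admissible.\<close>

definition balanced :: "nat \<Rightarrow> bool" where
  "balanced d \<longleftrightarrow> (\<forall>r\<in>I - {lo}. card (block r) = d)"

lemma block_subset: "block r \<subseteq> {1..n}"
  using lo_hi(4) by (auto simp: block_def)

lemma finite_block [simp]: "finite (block r)"
  using block_subset finite_subset by blast

lemma block_self: "r \<in> I - {lo} \<Longrightarrow> r \<in> block r"
  using lo_hi(5,6)[of r] by (auto simp: block_def next_in_id)

lemma sum_coords:
  fixes F :: "nat \<Rightarrow> 'b::comm_monoid_add"
  shows
  "(\<Sum>k\<in>{1..n}. F k) = (\<Sum>k\<in>{1..lo}. F k) + (\<Sum>r\<in>I - {lo}. \<Sum>k\<in>block r. F k) + (\<Sum>k\<in>{Suc hi..n}. F k)"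
proof -
  have "{1..n} = {1..lo} \<union> {Suc lo..hi} \<union> {Suc hi..n}" using lo_hi(3,4) by auto
  then have "(\<Sum>k\<in>{1..n}. F k) = (\<Sum>k\<in>{1..lo} \<union> {Suc lo..hi}. F k) + (\<Sum>k\<in>{Suc hi..n}. F k)"
    using lo_hi(3) sum.union_disjoint[of "{1..lo} \<union> {Suc lo..hi}" "{Suc hi..n}" F] by (simp add: Int_Un_distrib2)
  also have "(\<Sum>k\<in>{1..lo} \<union> {Suc lo..hi}. F k) = (\<Sum>k\<in>{1..lo}. F k) + (\<Sum>k\<in>{Suc lo..hi}. F k)"
    by (rule sum.union_disjoint) auto
  also have "{Suc lo..hi} = (\<Union>r\<in>I - {lo}. block r)"
    using next_in_gt by (auto simp: block_def Suc_le_eq)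
  also have "(\<Sum>k\<in>(\<Union>r\<in>I - {lo}. block r). F k) = (\<Sum>r\<in>I - {lo}. \<Sum>k\<in>block r. F k)"
    using finite_I by (intro sum.UNION_disjoint) (auto simp: block_def)
  finally show ?thesis .
qed

lemma sum_flat:
  fixes G :: "complex \<Rightarrow> 'b::semiring_1"
  assumes "x \<in> M"
  shows "(\<Sum>k\<in>{1..n}. G (x k)) = of_nat lo * G (-1) + (\<Sum>r\<in>I - {lo}. of_nat (card (block r)) * G (x r)) + of_nat (n - hi) * G 1"
proof -
  have "(\<Sum>k\<in>{1..lo}. G (x k)) = (\<Sum>k\<in>{1..lo}. G (-1))"
    using flat_low[OF assms] by (intro sum.cong) auto
  moreover have "(\<Sum>k\<in>{Suc hi..n}. G (x k)) = (\<Sum>k\<in>{Suc hi..n}. G 1)"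
    using flat_high[OF assms] by (intro sum.cong) auto
  moreover have "(\<Sum>k\<in>block r. G (x k)) = (\<Sum>k\<in>block r. G (x r))" for r
    using flat_next[OF assms] by (intro sum.cong) (auto simp: block_def)
  ultimately show ?thesis unfolding sum_coords[of "\<lambda>k. G (x k)"] by simp
qed

end

lemma (in quotient_image) image_M_eq':
  assumes "g \<in> \<Gamma>" "g ` M \<subseteq> M"
  shows "g ` M = M"
proof -
  obtain g' where g': "g' \<in> \<Gamma>" "g \<circ> g' = id" "g' \<circ> g = id" using inverse_\<Gamma>[OF assms(1)] by blast
  have "M = g' ` g ` M" using g'(3) by (simp add: image_comp)
  also have "\<dots> \<subseteq> g' ` M" using assms(2) by (rule image_mono)
  finally have "g' ` M = M" by (rule image_M_eq[OF g'(1)])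
  then have "g ` M = g ` g' ` M" by simp
  also have "\<dots> = M" using g'(2) by (simp add: image_comp)
  finally show ?thesis .
qed

context alcove_flat begin

text \<open>Blocks of equal size can be permuted as wholes: the element k goes to the element with
  the same position in the block of \<open>\<tau> (\<rho> k)\<close>, positions being taken in fixed
  enumerations \<beta> of the blocks.\<close>

lemma block_permutation:
  assumes d: "balanced d" and \<tau>: "\<tau> permutes I - {lo}"
  obtains \<sigma> where "\<sigma> permutes {1..n}"
    "\<And>x. x \<in> M \<Longrightarrow> signed_perm n \<sigma> 1 x = flat_proj I (x \<circ> \<tau>)"
proof -
  define U where "U = {k. lo < k \<and> k \<le> hi}"
  have "\<forall>r\<in>I - {lo}. \<exists>b. bij_betw b {0..<d} (block r)"
    using d ex_bij_betw_nat_finite[OF finite_block] by (metis balanced_def)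
  from bchoice[OF this] obtain \<beta> where \<beta>: "\<And>r. r \<in> I - {lo} \<Longrightarrow> bij_betw (\<beta> r) {0..<d} (block r)"
    by blast
  define \<sigma> where "\<sigma> k = (if k \<in> U then \<beta> (\<tau> (\<rho> k)) (inv_into {0..<d} (\<beta> (\<rho> k)) k) else k)" for k
  have r: "\<rho> k \<in> I - {lo}" "\<tau> (\<rho> k) \<in> I - {lo}" "k \<in> block (\<rho> k)" if "k \<in> U" for k
  proof -
    show "\<rho> k \<in> I - {lo}" using that next_in_gt by (simp add: U_def)
    then show "\<tau> (\<rho> k) \<in> I - {lo}" using permutes_in_image[OF \<tau>] by blast
    show "k \<in> block (\<rho> k)" using that by (simp add: block_def U_def)
  qed
  have idx: "inv_into {0..<d} (\<beta> (\<rho> k)) k \<in> {0..<d}" if "k \<in> U" for k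
    using \<beta>[OF r(1)[OF that]] r(3)[OF that] by (metis bij_betw_imp_surj_on inv_into_into)
  have \<sigma>_block: "\<sigma> k \<in> block (\<tau> (\<rho> k))" if "k \<in> U" for k
    using \<beta>[OF r(2)[OF that]] idx[OF that] that by (auto simp: \<sigma>_def dest: bij_betwE)
  then have \<sigma>_U: "\<sigma> k \<in> U" "\<rho> (\<sigma> k) = \<tau> (\<rho> k)" if "k \<in> U" for k
    using that by (auto simp: block_def U_def)
  have U: "U \<subseteq> {1..n}" using lo_hi(4) by (auto simp: U_def)
  have "inj_on \<sigma> {1..n}"
  proof (rule inj_onI)
    fix k l assume kl: "k \<in> {1..n}" "l \<in> {1..n}" "\<sigma> k = \<sigma> l"
    consider "k \<in> U" "l \<in> U" | "k \<in> U" "l \<notin> U" | "k \<notin> U" "l \<in> U" | "k \<notin> U" "l \<notin> U" by blast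
    then show "k = l"
    proof cases
      case 1
      then have "\<tau> (\<rho> k) = \<tau> (\<rho> l)" using kl(3) \<sigma>_U(2) by metis
      then have eq: "\<rho> k = \<rho> l" using permutes_inj[OF \<tau>] by (simp add: inj_eq)
      have "\<beta> (\<tau> (\<rho> k)) (inv_into {0..<d} (\<beta> (\<rho> k)) k) = \<beta> (\<tau> (\<rho> k)) (inv_into {0..<d} (\<beta> (\<rho> k)) l)"
        using kl(3) 1 eq by (simp add: \<sigma>_def)
      then have "inv_into {0..<d} (\<beta> (\<rho> k)) k = inv_into {0..<d} (\<beta> (\<rho> k)) l"
        using bij_betw_imp_inj_on[OF \<beta>[OF r(2)[OF 1(1)]]] idx[OF 1(1)] idx[OF 1(2)] eq
        by (simp add: inj_on_eq_iff)
      then show ?thesis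
        using bij_betw_inv_into_right[OF \<beta>[OF r(1)[OF 1(1)]]] r(3)[OF 1(1)] r(3)[OF 1(2)] eq by metis
    next
      case 2 then show ?thesis using \<sigma>_U(1)[of k] kl by (simp add: \<sigma>_def[of l])
    next
      case 3 then show ?thesis using \<sigma>_U(1)[of l] kl by (simp add: \<sigma>_def[of k])
    next
      case 4 then show ?thesis using kl by (simp add: \<sigma>_def)
    qed
  qed
  moreover have "\<sigma> ` {1..n} \<subseteq> {1..n}"
  proof
    fix l assume "l \<in> \<sigma> ` {1..n}"
    then obtain k where "l = \<sigma> k" "k \<in> {1..n}" by blast
    then show "l \<in> {1..n}" using \<sigma>_U(1)[of k] U by (cases "k \<in> U") (auto simp: \<sigma>_def[of k])
  qed
  ultimately have "bij_betw \<sigma> {1..n} {1..n}"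
    by (simp add: bij_betw_def endo_inj_surj)
  then have "\<sigma> permutes {1..n}"
    by (rule bij_imp_permutes) (use U in \<open>auto simp: \<sigma>_def\<close>)
  moreover have "signed_perm n \<sigma> 1 x = flat_proj I (x \<circ> \<tau>)" if x: "x \<in> M" for x
  proof
    fix k
    show "signed_perm n \<sigma> 1 x k = flat_proj I (x \<circ> \<tau>) k"
    proof (cases "k \<in> U")
      case True
      then have "x (\<sigma> k) = x (\<tau> (\<rho> k))"
        using flat_next[OF x, of "\<sigma> k"] \<sigma>_U[OF True] by (simp add: U_def)
      then show ?thesis using True U by (auto simp: signed_perm_def U_def flat_proj_simps)
    next
      case False
      then have "signed_perm n \<sigma> 1 x k = x k" by (simp add: signed_perm_def \<sigma>_def)
      then show ?thesis
        using False flat_low[OF x, of k] flat_high[OF x, of k]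
        by (cases "k \<le> lo") (simp_all add: flat_proj_simps U_def)
    qed
  qed
  ultimately show ?thesis using that by blast
qed

text \<open>Permuting blocks stabilises M, so a stable function is symmetric in the free coordinates
  and hence a polynomial in their power sums. These extend, since a power sum of all coordinates
  restricts to d times the power sum of the free ones plus a constant.\<close>

lemma sp_stable_extends:
  assumes d: "balanced d" and h: "h \<in> polyfun {1..n}" "sp.stable h"
  shows "\<exists>H\<in>sp.invs. \<forall>x\<in>M. H x = h x"
proof -
  define S where "S = I - {lo}"
  have S: "finite S" using finite_I by (simp add: S_def)
  define A where "A = {f. \<exists>H\<in>sp.invs. \<forall>x\<in>M. H x = f x}"
  have "(\<lambda>x. h (flat_proj I x)) \<in> A"
  proof (rule symmetric_in_power_sum_algebra[OF _ S])
    show "(\<lambda>x. h (flat_proj I x)) \<in> polyfun S"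
      unfolding S_def by (rule polyfun_compose[OF h(1)]) (rule polyfun_flat_proj)
    show "h (flat_proj I (x \<circ> \<tau>)) = h (flat_proj I x)" if \<tau>: "\<tau> permutes S" for \<tau> x
    proof -
      obtain \<sigma> where \<sigma>: "\<sigma> permutes {1..n}"
        "\<And>x. x \<in> M \<Longrightarrow> signed_perm n \<sigma> 1 x = flat_proj I (x \<circ> \<tau>)"
        using block_permutation[OF d] \<tau> unfolding S_def by metis
      have g: "signed_perm n \<sigma> 1 \<in> signed_perms n {1}" using \<sigma>(1) by (simp add: signed_permI)
      have "signed_perm n \<sigma> 1 ` M \<subseteq> M" using \<sigma>(2) flat_proj_in by auto
      then have gM: "signed_perm n \<sigma> 1 ` M = M" by (rule sp.image_M_eq'[OF g])
      \<comment> \<open>Stability speaks about points of M only, while x is arbitrary here.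
        Replacing x by its projection keeps the coordinates in S, which are the only ones that
        \<open>flat_proj I (x \<circ> \<tau>)\<close> reads.\<close>
      define y where "y = flat_proj I x"
      have y: "y \<in> M" by (simp add: y_def flat_proj_in)
      have "flat_proj I (y \<circ> \<tau>) = flat_proj I (x \<circ> \<tau>)"
      proof
        fix k
        show "flat_proj I (y \<circ> \<tau>) k = flat_proj I (x \<circ> \<tau>) k"
        proof (cases "lo < k \<and> k \<le> hi")
          case True
          then have "\<tau> (\<rho> k) \<in> I - {lo}" using permutes_in_image[OF \<tau>] next_in_gt unfolding S_def by blast
          then have "y (\<tau> (\<rho> k)) = x (\<tau> (\<rho> k))"
            using lo_hi(5,6)[of "\<tau> (\<rho> k)"] by (simp add: y_def flat_proj_simps next_in_id)
          then show ?thesis using True by (simp add: flat_proj_simps)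
        next
          case False
          then show ?thesis by (cases "k \<le> lo") (simp_all add: flat_proj_simps)
        qed
      qed
      then have "h (flat_proj I (x \<circ> \<tau>)) = h (signed_perm n \<sigma> 1 y)" using \<sigma>(2)[OF y] by simp
      also have "\<dots> = h y" using h(2) g gM y unfolding sp.stable_def by blast
      finally show ?thesis by (simp add: y_def)
    qed
    show "(\<lambda>x. c) \<in> A" for c unfolding A_def mem_Collect_eq by (intro bexI[of _ "\<lambda>x. c"] sp.invs_const) simp
    show "(\<lambda>x. f x + g x) \<in> A" "(\<lambda>x. f x * g x) \<in> A" if fg: "f \<in> A" "g \<in> A" for f g
    proof -
      obtain F G where "F \<in> sp.invs" "\<forall>x\<in>M. F x = f x" "G \<in> sp.invs" "\<forall>x\<in>M. G x = g x"
        using fg unfolding A_def by blast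
      note FG = this
      have "\<exists>H\<in>sp.invs. \<forall>x\<in>M. H x = f x + g x"
        using FG by (intro bexI[of _ "\<lambda>x. F x + G x"] sp.invs_add) simp
      moreover have "\<exists>H\<in>sp.invs. \<forall>x\<in>M. H x = f x * g x"
        using FG by (intro bexI[of _ "\<lambda>x. F x * G x"] sp.invs_mult) simp
      ultimately show "(\<lambda>x. f x + g x) \<in> A" "(\<lambda>x. f x * g x) \<in> A" by (simp_all add: A_def)
    qed
    show "(\<lambda>x. \<Sum>r\<in>S. x r ^ k) \<in> A" for k
    proof (cases "S = {}")
      case True then show ?thesis using \<open>\<And>c. (\<lambda>x. c) \<in> A\<close> by simp
    next
      case False
      then obtain r where r: "r \<in> S" by blast
      then have "r \<in> block r" using block_self by (simp add: S_def)
      moreover have "card (block r) = d" using d r by (simp add: balanced_def S_def)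
      ultimately have d0: "d \<noteq> 0" using finite_block[of r] by (metis card_eq_0_iff empty_iff)
      \<comment> \<open>The subtracted constant is the contribution of the lo coordinates equal to
        -1 and the \<open>n - hi\<close> coordinates equal to 1; each free coordinate is counted d
        times.\<close>
      define H where "H x = ((\<Sum>j\<in>{1..n}. x j ^ k) - (of_nat lo * (-1) ^ k + of_nat (n - hi))) * (1 / of_nat d)"
        for x :: "nat \<Rightarrow> complex"
      have "(\<lambda>x. \<Sum>j\<in>{1..n}. x j ^ k) \<in> sp.invs"
      proof (rule sp.invsI)
        show "(\<lambda>x. \<Sum>j\<in>{1..n}. x j ^ k) \<in> polyfun {1..n}"
          by (intro polyfun_sum polyfun_power polyfun_coord)
        show "(\<Sum>j\<in>{1..n}. g x j ^ k) = (\<Sum>j\<in>{1..n}. x j ^ k)" if "g \<in> signed_perms n {1}" for g x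
        proof -
          obtain \<sigma> where \<sigma>: "g = signed_perm n \<sigma> 1" "\<sigma> permutes {1..n}"
            using \<open>g \<in> signed_perms n {1}\<close> by (auto elim: signed_permE)
          have "(\<Sum>j\<in>{1..n}. g x j ^ k) = (\<Sum>j\<in>{1..n}. x (\<sigma> j) ^ k)"
            by (intro sum.cong) (auto simp: \<sigma>(1) signed_perm_def)
          also have "\<dots> = (\<Sum>j\<in>{1..n}. x j ^ k)"
            using sum.permute[OF \<sigma>(2), of "\<lambda>j. x j ^ k"] by (simp add: comp_def)
          finally show ?thesis .
        qed
      qed
      then have "H \<in> sp.invs" unfolding H_def[abs_def] by (intro sp.invs_mult sp.invs_diff sp.invs_const)
      moreover have "H x = (\<Sum>r\<in>S. x r ^ k)" if "x \<in> M" for x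
      proof -
        have "(\<Sum>r\<in>S. of_nat (card (block r)) * x r ^ k) = of_nat d * (\<Sum>r\<in>S. x r ^ k)"
          unfolding sum_distrib_left using d by (intro sum.cong) (auto simp: balanced_def S_def)
        then show ?thesis
          unfolding H_def sum_flat[OF that, of "\<lambda>z. z ^ k"] S_def[symmetric] using d0 by simp
      qed
      ultimately show ?thesis unfolding A_def by blast
    qed
  qed
  then obtain H where "H \<in> sp.invs" "\<forall>x\<in>M. H x = h (flat_proj I x)" unfolding A_def by blast
  then show ?thesis using flat_proj_id by (intro bexI[of _ H]) auto
qed

section \<open>The stabiliser of a flat, and the necessity of equal block sizes\<close>

lemma stabiliser_same_class:
  assumes g: "signed_perm n \<sigma> e ` M = M" "\<sigma> permutes {1..n}" "e \<noteq> 0" and kl: "k \<in> {1..n}" "l \<in> {1..n}"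
  shows "(\<forall>x\<in>M. x (\<sigma> k) = x (\<sigma> l)) \<longleftrightarrow> (\<forall>x\<in>M. x k = x l)"
proof -
  have "(\<forall>x\<in>M. x k = x l) \<longleftrightarrow> (\<forall>x\<in>signed_perm n \<sigma> e ` M. x k = x l)" using g(1) by simp
  also have "\<dots> \<longleftrightarrow> (\<forall>x\<in>M. x (\<sigma> k) = x (\<sigma> l))"
    using kl g(3) by (auto simp: signed_perm_def)
  finally show ?thesis by blast
qed

lemma stabiliser_constant:
  assumes g: "signed_perm n \<sigma> e ` M = M" "\<sigma> permutes {1..n}" and k: "k \<in> {1..n}"
  shows "(\<forall>x\<in>M. x k = c) \<longleftrightarrow> (\<forall>x\<in>M. e * x (\<sigma> k) = c)"
proof -
  have "(\<forall>x\<in>M. x k = c) \<longleftrightarrow> (\<forall>x\<in>signed_perm n \<sigma> e ` M. x k = c)" using g(1) by simp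
  also have "\<dots> \<longleftrightarrow> (\<forall>x\<in>M. e * x (\<sigma> k) = c)"
    using k by (auto simp: signed_perm_def)
  finally show ?thesis .
qed

definition nonconst :: "nat \<Rightarrow> bool" where
  "nonconst k \<longleftrightarrow> (\<nexists>c. \<forall>x\<in>M. x k = c)"

definition coord_class :: "nat \<Rightarrow> nat set" where
  "coord_class k = {l \<in> {1..n}. \<forall>x\<in>M. x l = x k}"

lemma nonconst_iff: "nonconst k \<longleftrightarrow> lo < k \<and> k \<le> hi"
proof
  assume "nonconst k"
  then show "lo < k \<and> k \<le> hi" using flat_low flat_high unfolding nonconst_def by (meson not_le)
next
  assume k: "lo < k \<and> k \<le> hi"
  have "flat_proj I (\<lambda>_. 0) k = 0" "flat_proj I (\<lambda>_. 1) k = 1" using k by (simp_all add: flat_proj_simps)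
  then show "nonconst k" unfolding nonconst_def using flat_proj_in by (metis zero_neq_one)
qed

lemma coord_class_eq:
  assumes r: "r \<in> I - {lo}" and k: "k \<in> block r"
  shows "coord_class k = block r"
proof -
  have "l \<in> block r" if l: "l \<in> {1..n}" "\<And>x. x \<in> M \<Longrightarrow> x l = x k" for l
  proof -
    have k': "lo < k" "k \<le> hi" "\<rho> k = r" using k by (auto simp: block_def)
    have "nonconst k" using k' nonconst_iff by blast
    then have "nonconst l" unfolding nonconst_def using l(2) by metis
    then have l': "lo < l" "l \<le> hi" using nonconst_iff by auto
    have "\<rho> l = r"
      using l(2)[OF flat_proj_in, of "\<lambda>i. if i = r then 1 else 0"] k' l'
      by (simp add: flat_proj_simps split: if_splits)
    then show ?thesis using l' by (simp add: block_def)
  qed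
  moreover have "x l = x k" if "l \<in> block r" "x \<in> M" for l x
    using that k flat_next[OF that(2)] by (auto simp: block_def)
  ultimately show ?thesis using block_subset[of r] by (auto simp: coord_class_def)
qed

end

text \<open>The transposition of k and l fixes p in these coordinates and exchanges the two
  coordinate lines through p, along which f therefore has the same derivative.\<close>

lemma gradient_symmetric:
  assumes D: "has_gradient f {1..n} p D" and f: "\<And>\<sigma> x. \<sigma> permutes {1..n} \<Longrightarrow> f (signed_perm n \<sigma> 1 x) = f x"
    and kl: "k \<in> {1..n}" "l \<in> {1..n}" "p k = p l"
  shows "D k = D l"
proof -
  define v where "v m j = (if j = m then 1 else 0 :: complex)" for m j :: nat
  have sum: "(\<Sum>j\<in>{1..n}. D j * v m j) = D m" if "m \<in> {1..n}" for m
  proof -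
    have "(\<Sum>j\<in>{1..n}. D j * v m j) = (\<Sum>j\<in>{1..n}. if j = m then D j else 0)"
      by (intro sum.cong) (auto simp: v_def)
    then show ?thesis using that by simp
  qed
  have "Transposition.transpose k l permutes {1..n}" using kl by (simp add: permutes_swap_id)
  note perm = this
  have "signed_perm n (Transposition.transpose k l) 1 (\<lambda>j. p j + s * v k j) = (\<lambda>j. p j + s * v l j)" for s
  proof
    fix j
    show "signed_perm n (Transposition.transpose k l) 1 (\<lambda>j. p j + s * v k j) j = p j + s * v l j"
      unfolding signed_perm_def v_def Transposition.transpose_def using kl
      by (cases "j = k"; cases "j = l") simp_all
  qed
  then have eq: "f (\<lambda>j. p j + s * v k j) = f (\<lambda>j. p j + s * v l j)" for s
    using f[OF perm, of "\<lambda>j. p j + s * v k j"] by (simp only:)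
  have "((\<lambda>s. f (\<lambda>j. p j + s * v m j)) has_field_derivative D m) (at 0)" if "m \<in> {1..n}" for m
    using D[unfolded has_gradient_def, rule_format, of "v m"] sum[OF that] by simp
  note deriv = this
  from deriv[OF kl(1)] have "((\<lambda>s. f (\<lambda>j. p j + s * v l j)) has_field_derivative D k) (at 0)"
    by (simp only: eq)
  then show ?thesis using deriv[OF kl(2)] by (rule DERIV_unique)
qed

context alcove_flat begin

text \<open>The sum of the squares of the coordinates whose class has the size of \<open>block r\<^sub>1\<close> is stable. At a point
  where all nonconstant coordinates agree, an invariant has the same partial derivative in all of them,
  so its derivatives along the blocks are proportional to their sizes; that sum violates this.\<close>

lemma normal_imp_balanced:
  assumes E: "finite E" "1 \<in> E" "\<And>e d. e \<in> E \<Longrightarrow> d \<in> E \<Longrightarrow> e * d \<in> E" "\<And>e. e \<in> E \<Longrightarrow> e * e = 1"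
    and normal: "\<And>p. p \<in> M \<Longrightarrow> quotient_image.normal_at {1..n} (signed_perms n E) M p"
  shows "\<exists>d. balanced d"
proof (rule ccontr)
  interpret q: quotient_image "{1..n}" "signed_perms n E" M "flat_proj I" by (rule quotient_image[OF E])
  assume "\<nexists>d. balanced d"
  then obtain r\<^sub>1 r\<^sub>2 where r: "r\<^sub>1 \<in> I - {lo}" "r\<^sub>2 \<in> I - {lo}" "card (block r\<^sub>1) \<noteq> card (block r\<^sub>2)"
    unfolding balanced_def by metis
  \<comment> \<open>Classes of coordinates that agree on all of M are intrinsic, so elements of the
    stabiliser permute them and preserve their sizes; for nonconstant coordinates they are the
    blocks. Squaring in h removes the sign e of such an element.\<close>
  define K where "K = {k \<in> {1..n}. nonconst k \<and> card (coord_class k) = card (block r\<^sub>1)}"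
  define h where "h x = (\<Sum>k\<in>K. x k ^ 2)" for x :: "nat \<Rightarrow> complex"
  have h_poly: "h \<in> polyfun {1..n}"
    unfolding h_def[abs_def] by (intro polyfun_sum polyfun_power polyfun_coord) (simp add: K_def)
  have "q.stable h"
    unfolding q.stable_def
  proof (intro ballI impI)
    fix g x assume g: "g \<in> signed_perms n E" "g ` M = M" and x: "x \<in> M"
    obtain \<sigma> e where \<sigma>: "g = signed_perm n \<sigma> e" "\<sigma> permutes {1..n}" "e \<in> E"
      using g(1) by (rule signed_permE)
    have e: "e * e = 1" "e \<noteq> 0" using E(4)[OF \<sigma>(3)] by auto
    note gM = g(2)[unfolded \<sigma>(1)]
    have \<sigma>J: "\<sigma> k \<in> {1..n} \<longleftrightarrow> k \<in> {1..n}" for k using permutes_in_image[OF \<sigma>(2)] .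
    have nc: "nonconst (\<sigma> k) \<longleftrightarrow> nonconst k" if k: "k \<in> {1..n}" for k
    proof -
      have "e * x = c \<longleftrightarrow> x = e * c" for x c
        using e(1) by (metis mult.assoc mult_1)
      then show ?thesis
        unfolding nonconst_def stabiliser_constant[OF gM \<sigma>(2) k] by (metis e(1) mult.assoc mult_1)
    qed
    have cls: "coord_class (\<sigma> k) = \<sigma> ` coord_class k" if k: "k \<in> {1..n}" for k
    proof -
      have "l \<in> coord_class (\<sigma> k) \<longleftrightarrow> l \<in> \<sigma> ` coord_class k" for l
      proof -
        obtain l' where l': "l = \<sigma> l'" using permutes_surj[OF \<sigma>(2)] by blast
        have "l \<in> coord_class (\<sigma> k) \<longleftrightarrow> l' \<in> coord_class k"
          unfolding l' coord_class_def using \<sigma>J[of l'] stabiliser_same_class[OF gM \<sigma>(2) e(2) _ k, of l'] by auto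
        then show ?thesis using permutes_inj[OF \<sigma>(2)] by (simp add: l' inj_image_mem_iff)
      qed
      then show ?thesis by blast
    qed
    have "card (coord_class (\<sigma> k)) = card (coord_class k)" if "k \<in> {1..n}" for k
      unfolding cls[OF that] using permutes_inj_on[OF \<sigma>(2)] by (rule card_image)
    then have K\<sigma>: "\<sigma> k \<in> K \<longleftrightarrow> k \<in> K" for k
      using \<sigma>J[of k] nc[of k] by (auto simp: K_def)
    have "\<sigma> ` K = K"
    proof
      show "K \<subseteq> \<sigma> ` K"
      proof
        fix l assume "l \<in> K"
        moreover obtain k where "l = \<sigma> k" using permutes_surj[OF \<sigma>(2)] by blast
        ultimately show "l \<in> \<sigma> ` K" using K\<sigma> by blast
      qed
    qed (use K\<sigma> in auto)
    then have "bij_betw \<sigma> K K" using permutes_inj_on[OF \<sigma>(2)] by (simp add: bij_betw_def)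
    have "h (g x) = (\<Sum>k\<in>K. x (\<sigma> k) ^ 2)"
      unfolding h_def
    proof (intro sum.cong refl)
      fix k assume "k \<in> K"
      then have "k \<in> {1..n}" by (simp add: K_def)
      then have "g x k = e * x (\<sigma> k)" by (simp add: \<sigma>(1) signed_perm_def)
      then show "g x k ^ 2 = x (\<sigma> k) ^ 2" using e(1) by (simp add: power2_eq_square mult_ac)
    qed
    also have "\<dots> = h x" unfolding h_def by (rule sum.reindex_bij_betw[OF \<open>bij_betw \<sigma> K K\<close>])
    finally show "h (g x) = h x" .
  qed
  \<comment> \<open>The common value 2 is nonzero, so each square has a nonzero derivative there,
    namely 4.\<close>
  define p where "p = flat_proj I (\<lambda>_. 2)"
  have p: "p \<in> M" by (simp add: p_def flat_proj_in)
  have p2: "p k = 2" if "nonconst k" for k using that by (simp add: nonconst_iff p_def flat_proj_simps)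
  obtain t c where tc: "t \<in> q.invs" "c \<in> q.invs" "t p \<noteq> 0" "\<And>x. x \<in> M \<Longrightarrow> t x * h x = c x"
    using q.normal_at_iff[THEN iffD1, OF normal[OF p], THEN bspec, OF h_poly, THEN mp, OF \<open>q.stable h\<close>] by blast
  have inv: "f (signed_perm n \<sigma> 1 x) = f x" if "f \<in> q.invs" "\<sigma> permutes {1..n}" for f \<sigma> x
    using q.invsD(2)[OF that(1) signed_permI[OF that(2) E(2)]] .
  obtain Dt Dc where D: "has_gradient t {1..n} p Dt" "has_gradient c {1..n} p Dc"
    using polyfun_gradient[OF q.invsD(1)[OF tc(1)]] polyfun_gradient[OF q.invsD(1)[OF tc(2)]] by blast
  have nc: "k \<in> {1..n} \<and> nonconst k" if "k \<in> block r" for k r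
    using that block_subset[of r] by (auto simp: nonconst_iff block_def)
  have r\<^sub>1: "r\<^sub>1 \<in> block r\<^sub>1" using block_self r(1) by blast
  have const: "Dt k = Dt r\<^sub>1" "Dc k = Dc r\<^sub>1" if "k \<in> block r" for k r
    using gradient_symmetric[OF D(1) inv[OF tc(1)], of k r\<^sub>1] gradient_symmetric[OF D(2) inv[OF tc(2)], of k r\<^sub>1]
      nc[OF that] nc[OF r\<^sub>1] p2 by auto
  \<comment> \<open>This is the product rule for \<open>t * h = c\<close> when the block r is moved
    as a whole. The term with \<open>t p\<close> survives for \<open>r\<^sub>1\<close>, whose block
    lies in K, and vanishes for \<open>r\<^sub>2\<close>, whose block misses K.\<close>
  have main: "of_nat (card (block r)) * (Dt r\<^sub>1 * h p) + of_nat (card (K \<inter> block r)) * (4 * t p)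
      = of_nat (card (block r)) * Dc r\<^sub>1" if r: "r \<in> I - {lo}" for r
  proof -
    define v where "v j = (if j \<in> block r then 1 else 0 :: complex)" for j
    have line: "(\<lambda>j. p j + s * v j) \<in> M" for s
    proof -
      have "(\<lambda>j. p j + s * v j) = flat_proj I (\<lambda>j. if j = r then 2 + s else 2)"
      proof
        fix k
        show "p k + s * v k = flat_proj I (\<lambda>j. if j = r then 2 + s else 2) k"
        proof (cases "lo < k \<and> k \<le> hi")
          case True then show ?thesis by (simp add: p_def v_def flat_proj_simps block_def)
        next
          case False
          then show ?thesis by (cases "k \<le> lo") (simp_all add: p_def v_def flat_proj_simps block_def)
        qed
      qed
      then show ?thesis using flat_proj_in by simp
    qed
    have sumv: "(\<Sum>j\<in>A. D j * v j) = (\<Sum>j\<in>A \<inter> block r. D j)" if "finite A" for A D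
      using that by (simp add: v_def sum.inter_restrict if_distrib cong: if_cong)
    have "(\<Sum>j\<in>{1..n}. Dt j * v j) = (\<Sum>j\<in>block r. Dt r\<^sub>1)"
      using block_subset[of r] const(1)[of _ r] by (simp add: sumv Int_absorb1)
    then have t': "((\<lambda>s. t (\<lambda>j. p j + s * v j)) has_field_derivative of_nat (card (block r)) * Dt r\<^sub>1) (at 0)"
      using D(1)[unfolded has_gradient_def, rule_format, of v] by simp
    have "(\<Sum>j\<in>{1..n}. Dc j * v j) = (\<Sum>j\<in>block r. Dc r\<^sub>1)"
      using block_subset[of r] const(2)[of _ r] by (simp add: sumv Int_absorb1)
    then have c': "((\<lambda>s. c (\<lambda>j. p j + s * v j)) has_field_derivative of_nat (card (block r)) * Dc r\<^sub>1) (at 0)"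
      using D(2)[unfolded has_gradient_def, rule_format, of v] by simp
    have "finite K" by (simp add: K_def)
    have "((\<lambda>s. h (\<lambda>j. p j + s * v j)) has_field_derivative (\<Sum>k\<in>K. 2 * p k * v k)) (at 0)"
      unfolding h_def by (auto intro!: derivative_eq_intros sum.cong)
    also have "(\<Sum>k\<in>K. 2 * p k * v k) = (\<Sum>k\<in>K \<inter> block r. 4)"
      unfolding sumv[OF \<open>finite K\<close>] by (intro sum.cong) (auto simp: K_def p2)
    finally have h': "((\<lambda>s. h (\<lambda>j. p j + s * v j)) has_field_derivative of_nat (card (K \<inter> block r)) * 4) (at 0)"
      by simp
    have "((\<lambda>s. c (\<lambda>j. p j + s * v j)) has_field_derivative
        of_nat (card (block r)) * Dt r\<^sub>1 * h p + of_nat (card (K \<inter> block r)) * 4 * t p) (at 0)"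
      using DERIV_mult[OF t' h'] tc(4)[OF line] by simp
    from DERIV_unique[OF this c'] show ?thesis by (simp add: mult.assoc)
  qed
  have "K \<inter> block r\<^sub>2 = {}"
    using coord_class_eq[OF r(2)] r(3) by (auto simp: K_def)
  moreover have "card (block r\<^sub>2) \<noteq> 0" using block_self[OF r(2)] finite_block by (metis card_eq_0_iff empty_iff)
  ultimately have "Dt r\<^sub>1 * h p = Dc r\<^sub>1" using main[OF r(2)] by simp
  moreover have "K \<inter> block r\<^sub>1 = block r\<^sub>1"
    using coord_class_eq[OF r(1)] nc[of _ r\<^sub>1] by (auto simp: K_def)
  moreover have "card (block r\<^sub>1) \<noteq> 0" using r\<^sub>1 finite_block by (metis card_eq_0_iff empty_iff)
  ultimately show False using main[OF r(1)] tc(3) by simp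
qed

section \<open>The sign change and the case of a symmetric index set\<close>

abbreviation neg :: "(nat \<Rightarrow> complex) \<Rightarrow> (nat \<Rightarrow> complex)" where
  "neg \<equiv> signed_perm n id (-1)"

lemma neg_neg [simp]: "neg (neg x) = x"
  by (auto simp: signed_perm_def fun_eq_iff)

lemma signed_perm_neg:
  assumes "\<sigma> permutes {1..n}"
  shows "signed_perm n \<sigma> e (neg x) = signed_perm n \<sigma> (- e) x" "neg (signed_perm n \<sigma> e x) = signed_perm n \<sigma> (- e) x"
  using permutes_in_image[OF assms] by (auto simp: signed_perm_def fun_eq_iff)

lemma sp_invsD: "f \<in> sp.invs \<Longrightarrow> \<sigma> permutes {1..n} \<Longrightarrow> f (signed_perm n \<sigma> 1 x) = f x"
  by (rule sp.invsD(2)) (auto intro: signed_permI)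

lemma psp_invsD: "f \<in> psp.invs \<Longrightarrow> \<sigma> permutes {1..n} \<Longrightarrow> f (signed_perm n \<sigma> (-1) x) = f x"
  by (rule psp.invsD(2)) (auto intro: signed_permI)

lemma psp_invsI:
  assumes "f \<in> sp.invs" "\<And>x. f (neg x) = f x"
  shows "f \<in> psp.invs"
proof (rule psp.invsI)
  show "f \<in> polyfun {1..n}" using assms(1) by (rule sp.invsD)
  fix g x assume "g \<in> signed_perms n {1, -1}"
  then obtain \<sigma> e where g: "g = signed_perm n \<sigma> e" "\<sigma> permutes {1..n}" "e \<in> {1, -1}" by (rule signed_permE)
  have "f (signed_perm n \<sigma> (-1) x) = f (signed_perm n \<sigma> 1 (neg x))"
    using signed_perm_neg(1)[OF g(2), of 1 x] by simp
  then show "f (g x) = f x"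
    using g(3) sp_invsD[OF assms(1) g(2)] assms(2) by (auto simp: g(1))
qed

lemma sp_invs_neg:
  assumes "f \<in> sp.invs"
  shows "(\<lambda>x. f (neg x)) \<in> sp.invs"
proof (rule sp.invsI)
  show "(\<lambda>x. f (neg x)) \<in> polyfun {1..n}"
    using sp.invsD(1)[OF assms] by (rule psp.polyfun_comp) (simp add: signed_permI permutes_id)
  fix g x assume "g \<in> signed_perms n {1}"
  then obtain \<sigma> where g: "g = signed_perm n \<sigma> 1" "\<sigma> permutes {1..n}" by (auto elim: signed_permE)
  have "neg (g x) = signed_perm n \<sigma> 1 (neg x)" using signed_perm_neg[OF g(2)] by (simp add: g(1))
  then show "f (neg (g x)) = f (neg x)" using sp_invsD[OF assms g(2)] by simp
qed

lemma psp_invs_symmetrize: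
  assumes "f \<in> sp.invs"
  shows "(\<lambda>x. f x + f (neg x)) \<in> psp.invs"
proof (rule psp_invsI)
  show "(\<lambda>x. f x + f (neg x)) \<in> sp.invs" using assms sp_invs_neg by (intro sp.invs_add)
qed (simp add: add.commute)

text \<open>Combined with the sign -1 this is the diagram symmetry in cosine coordinates: it sends
  \<open>x k\<close> to \<open>- x (n + 1 - k)\<close>, respects the boundary values -1 at 0 and 1
  at n + 1, and takes the wall i to the wall \<open>n - i\<close>.\<close>

definition rev_perm :: "nat \<Rightarrow> nat" where
  "rev_perm k = (if k \<in> {1..n} then Suc n - k else k)"

lemma rev_perm_permutes: "rev_perm permutes {1..n}"
proof (rule bij_imp_permutes)
  show "bij_betw rev_perm {1..n} {1..n}"
    by (rule bij_betw_byWitness[where f' = rev_perm]) (auto simp: rev_perm_def)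
qed (auto simp: rev_perm_def)

lemma rev_neg_apply:
  assumes "x 0 = -1" "x (Suc n) = 1" "k \<le> Suc n"
  shows "signed_perm n rev_perm (-1) x k = - x (Suc n - k)"
proof -
  consider "k = 0" | "k = Suc n" | "k \<in> {1..n}" using assms(3) by fastforce
  then show ?thesis using assms by cases (auto simp: signed_perm_def rev_perm_def)
qed

lemma rev_neg_flat:
  assumes sym: "\<And>i. i \<in> I \<Longrightarrow> n - i \<in> I" and x: "x \<in> M"
  shows "signed_perm n rev_perm (-1) x \<in> M"
proof -
  let ?y = "signed_perm n rev_perm (-1) x"
  have x0: "x 0 = -1" "x (Suc n) = 1" using x by (auto simp: flat_def)
  have "?y i = ?y (Suc i)" if i: "i \<in> {0..n} - I" for i
  proof -
    have "n - i \<notin> I" using sym[of "n - i"] i by auto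
    then have "x (n - i) = x (Suc (n - i))" using x by (auto simp: flat_def)
    then show ?thesis using i rev_neg_apply[OF x0] by (simp add: Suc_diff_le)
  qed
  moreover have "?y k = x k" if "k = 0 \<or> k > n" for k using that by (auto simp: signed_perm_def)
  ultimately show ?thesis using x by (auto simp: flat_def)
qed

lemma psp_stable_sp: "psp.stable h \<Longrightarrow> sp.stable h"
  unfolding psp.stable_def sp.stable_def unfolding signed_perms_def by blast

text \<open>The extension H need not be invariant under the sign, but on the negative of M it
  already has the right values, because the signed reversal stabilises M. So
  \<open>H x + H (neg x)\<close> restricts to \<open>2 * h\<close>.\<close>

lemma psp_normal_symmetric:
  assumes d: "balanced d" and sym: "\<And>i. i \<in> I \<Longrightarrow> n - i \<in> I"
  shows "psp.normal_at p"
  unfolding psp.normal_at_iff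
proof (intro ballI impI)
  fix h assume h: "h \<in> polyfun {1..n}" "psp.stable h"
  obtain H where H: "H \<in> sp.invs" "\<And>x. x \<in> M \<Longrightarrow> H x = h x"
    using sp_stable_extends[OF d h(1) psp_stable_sp[OF h(2)]] by blast
  let ?g = "signed_perm n rev_perm (-1)"
  have g: "?g \<in> signed_perms n {1, -1}" by (intro signed_permI rev_perm_permutes) simp
  have "?g ` M \<subseteq> M" using rev_neg_flat[OF sym] by blast
  then have gM: "?g ` M = M" by (rule psp.image_M_eq'[OF g])
  have "H (neg x) = h x" if x: "x \<in> M" for x
  proof -
    have "H (neg x) = H (?g x)"
      using sp_invsD[OF H(1) rev_perm_permutes, of "neg x"] signed_perm_neg(1)[OF rev_perm_permutes, of 1 x] by simp
    also have "\<dots> = h (?g x)" using H(2) x rev_neg_flat[OF sym] by blast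
    also have "\<dots> = h x" using h(2) g gM x unfolding psp.stable_def by blast
    finally show ?thesis .
  qed
  then show "\<exists>t\<in>psp.invs. \<exists>c\<in>psp.invs. t p \<noteq> 0 \<and> (\<forall>x\<in>M. t x * h x = c x)"
    using psp_invs_symmetrize[OF H(1)] H(2)
    by (intro bexI[of _ "\<lambda>_. 2"] bexI[of _ "\<lambda>x. H x + H (neg x)"] psp.invs_const) auto
qed

end

lemma ex_permutes_image:
  assumes "finite J" "A \<subseteq> J" "B \<subseteq> J" "card A = card B"
  obtains \<sigma> where "\<sigma> permutes J" "\<And>k. \<sigma> k \<in> B \<longleftrightarrow> k \<in> A"
proof -
  have fin: "finite A" "finite B" using assms finite_subset by auto
  obtain f where f: "bij_betw f A B"
    using finite_same_card_bij[OF fin assms(4)] by blast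
  have "card (J - A) = card (J - B)"
    using assms fin by (simp add: card_Diff_subset)
  then obtain g where g: "bij_betw g (J - A) (J - B)"
    using finite_same_card_bij[of "J - A" "J - B"] assms(1) by auto
  define \<sigma> where "\<sigma> k = (if k \<in> J then if k \<in> A then f k else g k else k)" for k
  have "bij_betw (\<lambda>k. if k \<in> A then f k else g k) (A \<union> (J - A)) (B \<union> (J - B))"
    using f g by (intro bij_betw_disjoint_Un) auto
  moreover have "A \<union> (J - A) = J" "B \<union> (J - B) = J" using assms by auto
  ultimately have "bij_betw (\<lambda>k. if k \<in> A then f k else g k) J J" by (simp only:)
  then have "bij_betw \<sigma> J J" by (rule bij_betw_cong[THEN iffD1, rotated]) (simp add: \<sigma>_def)
  then have "\<sigma> permutes J" by (rule bij_imp_permutes) (simp add: \<sigma>_def)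
  moreover have "\<sigma> k \<in> B \<longleftrightarrow> k \<in> A" for k
    using assms(2,3) bij_betwE[OF f] bij_betwE[OF g] by (auto simp: \<sigma>_def)
  ultimately show ?thesis using that by blast
qed

text \<open>A linear space of functions over an infinite field is not a finite union of proper
  subspaces. At each step a multiple of m is added to l, with a factor c that avoids finitely many
  ratios.\<close>

lemma vanishing_generic:
  assumes "finite Q" "\<And>q. q \<in> Q \<Longrightarrow> \<exists>l\<in>V. l q \<noteq> (0::complex)"
    and zero: "(\<lambda>_. 0) \<in> V" and add: "\<And>l m c. l \<in> V \<Longrightarrow> m \<in> V \<Longrightarrow> (\<lambda>x. l x + c * m x) \<in> V"
  shows "\<exists>l\<in>V. \<forall>q\<in>Q. l q \<noteq> 0"
  using assms(1,2)
proof (induction Q)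
  case empty then show ?case using zero by blast
next
  case (insert q Q)
  obtain l m where l: "l \<in> V" "\<And>q. q \<in> Q \<Longrightarrow> l q \<noteq> 0" and m: "m \<in> V" "m q \<noteq> 0"
    using insert by (metis insertI1 insertI2)
  have "finite ((\<lambda>q. - l q / m q) ` insert q Q)" using insert(1) by simp
  then obtain c where c: "c \<notin> (\<lambda>q. - l q / m q) ` insert q Q"
    using ex_new_if_finite[OF infinite_UNIV_char_0] by blast
  have nz: "l q' + c * m q' \<noteq> 0" if "q' \<in> insert q Q" for q'
  proof (cases "m q' = 0")
    case True then show ?thesis using that l(2) m(2) by auto
  next
    case False
    then have "c \<noteq> - l q' / m q'" using c that by blast
    then have "c * m q' \<noteq> - l q'" by (metis nonzero_eq_divide_eq False)
    then show ?thesis by (simp add: eq_neg_iff_add_eq_0 add.commute)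
  qed
  show ?case
    by (rule rev_bexI[OF add[OF l(1) m(1), of c]]) (rule ballI, erule nz)
qed

context alcove_flat begin

text \<open>The permutations of p stay off the negative of M, so some polynomial vanishes on that
  set and at no permutation of p; the product \<Phi> of its translates is symmetric with the same
  property. It serves as a cutoff: \<open>\<Phi> * f\<close> plus its reflected copy is sign
  invariant and equals \<open>\<Phi> * f\<close> on M.\<close>

lemma extend_away_from_neg:
  assumes p: "p \<in> M" and sep: "\<And>\<sigma>. \<sigma> permutes {1..n} \<Longrightarrow> signed_perm n \<sigma> (-1) p \<notin> M"
    and f: "f \<in> sp.invs"
  shows "\<exists>t\<in>psp.invs. \<exists>c\<in>psp.invs. t p \<noteq> 0 \<and> (\<forall>x\<in>M. t x * f x = c x)"
proof -
  define V where "V = {l \<in> polyfun {1..n}. \<forall>x\<in>M. l (neg x) = 0}"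
  have negG: "neg \<in> signed_perms n {1, -1}" by (intro signed_permI permutes_id) simp
  have "\<exists>l\<in>V. \<forall>q\<in>(\<lambda>g. g p) ` signed_perms n {1}. l q \<noteq> 0"
  proof (rule vanishing_generic)
    show "finite ((\<lambda>g. g p) ` signed_perms n {1})" using sp.finite_\<Gamma> by simp
    show "(\<lambda>_. 0) \<in> V" unfolding V_def mem_Collect_eq by (intro conjI polyfun.const) simp
    show "(\<lambda>x. l x + c * m x) \<in> V" if "l \<in> V" "m \<in> V" for l m c
      using that unfolding V_def mem_Collect_eq by (intro conjI polyfun.add polyfun_mult polyfun.const) simp_all
    fix q assume "q \<in> (\<lambda>g. g p) ` signed_perms n {1}"
    then obtain g where "q = g p" "g \<in> signed_perms n {1}" by blast
    then obtain \<sigma> where \<sigma>: "q = signed_perm n \<sigma> 1 p" "\<sigma> permutes {1..n}" by (auto elim: signed_permE)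
    have nq: "neg q = signed_perm n \<sigma> (-1) p" using signed_perm_neg(2)[OF \<sigma>(2)] by (simp add: \<sigma>(1))
    have "signed_perm n \<sigma> (-1) \<in> signed_perms n {1, -1}" by (intro signed_permI \<sigma>(2)) simp
    from psp.in_M[OF p this] sep[OF \<sigma>(2)]
    obtain j where j: "j \<in> {1..n}" "flat_proj I (neg q) j \<noteq> neg q j" unfolding nq by blast
    have "(\<lambda>x. flat_proj I (neg x) j - neg x j) \<in> polyfun {1..n}"
      using psp.polyfun_comp[OF psp.polyfun_\<pi>[OF j(1)] negG] psp.polyfun_\<Gamma>[OF negG j(1)] by (rule polyfun_diff)
    then show "\<exists>l\<in>V. l q \<noteq> 0"
      using j(2) unfolding V_def by (intro bexI[of _ "\<lambda>x. flat_proj I (neg x) j - neg x j"]) (simp_all add: flat_proj_id)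
  qed
  then obtain l where l: "l \<in> polyfun {1..n}" "\<And>x. x \<in> M \<Longrightarrow> l (neg x) = 0"
    "\<And>g. g \<in> signed_perms n {1} \<Longrightarrow> l (g p) \<noteq> 0"
    unfolding V_def by blast
  define \<Phi> where "\<Phi> x = (\<Prod>g\<in>signed_perms n {1}. l (g x))" for x
  have \<Phi>: "\<Phi> \<in> sp.invs"
  proof (rule sp.invsI)
    show "\<Phi> \<in> polyfun {1..n}" unfolding \<Phi>_def[abs_def] by (intro polyfun_prod sp.polyfun_comp[OF l(1)])
    show "\<Phi> (g x) = \<Phi> x" if "g \<in> signed_perms n {1}" for g x
      unfolding \<Phi>_def using sp.prod_\<Gamma>_comp[OF that, of "\<lambda>h. l (h x)"] by simp
  qed
  have "\<Phi> p \<noteq> 0" unfolding \<Phi>_def using l(3) sp.finite_\<Gamma> by (simp add: prod_zero_iff)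
  have \<Phi>0: "\<Phi> (neg x) = 0" if "x \<in> M" for x
    unfolding \<Phi>_def using sp.finite_\<Gamma>
    by (rule prod_zero) (use l(2)[OF that] sp.id_\<Gamma> in \<open>auto intro!: bexI[of _ id]\<close>)
  show ?thesis
    using psp_invs_symmetrize[OF \<Phi>] psp_invs_symmetrize[OF sp.invs_mult[OF \<Phi> f]] \<open>\<Phi> p \<noteq> 0\<close> \<Phi>0 p
    by (intro bexI[of _ "\<lambda>x. \<Phi> x + \<Phi> (neg x)"] bexI[of _ "\<lambda>x. \<Phi> x * f x + \<Phi> (neg x) * f (neg x)"]) auto
qed

text \<open>
  In \<open>\<xi> = 1 + e x\<close>, points of \<open>M\<close> have at least \<open>h\<close> coordinates 2 and points of \<open>neg M\<close> at least
  \<open>h\<close> coordinates 0, out of \<open>2 h\<close>. The weight of \<open>T\<close> is \<open>\<Prod>\<^sub>T \<xi> \<Prod>\<^sub>T\<^sub>' (2 - \<xi>)\<close>, with \<open>T'\<close> the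
  complement of \<open>T\<close>; on \<open>M\<close> it vanishes unless \<open>\<xi> = 2\<close> exactly on \<open>T\<close>, and on \<open>neg M\<close> unless
  \<open>\<xi> = 0\<close> exactly on \<open>T'\<close>. So replacing the coordinates in \<open>T\<close> by \<open>e\<close> does not change \<open>f\<close> on
  \<open>M\<close>, and makes it constant on \<open>neg M\<close>.
\<close>

lemma extend_at_balanced_point:
  assumes n: "n = 2 * h" and e: "e = 1 \<or> e = -1"
    and M: "\<And>x. x \<in> M \<Longrightarrow> h \<le> card {k \<in> {1..n}. x k = e}"
    and p: "h \<le> card {k \<in> {1..n}. p k = e}" "h \<le> card {k \<in> {1..n}. p k = - e}"
    and f: "f \<in> sp.invs"
  shows "\<exists>t\<in>psp.invs. \<exists>c\<in>psp.invs. t p \<noteq> 0 \<and> (\<forall>x\<in>M. t x * f x = c x)"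
proof -
  define S where "S = {T. T \<subseteq> {1..n} \<and> card T = h}"
  define w where "w T x = (\<Prod>k\<in>T. 1 + e * x k) * (\<Prod>k\<in>{1..n} - T. 1 - e * x k)" for T and x :: "nat \<Rightarrow> complex"
  define sub where "sub T x = (\<lambda>k. if k \<in> T then e else x k)" for T and x :: "nat \<Rightarrow> complex"
  define U where "U x = (\<Sum>T\<in>S. w T x)" for x
  \<comment> \<open>The constant \<open>f p\<close> is subtracted because on the negative of M,
    wherever the weight is nonzero, the substituted point is a permutation of p. With the
    subtraction every term vanishes there.\<close>
  define \<Phi> where "\<Phi> x = (\<Sum>T\<in>S. w T x * (f (sub T x) - f p))" for x
  have ee: "e * e = 1" "e \<noteq> 0" "e \<noteq> - e" using e by auto
  have finS: "finite S" "\<And>T. T \<in> S \<Longrightarrow> finite T" "\<And>T. T \<in> S \<Longrightarrow> T \<subseteq> {1..n}" "\<And>T. T \<in> S \<Longrightarrow> card T = h"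
    by (auto simp: S_def dest: finite_subset)
  have w_poly: "w T \<in> polyfun {1..n}" if "T \<in> S" for T
    unfolding w_def[abs_def] using finS(3)[OF that]
    by (intro polyfun_mult polyfun_prod polyfun.add polyfun_diff polyfun.const polyfun_coord) auto
  have f_poly: "(\<lambda>x. f (sub T x)) \<in> polyfun {1..n}" for T
  proof (rule polyfun_compose[OF sp.invsD(1)[OF f]])
    fix j assume "j \<in> {1..n}"
    then show "(\<lambda>x. sub T x j) \<in> polyfun {1..n}"
      by (cases "j \<in> T") (simp_all add: sub_def polyfun_coord polyfun.const)
  qed
  have inv: "(\<Sum>T\<in>S. G T (g x)) = (\<Sum>T\<in>S. G T x)"
    if g: "g \<in> signed_perms n {1}"
      and G: "\<And>T \<sigma>. \<sigma> permutes {1..n} \<Longrightarrow> T \<in> S \<Longrightarrow> G T (signed_perm n \<sigma> 1 x) = G (\<sigma> ` T) x"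
    for G :: "nat set \<Rightarrow> (nat \<Rightarrow> complex) \<Rightarrow> complex" and g x
  proof -
    obtain \<sigma> where \<sigma>: "g = signed_perm n \<sigma> 1" "\<sigma> permutes {1..n}" using g by (auto elim: signed_permE)
    have *: "\<tau> ` T \<in> S" if "\<tau> permutes {1..n}" "T \<in> S" for \<tau> T
      using that permutes_image[OF that(1)] by (auto simp: S_def card_image permutes_inj_on)
    have "bij_betw (\<lambda>T. \<sigma> ` T) S S"
      using *[OF \<sigma>(2)] *[OF permutes_inv[OF \<sigma>(2)]] permutes_inv_o[OF \<sigma>(2)]
      by (intro bij_betw_byWitness[where f' = "\<lambda>T. inv_into UNIV \<sigma> ` T"]) (auto simp: image_comp)
    then have "(\<Sum>T\<in>S. G (\<sigma> ` T) x) = (\<Sum>T\<in>S. G T x)" by (rule sum.reindex_bij_betw)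
    then show ?thesis using G[OF \<sigma>(2)] by (simp add: \<sigma>(1))
  qed
  have w_perm: "w T (signed_perm n \<sigma> 1 x) = w (\<sigma> ` T) x" if \<sigma>: "\<sigma> permutes {1..n}" and T: "T \<in> S" for \<sigma> T x
  proof -
    have "{1..n} - \<sigma> ` T = \<sigma> ` ({1..n} - T)"
      using image_set_diff[OF permutes_inj[OF \<sigma>], of "{1..n}" T] permutes_image[OF \<sigma>] by simp
    moreover have "(\<Prod>k\<in>\<sigma> ` A. F (x k)) = (\<Prod>k\<in>A. F (signed_perm n \<sigma> 1 x k))" if "A \<subseteq> {1..n}" for A and F :: "complex \<Rightarrow> complex"
    proof -
      have "(\<Prod>k\<in>\<sigma> ` A. F (x k)) = (\<Prod>k\<in>A. F (x (\<sigma> k)))"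
        by (simp add: prod.reindex[OF permutes_inj_on[OF \<sigma>]])
      also have "\<dots> = (\<Prod>k\<in>A. F (signed_perm n \<sigma> 1 x k))"
        using that by (intro prod.cong) (auto simp: signed_perm_def)
      finally show ?thesis .
    qed
    from this[OF finS(3)[OF T], of "\<lambda>z. 1 + e * z"] this[of "{1..n} - T" "\<lambda>z. 1 - e * z"]
    show ?thesis unfolding w_def \<open>{1..n} - \<sigma> ` T = _\<close> by simp
  qed
  have f_perm: "f (sub T (signed_perm n \<sigma> 1 x)) = f (sub (\<sigma> ` T) x)" if \<sigma>: "\<sigma> permutes {1..n}" and T: "T \<in> S" for \<sigma> T x
  proof -
    have "sub T (signed_perm n \<sigma> 1 x) = signed_perm n \<sigma> 1 (sub (\<sigma> ` T) x)"
    proof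
      fix k
      have "\<sigma> k \<in> \<sigma> ` T \<longleftrightarrow> k \<in> T" using permutes_inj[OF \<sigma>] by (simp add: inj_image_mem_iff)
      moreover have "k \<in> T \<Longrightarrow> k \<in> {1..n}" using finS(3)[OF T] by blast
      moreover have "k \<in> \<sigma> ` T \<longrightarrow> k \<in> {1..n}"
        using image_mono[OF finS(3)[OF T], of \<sigma>] permutes_image[OF \<sigma>] by blast
      ultimately show "sub T (signed_perm n \<sigma> 1 x) k = signed_perm n \<sigma> 1 (sub (\<sigma> ` T) x) k"
        by (cases "k \<in> T"; cases "k \<in> {1..n}") (auto simp: sub_def signed_perm_def simp del: atLeastAtMost_iff)
    qed
    then show ?thesis using sp_invsD[OF f \<sigma>] by simp
  qed
  have U: "U \<in> sp.invs"
  proof (rule sp.invsI)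
    show "U \<in> polyfun {1..n}" unfolding U_def[abs_def] by (intro polyfun_sum w_poly)
    show "U (g x) = U x" if "g \<in> signed_perms n {1}" for g x
      unfolding U_def by (rule inv[OF that]) (rule w_perm)
  qed
  have \<Phi>: "\<Phi> \<in> sp.invs"
  proof (rule sp.invsI)
    show "\<Phi> \<in> polyfun {1..n}" unfolding \<Phi>_def[abs_def] 
      by (intro polyfun_sum polyfun_mult polyfun_diff f_poly polyfun.const) (rule w_poly)
    show "\<Phi> (g x) = \<Phi> x" if "g \<in> signed_perms n {1}" for g x
      unfolding \<Phi>_def by (rule inv[OF that]) (simp only: w_perm f_perm)
  qed
  have w_nonzero: "{k \<in> {1..n}. x k = e} \<subseteq> T" "{k \<in> {1..n}. x k = - e} \<subseteq> {1..n} - T"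
    if "w T x \<noteq> 0" "T \<in> S" for T x
  proof -
    have "\<forall>k\<in>T. 1 + e * x k \<noteq> 0" "\<forall>k\<in>{1..n} - T. 1 - e * x k \<noteq> 0"
      using that finS(2)[OF that(2)] by (auto simp: w_def prod_zero_iff)
    then show "{k \<in> {1..n}. x k = e} \<subseteq> T" "{k \<in> {1..n}. x k = - e} \<subseteq> {1..n} - T"
      using ee(1) by fastforce+
  qed
  have \<Phi>M: "\<Phi> x = U x * (f x - f p)" if x: "x \<in> M" for x
    unfolding \<Phi>_def U_def sum_distrib_right
  proof (intro sum.cong refl)
    fix T assume T: "T \<in> S"
    show "w T x * (f (sub T x) - f p) = w T x * (f x - f p)"
    proof (cases "w T x = 0")
      case False
      have "{k \<in> {1..n}. x k = e} = T"
        using w_nonzero(1)[OF False T] finS(2-4)[of T] T M[OF x] by (intro card_subset_eq) (auto intro!: le_antisym card_mono)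
      then have "sub T x = x" by (auto simp: sub_def)
      then show ?thesis by simp
    qed simp
  qed
  have p_card: "card {k \<in> {1..n}. q k = e} = h \<and> (\<forall>k\<in>{1..n}. q k \<noteq> e \<longrightarrow> q k = - e)"
    if q: "h \<le> card {k \<in> {1..n}. q k = e}" "h \<le> card {k \<in> {1..n}. q k = - e}" for q
  proof -
    have disj: "card ({k \<in> {1..n}. q k = e} \<union> {k \<in> {1..n}. q k = - e})
        = card {k \<in> {1..n}. q k = e} + card {k \<in> {1..n}. q k = - e}"
      using ee(3) by (intro card_Un_disjoint) auto
    moreover have "card ({k \<in> {1..n}. q k = e} \<union> {k \<in> {1..n}. q k = - e}) \<le> card {1..n}"
      by (intro card_mono) auto
    ultimately have "card {k \<in> {1..n}. q k = e} = h"
      "card ({k \<in> {1..n}. q k = e} \<union> {k \<in> {1..n}. q k = - e}) = card {1..n}"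
      using q n by auto
    moreover from this(2) have "{k \<in> {1..n}. q k = e} \<union> {k \<in> {1..n}. q k = - e} = {1..n}"
      by (intro card_subset_eq) auto
    ultimately show ?thesis by blast
  qed
  have U_nonzero: "U q \<noteq> 0"
    if q: "h \<le> card {k \<in> {1..n}. q k = e}" "h \<le> card {k \<in> {1..n}. q k = - e}" for q
  proof -
    define A where "A = {k \<in> {1..n}. q k = e}"
    have A: "A \<in> S" using p_card[OF q] by (auto simp: S_def A_def)
    have "w T q = 0" if "T \<in> S - {A}" for T
    proof (rule ccontr)
      assume "w T q \<noteq> 0"
      then have "A \<subseteq> T" using w_nonzero(1) that by (simp add: A_def)
      then have "A = T" using finS(2,4) A that by (intro card_subset_eq) auto
      then show False using that by blast
    qed
    then have "U q = w A q" unfolding U_def using finS(1) A by (simp add: sum.remove)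
    also have "\<dots> \<noteq> 0"
      using p_card[OF q] ee(1) finS(2)[OF A] by (auto simp: w_def prod_zero_iff A_def)
    finally show ?thesis .
  qed
  have neg_card: "{k \<in> {1..n}. neg q k = c} = {k \<in> {1..n}. q k = - c}" for q c
    by (auto simp: signed_perm_def)
  have \<Phi>0: "\<Phi> (neg x) = 0" if x: "x \<in> M" for x
    unfolding \<Phi>_def
  proof (intro sum.neutral ballI)
    fix T assume T: "T \<in> S"
    show "w T (neg x) * (f (sub T (neg x)) - f p) = 0"
    proof (cases "w T (neg x) = 0")
      case False
      have le: "h \<le> card {k \<in> {1..n}. neg x k = - e}" unfolding neg_card using M[OF x] by simp
      have "card ({1..n} - T) = h" using finS(2-4)[of T] T n by (simp add: card_Diff_subset)
      then have eq: "{k \<in> {1..n}. neg x k = - e} = {1..n} - T"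
        using w_nonzero(2)[OF False T] le by (intro card_subset_eq) (auto intro!: le_antisym card_mono)
      define B where "B = {k \<in> {1..n}. p k = e}"
      have cardB: "card T = card B" using p_card[OF p] finS(4)[OF T] by (simp add: B_def)
      have "B \<subseteq> {1..n}" by (auto simp: B_def)
      then obtain \<sigma> where \<sigma>: "\<sigma> permutes {1..n}" "\<And>k. \<sigma> k \<in> B \<longleftrightarrow> k \<in> T"
        using cardB by (rule ex_permutes_image[OF finite_atLeastAtMost finS(3)[OF T]]) (erule that, blast)
      have "f (sub T (neg x)) = f (signed_perm n \<sigma> 1 p)"
      proof (rule polyfun_cong[OF sp.invsD(1)[OF f]])
        fix k assume k: "k \<in> {1..n}"
        then have \<sigma>k: "\<sigma> k \<in> {1..n}" using permutes_in_image[OF \<sigma>(1)] by blast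
        show "sub T (neg x) k = signed_perm n \<sigma> 1 p k"
        proof (cases "k \<in> T")
          case True
          then have "p (\<sigma> k) = e" using \<sigma>(2)[of k] by (simp add: B_def)
          then show ?thesis using True k by (simp add: sub_def signed_perm_def)
        next
          case False
          then have "p (\<sigma> k) = - e" using \<sigma>(2)[of k] p_card[OF p] \<sigma>k by (auto simp: B_def)
          moreover have "neg x k = - e" using eq False k by blast
          ultimately show ?thesis using False k by (simp add: sub_def signed_perm_def)
        qed
      qed
      then show ?thesis using sp_invsD[OF f \<sigma>(1)] by simp
    qed simp
  qed
  \<comment> \<open>The second factor makes t invariant under the sign. On M the term with
    \<open>\<Phi> (neg x)\<close> is zero and \<open>\<Phi> x = U x * (f x - f p)\<close>, so c
    collapses to \<open>t x * f x\<close>.\<close>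
  define t where "t x = U x * U (neg x)" for x
  define c where "c x = f p * t x + (\<Phi> x * U (neg x) + \<Phi> (neg x) * U x)" for x
  have t: "t \<in> psp.invs"
  proof (rule psp_invsI)
    show "t \<in> sp.invs" unfolding t_def[abs_def] by (intro sp.invs_mult U sp_invs_neg)
  qed (simp add: t_def)
  moreover have "c \<in> psp.invs"
  proof -
    have "(\<lambda>x. \<Phi> x * U (neg x) + \<Phi> (neg x) * U (neg (neg x))) \<in> psp.invs"
      by (rule psp_invs_symmetrize) (intro sp.invs_mult \<Phi> sp_invs_neg U)
    then have "(\<lambda>x. \<Phi> x * U (neg x) + \<Phi> (neg x) * U x) \<in> psp.invs" by (simp only: neg_neg)
    then show ?thesis
      unfolding c_def[abs_def] by (rule psp.invs_add[OF psp.invs_mult[OF psp.invs_const t]])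
  qed
  moreover have "t p \<noteq> 0"
    unfolding t_def using U_nonzero[OF p] U_nonzero[of "neg p"] p unfolding neg_card by simp
  moreover have "t x * f x = c x" if "x \<in> M" for x
    unfolding t_def c_def \<Phi>M[OF that] \<Phi>0[OF that] by (simp add: algebra_simps)
  ultimately show ?thesis by blast
qed

end

section \<open>Index sets with equal blocks, and the two normality criteria\<close>

context alcove_flat begin

text \<open>The interval from lo + 1 to i is tiled by the blocks ending at elements of I up to i,
  each of size d. Thus I is an arithmetic progression with difference d.\<close>

lemma balanced_rank:
  assumes d: "balanced d" and i: "i \<in> I"
  shows "i = lo + d * card {r \<in> I - {lo}. r \<le> i}"
proof -
  have "{Suc lo..i} = (\<Union>r\<in>{r \<in> I - {lo}. r \<le> i}. block r)"
  proof (intro equalityI subsetI)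
    fix k assume "k \<in> {Suc lo..i}"
    then have k: "lo < k" "k \<le> i" by auto
    then have "k \<le> hi" using lo_hi(6)[OF i] by simp
    then show "k \<in> (\<Union>r\<in>{r \<in> I - {lo}. r \<le> i}. block r)"
      using next_in_gt[OF k(1)] next_in(3)[of k i] i k by (intro UN_I[of "\<rho> k"]) (auto simp: block_def)
  next
    fix k assume "k \<in> (\<Union>r\<in>{r \<in> I - {lo}. r \<le> i}. block r)"
    then show "k \<in> {Suc lo..i}" using next_in(2)[of k] by (auto simp: block_def)
  qed
  then have "card {Suc lo..i} = card (\<Union>r\<in>{r \<in> I - {lo}. r \<le> i}. block r)" by simp
  also have "\<dots> = (\<Sum>r\<in>{r \<in> I - {lo}. r \<le> i}. card (block r))"
    using finite_I by (intro card_UN_disjoint) (auto simp: block_def)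
  also have "\<dots> = (\<Sum>r\<in>{r \<in> I - {lo}. r \<le> i}. d)"
    using d by (intro sum.cong) (auto simp: balanced_def)
  finally have "i - lo = d * card {r \<in> I - {lo}. r \<le> i}" by simp
  then show ?thesis using lo_hi(5)[OF i] by simp
qed

lemma balanced_progression:
  assumes d: "balanced d"
  shows "I = (\<lambda>j. lo + d * j) ` {0..card (I - {lo})}"
proof -
  let ?f = "\<lambda>i. card {r \<in> I - {lo}. r \<le> i}"
  have "inj_on ?f I" using balanced_rank[OF d] by (metis (no_types, lifting) inj_onI)
  moreover have "?f ` I \<subseteq> {0..card (I - {lo})}"
    using finite_I by (auto intro!: card_mono)
  moreover have "card {0..card (I - {lo})} = card I"
    using finite_I lo_hi(1) by (simp add: card_Diff_singleton card_gt_0_iff Suc_diff_1 del: card_Diff_insert)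
      (metis Suc_pred card_gt_0_iff empty_iff)
  ultimately have f: "?f ` I = {0..card (I - {lo})}"
    by (intro card_subset_eq) (auto simp: card_image)
  have "I = (\<lambda>i. lo + d * ?f i) ` I" using balanced_rank[OF d] by force
  also have "\<dots> = (\<lambda>j. lo + d * j) ` ?f ` I" by (simp add: image_image)
  finally show ?thesis unfolding f .
qed

lemma balanced_hi: "balanced d \<Longrightarrow> hi = lo + d * card (I - {lo})"
proof -
  assume d: "balanced d"
  have "{r \<in> I - {lo}. r \<le> hi} = I - {lo}" using lo_hi(6) by auto
  then show ?thesis using balanced_rank[OF d lo_hi(2)] by simp
qed

lemma balanced_memI:
  assumes "balanced d" "j \<le> card (I - {lo})"
  shows "lo + d * j \<in> I"
  by (rule subsetD[OF equalityD2[OF balanced_progression[OF assms(1)]] imageI]) (simp add: assms(2))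

text \<open>An arithmetic progression whose end points are exchanged by reversal is mapped onto
  itself.\<close>

lemma balanced_symmetric:
  assumes d: "balanced d" and lo: "lo = n - hi" and i: "i \<in> I"
  shows "n - i \<in> I"
proof -
  obtain j where j: "i = lo + d * j" "j \<in> {0..card (I - {lo})}"
    using subsetD[OF equalityD1[OF balanced_progression[OF d]] i] by (rule imageE)
  have "n - i = lo + d * (card (I - {lo}) - j)"
    using balanced_hi[OF d] lo lo_hi(4) j by (simp add: diff_mult_distrib2 algebra_simps)
  then show ?thesis using balanced_memI[OF d, of "card (I - {lo}) - j"] by simp
qed

lemma card_minus_one:
  assumes d: "balanced d" and x: "x \<in> M"
  shows "card {k \<in> {1..n}. x k = -1} = lo + d * card {r \<in> I - {lo}. x r = -1}"
    and "card {k \<in> {1..n}. x k = 1} = n - hi + d * card {r \<in> I - {lo}. x r = 1}"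
proof -
  have *: "card {k \<in> A. x k = c} = (\<Sum>k\<in>A. if x k = c then 1 else 0)" if "finite A" for A c
    using that by (simp add: sum.If_cases Int_def)
  have d': "(\<Sum>r\<in>I - {lo}. of_nat (card (block r)) * F r) = d * (\<Sum>r\<in>I - {lo}. F r)" for F :: "nat \<Rightarrow> nat"
    unfolding sum_distrib_left using d by (intro sum.cong) (auto simp: balanced_def)
  show "card {k \<in> {1..n}. x k = -1} = lo + d * card {r \<in> I - {lo}. x r = -1}"
    using sum_flat[OF x, of "\<lambda>z. if z = -1 then 1 else 0 :: nat"] finite_I
    by (simp only: * finite_atLeastAtMost finite_Diff d') simp
  show "card {k \<in> {1..n}. x k = 1} = n - hi + d * card {r \<in> I - {lo}. x r = 1}"
    using sum_flat[OF x, of "\<lambda>z. if z = 1 then 1 else 0 :: nat"] finite_I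
    by (simp only: * finite_atLeastAtMost finite_Diff d') simp
qed

lemma card_signed_perm_neg:
  assumes "\<sigma> permutes {1..n}"
  shows "card {k \<in> {1..n}. signed_perm n \<sigma> (-1) p k = c} = card {k \<in> {1..n}. p k = - c}"
proof -
  have "\<sigma> ` {k \<in> {1..n}. signed_perm n \<sigma> (-1) p k = c} = {k \<in> {1..n}. p k = - c}"
  proof (intro equalityI subsetI)
    fix l assume "l \<in> \<sigma> ` {k \<in> {1..n}. signed_perm n \<sigma> (-1) p k = c}"
    then obtain k where k: "l = \<sigma> k" "k \<in> {1..n}" "signed_perm n \<sigma> (-1) p k = c" by blast
    then have "- p (\<sigma> k) = c" by (simp add: signed_perm_def)
    then show "l \<in> {k \<in> {1..n}. p k = - c}"
      using k permutes_in_image[OF assms, of k] by auto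
  next
    fix l assume l: "l \<in> {k \<in> {1..n}. p k = - c}"
    obtain k where k: "l = \<sigma> k" using permutes_surj[OF assms] by blast
    then have "k \<in> {1..n}" using l permutes_in_image[OF assms, of k] by simp
    then show "l \<in> \<sigma> ` {k \<in> {1..n}. signed_perm n \<sigma> (-1) p k = c}"
      using l k by (auto simp: signed_perm_def)
  qed
  then show ?thesis using card_image[OF permutes_inj_on[OF assms]] by metis
qed

text \<open>If a permutation q of -p also lies in M, counting the coordinates 1 of q and -1 of p
  shows that lo and \<open>n - hi\<close> differ by a multiple of d. As I is a progression, this
  puts \<open>n - hi\<close> or \<open>n - lo\<close> into I; its mirror image hi or lo is there
  too, so the hypothesis makes p a point with half of its coordinates 1 and half -1.\<close>

lemma extend_locally:
  assumes d: "balanced d" and I': "\<And>j. j \<in> I \<Longrightarrow> n - j \<in> I \<Longrightarrow> 2 * j = n"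
    and p: "p \<in> M" and f: "f \<in> sp.invs"
  shows "\<exists>t\<in>psp.invs. \<exists>c\<in>psp.invs. t p \<noteq> 0 \<and> (\<forall>x\<in>M. t x * f x = c x)"
proof (cases "\<exists>\<sigma>. \<sigma> permutes {1..n} \<and> signed_perm n \<sigma> (-1) p \<in> M")
  case False
  then show ?thesis using extend_away_from_neg[OF p _ f] by blast
next
  case True
  then obtain \<sigma> where \<sigma>: "\<sigma> permutes {1..n}" "signed_perm n \<sigma> (-1) p \<in> M" by blast
  define q where "q = signed_perm n \<sigma> (-1) p"
  have q: "q \<in> M" using \<sigma>(2) by (simp add: q_def)
  note count = card_minus_one[OF d p] card_minus_one[OF d q]
  have pq: "card {k \<in> {1..n}. q k = 1} = card {k \<in> {1..n}. p k = -1}"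
    "card {k \<in> {1..n}. q k = -1} = card {k \<in> {1..n}. p k = 1}"
    using card_signed_perm_neg[OF \<sigma>(1), of p 1] card_signed_perm_neg[OF \<sigma>(1), of p "-1"] by (simp_all add: q_def)
  define j where "j = card {r \<in> I - {lo}. p r = -1}"
  define j' where "j' = card {r \<in> I - {lo}. q r = 1}"
  have j: "j \<le> card (I - {lo})" "j' \<le> card (I - {lo})"
    unfolding j_def j'_def using finite_I by (auto intro!: card_mono)
  have eq: "lo + d * j = n - hi + d * j'" using count pq by (simp add: j_def j'_def)
  show ?thesis
  proof (cases "lo \<le> n - hi")
    case True
    \<comment> \<open>For j below j' the count together with \<open>lo \<le> n - hi\<close> forces
      lo and \<open>n - hi\<close> to be equal, which is what truncated subtraction yields in this
      formula.\<close>
    have "n - hi = lo + d * (j - j')"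
    proof (cases "j' \<le> j")
      case True then show ?thesis using eq by (simp add: diff_mult_distrib2)
    next
      case False
      then have "d * j \<le> d * j'" by simp
      then have "n - hi = lo" using eq True by linarith
      then show ?thesis using False by simp
    qed
    then have "n - hi \<in> I" using balanced_memI[OF d, of "j - j'"] j by simp
    moreover have "n - (n - hi) \<in> I" using lo_hi(2,4) by simp
    ultimately have n: "n = 2 * (n - hi)" using I' by metis
    show ?thesis
    proof (rule extend_at_balanced_point[OF n, of 1])
      show "n - hi \<le> card {k \<in> {1..n}. x k = 1}" if "x \<in> M" for x
        unfolding card_minus_one(2)[OF d that] by simp
      show "n - hi \<le> card {k \<in> {1..n}. p k = 1}" unfolding card_minus_one(2)[OF d p] by simp
      show "n - hi \<le> card {k \<in> {1..n}. p k = - 1}" using pq(1) count(4) by simp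
    qed (use f in auto)
  next
    case False
    then have "d * j \<le> d * j'" using eq by linarith
    then have "j \<le> j' \<or> d = 0" by auto
    then have "n - lo = lo + d * (card (I - {lo}) - (j' - j))"
    proof
      assume jj: "j \<le> j'"
      have "card (I - {lo}) - (j' - j) + j' = card (I - {lo}) + j" using jj j by simp
      then have "d * (card (I - {lo}) - (j' - j)) + d * j' = d * card (I - {lo}) + d * j"
        by (metis distrib_left)
      then show ?thesis using balanced_hi[OF d] lo_hi(3,4) eq by linarith
    qed (use eq False in simp)
    then have "n - lo \<in> I" using balanced_memI[OF d] by simp
    then have n: "n = 2 * lo" using I'[OF lo_hi(1)] by simp
    show ?thesis
    proof (rule extend_at_balanced_point[OF n, of "-1"])
      show "lo \<le> card {k \<in> {1..n}. x k = -1}" if "x \<in> M" for x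
        unfolding card_minus_one(1)[OF d that] by simp
      show "lo \<le> card {k \<in> {1..n}. p k = -1}" unfolding card_minus_one(1)[OF d p] by simp
      show "lo \<le> card {k \<in> {1..n}. p k = - (-1)}" using pq(2) count(3) by simp
    qed (use f in auto)
  qed
qed

lemma card_constant_coords:
  "card {k \<in> {1..n}. \<forall>x\<in>M. x k = 1} = n - hi" "card {k \<in> {1..n}. \<forall>x\<in>M. x k = -1} = lo"
proof -
  have "{k \<in> {1..n}. \<forall>x\<in>M. x k = 1} = {Suc hi..n}"
  proof (intro equalityI subsetI)
    fix k assume k: "k \<in> {k \<in> {1..n}. \<forall>x\<in>M. x k = 1}"
    then have "\<not> nonconst k" by (auto simp: nonconst_def)
    moreover have "\<not> k \<le> lo" using k flat_proj_in[of "\<lambda>_. 0"] flat_proj_simps(1)[of k "\<lambda>_. 0"] by auto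
    ultimately show "k \<in> {Suc hi..n}" using k by (auto simp: nonconst_iff)
  qed (use flat_high in auto)
  then show "card {k \<in> {1..n}. \<forall>x\<in>M. x k = 1} = n - hi" by simp
  have "{k \<in> {1..n}. \<forall>x\<in>M. x k = -1} = {1..lo}"
  proof (intro equalityI subsetI)
    fix k assume k: "k \<in> {k \<in> {1..n}. \<forall>x\<in>M. x k = -1}"
    then have "\<not> nonconst k" by (auto simp: nonconst_def)
    moreover have "\<not> hi < k" using k flat_proj_in[of "\<lambda>_. 0"] flat_proj_simps(2)[of k "\<lambda>_. 0"] by auto
    ultimately show "k \<in> {1..lo}" using k by (auto simp: nonconst_iff)
  qed (use flat_low lo_hi(3,4) in auto)
  then show "card {k \<in> {1..n}. \<forall>x\<in>M. x k = -1} = lo" by simp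
qed

text \<open>A sign-changing element of the stabiliser of M exchanges the coordinates constantly 1
  with those constantly -1, so \<open>lo = n - hi\<close> and the progression is symmetric. Without
  such an element the sum of the coordinates is stable, and two vertices with the same image test
  it.\<close>

lemma psp_normal_imp:
  assumes d: "balanced d" and normal: "\<And>p. p \<in> M \<Longrightarrow> psp.normal_at p"
    and j: "j \<in> I" "n - j \<in> I" "2 * j \<noteq> n" and i: "i \<in> I"
  shows "n - i \<in> I"
proof (cases "\<exists>\<sigma>. \<sigma> permutes {1..n} \<and> signed_perm n \<sigma> (-1) ` M = M")
  case True
  then obtain \<sigma> where \<sigma>: "\<sigma> permutes {1..n}" "signed_perm n \<sigma> (-1) ` M = M" by blast
  have "\<sigma> ` {k \<in> {1..n}. \<forall>x\<in>M. x k = 1} = {k \<in> {1..n}. \<forall>x\<in>M. x k = -1}"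
  proof (intro equalityI subsetI)
    fix l assume "l \<in> \<sigma> ` {k \<in> {1..n}. \<forall>x\<in>M. x k = 1}"
    then obtain k where k: "l = \<sigma> k" "k \<in> {1..n}" "\<forall>x\<in>M. x k = 1" by blast
    then have "\<forall>x\<in>M. - x (\<sigma> k) = 1" using stabiliser_constant[OF \<sigma>(2,1) k(2), of 1] by simp
    then have "\<forall>x\<in>M. x (\<sigma> k) = -1" by (metis minus_minus)
    then show "l \<in> {k \<in> {1..n}. \<forall>x\<in>M. x k = -1}"
      using k permutes_in_image[OF \<sigma>(1), of k] by simp
  next
    fix l assume l: "l \<in> {k \<in> {1..n}. \<forall>x\<in>M. x k = -1}"
    obtain k where k: "l = \<sigma> k" using permutes_surj[OF \<sigma>(1)] by blast
    then have "k \<in> {1..n}" using l permutes_in_image[OF \<sigma>(1), of k] by simp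
    then show "l \<in> \<sigma> ` {k \<in> {1..n}. \<forall>x\<in>M. x k = 1}"
      using stabiliser_constant[OF \<sigma>(2,1), of k 1] l unfolding k by (intro imageI) auto
  qed
  from card_image[OF permutes_inj_on[OF \<sigma>(1)], of "{k \<in> {1..n}. \<forall>x\<in>M. x k = 1}", unfolded this]
  have "lo = n - hi" unfolding card_constant_coords .
  from balanced_symmetric[OF d this i] show ?thesis .
next
  case False
  define h where "h x = (\<Sum>k\<in>{1..n}. x k)" for x :: "nat \<Rightarrow> complex"
  have h: "h \<in> polyfun {1..n}" unfolding h_def[abs_def] by (intro polyfun_sum polyfun_coord)
  have "psp.stable h"
    unfolding psp.stable_def
  proof (intro ballI impI)
    fix g x assume g: "g \<in> signed_perms n {1, -1}" "g ` M = M"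
    obtain \<sigma> e where \<sigma>: "g = signed_perm n \<sigma> e" "\<sigma> permutes {1..n}" "e \<in> {1, -1}"
      using g(1) by (rule signed_permE)
    then have "e = 1" using False g(2) by auto
    have "h (g x) = (\<Sum>k\<in>{1..n}. x (\<sigma> k))"
      unfolding h_def by (intro sum.cong) (auto simp: \<sigma>(1) \<open>e = 1\<close> signed_perm_def)
    also have "\<dots> = h x"
      unfolding h_def using sum.permute[OF \<sigma>(2), of x] by (simp add: comp_def)
    finally show "h (g x) = h x" .
  qed
  \<comment> \<open>The vertex with index j in cosine coordinates: its first j coordinates are 1/2
    before taking cosines, and the others are 0.\<close>
  define P where "P j k = (if k \<le> j then -1 else 1 :: complex)" for j k :: nat
  have P: "P j \<in> M" if "j \<in> I" for j
    using that I(1) by (auto simp: flat_def P_def le_less Suc_le_eq)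
  have hP: "h (P j) = of_nat (n - j) - of_nat j" if "j \<le> n" for j
  proof -
    have "{1..n} = {1..j} \<union> {Suc j..n}" using that by auto
    then have "h (P j) = (\<Sum>k\<in>{1..j}. P j k) + (\<Sum>k\<in>{Suc j..n}. P j k)"
      unfolding h_def by (simp only:) (rule sum.union_disjoint, auto)
    also have "(\<Sum>k\<in>{1..j}. P j k) = (\<Sum>k\<in>{1..j}. -1)" by (intro sum.cong) (auto simp: P_def)
    also have "(\<Sum>k\<in>{Suc j..n}. P j k) = (\<Sum>k\<in>{Suc j..n}. 1)" by (intro sum.cong) (auto simp: P_def)
    finally show ?thesis by simp
  qed
  have jn: "j \<le> n" using j(1) I(1) by auto
  have "signed_perm n rev_perm (-1) (P j) = P (n - j)"
  proof
    fix k
    show "signed_perm n rev_perm (-1) (P j) k = P (n - j) k"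
    proof (cases "k \<le> Suc n")
      case True
      then show ?thesis using rev_neg_apply[of "P j" k] jn by (auto simp: P_def)
    next
      case False
      then show ?thesis using jn by (auto simp: P_def signed_perm_def)
    qed
  qed
  then have eq: "f (P (n - j)) = f (P j)" if "f \<in> psp.invs" for f
    using psp_invsD[OF that rev_perm_permutes, of "P j"] by simp
  obtain t c where tc: "t \<in> psp.invs" "c \<in> psp.invs" "t (P j) \<noteq> 0" "\<And>x. x \<in> M \<Longrightarrow> t x * h x = c x"
    using psp.normal_at_iff[THEN iffD1, OF normal[OF P[OF j(1)]], THEN bspec, OF h, THEN mp, OF \<open>psp.stable h\<close>] by blast
  have "t (P j) * h (P (n - j)) = t (P j) * h (P j)"
    using tc(4)[OF P[OF j(1)]] tc(4)[OF P[OF j(2)]] eq[OF tc(1)] eq[OF tc(2)] by simp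
  then have "h (P (n - j)) = h (P j)" using tc(3) by simp
  then have "of_nat (n - j) = (of_nat j :: complex)"
    using hP[OF jn] hP[of "n - j"] jn by simp
  then have "n - j = j" by (simp only: of_nat_eq_iff)
  then show ?thesis using j(3) jn by simp
qed

theorem sp_normal_iff: "(\<forall>p\<in>M. sp.normal_at p) \<longleftrightarrow> (\<exists>d. balanced d)"
proof
  assume "\<forall>p\<in>M. sp.normal_at p"
  then show "\<exists>d. balanced d" by (intro normal_imp_balanced[of "{1}"]) auto
next
  assume "\<exists>d. balanced d"
  then obtain d where d: "balanced d" by blast
  have "sp.normal_at p" for p
    unfolding sp.normal_at_iff
  proof (intro ballI impI)
    fix h assume "h \<in> polyfun {1..n}" "sp.stable h"
    then obtain H where "H \<in> sp.invs" "\<forall>x\<in>M. H x = h x" using sp_stable_extends[OF d] by blast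
    then show "\<exists>t\<in>sp.invs. \<exists>c\<in>sp.invs. t p \<noteq> 0 \<and> (\<forall>x\<in>M. t x * h x = c x)"
      by (intro bexI[of _ "\<lambda>_. 1"] bexI[of _ H] sp.invs_const) auto
  qed
  then show "\<forall>p\<in>M. sp.normal_at p" by blast
qed

theorem psp_normal_iff:
  "(\<forall>p\<in>M. psp.normal_at p) \<longleftrightarrow>
    (\<exists>d. balanced d) \<and> (\<forall>j\<in>I. n - j \<in> I \<longrightarrow> 2 * j \<noteq> n \<longrightarrow> (\<forall>i\<in>I. n - i \<in> I))"
proof
  assume normal: "\<forall>p\<in>M. psp.normal_at p"
  then have "\<exists>d. balanced d" by (intro normal_imp_balanced[of "{1, -1}"]) auto
  then show "(\<exists>d. balanced d) \<and> (\<forall>j\<in>I. n - j \<in> I \<longrightarrow> 2 * j \<noteq> n \<longrightarrow> (\<forall>i\<in>I. n - i \<in> I))"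
    using psp_normal_imp normal by blast
next
  assume *: "(\<exists>d. balanced d) \<and> (\<forall>j\<in>I. n - j \<in> I \<longrightarrow> 2 * j \<noteq> n \<longrightarrow> (\<forall>i\<in>I. n - i \<in> I))"
  then obtain d where d: "balanced d" by blast
  show "\<forall>p\<in>M. psp.normal_at p"
  proof (cases "\<forall>i\<in>I. n - i \<in> I")
    case True
    then show ?thesis using psp_normal_symmetric[OF d] by blast
  next
    case False
    then have I': "2 * j = n" if "j \<in> I" "n - j \<in> I" for j using * that by blast
    show ?thesis
      unfolding psp.normal_at_iff
    proof (intro ballI impI)
      fix p h assume p: "p \<in> M" and h: "h \<in> polyfun {1..n}" "psp.stable h"
      obtain H where H: "H \<in> sp.invs" "\<And>x. x \<in> M \<Longrightarrow> H x = h x"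
        using sp_stable_extends[OF d h(1) psp_stable_sp[OF h(2)]] by blast
      then show "\<exists>t\<in>psp.invs. \<exists>c\<in>psp.invs. t p \<noteq> 0 \<and> (\<forall>x\<in>M. t x * h x = c x)"
        using extend_locally[OF d I' p H(1)] by simp
    qed
  qed
qed

end

section \<open>Integral closedness of localizations\<close>

text \<open>An equation of integral dependence for \<open>a / b\<close>, multiplied by the d-th
  power of b so that it can be stated inside the ring.\<close>

definition integral_relation :: "('a, 'm) ring_scheme \<Rightarrow> 'a \<Rightarrow> 'a \<Rightarrow> bool" where
  "integral_relation R a b \<longleftrightarrow> (\<exists>(d::nat) c. (\<forall>i<d. c i \<in> carrier R) \<and>
     a [^]\<^bsub>R\<^esub> d \<oplus>\<^bsub>R\<^esub> (\<Oplus>\<^bsub>R\<^esub>i\<in>{..<d}. c i \<otimes>\<^bsub>R\<^esub> a [^]\<^bsub>R\<^esub> i \<otimes>\<^bsub>R\<^esub> b [^]\<^bsub>R\<^esub> (d - i)) = \<zero>\<^bsub>R\<^esub>)"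

text \<open>An abstract inclusion of R into a ring of fractions with denominators in S. It is
  applied to the field of fractions and to the local rings alike, which confines the handling of
  representatives to one place.\<close>

locale fraction_extension = R: domain R + K: domain K + ring_hom_cring R K h
  for R :: "('a, 'm) ring_scheme" (structure) and K :: "('b, 'n) ring_scheme" and h +
  fixes S :: "'a set"
  assumes inj: "inj_on h (carrier R)"
    and S: "S \<subseteq> carrier R" "\<one> \<in> S" "\<zero> \<notin> S" "s \<in> S \<Longrightarrow> t \<in> S \<Longrightarrow> s \<otimes> t \<in> S"
    and numerator: "x \<in> carrier K \<Longrightarrow> \<exists>s\<in>S. \<exists>a\<in>carrier R. h s \<otimes>\<^bsub>K\<^esub> x = h a"
    and quotient: "a \<in> carrier R \<Longrightarrow> s \<in> S \<Longrightarrow> \<exists>x\<in>carrier K. h s \<otimes>\<^bsub>K\<^esub> x = h a"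
begin

lemma S_carrier: "s \<in> S \<Longrightarrow> s \<in> carrier R" using S(1) by blast

lemma h_eq: "a \<in> carrier R \<Longrightarrow> b \<in> carrier R \<Longrightarrow> h a = h b \<longleftrightarrow> a = b"
  using inj by (auto simp: inj_on_def)

lemma h_eq_zero: "a \<in> carrier R \<Longrightarrow> h a = \<zero>\<^bsub>K\<^esub> \<longleftrightarrow> a = \<zero>"
  using h_eq[of a \<zero>] by simp

lemma h_S_nonzero: "s \<in> S \<Longrightarrow> h s \<noteq> \<zero>\<^bsub>K\<^esub>"
  using h_eq_zero S_carrier S(3) by metis

lemma h_pow: "a \<in> carrier R \<Longrightarrow> h (a [^] (k::nat)) = h a [^]\<^bsub>K\<^esub> k"
  by (induction k) simp_all

lemma h_relation:
  fixes d :: nat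
  assumes "a \<in> carrier R" "b \<in> carrier R" "\<And>i. i < d \<Longrightarrow> c i \<in> carrier R"
  shows "h (a [^] d \<oplus> (\<Oplus>i\<in>{..<d}. c i \<otimes> a [^] i \<otimes> b [^] (d - i))) =
    h a [^]\<^bsub>K\<^esub> d \<oplus>\<^bsub>K\<^esub> (\<Oplus>\<^bsub>K\<^esub>i\<in>{..<d}. h (c i) \<otimes>\<^bsub>K\<^esub> h a [^]\<^bsub>K\<^esub> i \<otimes>\<^bsub>K\<^esub> h b [^]\<^bsub>K\<^esub> (d - i))"
proof -
  have "(\<lambda>i. c i \<otimes> a [^] i \<otimes> b [^] (d - i)) \<in> {..<d} \<rightarrow> carrier R" using assms by auto
  from hom_finsum[OF this]
  have "h (\<Oplus>i\<in>{..<d}. c i \<otimes> a [^] i \<otimes> b [^] (d - i)) = (\<Oplus>\<^bsub>K\<^esub>i\<in>{..<d}. h (c i \<otimes> a [^] i \<otimes> b [^] (d - i)))"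
    by (simp add: comp_def)
  also have "\<dots> = (\<Oplus>\<^bsub>K\<^esub>i\<in>{..<d}. h (c i) \<otimes>\<^bsub>K\<^esub> h a [^]\<^bsub>K\<^esub> i \<otimes>\<^bsub>K\<^esub> h b [^]\<^bsub>K\<^esub> (d - i))"
    using assms by (intro K.finsum_cong') (auto simp: h_pow)
  finally show ?thesis
    using assms by (simp add: h_pow R.finsum_closed)
qed

text \<open>Each summand must gain the factor \<open>(T u) ^ d\<close>. The powers of
  \<open>T u x\<close> and \<open>u y\<close> supply all of the u and i factors T, so the
  coefficient supplies the other \<open>d - i\<close>: one of them is there to clear its
  denominator, the remaining \<open>d - 1 - i\<close> are split off as a power.\<close>

lemma K_scale:
  fixes d :: nat
  assumes "x \<in> carrier K" "y \<in> carrier K" "T \<in> carrier K" "u \<in> carrier K" "\<And>i. i < d \<Longrightarrow> c i \<in> carrier K"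
    and "\<And>i. i < d \<Longrightarrow> c' i = T \<otimes>\<^bsub>K\<^esub> c i \<otimes>\<^bsub>K\<^esub> T [^]\<^bsub>K\<^esub> (d - 1 - i)"
  shows "(T \<otimes>\<^bsub>K\<^esub> u \<otimes>\<^bsub>K\<^esub> x) [^]\<^bsub>K\<^esub> d \<oplus>\<^bsub>K\<^esub>
      (\<Oplus>\<^bsub>K\<^esub>i\<in>{..<d}. c' i \<otimes>\<^bsub>K\<^esub> (T \<otimes>\<^bsub>K\<^esub> u \<otimes>\<^bsub>K\<^esub> x) [^]\<^bsub>K\<^esub> i \<otimes>\<^bsub>K\<^esub> (u \<otimes>\<^bsub>K\<^esub> y) [^]\<^bsub>K\<^esub> (d - i))
    = (T \<otimes>\<^bsub>K\<^esub> u) [^]\<^bsub>K\<^esub> d \<otimes>\<^bsub>K\<^esub>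
      (x [^]\<^bsub>K\<^esub> d \<oplus>\<^bsub>K\<^esub> (\<Oplus>\<^bsub>K\<^esub>i\<in>{..<d}. c i \<otimes>\<^bsub>K\<^esub> x [^]\<^bsub>K\<^esub> i \<otimes>\<^bsub>K\<^esub> y [^]\<^bsub>K\<^esub> (d - i)))"
proof -
  have "c' i \<otimes>\<^bsub>K\<^esub> (T \<otimes>\<^bsub>K\<^esub> u \<otimes>\<^bsub>K\<^esub> x) [^]\<^bsub>K\<^esub> i \<otimes>\<^bsub>K\<^esub> (u \<otimes>\<^bsub>K\<^esub> y) [^]\<^bsub>K\<^esub> (d - i)
      = (T \<otimes>\<^bsub>K\<^esub> u) [^]\<^bsub>K\<^esub> d \<otimes>\<^bsub>K\<^esub> (c i \<otimes>\<^bsub>K\<^esub> x [^]\<^bsub>K\<^esub> i \<otimes>\<^bsub>K\<^esub> y [^]\<^bsub>K\<^esub> (d - i))" if i: "i < d" for i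
  proof -
    have "T [^]\<^bsub>K\<^esub> d = T \<otimes>\<^bsub>K\<^esub> T [^]\<^bsub>K\<^esub> (d - 1 - i) \<otimes>\<^bsub>K\<^esub> T [^]\<^bsub>K\<^esub> i"
    proof -
      have "d = Suc (d - 1 - i) + i" using i by simp
      then have "T [^]\<^bsub>K\<^esub> d = T [^]\<^bsub>K\<^esub> Suc (d - 1 - i) \<otimes>\<^bsub>K\<^esub> T [^]\<^bsub>K\<^esub> i"
        using K.nat_pow_mult[OF assms(3), of "Suc (d - 1 - i)" i] by (simp only:)
      also have "T [^]\<^bsub>K\<^esub> Suc (d - 1 - i) = T \<otimes>\<^bsub>K\<^esub> T [^]\<^bsub>K\<^esub> (d - 1 - i)"
        using assms(3) by (simp add: K.m_comm)
      finally show ?thesis .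
    qed
    moreover have "u [^]\<^bsub>K\<^esub> d = u [^]\<^bsub>K\<^esub> i \<otimes>\<^bsub>K\<^esub> u [^]\<^bsub>K\<^esub> (d - i)"
      using K.nat_pow_mult[OF assms(4), of i "d - i"] i by simp
    ultimately show ?thesis
      using assms(1-5) i by (simp add: assms(6) K.nat_pow_distrib K.m_ac)
  qed
  then have "(\<Oplus>\<^bsub>K\<^esub>i\<in>{..<d}. c' i \<otimes>\<^bsub>K\<^esub> (T \<otimes>\<^bsub>K\<^esub> u \<otimes>\<^bsub>K\<^esub> x) [^]\<^bsub>K\<^esub> i \<otimes>\<^bsub>K\<^esub> (u \<otimes>\<^bsub>K\<^esub> y) [^]\<^bsub>K\<^esub> (d - i))
      = (\<Oplus>\<^bsub>K\<^esub>i\<in>{..<d}. (T \<otimes>\<^bsub>K\<^esub> u) [^]\<^bsub>K\<^esub> d \<otimes>\<^bsub>K\<^esub> (c i \<otimes>\<^bsub>K\<^esub> x [^]\<^bsub>K\<^esub> i \<otimes>\<^bsub>K\<^esub> y [^]\<^bsub>K\<^esub> (d - i)))"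
    using assms by (intro K.finsum_cong') auto
  also have "\<dots> = (T \<otimes>\<^bsub>K\<^esub> u) [^]\<^bsub>K\<^esub> d \<otimes>\<^bsub>K\<^esub> (\<Oplus>\<^bsub>K\<^esub>i\<in>{..<d}. c i \<otimes>\<^bsub>K\<^esub> x [^]\<^bsub>K\<^esub> i \<otimes>\<^bsub>K\<^esub> y [^]\<^bsub>K\<^esub> (d - i))"
    using assms by (intro K.finsum_rdistr[symmetric]) auto
  finally show ?thesis
    using assms(1-5) by (simp add: K.r_distr K.finsum_closed K.nat_pow_distrib)
qed

lemma integral_over_iff:
  assumes b: "b \<in> carrier R" "b \<noteq> \<zero>" and a: "a \<in> carrier R"
    and x: "x \<in> carrier K" "h b \<otimes>\<^bsub>K\<^esub> x = h a"
  shows "integral_over K (h ` carrier R) x \<longleftrightarrow> integral_relation R a b"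
proof -
  have key: "x [^]\<^bsub>K\<^esub> d \<oplus>\<^bsub>K\<^esub> (\<Oplus>\<^bsub>K\<^esub>i\<in>{..<d}. h (c i) \<otimes>\<^bsub>K\<^esub> x [^]\<^bsub>K\<^esub> i) = \<zero>\<^bsub>K\<^esub> \<longleftrightarrow>
    a [^] d \<oplus> (\<Oplus>i\<in>{..<d}. c i \<otimes> a [^] i \<otimes> b [^] (d - i)) = \<zero>"
    if c: "\<And>i. i < d \<Longrightarrow> c i \<in> carrier R" for d :: nat and c
  proof -
    let ?E = "x [^]\<^bsub>K\<^esub> d \<oplus>\<^bsub>K\<^esub> (\<Oplus>\<^bsub>K\<^esub>i\<in>{..<d}. h (c i) \<otimes>\<^bsub>K\<^esub> x [^]\<^bsub>K\<^esub> i)"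
    let ?r = "a [^] d \<oplus> (\<Oplus>i\<in>{..<d}. c i \<otimes> a [^] i \<otimes> b [^] (d - i))"
    have E: "?E \<in> carrier K" using c x(1) by (auto intro!: K.finsum_closed K.a_closed)
    have r: "?r \<in> carrier R" using a b c by (auto intro!: R.finsum_closed R.a_closed)
    have "(\<Oplus>\<^bsub>K\<^esub>i\<in>{..<d}. h (c i) \<otimes>\<^bsub>K\<^esub> x [^]\<^bsub>K\<^esub> i) = (\<Oplus>\<^bsub>K\<^esub>i\<in>{..<d}. h (c i) \<otimes>\<^bsub>K\<^esub> x [^]\<^bsub>K\<^esub> i \<otimes>\<^bsub>K\<^esub> \<one>\<^bsub>K\<^esub> [^]\<^bsub>K\<^esub> (d - i))"
      using c x(1) by (intro K.finsum_cong') auto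
    then have "h ?r = (\<one>\<^bsub>K\<^esub> \<otimes>\<^bsub>K\<^esub> h b) [^]\<^bsub>K\<^esub> d \<otimes>\<^bsub>K\<^esub> ?E"
      using h_relation[of a b d c] a b(1) K_scale[of x "\<one>\<^bsub>K\<^esub>" "\<one>\<^bsub>K\<^esub>" "h b" d "\<lambda>i. h (c i)" "\<lambda>i. h (c i)"] c x b(1) by simp
    then have "h ?r = h b [^]\<^bsub>K\<^esub> d \<otimes>\<^bsub>K\<^esub> ?E" using b(1) by simp
    moreover have "h b [^]\<^bsub>K\<^esub> d \<noteq> \<zero>\<^bsub>K\<^esub>"
      using h_eq_zero[OF b(1)] b by (induction d) (auto simp: K.integral_iff)
    ultimately have "h ?r = \<zero>\<^bsub>K\<^esub> \<longleftrightarrow> ?E = \<zero>\<^bsub>K\<^esub>"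
      using K.integral_iff[of "h b [^]\<^bsub>K\<^esub> d" ?E] E b(1) by auto
    then show ?thesis using h_eq_zero[OF r] by simp
  qed
  show ?thesis
  proof
    assume "integral_over K (h ` carrier R) x"
    then obtain d :: nat and C where C: "\<And>i. i < d \<Longrightarrow> C i \<in> h ` carrier R"
      "x [^]\<^bsub>K\<^esub> d \<oplus>\<^bsub>K\<^esub> (\<Oplus>\<^bsub>K\<^esub>i\<in>{..<d}. C i \<otimes>\<^bsub>K\<^esub> x [^]\<^bsub>K\<^esub> i) = \<zero>\<^bsub>K\<^esub>"
      unfolding integral_over_def by blast
    define c where "c i = inv_into (carrier R) h (C i)" for i
    have c: "c i \<in> carrier R" "h (c i) = C i" if "i < d" for i
      using C(1)[OF that] by (simp_all add: c_def inv_into_into f_inv_into_f)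
    have "(\<Oplus>\<^bsub>K\<^esub>i\<in>{..<d}. C i \<otimes>\<^bsub>K\<^esub> x [^]\<^bsub>K\<^esub> i) = (\<Oplus>\<^bsub>K\<^esub>i\<in>{..<d}. h (c i) \<otimes>\<^bsub>K\<^esub> x [^]\<^bsub>K\<^esub> i)"
      using c x(1) by (intro K.finsum_cong') auto
    then show "integral_relation R a b"
      using C(2) key[of d c] c(1) unfolding integral_relation_def by auto
  next
    assume "integral_relation R a b"
    then obtain d :: nat and c where c: "\<And>i. i < d \<Longrightarrow> c i \<in> carrier R"
      "a [^] d \<oplus> (\<Oplus>i\<in>{..<d}. c i \<otimes> a [^] i \<otimes> b [^] (d - i)) = \<zero>"
      unfolding integral_relation_def by blast
    then show "integral_over K (h ` carrier R) x"
      using key[of d c] unfolding integral_over_def by (intro exI[of _ d] exI[of _ "\<lambda>i. h (c i)"]) auto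
  qed
qed

lemma common_denominator:
  "(\<And>i. i < d \<Longrightarrow> C i \<in> carrier K) \<Longrightarrow> \<exists>s\<in>S. \<forall>i<(d::nat). \<exists>c\<in>carrier R. h s \<otimes>\<^bsub>K\<^esub> C i = h c"
proof (induction d)
  case 0 then show ?case using S(2) by blast
next
  case (Suc d)
  then obtain s where s: "s \<in> S" "\<forall>i<d. \<exists>c\<in>carrier R. h s \<otimes>\<^bsub>K\<^esub> C i = h c" by auto
  obtain t a where t: "t \<in> S" "a \<in> carrier R" "h t \<otimes>\<^bsub>K\<^esub> C d = h a" using numerator[OF Suc.prems[of d]] by auto
  have "\<exists>c\<in>carrier R. h (s \<otimes> t) \<otimes>\<^bsub>K\<^esub> C i = h c" if i: "i < Suc d" for i
  proof (cases "i = d")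
    case True
    have "h (s \<otimes> t) \<otimes>\<^bsub>K\<^esub> C i = h s \<otimes>\<^bsub>K\<^esub> (h t \<otimes>\<^bsub>K\<^esub> C d)"
      using True s(1) t(1) S_carrier Suc.prems[of d] by (simp add: K.m_assoc)
    also have "\<dots> = h (s \<otimes> a)" using s(1) t S_carrier by simp
    finally show ?thesis using s(1) t(2) S_carrier by blast
  next
    case False
    then have "i < d" using i by simp
    then obtain c where c: "c \<in> carrier R" "h s \<otimes>\<^bsub>K\<^esub> C i = h c" using s(2) by blast
    have "h (s \<otimes> t) \<otimes>\<^bsub>K\<^esub> C i = h t \<otimes>\<^bsub>K\<^esub> (h s \<otimes>\<^bsub>K\<^esub> C i)"
      using s(1) t(1) S_carrier Suc.prems[OF i] by (simp add: K.m_ac)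
    also have "\<dots> = h (t \<otimes> c)" using c t S_carrier by simp
    finally show ?thesis using c(1) t(1) S_carrier by blast
  qed
  then show ?case using S(4)[OF s(1) t(1)] by blast
qed

text \<open>Downwards, a denominator of the quotient z gives t. Upwards, a common denominator s of x
  and y and one T of all coefficients move the relation to \<open>T \<otimes> a\<close> and b in R;
  the resulting factors s, t and T are cancelled at the end, being nonzero in the domain K.\<close>

lemma integrally_closed_localization_iff:
  "(\<forall>x\<in>carrier K. \<forall>y\<in>carrier K. y \<noteq> \<zero>\<^bsub>K\<^esub> \<longrightarrow> integral_relation K x y \<longrightarrow> (\<exists>z\<in>carrier K. y \<otimes>\<^bsub>K\<^esub> z = x)) \<longleftrightarrow>
   (\<forall>a\<in>carrier R. \<forall>b\<in>carrier R. b \<noteq> \<zero> \<longrightarrow> integral_relation R a b \<longrightarrow> (\<exists>t\<in>S. \<exists>c\<in>carrier R. t \<otimes> a = b \<otimes> c))"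
  (is "?K \<longleftrightarrow> ?R")
proof
  assume K: ?K
  show ?R
  proof (intro ballI impI)
    fix a b assume ab: "a \<in> carrier R" "b \<in> carrier R" "b \<noteq> \<zero>" "integral_relation R a b"
    obtain d :: nat and c where c: "\<And>i. i < d \<Longrightarrow> c i \<in> carrier R"
      "a [^] d \<oplus> (\<Oplus>i\<in>{..<d}. c i \<otimes> a [^] i \<otimes> b [^] (d - i)) = \<zero>"
      using ab(4) unfolding integral_relation_def by blast
    have "integral_relation K (h a) (h b)"
      unfolding integral_relation_def using h_relation[of a b d c] ab(1,2) c
      by (intro exI[of _ d] exI[of _ "\<lambda>i. h (c i)"]) auto
    then obtain z where z: "z \<in> carrier K" "h b \<otimes>\<^bsub>K\<^esub> z = h a"
      using K ab h_eq_zero[of b] by auto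
    obtain t e where t: "t \<in> S" "e \<in> carrier R" "h t \<otimes>\<^bsub>K\<^esub> z = h e" using numerator[OF z(1)] by auto
    have "h (t \<otimes> a) = h t \<otimes>\<^bsub>K\<^esub> (h b \<otimes>\<^bsub>K\<^esub> z)" using ab t S_carrier z by simp
    also have "\<dots> = h b \<otimes>\<^bsub>K\<^esub> (h t \<otimes>\<^bsub>K\<^esub> z)" using ab t S_carrier z(1) by (simp add: K.m_lcomm)
    also have "\<dots> = h (b \<otimes> e)" using ab t by simp
    finally have "t \<otimes> a = b \<otimes> e"
      by (rule h_eq[THEN iffD1, rotated 2]) (use ab t S_carrier in auto)
    then show "\<exists>t\<in>S. \<exists>c\<in>carrier R. t \<otimes> a = b \<otimes> c" using t by blast
  qed
next
  assume R: ?R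
  show ?K
  proof (intro ballI impI)
    fix x y assume xy: "x \<in> carrier K" "y \<in> carrier K" "y \<noteq> \<zero>\<^bsub>K\<^esub>" "integral_relation K x y"
    obtain d :: nat and C where C: "\<And>i. i < d \<Longrightarrow> C i \<in> carrier K"
      "x [^]\<^bsub>K\<^esub> d \<oplus>\<^bsub>K\<^esub> (\<Oplus>\<^bsub>K\<^esub>i\<in>{..<d}. C i \<otimes>\<^bsub>K\<^esub> x [^]\<^bsub>K\<^esub> i \<otimes>\<^bsub>K\<^esub> y [^]\<^bsub>K\<^esub> (d - i)) = \<zero>\<^bsub>K\<^esub>"
      using xy(4) unfolding integral_relation_def by blast
    have "(if i = 0 then x else y) \<in> carrier K" if "i < 2" for i :: nat using xy by simp
    from common_denominator[of 2 "\<lambda>i. if i = 0 then x else y", OF this]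
    obtain s where s: "s \<in> S" "\<forall>i<2. \<exists>c\<in>carrier R. h s \<otimes>\<^bsub>K\<^esub> (if i = (0::nat) then x else y) = h c"
      by blast
    obtain a b where ab: "a \<in> carrier R" "h s \<otimes>\<^bsub>K\<^esub> x = h a" "b \<in> carrier R" "h s \<otimes>\<^bsub>K\<^esub> y = h b"
      using s(2)[rule_format, of 0] s(2)[rule_format, of 1] by auto
    obtain T where T: "T \<in> S" "\<forall>i<d. \<exists>c\<in>carrier R. h T \<otimes>\<^bsub>K\<^esub> C i = h c"
      using common_denominator[of d C, OF C(1)] by blast
    obtain c where c: "\<And>i. i < d \<Longrightarrow> c i \<in> carrier R" "\<And>i. i < d \<Longrightarrow> h T \<otimes>\<^bsub>K\<^esub> C i = h (c i)"
      using T(2) by metis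
    note Sc = S_carrier[OF s(1)] S_carrier[OF T(1)]
    define e where "e i = c i \<otimes> T [^] (d - 1 - i)" for i
    have e: "e i \<in> carrier R" "h (e i) = h T \<otimes>\<^bsub>K\<^esub> C i \<otimes>\<^bsub>K\<^esub> h T [^]\<^bsub>K\<^esub> (d - 1 - i)" if "i < d" for i
      using c[OF that] Sc by (simp_all add: e_def h_pow)
    let ?r = "(T \<otimes> a) [^] d \<oplus> (\<Oplus>i\<in>{..<d}. e i \<otimes> (T \<otimes> a) [^] i \<otimes> b [^] (d - i))"
    have hTa: "h (T \<otimes> a) = h T \<otimes>\<^bsub>K\<^esub> h s \<otimes>\<^bsub>K\<^esub> x"
      using ab(1) Sc xy(1) by (simp add: K.m_assoc flip: ab(2))
    have "h ?r = h (T \<otimes> a) [^]\<^bsub>K\<^esub> d \<oplus>\<^bsub>K\<^esub>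
        (\<Oplus>\<^bsub>K\<^esub>i\<in>{..<d}. h (e i) \<otimes>\<^bsub>K\<^esub> h (T \<otimes> a) [^]\<^bsub>K\<^esub> i \<otimes>\<^bsub>K\<^esub> h b [^]\<^bsub>K\<^esub> (d - i))"
      by (rule h_relation) (use ab Sc e(1) in auto)
    also have "\<dots> = \<zero>\<^bsub>K\<^esub>"
      unfolding hTa ab(4)[symmetric]
      using K_scale[of x y "h T" "h s" d C "\<lambda>i. h (e i)", OF xy(1,2) _ _ C(1) e(2)] Sc C(2) by simp
    finally have "h ?r = \<zero>\<^bsub>K\<^esub>" .
    moreover have "?r \<in> carrier R" using ab e Sc by (auto intro!: R.finsum_closed R.a_closed)
    ultimately have "?r = \<zero>" using h_eq_zero by blast
    then have "integral_relation R (T \<otimes> a) b"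
      unfolding integral_relation_def using e(1) by blast
    moreover have "b \<noteq> \<zero>"
      using K.integral_iff[of "h s" y] h_S_nonzero[OF s(1)] xy(2,3) ab(4) Sc h_eq_zero[OF ab(3)] by auto
    ultimately obtain t f where tf: "t \<in> S" "f \<in> carrier R" "t \<otimes> (T \<otimes> a) = b \<otimes> f"
      using R ab Sc by (metis R.m_closed)
    have tT: "t \<otimes> T \<in> S" "t \<otimes> T \<in> carrier R" using S(4) tf T Sc S_carrier by auto
    obtain z where z: "z \<in> carrier K" "h (t \<otimes> T) \<otimes>\<^bsub>K\<^esub> z = h f" using quotient[OF tf(2) tT(1)] by auto
    have "h s \<otimes>\<^bsub>K\<^esub> h (t \<otimes> T) \<otimes>\<^bsub>K\<^esub> x = h (t \<otimes> T) \<otimes>\<^bsub>K\<^esub> (h s \<otimes>\<^bsub>K\<^esub> x)"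
      using Sc tT(2) xy(1) hom_closed by (simp add: K.m_ac del: hom_mult)
    also have "\<dots> = h (t \<otimes> (T \<otimes> a))"
      unfolding ab(2) using Sc tf(1) ab S_carrier by (simp add: K.m_assoc)
    also have "\<dots> = h s \<otimes>\<^bsub>K\<^esub> y \<otimes>\<^bsub>K\<^esub> (h (t \<otimes> T) \<otimes>\<^bsub>K\<^esub> z)"
      unfolding tf(3) ab(4) z(2) using ab tf by simp
    also have "\<dots> = h s \<otimes>\<^bsub>K\<^esub> h (t \<otimes> T) \<otimes>\<^bsub>K\<^esub> (y \<otimes>\<^bsub>K\<^esub> z)"
      using Sc tT(2) xy(2) z(1) hom_closed by (simp add: K.m_ac del: hom_mult)
    finally have "x = y \<otimes>\<^bsub>K\<^esub> z"
      using K.m_lcancel[of "h s \<otimes>\<^bsub>K\<^esub> h (t \<otimes> T)" x "y \<otimes>\<^bsub>K\<^esub> z"] K.integral_iff[of "h s" "h (t \<otimes> T)"]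
        h_S_nonzero[OF s(1)] h_S_nonzero[OF tT(1)] hom_closed[OF Sc(1)] hom_closed[OF tT(2)] xy z(1)
      by (simp del: hom_mult)
    then show "\<exists>z\<in>carrier K. y \<otimes>\<^bsub>K\<^esub> z = x" using z(1) by blast
  qed
qed

end


section \<open>The localization of a domain, realised by classes of pairs\<close>

locale multiplicative_set = domain R for R (structure) +
  fixes S
  assumes S: "S \<subseteq> carrier R" "\<one> \<in> S" "\<zero> \<notin> S" "s \<in> S \<Longrightarrow> t \<in> S \<Longrightarrow> s \<otimes> t \<in> S"
begin

abbreviation "fr \<equiv> fraction R S"
abbreviation "Q \<equiv> localization R S"

lemma S_carrier: "s \<in> S \<Longrightarrow> s \<in> carrier R" using S(1) by blast

lemma S_nonzero: "s \<in> S \<Longrightarrow> s \<noteq> \<zero>" using S(3) by blast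

text \<open>The auxiliary factor u in the relation between fractions is nonzero, so in a domain it
  cancels.\<close>

lemma mem_frac:
  assumes "a \<in> carrier R" "s \<in> S"
  shows "(b, t) \<in> fr a s \<longleftrightarrow> b \<in> carrier R \<and> t \<in> S \<and> a \<otimes> t = b \<otimes> s"
proof -
  have "(\<exists>u\<in>S. u \<otimes> (a \<otimes> t \<ominus> b \<otimes> s) = \<zero>) \<longleftrightarrow> a \<otimes> t = b \<otimes> s" if "b \<in> carrier R" "t \<in> S"
  proof -
    have "a \<otimes> t \<ominus> b \<otimes> s \<in> carrier R" using assms that S_carrier by simp
    then have "(\<exists>u\<in>S. u \<otimes> (a \<otimes> t \<ominus> b \<otimes> s) = \<zero>) \<longleftrightarrow> a \<otimes> t \<ominus> b \<otimes> s = \<zero>"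
      using integral_iff S_carrier S_nonzero S(2) by auto
    moreover have "x \<ominus> y = \<zero> \<longleftrightarrow> x = y" if "x \<in> carrier R" "y \<in> carrier R" for x y
      using that by (metis a_minus_def add.inv_closed minus_equality r_neg)
    ultimately show ?thesis using assms that S_carrier by simp
  qed
  then show ?thesis by (auto simp: fraction_def)
qed

lemma frac_self: "a \<in> carrier R \<Longrightarrow> s \<in> S \<Longrightarrow> (a, s) \<in> fr a s"
  by (simp add: mem_frac)

lemma frac_eq_iff:
  assumes "a \<in> carrier R" "s \<in> S" "b \<in> carrier R" "t \<in> S"
  shows "fr a s = fr b t \<longleftrightarrow> a \<otimes> t = b \<otimes> s"
proof
  assume "fr a s = fr b t"
  then have "(b, t) \<in> fr a s" using frac_self assms by simp
  then show "a \<otimes> t = b \<otimes> s" using mem_frac assms by simp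
next
  assume eq: "a \<otimes> t = b \<otimes> s"
  have sub: "fr a s \<subseteq> fr b t"
    if "a \<in> carrier R" "s \<in> S" "b \<in> carrier R" "t \<in> S" "a \<otimes> t = b \<otimes> s" for a s b t
  proof (clarify)
    fix c u assume "(c, u) \<in> fr a s"
    then have c: "c \<in> carrier R" "u \<in> S" "a \<otimes> u = c \<otimes> s" using mem_frac that by simp_all
    note carr = S_carrier[OF that(2)] S_carrier[OF that(4)] S_carrier[OF c(2)] that(1,3) c(1)
    have "s \<otimes> (b \<otimes> u) = u \<otimes> (a \<otimes> t)" unfolding that(5) using carr by (simp add: m_ac)
    also have "\<dots> = t \<otimes> (a \<otimes> u)" using carr by (simp add: m_ac)
    also have "\<dots> = s \<otimes> (c \<otimes> t)" unfolding c(3) using carr by (simp add: m_ac)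
    finally have "b \<otimes> u = c \<otimes> t" using carr S_nonzero[OF that(2)] by (simp add: m_lcancel)
    then show "(c, u) \<in> fr b t" using mem_frac that c by simp
  qed
  show "fr a s = fr b t" using sub[OF assms eq] sub[OF assms(3,4,1,2) eq[symmetric]] by blast
qed

lemma frac_carrier: "a \<in> carrier R \<Longrightarrow> s \<in> S \<Longrightarrow> fr a s \<in> carrier Q"
  by (auto simp: localization_def)

lemma carrierE:
  assumes "x \<in> carrier Q"
  obtains a s where "x = fr a s" "a \<in> carrier R" "s \<in> S"
  using assms by (auto simp: localization_def)

text \<open>Sums and products in \<open>localization\<close> are unions over all representatives.
  When the resulting class is the same for each choice, the union collapses to it, since classes are
  nonempty.\<close>

lemma frac_UN:
  assumes "a \<in> carrier R" "s \<in> S" "b \<in> carrier R" "t \<in> S"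
    and "\<And>a' s' b' t'. (a', s') \<in> fr a s \<Longrightarrow> (b', t') \<in> fr b t \<Longrightarrow> F a' s' b' t' = G"
  shows "(\<Union>(a', s')\<in>fr a s. \<Union>(b', t')\<in>fr b t. F a' s' b' t') = G"
proof -
  have "(\<Union>(a', s')\<in>fr a s. \<Union>(b', t')\<in>fr b t. F a' s' b' t') = (\<Union>p\<in>fr a s. \<Union>q\<in>fr b t. G)"
    using assms(5) by (intro SUP_cong refl) auto
  then show ?thesis using frac_self[OF assms(1,2)] frac_self[OF assms(3,4)] by auto
qed

lemma frac_mult:
  assumes ab: "a \<in> carrier R" "s \<in> S" "b \<in> carrier R" "t \<in> S"
  shows "fr a s \<otimes>\<^bsub>Q\<^esub> fr b t = fr (a \<otimes> b) (s \<otimes> t)"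
proof -
  have "fr (a' \<otimes> b') (s' \<otimes> t') = fr (a \<otimes> b) (s \<otimes> t)"
    if "(a', s') \<in> fr a s" "(b', t') \<in> fr b t" for a' s' b' t'
  proof -
    have *: "a' \<in> carrier R" "s' \<in> S" "a \<otimes> s' = a' \<otimes> s" "b' \<in> carrier R" "t' \<in> S" "b \<otimes> t' = b' \<otimes> t"
      using that mem_frac ab by auto
    note carr = ab(1,3) *(1,4) S_carrier[OF ab(2)] S_carrier[OF ab(4)] S_carrier[OF *(2)] S_carrier[OF *(5)]
    have "(a' \<otimes> b') \<otimes> (s \<otimes> t) = (a' \<otimes> s) \<otimes> (b' \<otimes> t)" using carr by (simp add: m_ac)
    also have "\<dots> = (a \<otimes> b) \<otimes> (s' \<otimes> t')" unfolding *(3,6)[symmetric] using carr by (simp add: m_ac)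
    finally show ?thesis using carr S(4) ab * by (simp add: frac_eq_iff)
  qed
  from frac_UN[OF ab this] show ?thesis by (simp add: localization_def)
qed

lemma frac_add:
  assumes ab: "a \<in> carrier R" "s \<in> S" "b \<in> carrier R" "t \<in> S"
  shows "fr a s \<oplus>\<^bsub>Q\<^esub> fr b t = fr (a \<otimes> t \<oplus> b \<otimes> s) (s \<otimes> t)"
proof -
  have "fr (a' \<otimes> t' \<oplus> b' \<otimes> s') (s' \<otimes> t') = fr (a \<otimes> t \<oplus> b \<otimes> s) (s \<otimes> t)"
    if "(a', s') \<in> fr a s" "(b', t') \<in> fr b t" for a' s' b' t'
  proof -
    have *: "a' \<in> carrier R" "s' \<in> S" "a \<otimes> s' = a' \<otimes> s" "b' \<in> carrier R" "t' \<in> S" "b \<otimes> t' = b' \<otimes> t"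
      using that mem_frac ab by auto
    note carr = ab(1,3) *(1,4) S_carrier[OF ab(2)] S_carrier[OF ab(4)] S_carrier[OF *(2)] S_carrier[OF *(5)]
    have "(a' \<otimes> t' \<oplus> b' \<otimes> s') \<otimes> (s \<otimes> t) = (a' \<otimes> s) \<otimes> (t \<otimes> t') \<oplus> (b' \<otimes> t) \<otimes> (s \<otimes> s')"
      using carr by (simp add: l_distr r_distr m_ac)
    also have "\<dots> = (a \<otimes> t \<oplus> b \<otimes> s) \<otimes> (s' \<otimes> t')"
      unfolding *(3,6)[symmetric] using carr by (simp add: l_distr r_distr m_ac)
    finally show ?thesis using carr S(4) ab * by (simp add: frac_eq_iff)
  qed
  from frac_UN[OF ab this] show ?thesis by (simp add: localization_def)
qed

lemma Q_one: "\<one>\<^bsub>Q\<^esub> = fr \<one> \<one>" and Q_zero: "\<zero>\<^bsub>Q\<^esub> = fr \<zero> \<one>"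
  by (simp_all add: localization_def)

lemma frac_eq_zero: "a \<in> carrier R \<Longrightarrow> s \<in> S \<Longrightarrow> fr a s = \<zero>\<^bsub>Q\<^esub> \<longleftrightarrow> a = \<zero>"
  using S(2) S_carrier by (simp add: Q_zero frac_eq_iff)

lemma localization_domain: "domain Q"
proof -
  have cring: "cring Q"
  proof (rule cringI)
    show "abelian_group Q"
    proof (rule abelian_groupI)
      fix x y assume "x \<in> carrier Q" "y \<in> carrier Q"
      then show "x \<oplus>\<^bsub>Q\<^esub> y \<in> carrier Q"
        by (elim carrierE) (auto simp: frac_add S(4) S_carrier intro!: frac_carrier)
    next
      show "\<zero>\<^bsub>Q\<^esub> \<in> carrier Q" using S(2) by (simp add: Q_zero frac_carrier)
    next
      fix x y z assume "x \<in> carrier Q" "y \<in> carrier Q" "z \<in> carrier Q"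
      then obtain a s b t c u where x: "x = fr a s" "a \<in> carrier R" "s \<in> S"
        and y: "y = fr b t" "b \<in> carrier R" "t \<in> S" and z: "z = fr c u" "c \<in> carrier R" "u \<in> S"
        by (elim carrierE)
      note carr = x y z S_carrier[OF x(3)] S_carrier[OF y(3)] S_carrier[OF z(3)]
      have "((a \<otimes> t \<oplus> b \<otimes> s) \<otimes> u \<oplus> c \<otimes> (s \<otimes> t)) = a \<otimes> (t \<otimes> u) \<oplus> (b \<otimes> u \<oplus> c \<otimes> t) \<otimes> s"
        using carr by (simp add: l_distr r_distr m_ac a_ac)
      then show "x \<oplus>\<^bsub>Q\<^esub> y \<oplus>\<^bsub>Q\<^esub> z = x \<oplus>\<^bsub>Q\<^esub> (y \<oplus>\<^bsub>Q\<^esub> z)"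
        using carr by (simp add: frac_add S(4) m_assoc)
    next
      fix x y assume "x \<in> carrier Q" "y \<in> carrier Q"
      then show "x \<oplus>\<^bsub>Q\<^esub> y = y \<oplus>\<^bsub>Q\<^esub> x"
        by (elim carrierE) (simp add: frac_add S_carrier m_comm a_comm)
    next
      fix x assume "x \<in> carrier Q"
      then show "\<zero>\<^bsub>Q\<^esub> \<oplus>\<^bsub>Q\<^esub> x = x"
        using S(2) by (elim carrierE) (simp add: Q_zero frac_add S_carrier)
    next
      fix x assume "x \<in> carrier Q"
      then obtain a s where x: "x = fr a s" "a \<in> carrier R" "s \<in> S" by (rule carrierE)
      have "(\<ominus> a) \<otimes> s \<oplus> a \<otimes> s = \<zero>" using x S_carrier by (simp add: l_distr[symmetric] l_neg)
      then have "fr (\<ominus> a) s \<oplus>\<^bsub>Q\<^esub> x = \<zero>\<^bsub>Q\<^esub>"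
        using x S(4) S_carrier by (simp add: frac_add frac_eq_zero)
      then show "\<exists>y\<in>carrier Q. y \<oplus>\<^bsub>Q\<^esub> x = \<zero>\<^bsub>Q\<^esub>" using x frac_carrier by blast
    qed
    show "comm_monoid Q"
    proof (rule comm_monoidI)
      show "\<one>\<^bsub>Q\<^esub> \<in> carrier Q" using S(2) by (simp add: Q_one frac_carrier)
      show "x \<otimes>\<^bsub>Q\<^esub> y \<in> carrier Q" if "x \<in> carrier Q" "y \<in> carrier Q" for x y
        using that by (elim carrierE) (auto simp: frac_mult S(4) intro!: frac_carrier)
      show "x \<otimes>\<^bsub>Q\<^esub> y \<otimes>\<^bsub>Q\<^esub> z = x \<otimes>\<^bsub>Q\<^esub> (y \<otimes>\<^bsub>Q\<^esub> z)"
        if "x \<in> carrier Q" "y \<in> carrier Q" "z \<in> carrier Q" for x y z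
        using that by (elim carrierE) (simp add: frac_mult S(4) S_carrier m_assoc)
      show "\<one>\<^bsub>Q\<^esub> \<otimes>\<^bsub>Q\<^esub> x = x" if "x \<in> carrier Q" for x
        using that S(2) by (elim carrierE) (simp add: Q_one frac_mult S_carrier)
      show "x \<otimes>\<^bsub>Q\<^esub> y = y \<otimes>\<^bsub>Q\<^esub> x" if "x \<in> carrier Q" "y \<in> carrier Q" for x y
        using that by (elim carrierE) (simp add: frac_mult S_carrier m_comm)
    qed
    fix x y z assume "x \<in> carrier Q" "y \<in> carrier Q" "z \<in> carrier Q"
    then obtain a s b t c u where x: "x = fr a s" "a \<in> carrier R" "s \<in> S"
      and y: "y = fr b t" "b \<in> carrier R" "t \<in> S" and z: "z = fr c u" "c \<in> carrier R" "u \<in> S"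
      by (elim carrierE)
    note carr = x y z S_carrier[OF x(3)] S_carrier[OF y(3)] S_carrier[OF z(3)]
    have "((a \<otimes> t \<oplus> b \<otimes> s) \<otimes> c) \<otimes> ((s \<otimes> u) \<otimes> (t \<otimes> u)) =
        ((a \<otimes> c) \<otimes> (t \<otimes> u) \<oplus> (b \<otimes> c) \<otimes> (s \<otimes> u)) \<otimes> ((s \<otimes> t) \<otimes> u)"
      using carr by (simp add: l_distr r_distr m_ac)
    then show "(x \<oplus>\<^bsub>Q\<^esub> y) \<otimes>\<^bsub>Q\<^esub> z = x \<otimes>\<^bsub>Q\<^esub> z \<oplus>\<^bsub>Q\<^esub> y \<otimes>\<^bsub>Q\<^esub> z"
      using carr by (simp add: frac_add frac_mult S(4) frac_eq_iff)
  qed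
  show ?thesis
  proof (rule domain.intro[OF cring], unfold_locales)
    show "\<one>\<^bsub>Q\<^esub> \<noteq> \<zero>\<^bsub>Q\<^esub>" using S(2) by (simp add: Q_one frac_eq_zero)
    show "x = \<zero>\<^bsub>Q\<^esub> \<or> y = \<zero>\<^bsub>Q\<^esub>"
      if "x \<otimes>\<^bsub>Q\<^esub> y = \<zero>\<^bsub>Q\<^esub>" "x \<in> carrier Q" "y \<in> carrier Q" for x y
      using that(2,3,1) by (elim carrierE) (simp add: frac_mult S(4) frac_eq_zero integral_iff)
  qed
qed

lemma fraction_extension: "fraction_extension R Q (\<lambda>a. fr a \<one>) S"
proof -
  interpret Q: domain Q by (rule localization_domain)
  have hom: "(\<lambda>a. fr a \<one>) \<in> ring_hom R Q"
    by (rule ring_hom_memI) (auto simp: frac_carrier frac_mult frac_add Q_one S(2))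
  show ?thesis
  proof (intro fraction_extension.intro fraction_extension_axioms.intro ring_hom_cring.intro ring_hom_cring_axioms.intro)
    show "domain R" "domain Q" "cring R" "cring Q" by unfold_locales
    show "(\<lambda>a. fr a \<one>) \<in> ring_hom R Q" by (rule hom)
    show "inj_on (\<lambda>a. fr a \<one>) (carrier R)"
      using S(2) by (auto simp: inj_on_def frac_eq_iff)
    have key: "fr s \<one> \<otimes>\<^bsub>Q\<^esub> fr a s = fr a \<one>" if "a \<in> carrier R" "s \<in> S" for a s
      using that S(2,4) S_carrier by (simp add: frac_mult frac_eq_iff m_comm)
    show "\<exists>s\<in>S. \<exists>a\<in>carrier R. fr s \<one> \<otimes>\<^bsub>Q\<^esub> x = fr a \<one>" if "x \<in> carrier Q" for x
      using that key by (elim carrierE) blast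
    show "\<exists>x\<in>carrier Q. fr s \<one> \<otimes>\<^bsub>Q\<^esub> x = fr a \<one>" if "a \<in> carrier R" "s \<in> S" for a s
      using key[OF that] frac_carrier[OF that] by blast
  qed (use S in auto)
qed

end

text \<open>Membership of \<open>a / b\<close> in the image of R amounts to divisibility of a by b,
  and integrality of \<open>a / b\<close> to a relation in R. The field of fractions thereby
  disappears from the criterion.\<close>

lemma integrally_closed_domain_iff:
  "integrally_closed_domain R \<longleftrightarrow> domain R \<and>
    (\<forall>x\<in>carrier R. \<forall>y\<in>carrier R. y \<noteq> \<zero>\<^bsub>R\<^esub> \<longrightarrow> integral_relation R x y \<longrightarrow> (\<exists>z\<in>carrier R. y \<otimes>\<^bsub>R\<^esub> z = x))"
proof (cases "domain R")
  case True
  interpret domain R by (rule True)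
  define S where "S = carrier R - {\<zero>\<^bsub>R\<^esub>}"
  interpret multiplicative_set R S
    by unfold_locales (auto simp: S_def integral_iff)
  interpret X: fraction_extension R Q "\<lambda>a. fr a \<one>\<^bsub>R\<^esub>" S by (rule fraction_extension)
  have div: "x \<in> (\<lambda>a. fr a \<one>\<^bsub>R\<^esub>) ` carrier R \<longleftrightarrow> (\<exists>z\<in>carrier R. b \<otimes>\<^bsub>R\<^esub> z = a)"
    if ab: "a \<in> carrier R" "b \<in> S" and x: "x \<in> carrier Q" "fr b \<one>\<^bsub>R\<^esub> \<otimes>\<^bsub>Q\<^esub> x = fr a \<one>\<^bsub>R\<^esub>" for a b x
  proof -
    have b: "b \<in> carrier R" "b \<noteq> \<zero>\<^bsub>R\<^esub>" using ab by (auto simp: S_def)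
    have "fr z \<one>\<^bsub>R\<^esub> = x \<longleftrightarrow> b \<otimes>\<^bsub>R\<^esub> z = a" if z: "z \<in> carrier R" for z
    proof -
      have "fr z \<one>\<^bsub>R\<^esub> = x \<longleftrightarrow> fr b \<one>\<^bsub>R\<^esub> \<otimes>\<^bsub>Q\<^esub> fr z \<one>\<^bsub>R\<^esub> = fr b \<one>\<^bsub>R\<^esub> \<otimes>\<^bsub>Q\<^esub> x"
        using X.K.m_lcancel[of "fr b \<one>\<^bsub>R\<^esub>" "fr z \<one>\<^bsub>R\<^esub>" x] X.h_S_nonzero[OF ab(2)] X.hom_closed[OF b(1)] X.hom_closed[OF z] x(1) by blast
      also have "\<dots> \<longleftrightarrow> fr (b \<otimes>\<^bsub>R\<^esub> z) \<one>\<^bsub>R\<^esub> = fr a \<one>\<^bsub>R\<^esub>"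
        unfolding x(2) X.hom_mult[OF b(1) z] ..
      also have "\<dots> \<longleftrightarrow> b \<otimes>\<^bsub>R\<^esub> z = a" using X.h_eq b(1) z ab(1) by blast
      finally show ?thesis .
    qed
    then show ?thesis by (auto simp: image_iff)
  qed
  have "(\<forall>x\<in>carrier Q. integral_over Q ((\<lambda>a. fr a \<one>\<^bsub>R\<^esub>) ` carrier R) x \<longrightarrow> x \<in> (\<lambda>a. fr a \<one>\<^bsub>R\<^esub>) ` carrier R)
    \<longleftrightarrow> (\<forall>a\<in>carrier R. \<forall>b\<in>carrier R. b \<noteq> \<zero>\<^bsub>R\<^esub> \<longrightarrow> integral_relation R a b \<longrightarrow> (\<exists>z\<in>carrier R. b \<otimes>\<^bsub>R\<^esub> z = a))"
    (is "?L \<longleftrightarrow> ?R")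
  proof
    assume L: ?L
    show ?R
    proof (intro ballI impI)
      fix a b assume ab: "a \<in> carrier R" "b \<in> carrier R" "b \<noteq> \<zero>\<^bsub>R\<^esub>" "integral_relation R a b"
      then have b: "b \<in> S" by (simp add: S_def)
      obtain x where x: "x \<in> carrier Q" "fr b \<one>\<^bsub>R\<^esub> \<otimes>\<^bsub>Q\<^esub> x = fr a \<one>\<^bsub>R\<^esub>" using X.quotient[OF ab(1) b] by blast
      then show "\<exists>z\<in>carrier R. b \<otimes>\<^bsub>R\<^esub> z = a"
        using L X.integral_over_iff[OF ab(2,3,1) x] ab(4) div[OF ab(1) b x] by blast
    qed
  next
    assume R: ?R
    show ?L
    proof (intro ballI impI)
      fix x assume x: "x \<in> carrier Q" "integral_over Q ((\<lambda>a. fr a \<one>\<^bsub>R\<^esub>) ` carrier R) x"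
      obtain b a where ab: "b \<in> S" "a \<in> carrier R" "fr b \<one>\<^bsub>R\<^esub> \<otimes>\<^bsub>Q\<^esub> x = fr a \<one>\<^bsub>R\<^esub>"
        using X.numerator[OF x(1)] by blast
      then have b: "b \<in> carrier R" "b \<noteq> \<zero>\<^bsub>R\<^esub>" by (auto simp: S_def)
      then show "x \<in> (\<lambda>a. fr a \<one>\<^bsub>R\<^esub>) ` carrier R"
        using R X.integral_over_iff[OF b ab(2) x(1) ab(3)] x(2) ab(2) div[OF ab(2,1) x(1) ab(3)] by blast
    qed
  qed
  then show ?thesis
    using True unfolding integrally_closed_domain_def fraction_field_def Let_def S_def by blast
qed (simp add: integrally_closed_domain_def)

theorem (in multiplicative_set) integrally_closed_domain_localization_iff:
  "integrally_closed_domain Q \<longleftrightarrow>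
    (\<forall>a\<in>carrier R. \<forall>b\<in>carrier R. b \<noteq> \<zero> \<longrightarrow> integral_relation R a b \<longrightarrow> (\<exists>t\<in>S. \<exists>c\<in>carrier R. t \<otimes> a = b \<otimes> c))"
  unfolding integrally_closed_domain_iff
  using localization_domain fraction_extension.integrally_closed_localization_iff[OF fraction_extension] by blast

section \<open>The affine Weyl groups\<close>

definition idx :: "nat \<Rightarrow> 'n::{finite,linorder}" where
  "idx k = sorted_list_of_set UNIV ! (k - 1)"

lemma eps_idx: "eps k = axis (idx k) 1"
  by (simp add: eps_def idx_def)

lemma bij_betw_idx: "bij_betw (idx :: nat \<Rightarrow> 'n::{finite,linorder}) {1..CARD('n)} UNIV"
proof -
  have "bij_betw ((!) (sorted_list_of_set (UNIV :: 'n set))) {..<CARD('n)} UNIV"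
    by (rule bij_betw_nth) (auto simp: sorted_list_of_set.distinct_sorted_key_list_of_set)
  moreover have "bij_betw (\<lambda>k. k - 1) {1..CARD('n)} {..<CARD('n)}"
    by (rule bij_betw_byWitness[where f' = Suc]) auto
  ultimately show ?thesis
    using bij_betw_trans by (force simp: idx_def[abs_def] comp_def)
qed

lemma idx_surj: "\<exists>k\<in>{1..CARD('n)}. idx k = (i :: 'n::{finite,linorder})"
  using bij_betw_imp_surj_on[OF bij_betw_idx] by (metis UNIV_I imageE)

lemma idx_eq_iff: "k \<in> {1..CARD('n)} \<Longrightarrow> l \<in> {1..CARD('n)} \<Longrightarrow> idx k = (idx l :: 'n::{finite,linorder}) \<longleftrightarrow> k = l"
  using inj_on_eq_iff[OF bij_betw_imp_inj_on[OF bij_betw_idx[where 'n = 'n]]] by blast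

lemma inv_idx: "k \<in> {1..CARD('n)} \<Longrightarrow> inv_into {1..CARD('n)} idx (idx k :: 'n::{finite,linorder}) = k"
  by (rule inv_into_f_f[OF bij_betw_imp_inj_on[OF bij_betw_idx]])

lemma idx_permutation:
  fixes \<tau> :: "'n::{finite,linorder} \<Rightarrow> 'n"
  assumes "bij \<tau>"
  obtains \<sigma> where "\<sigma> permutes {1..CARD('n)}" "\<And>k. k \<in> {1..CARD('n)} \<Longrightarrow> idx (\<sigma> k) = \<tau> (idx k)"
proof -
  let ?inv = "inv_into {1..CARD('n)} idx :: 'n \<Rightarrow> nat"
  define \<sigma> where "\<sigma> k = (if k \<in> {1..CARD('n)} then ?inv (\<tau> (idx k)) else k)" for k
  have inv: "idx (?inv i) = i" for i
    using bij_betw_idx[where 'n = 'n] by (auto simp: bij_betw_def f_inv_into_f simp del: atLeastAtMost_iff)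
  have "bij_betw (?inv \<circ> \<tau> \<circ> idx) {1..CARD('n)} {1..CARD('n)}"
    by (rule bij_betw_trans[OF bij_betw_trans[OF bij_betw_idx assms] bij_betw_inv_into[OF bij_betw_idx], folded comp_assoc])
  moreover have "bij_betw (?inv \<circ> \<tau> \<circ> idx) {1..CARD('n)} {1..CARD('n)} = bij_betw \<sigma> {1..CARD('n)} {1..CARD('n)}"
    by (rule bij_betw_cong) (simp add: \<sigma>_def)
  ultimately have "bij_betw \<sigma> {1..CARD('n)} {1..CARD('n)}" by simp
  then have "\<sigma> permutes {1..CARD('n)}"
    by (rule bij_imp_permutes) (simp only: \<sigma>_def if_False)
  then show ?thesis by (rule that) (simp only: \<sigma>_def inv if_True)
qed

section \<open>The Weyl group as signed permutations, and its two lattices\<close>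

definition signed_map :: "('n \<Rightarrow> 'n) \<Rightarrow> ('n \<Rightarrow> real) \<Rightarrow> real^'n \<Rightarrow> real^'n \<Rightarrow> real^'n" where
  "signed_map \<sigma> s q x = (\<chi> i. s i * x $ \<sigma> i + q $ i)"

definition signs :: "('n \<Rightarrow> real) \<Rightarrow> bool" where
  "signs s \<longleftrightarrow> (\<forall>i. s i = 1 \<or> s i = -1)"

lemma signs_square: "signs s \<Longrightarrow> s i * s i = 1"
  by (metis signs_def mult_1 mult_minus1_right minus_minus)

lemma signs_mult: "signs s \<Longrightarrow> signs t \<Longrightarrow> signs (\<lambda>i. s i * t (\<sigma> i))"
  unfolding signs_def by (metis mult_1 mult_minus1 minus_minus)

lemma signs_comp: "signs s \<Longrightarrow> signs (\<lambda>i. s (\<sigma> i))"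
  unfolding signs_def by blast

lemma signs_one [simp]: "signs (\<lambda>i. 1)"
  by (simp add: signs_def)

lemma signed_map_nth [simp]: "signed_map \<sigma> s q x $ i = s i * x $ \<sigma> i + q $ i"
  by (simp add: signed_map_def)

lemma signed_map_comp:
  "signed_map \<sigma> s q \<circ> signed_map \<tau> t r = signed_map (\<tau> \<circ> \<sigma>) (\<lambda>i. s i * t (\<sigma> i)) (signed_map \<sigma> s q r)"
  by (auto simp: fun_eq_iff vec_eq_iff algebra_simps)

lemma signed_map_id: "signed_map id (\<lambda>_. 1) 0 = id"
  by (auto simp: fun_eq_iff vec_eq_iff)

lemma signed_map_inverse:
  fixes q :: "real^'n"
  assumes "bij \<sigma>" "signs s"
  defines "\<tau> \<equiv> inv_into UNIV \<sigma>"
  defines "g \<equiv> signed_map \<tau> (\<lambda>i. s (\<tau> i)) (- signed_map \<tau> (\<lambda>i. s (\<tau> i)) 0 q)"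
  shows "signed_map \<sigma> s q \<circ> g = id" "g \<circ> signed_map \<sigma> s q = id"
proof -
  have \<tau>: "\<tau> (\<sigma> i) = i" "\<sigma> (\<tau> i) = i" for i
    using assms(1) by (simp_all add: \<tau>_def bij_is_inj bij_is_surj surj_f_inv_f)
  have ss: "s i * (s i * a) = a" for i a using signs_square[OF assms(2), of i] by (simp flip: mult.assoc)
  note s2 = signs_square[OF assms(2)]
  show "signed_map \<sigma> s q \<circ> g = id" "g \<circ> signed_map \<sigma> s q = id"
    by (auto simp: g_def fun_eq_iff vec_eq_iff \<tau> ss s2 algebra_simps)
qed

lemma signed_map_bij: "bij \<sigma> \<Longrightarrow> signs s \<Longrightarrow> bij (signed_map \<sigma> s q)"
  using signed_map_inverse[of \<sigma> s q] o_bij by blast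

lemma roots_eq:
  "(roots :: (real^'n::{finite,linorder}) set) =
    {c *\<^sub>R axis i 1 | c i. c \<in> {2, -2}} \<union>
    {c *\<^sub>R axis i 1 + d *\<^sub>R axis j 1 | c d i j. c \<in> {1, -1} \<and> d \<in> {1, -1} \<and> i \<noteq> j}"
    (is "_ = ?A \<union> ?B")
proof (intro equalityI subsetI)
  fix x :: "real^'n::_" assume x: "x \<in> roots"
  have long: "c *\<^sub>R axis (idx k) 1 \<in> ?A \<union> ?B" if "c \<in> {2, -2}" for c k
  proof (rule UnI1, rule CollectI)
    show "\<exists>c' i. (c *\<^sub>R axis (idx k) 1 :: real^'n::_) = c' *\<^sub>R axis i 1 \<and> c' \<in> {2, -2}"
      by (rule exI[of _ c], rule exI[of _ "idx k"]) (simp only: that simp_thms)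
  qed
  have short: "c *\<^sub>R axis (idx k) 1 + d *\<^sub>R axis (idx l) 1 \<in> ?A \<union> ?B"
    if "c \<in> {1, -1}" "d \<in> {1, -1}" "k \<in> {1..CARD('n)}" "l \<in> {1..CARD('n)}" "k \<noteq> l" for c d k l
  proof (rule UnI2, rule CollectI)
    have ne: "idx k \<noteq> (idx l :: 'n)" using idx_eq_iff that by blast
    show "\<exists>c' d' i j. c *\<^sub>R axis (idx k) 1 + d *\<^sub>R axis (idx l) 1 = (c' *\<^sub>R axis i 1 + d' *\<^sub>R axis j 1 :: real^'n::_) \<and>
        c' \<in> {1, -1} \<and> d' \<in> {1, -1} \<and> i \<noteq> j"
      by (rule exI[of _ c], rule exI[of _ d], rule exI[of _ "idx k"], rule exI[of _ "idx l"]) (intro conjI refl that ne)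
  qed
  from x show "x \<in> ?A \<union> ?B"
    unfolding roots_def eps_idx by (elim UnE CollectE exE conjE) (simp_all only: long short simp_thms)
next
  fix x :: "real^'n::_"
  assume x: "x \<in> {c *\<^sub>R axis i 1 | c i. c \<in> {2, -2}} \<union>
    {c *\<^sub>R axis i 1 + d *\<^sub>R axis j 1 | c d i j. c \<in> {1, -1} \<and> d \<in> {1, -1} \<and> i \<noteq> j}"
  have long: "c *\<^sub>R axis i 1 \<in> roots" if "c \<in> {2, -2}" for c and i :: 'n
  proof -
    obtain k where "k \<in> {1..CARD('n)}" "idx k = i" using idx_surj[of i] by auto
    then show ?thesis using that unfolding roots_def eps_idx by blast
  qed
  have short: "c *\<^sub>R axis i 1 + d *\<^sub>R axis j 1 \<in> roots"
    if "c \<in> {1, -1}" "d \<in> {1, -1}" "i \<noteq> j" for c d and i j :: 'n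
  proof -
    obtain k where k: "k \<in> {1..CARD('n)}" "idx k = i" using idx_surj[of i] by auto
    obtain l where l: "l \<in> {1..CARD('n)}" "idx l = j" using idx_surj[of j] by auto
    have "k \<noteq> l" using k(2) l(2) that(3) by auto
    then show ?thesis using that k(1) l(1) unfolding roots_def eps_idx k(2)[symmetric] l(2)[symmetric] by blast
  qed
  from x show "x \<in> roots"
    by (elim UnE CollectE exE conjE) (simp_all only: long short simp_thms)
qed

lemma coroot_long: "c \<in> {2, -2} \<Longrightarrow> coroot (c *\<^sub>R axis i 1) = (c / 2) *\<^sub>R (axis i 1 :: real^'n)"
  by (auto simp: coroot_def inner_axis_axis)

lemma coroot_short:
  assumes "c \<in> {1, -1}" "d \<in> {1, -1}" "i \<noteq> j"
  shows "coroot (c *\<^sub>R axis i 1 + d *\<^sub>R axis j 1) = c *\<^sub>R axis i 1 + d *\<^sub>R (axis j 1 :: real^'n)"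
  using assms by (auto simp: coroot_def inner_axis_axis inner_add_left inner_add_right)

definition reflection :: "real^'n \<Rightarrow> real^'n \<Rightarrow> real^'n" where
  "reflection \<alpha> x = x - (\<alpha> \<bullet> x) *\<^sub>R coroot \<alpha>"

lemma reflection_long:
  assumes "c \<in> {2, -2}"
  shows "reflection (c *\<^sub>R axis i 1) = signed_map id (\<lambda>j. if j = i then -1 else 1) (0 :: real^'n)"
  using assms unfolding reflection_def coroot_long[OF assms] fun_eq_iff vec_eq_iff inner_scaleR_left inner_axis'
  by (auto simp: axis_def)

lemma reflection_short:
  assumes "c \<in> {1, -1}" "d \<in> {1, -1}" "i \<noteq> j"
  shows "reflection (c *\<^sub>R axis i 1 + d *\<^sub>R axis j 1) =
    signed_map (Transposition.transpose i j) (\<lambda>k. if k = i \<or> k = j then - c * d else 1) (0 :: real^'n)"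
  using assms unfolding reflection_def coroot_short[OF assms] fun_eq_iff vec_eq_iff
    inner_add_left inner_scaleR_left inner_axis'
  by (auto simp: axis_def Transposition.transpose_def)

text \<open>Reflections in long roots change one sign, and those in differences of two basis vectors
  are transpositions; together they generate all signed permutations. Conversely every reflection in
  a root is a signed permutation.\<close>

lemma weyl_group_eq:
  "weyl_group = {signed_map \<sigma> s 0 | (\<sigma> :: 'n::{finite,linorder} \<Rightarrow> 'n) s. bij \<sigma> \<and> signs s}" (is "_ = ?T")
proof -
  interpret B: group "BijGroup (UNIV :: (real^'n::_) set)" by (rule group_BijGroup)
  have bij: "bij f" if "f \<in> ?T" for f using that signed_map_bij by blast
  have carrier: "f \<in> carrier (BijGroup UNIV) \<longleftrightarrow> bij f" for f :: "real^'n::_ \<Rightarrow> real^'n::_"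
    by (simp add: BijGroup_def Bij_def)
  have mult: "f \<otimes>\<^bsub>BijGroup UNIV\<^esub> g = f \<circ> g" if "bij f" "bij g" for f g :: "real^'n::_ \<Rightarrow> real^'n::_"
    using that by (simp add: BijGroup_def Bij_def compose_def comp_def restrict_def)
  have one: "\<one>\<^bsub>BijGroup UNIV\<^esub> = (id :: real^'n::_ \<Rightarrow> real^'n::_)"
    by (simp add: BijGroup_def id_def restrict_def)
  define G where "G = {\<lambda>x. x - (\<alpha> \<bullet> x) *\<^sub>R coroot \<alpha> | \<alpha>. \<alpha> \<in> (roots :: (real^'n::_) set)}"
  have G: "G = reflection ` roots" by (auto simp: G_def reflection_def[abs_def])
  have GT: "G \<subseteq> ?T"
  proof
    fix f assume "f \<in> G"
    then obtain \<alpha> where \<alpha>: "\<alpha> \<in> roots" "f = reflection \<alpha>" using G by blast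
    then consider c i where "\<alpha> = c *\<^sub>R axis i 1" "c \<in> {2, -2}"
      | c d i j where "\<alpha> = c *\<^sub>R axis i 1 + d *\<^sub>R axis j 1" "c \<in> {1, -1}" "d \<in> {1, -1}" "i \<noteq> j"
      unfolding roots_eq by blast
    then show "f \<in> ?T"
    proof cases
      case 1
      have "signs (\<lambda>j. if j = i then -1 else 1)" by (auto simp: signs_def)
      then show ?thesis unfolding \<alpha>(2) 1(1) reflection_long[OF 1(2)] using bij_id by blast
    next
      case 2
      have sg: "signs (\<lambda>k. if k = i \<or> k = j then - c * d else 1)" using 2 by (auto simp: signs_def)
      show ?thesis unfolding \<alpha>(2) 2(1) reflection_short[OF 2(2-4)]
        by (rule CollectI, rule exI[of _ "Transposition.transpose i j"],
            rule exI[of _ "\<lambda>k. if k = i \<or> k = j then - c * d else 1"]) (intro conjI refl bij_transpose sg)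
    qed
  qed
  have "subgroup ?T (BijGroup UNIV)"
  proof (rule B.subgroupI)
    show "?T \<subseteq> carrier (BijGroup UNIV)" using bij carrier by blast
    show "?T \<noteq> {}" using signs_one bij_id by blast
    show "m_inv (BijGroup UNIV) f \<in> ?T" if "f \<in> ?T" for f
    proof -
      obtain \<sigma> s where f: "f = signed_map \<sigma> s 0" "bij \<sigma>" "signs s" using \<open>f \<in> ?T\<close> by blast
      define g where "g = signed_map (inv_into UNIV \<sigma>) (\<lambda>i. s (inv_into UNIV \<sigma> i)) (0 :: real^'n::_)"
      have "- signed_map \<tau> t 0 (0 :: real^'n::_) = 0" for \<tau> t by (simp add: vec_eq_iff)
      then have fg: "g \<circ> f = id" using signed_map_inverse(2)[OF f(2,3), of 0] by (simp add: g_def f(1))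
      have gT: "g \<in> ?T" using f(2,3) bij_imp_bij_inv signs_comp unfolding g_def by blast
      then have "m_inv (BijGroup UNIV) f = g"
        using that bij carrier mult one fg by (intro B.inv_equality) auto
      then show ?thesis using gT by simp
    qed
    show "f \<otimes>\<^bsub>BijGroup UNIV\<^esub> g \<in> ?T" if fg: "f \<in> ?T" "g \<in> ?T" for f g
    proof -
      obtain \<sigma> s \<tau> t where f: "f = signed_map \<sigma> s 0" "bij \<sigma>" "signs s" and g: "g = signed_map \<tau> t 0" "bij \<tau>" "signs t"
        using fg by blast
      have "signed_map \<sigma> s 0 0 = (0 :: real^'n::_)" by (simp add: vec_eq_iff)
      then have "f \<circ> g = signed_map (\<tau> \<circ> \<sigma>) (\<lambda>i. s i * t (\<sigma> i)) 0"
        by (simp add: f g signed_map_comp)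
      then show ?thesis
        using mult[OF bij[OF fg(1)] bij[OF fg(2)]] bij_comp[OF f(2) g(2)] signs_mult[OF f(3) g(3)] by auto
    qed
  qed
  then have "generate (BijGroup UNIV) G \<subseteq> ?T" using GT by (rule B.generate_subgroup_incl[rotated])
  moreover have "?T \<subseteq> generate (BijGroup UNIV) G"
  proof -
    have gen: "f \<circ> g \<in> generate (BijGroup UNIV) G" "bij f"
      if "f \<in> generate (BijGroup UNIV) G" "g \<in> generate (BijGroup UNIV) G" for f g
    proof -
      have "bij f" "bij g"
        using that \<open>generate (BijGroup UNIV) G \<subseteq> ?T\<close> bij by blast+
      then show "f \<circ> g \<in> generate (BijGroup UNIV) G" "bij f"
        using generate.eng[OF that] mult by auto
    qed
    have id: "id \<in> generate (BijGroup UNIV) G" using generate.one[of "BijGroup UNIV" G] one by simp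
    have flip: "signed_map id (\<lambda>j. if j \<in> A then -1 else 1) 0 \<in> generate (BijGroup UNIV) G" if "finite A" for A :: "'n set"
      using that
    proof (induction A)
      case empty
      show ?case using \<open>id \<in> generate (BijGroup UNIV) G\<close> by (simp only: empty_iff if_False signed_map_id)
    next
      case (insert i A)
      have "reflection (2 *\<^sub>R axis i 1) \<in> G" unfolding G roots_eq by blast
      then have "signed_map id (\<lambda>j. if j = i then -1 else 1) 0 \<in> generate (BijGroup UNIV) G"
        using reflection_long[of 2 i] generate.incl by fastforce
      from gen(1)[OF this insert.IH]
      have "signed_map id (\<lambda>j. if j = i then -1 else 1) 0 \<circ> signed_map id (\<lambda>j. if j \<in> A then -1 else 1) 0
        \<in> generate (BijGroup UNIV) G" .
      also have "signed_map id (\<lambda>j. if j = i then -1 else 1) 0 \<circ> signed_map id (\<lambda>j. if j \<in> A then -1 else 1) 0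
        = signed_map id (\<lambda>j. if j \<in> insert i A then -1 else 1) (0 :: real^'n::_)"
        using insert(2) by (auto simp: fun_eq_iff vec_eq_iff)
      finally show ?case .
    qed
    have transp: "signed_map (Transposition.transpose i j) (\<lambda>_. 1) 0 \<in> generate (BijGroup UNIV) G" if "i \<noteq> j" for i j :: 'n
    proof -
      have "1 *\<^sub>R axis i 1 + (-1) *\<^sub>R axis j 1 \<in> (roots :: (real^'n::_) set)" unfolding roots_eq using that by blast
      then have "reflection (1 *\<^sub>R axis i 1 + (-1) *\<^sub>R axis j 1) \<in> G" unfolding G by blast
      moreover have "(\<lambda>k. if k = i \<or> k = j then - 1 * - 1 else 1) = (\<lambda>_. 1 :: real)" by auto
      ultimately show ?thesis using reflection_short[of 1 "-1" i j] that generate.incl by fastforce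
    qed
    have perm: "signed_map \<sigma> (\<lambda>_. 1) 0 \<in> generate (BijGroup UNIV) G" if "\<sigma> permutes UNIV" for \<sigma> :: "'n \<Rightarrow> 'n"
      using that finite
    proof (induction rule: permutes_induct)
      case id
      show ?case using \<open>id \<in> generate (BijGroup UNIV) G\<close> by (simp only: signed_map_id)
    next
      case (swap a b p)
      show ?case
      proof (cases "a = b")
        case True then show ?thesis using swap by simp
      next
        case False
        have "signed_map p (\<lambda>_. 1) 0 \<circ> signed_map (Transposition.transpose a b) (\<lambda>_. 1) 0
          = signed_map (Transposition.transpose a b \<circ> p) (\<lambda>_. 1) (0 :: real^'n::_)"
          by (auto simp: fun_eq_iff vec_eq_iff)
        then show ?thesis using gen(1)[OF swap.IH transp[OF False]] by (simp only:)
      qed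
    qed
    show ?thesis
    proof
      fix f assume "f \<in> ?T"
      then obtain \<sigma> s where f: "f = signed_map \<sigma> s 0" "bij \<sigma>" "signs s" by blast
      have \<sigma>: "\<sigma> permutes UNIV" using f(2) by (rule bij_imp_permutes) simp
      have "signed_map id (\<lambda>j. if j \<in> {j. s j = -1} then -1 else 1) 0 \<circ> signed_map \<sigma> (\<lambda>_. 1) 0 \<in> generate (BijGroup UNIV) G"
        by (rule gen(1)[OF flip[OF finite] perm[OF \<sigma>]])
      moreover have "(\<lambda>j. if j \<in> {j. s j = -1} then -1 else 1) = s"
        by (rule ext) (use f(3) in \<open>auto simp: signs_def\<close>)
      moreover have "signed_map id s 0 \<circ> signed_map \<sigma> (\<lambda>_. 1) 0 = f"
        by (auto simp: f(1) fun_eq_iff vec_eq_iff)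
      ultimately show "f \<in> generate (BijGroup UNIV) G" by (simp only:)
    qed
  qed
  ultimately show ?thesis unfolding weyl_group_def G_def by blast
qed

lemma coroot_integral: "\<alpha> \<in> roots \<Longrightarrow> coroot \<alpha> $ i \<in> \<int>"
  for \<alpha> :: "real^'n::{finite,linorder}"
proof -
  assume "\<alpha> \<in> roots"
  then consider c j where "\<alpha> = c *\<^sub>R axis j 1" "c \<in> {2, -2}"
    | c d j k where "\<alpha> = c *\<^sub>R axis j 1 + d *\<^sub>R axis k 1" "c \<in> {1, -1}" "d \<in> {1, -1}" "j \<noteq> k"
    unfolding roots_eq by blast
  then show ?thesis
  proof cases
    case 1 then show ?thesis unfolding 1(1) coroot_long[OF 1(2)] by (auto simp: axis_def)
  next
    case 2 then show ?thesis unfolding 2(1) coroot_short[OF 2(2-4)] by (auto simp: axis_def)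
  qed
qed

lemma finite_roots: "finite (roots :: (real^'n::{finite,linorder}) set)"
proof -
  have "(roots :: (real^'n::_) set) \<subseteq> (\<Union>c\<in>{2, -2}. \<Union>i. {c *\<^sub>R axis i 1}) \<union>
    (\<Union>c\<in>{1, -1}. \<Union>d\<in>{1, -1}. \<Union>i. \<Union>j. {c *\<^sub>R axis i 1 + d *\<^sub>R axis j 1})"
    (is "_ \<subseteq> ?A \<union> ?B")
  proof
    fix x :: "real^'n::_" assume "x \<in> roots"
    then consider c j where "x = c *\<^sub>R axis j 1" "c \<in> {2, -2}"
      | c d j k where "x = c *\<^sub>R axis j 1 + d *\<^sub>R axis k 1" "c \<in> {1, -1}" "d \<in> {1, -1}"
      unfolding roots_eq by blast
    then show "x \<in> ?A \<union> ?B"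
    proof cases
      case 1
      then have "x \<in> ?A" by (intro UN_I[of c] UN_I[of j] UNIV_I singletonI) (simp_all only: singleton_iff)
      then show ?thesis by (rule UnI1)
    next
      case 2
      then have "x \<in> ?B" by (intro UN_I[of c] UN_I[of d]) (simp_all only: UN_iff singleton_iff UNIV_I bex_UNIV, blast)
      then show ?thesis by (rule UnI2)
    qed
  qed
  then show ?thesis by (rule finite_subset) (intro finite_UnI finite_UN_I finite.intros finite)
qed

text \<open>The coroots of the long roots are the standard basis vectors up to sign, and all other
  coroots have integral coordinates.\<close>

lemma coroot_lattice_eq: "coroot_lattice = {v :: real^'n::{finite,linorder}. \<forall>i. v $ i \<in> \<int>}"
proof (intro equalityI subsetI)
  fix v :: "real^'n::_" assume "v \<in> coroot_lattice"
  then obtain m where "v = (\<Sum>\<alpha>\<in>roots. of_int (m \<alpha>) *\<^sub>R coroot \<alpha>)" unfolding coroot_lattice_def by blast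
  then show "v \<in> {v. \<forall>i. v $ i \<in> \<int>}" by (auto intro!: Ints_sum Ints_mult coroot_integral)
next
  fix v :: "real^'n::_" assume "v \<in> {v. \<forall>i. v $ i \<in> \<int>}"
  then have v: "of_int \<lfloor>v $ i\<rfloor> = v $ i" for i by (simp add: of_int_floor)
  let ?r = "\<lambda>i :: 'n. 2 *\<^sub>R axis i 1 :: real^'n::_"
  have inj: "?r i = ?r j \<longleftrightarrow> i = j" for i j by (auto simp: axis_eq_axis)
  define m where "m \<alpha> = (\<Sum>i\<in>UNIV. if \<alpha> = ?r i then \<lfloor>v $ i\<rfloor> else 0)" for \<alpha>
  have "(\<Sum>\<alpha>\<in>roots. of_int (m \<alpha>) *\<^sub>R coroot \<alpha>) = (\<Sum>\<alpha>\<in>range ?r. of_int (m \<alpha>) *\<^sub>R coroot \<alpha>)"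
  proof (rule sum.mono_neutral_right[OF finite_roots])
    show "range ?r \<subseteq> roots" unfolding roots_eq by blast
    show "\<forall>\<alpha>\<in>roots - range ?r. of_int (m \<alpha>) *\<^sub>R coroot \<alpha> = 0"
      by (auto simp: m_def intro!: sum.neutral)
  qed
  also have "\<dots> = (\<Sum>i\<in>UNIV. of_int (m (?r i)) *\<^sub>R coroot (?r i))"
    by (rule sum.reindex_cong[where l = ?r]) (simp_all only: inj_on_def inj simp_thms ball_UNIV)
  also have "\<dots> = (\<Sum>i\<in>UNIV. v $ i *\<^sub>R axis i 1)"
  proof (rule sum.cong[OF refl])
    fix i :: 'n
    have "m (?r i) = \<lfloor>v $ i\<rfloor>" unfolding m_def inj by simp
    then show "of_int (m (?r i)) *\<^sub>R coroot (?r i) = v $ i *\<^sub>R axis i 1"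
      using coroot_long[of 2 i] v[of i] by simp
  qed
  also have "\<dots> = v" by (simp add: vec_eq_iff axis_def if_distrib cong: if_cong)
  finally have "v = (\<Sum>\<alpha>\<in>roots. of_int (m \<alpha>) *\<^sub>R coroot \<alpha>)" ..
  then show "v \<in> coroot_lattice" unfolding coroot_lattice_def by blast
qed

text \<open>Long roots make each \<open>2 * v $ i\<close> integral and short roots make the
  differences of coordinates integral, so the coordinates are all integers or all
  half-integers.\<close>

lemma coweight_lattice_eq:
  "coweight_lattice = {v :: real^'n::{finite,linorder}. (\<forall>i. v $ i \<in> \<int>) \<or> (\<forall>i. v $ i - 1/2 \<in> \<int>)}"
proof (intro equalityI subsetI)
  fix v :: "real^'n::_" assume "v \<in> coweight_lattice"
  then have v: "\<alpha> \<bullet> v \<in> \<int>" if "\<alpha> \<in> roots" for \<alpha> using that by (simp add: coweight_lattice_def)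
  have two: "2 * v $ i \<in> \<int>" for i
  proof -
    have "2 *\<^sub>R axis i 1 \<in> (roots :: (real^'n::_) set)" unfolding roots_eq by blast
    from v[OF this] show ?thesis by (simp add: inner_axis')
  qed
  have diff: "v $ i - v $ j \<in> \<int>" for i j
  proof (cases "i = j")
    case False
    then have "1 *\<^sub>R axis i 1 + (-1) *\<^sub>R axis j 1 \<in> (roots :: (real^'n::_) set)" unfolding roots_eq by blast
    from v[OF this] show ?thesis by (simp add: inner_axis' inner_diff_left)
  qed simp
  show "v \<in> {v. (\<forall>i. v $ i \<in> \<int>) \<or> (\<forall>i. v $ i - 1/2 \<in> \<int>)}"
  proof (cases "\<exists>i. v $ i \<in> \<int>")
    case True
    then obtain i where i: "v $ i \<in> \<int>" by blast
    have "v $ j \<in> \<int>" for j using Ints_add[OF diff[of j i] i] by simp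
    then show ?thesis by blast
  next
    case False
    have "v $ i - 1/2 \<in> \<int>" for i
    proof -
      obtain m where m: "2 * v $ i = of_int m" using two[of i] by (auto elim: Ints_cases)
      have "odd m"
      proof
        assume "even m"
        then obtain k where "m = 2 * k" by blast
        then have "v $ i = of_int k" using m by simp
        then show False using False by (metis Ints_of_int)
      qed
      then obtain k where "m = 2 * k + 1" by (rule oddE)
      then have "v $ i - 1/2 = of_int k" using m by simp
      then show ?thesis by (metis Ints_of_int)
    qed
    then show ?thesis by blast
  qed
next
  fix v :: "real^'n::_" assume v: "v \<in> {v. (\<forall>i. v $ i \<in> \<int>) \<or> (\<forall>i. v $ i - 1/2 \<in> \<int>)}"
  have two: "2 * v $ i \<in> \<int>" for i
  proof (cases "v $ i \<in> \<int>")
    case False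
    then have "v $ i - 1/2 \<in> \<int>" using v by blast
    then have "2 * (v $ i - 1/2) + 1 \<in> \<int>" by (intro Ints_add Ints_mult) auto
    then show ?thesis by (simp add: algebra_simps)
  qed (intro Ints_mult; simp)
  have diff: "v $ i - v $ j \<in> \<int>" for i j
  proof (cases "\<forall>i. v $ i \<in> \<int>")
    case False
    then have "v $ i - 1/2 \<in> \<int>" "v $ j - 1/2 \<in> \<int>" using v by auto
    from Ints_diff[OF this] have "(v $ i - 1/2) - (v $ j - 1/2) \<in> \<int>" .
    then show ?thesis by simp
  qed auto
  have "\<alpha> \<bullet> v \<in> \<int>" if "\<alpha> \<in> roots" for \<alpha>
  proof -
    have sum: "v $ i + v $ j \<in> \<int>" for i j using Ints_add[OF diff[of i j] two[of j]] by (simp add: add.commute)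
    have neg: "- a \<in> \<int>" if "a \<in> \<int>" for a :: real using that by simp
    from that consider c i where "\<alpha> = c *\<^sub>R axis i 1" "c \<in> {2, -2}"
      | c d i j where "\<alpha> = c *\<^sub>R axis i 1 + d *\<^sub>R axis j 1" "c \<in> {1, -1}" "d \<in> {1, -1}" "i \<noteq> j"
      unfolding roots_eq by blast
    then show ?thesis
    proof cases
      case 1 then show ?thesis using two[of i] neg[OF two[of i]] by (auto simp: inner_axis')
    next
      case 2 then show ?thesis
        using sum[of i j] neg[OF sum[of i j]] diff[of i j] diff[of j i] by (auto simp: inner_add_left inner_axis')
    qed
  qed
  then show "v \<in> coweight_lattice" by (simp add: coweight_lattice_def)
qed

text \<open>The translations in \<open>\<Lambda>\<close> multiply the functions \<open>cos (2 \<pi> z\<^sub>k)\<close> by the signs in \<open>E\<close>.\<close>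

definition sign_lattice :: "(real^'n::{finite,linorder}) set \<Rightarrow> complex set \<Rightarrow> bool" where
  "sign_lattice \<Lambda> E \<longleftrightarrow> \<Lambda> = coroot_lattice \<and> E = {1} \<or> \<Lambda> = coweight_lattice \<and> E = {1, -1}"

lemma affine_weyl_eq:
  "affine_weyl \<Lambda> = {signed_map \<sigma> s q | (\<sigma> :: 'n::{finite,linorder} \<Rightarrow> 'n) s q. bij \<sigma> \<and> signs s \<and> q \<in> \<Lambda>}"
proof -
  have "(\<lambda>x. signed_map \<sigma> s 0 x + q) = signed_map \<sigma> s q" for \<sigma> s and q :: "real^'n::_"
    by (simp add: fun_eq_iff vec_eq_iff)
  note eq = this
  show ?thesis
  proof (intro equalityI subsetI)
    fix g :: "real^'n::_ \<Rightarrow> real^'n::_" assume "g \<in> affine_weyl \<Lambda>"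
    then obtain w q where g: "g = (\<lambda>x. w x + q)" "w \<in> weyl_group" "q \<in> \<Lambda>" unfolding affine_weyl_def by blast
    obtain \<sigma> s where w: "w = signed_map \<sigma> s 0" "bij \<sigma>" "signs s" using g(2) unfolding weyl_group_eq by blast
    have "g = signed_map \<sigma> s q" unfolding g(1) w(1) by (rule eq)
    then show "g \<in> {signed_map \<sigma> s q | \<sigma> s q. bij \<sigma> \<and> signs s \<and> q \<in> \<Lambda>}" using w g(3) by blast
  next
    fix g :: "real^'n::_ \<Rightarrow> real^'n::_" assume "g \<in> {signed_map \<sigma> s q | \<sigma> s q. bij \<sigma> \<and> signs s \<and> q \<in> \<Lambda>}"
    then obtain \<sigma> s q where g: "g = signed_map \<sigma> s q" "bij \<sigma>" "signs s" "q \<in> \<Lambda>" by blast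
    have "signed_map \<sigma> s 0 \<in> weyl_group" unfolding weyl_group_eq using g by blast
    moreover have "g = (\<lambda>x. signed_map \<sigma> s 0 x + q)" unfolding g(1) by (rule eq[symmetric])
    ultimately show "g \<in> affine_weyl \<Lambda>" unfolding affine_weyl_def using g(4) by blast
  qed
qed

lemma half_sign: "s = 1 \<or> s = -1 \<Longrightarrow> r - 1/2 \<in> \<int> \<Longrightarrow> s * r - 1/2 \<in> (\<int> :: real set)"
proof -
  assume s: "s = 1 \<or> s = -1" and r: "r - 1/2 \<in> \<int>"
  have neg: "- (r - 1/2) - 1 \<in> \<int>" by (rule Ints_diff[OF Ints_minus[OF r] Ints_1])
  show ?thesis
  proof (cases "s = 1")
    case False
    then have "s * r - 1/2 = - (r - 1/2) - 1" using s by simp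
    then show ?thesis using neg by (simp only:)
  qed (use r in simp)
qed

lemma half_add: "a - 1/2 \<in> \<int> \<Longrightarrow> b - 1/2 \<in> \<int> \<Longrightarrow> a + b \<in> (\<int> :: real set)"
proof -
  assume "a - 1/2 \<in> \<int>" "b - 1/2 \<in> \<int>"
  then have "(a - 1/2) + (b - 1/2) + 1 \<in> \<int>" by (intro Ints_add) auto
  then show ?thesis by simp
qed

lemma sign_lattice_signed_map:
  assumes \<Lambda>: "sign_lattice \<Lambda> E" and "signs s" "q \<in> \<Lambda>" "r \<in> \<Lambda>"
  shows "signed_map \<sigma> s q r \<in> \<Lambda>"
proof -
  have sr: "s i * r $ j \<in> \<int>" if "r $ j \<in> \<int>" for i j using that assms(2) by (metis Ints_minus mult_1 mult_minus1 signs_def)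
  have sr2: "s i * r $ j - 1/2 \<in> \<int>" if "r $ j - 1/2 \<in> \<int>" for i j
    using half_sign that assms(2) by (simp add: signs_def)
  consider "\<forall>i. q $ i \<in> \<int>" "\<forall>i. r $ i \<in> \<int>" | "\<Lambda> = coweight_lattice" "\<forall>i. q $ i \<in> \<int>" "\<forall>i. r $ i - 1/2 \<in> \<int>"
    | "\<Lambda> = coweight_lattice" "\<forall>i. q $ i - 1/2 \<in> \<int>" "\<forall>i. r $ i \<in> \<int>"
    | "\<Lambda> = coweight_lattice" "\<forall>i. q $ i - 1/2 \<in> \<int>" "\<forall>i. r $ i - 1/2 \<in> \<int>"
    using assms unfolding sign_lattice_def by (auto simp: coroot_lattice_eq coweight_lattice_eq)
  then show ?thesis
  proof cases
    case 1
    then have "\<forall>i. signed_map \<sigma> s q r $ i \<in> \<int>" by (simp add: sr)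
    then show ?thesis using \<Lambda> by (auto simp: sign_lattice_def coroot_lattice_eq coweight_lattice_eq)
  next
    case 2
    have "signed_map \<sigma> s q r $ i - 1/2 \<in> \<int>" for i
      using Ints_add[OF sr2[of "\<sigma> i" i] , of "q $ i"] 2 by (simp add: algebra_simps)
    then show ?thesis using 2(1) by (simp add: coweight_lattice_eq)
  next
    case 3
    have "signed_map \<sigma> s q r $ i - 1/2 \<in> \<int>" for i
      using Ints_add[OF sr[of "\<sigma> i" i] , of "q $ i - 1/2"] 3 by (simp add: algebra_simps)
    then show ?thesis using 3(1) by (simp add: coweight_lattice_eq)
  next
    case 4
    have "signed_map \<sigma> s q r $ i \<in> \<int>" for i
      using half_add[OF sr2[of "\<sigma> i" i], of "q $ i"] 4 by simp
    then show ?thesis using 4(1) by (simp add: coweight_lattice_eq)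
  qed
qed

lemma zero_in_lattice: "sign_lattice \<Lambda> E \<Longrightarrow> 0 \<in> \<Lambda>"
  by (auto simp: sign_lattice_def coroot_lattice_eq coweight_lattice_eq)

lemma affine_weyl_comp:
  assumes "sign_lattice \<Lambda> E" "g \<in> affine_weyl \<Lambda>" "h \<in> affine_weyl \<Lambda>"
  shows "g \<circ> h \<in> affine_weyl \<Lambda>"
proof -
  obtain \<sigma> s q \<tau> t r where g: "g = signed_map \<sigma> s q" "bij \<sigma>" "signs s" "q \<in> \<Lambda>"
    and h: "h = signed_map \<tau> t r" "bij \<tau>" "signs t" "r \<in> \<Lambda>"
    using assms(2,3) unfolding affine_weyl_eq by blast
  have "g \<circ> h = signed_map (\<tau> \<circ> \<sigma>) (\<lambda>i. s i * t (\<sigma> i)) (signed_map \<sigma> s q r)"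
    by (simp add: g h signed_map_comp)
  then show ?thesis
    unfolding affine_weyl_eq
    using bij_comp[OF g(2) h(2)] signs_mult[OF g(3) h(3)] sign_lattice_signed_map[OF assms(1) g(3,4) h(4)] by blast
qed

lemma affine_weyl_inverse:
  assumes "sign_lattice \<Lambda> E" "g \<in> affine_weyl \<Lambda>"
  shows "\<exists>h\<in>affine_weyl \<Lambda>. g \<circ> h = id \<and> h \<circ> g = id"
proof -
  obtain \<sigma> s q where g: "g = signed_map \<sigma> s q" "bij \<sigma>" "signs s" "q \<in> \<Lambda>"
    using assms(2) unfolding affine_weyl_eq by blast
  let ?\<tau> = "inv_into UNIV \<sigma>"
  have t: "signs (\<lambda>i. s (?\<tau> i))" using g(3) by (rule signs_comp)
  have "signs (\<lambda>i :: 'b. -1 :: real)" by (simp add: signs_def)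
  have minus: "- v \<in> \<Lambda>" if "v \<in> \<Lambda>" for v
  proof -
    have "signed_map id (\<lambda>_. -1) 0 v \<in> \<Lambda>"
      by (rule sign_lattice_signed_map[OF assms(1) _ zero_in_lattice[OF assms(1)] that]) (simp add: signs_def)
    moreover have "signed_map id (\<lambda>_. -1) 0 v = - v" by (simp add: vec_eq_iff)
    ultimately show ?thesis by simp
  qed
  have "- signed_map ?\<tau> (\<lambda>i. s (?\<tau> i)) 0 q \<in> \<Lambda>"
    by (rule minus, rule sign_lattice_signed_map[OF assms(1) t zero_in_lattice[OF assms(1)] g(4)])
  then have "signed_map ?\<tau> (\<lambda>i. s (?\<tau> i)) (- signed_map ?\<tau> (\<lambda>i. s (?\<tau> i)) 0 q) \<in> affine_weyl \<Lambda>"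
    unfolding affine_weyl_eq using bij_imp_bij_inv[OF g(2)] t by blast
  then show ?thesis using signed_map_inverse[OF g(2,3), of q] unfolding g(1) by blast
qed

lemma complex_action_signed_map:
  "complex_action (signed_map \<sigma> s q) z $ i = of_real (s i) * z $ \<sigma> i + of_real (q $ i)"
  by (simp add: complex_action_def complex_point_def Let_def complex_eq_iff)

lemma complex_action_comp:
  assumes "sign_lattice \<Lambda> E" "g \<in> affine_weyl \<Lambda>" "h \<in> affine_weyl \<Lambda>"
  shows "complex_action g (complex_action h z) = complex_action (g \<circ> h) z"
proof -
  obtain \<sigma> s q \<tau> t r where g: "g = signed_map \<sigma> s q" and h: "h = signed_map \<tau> t r"
    using assms(2,3) unfolding affine_weyl_eq by blast
  show ?thesis unfolding g h signed_map_comp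
    by (simp add: vec_eq_iff complex_action_signed_map algebra_simps)
qed

lemma id_affine_weyl: "sign_lattice \<Lambda> E \<Longrightarrow> id \<in> affine_weyl \<Lambda>"
proof -
  assume "sign_lattice \<Lambda> E"
  then have "signed_map id (\<lambda>_. 1) 0 \<in> affine_weyl \<Lambda>"
    unfolding affine_weyl_eq using zero_in_lattice bij_id signs_one by blast
  then show ?thesis by (simp only: signed_map_id)
qed

lemma complex_action_id: "complex_action id z = z"
  by (simp add: complex_action_def complex_point_def vec_eq_iff)

lemma orbit_of_action:
  assumes "sign_lattice \<Lambda> E" "g \<in> affine_weyl \<Lambda>"
  shows "orbit_of \<Lambda> (complex_action g z) = orbit_of \<Lambda> z"
proof -
  have sub: "orbit_of \<Lambda> (complex_action g z) \<subseteq> orbit_of \<Lambda> z" if "g \<in> affine_weyl \<Lambda>" for g z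
    unfolding orbit_of_def using complex_action_comp[OF assms(1) _ that] affine_weyl_comp[OF assms(1) _ that] by blast
  obtain h where h: "h \<in> affine_weyl \<Lambda>" "h \<circ> g = id" using affine_weyl_inverse[OF assms] by blast
  have "complex_action h (complex_action g z) = z"
    using complex_action_comp[OF assms(1) h(1) assms(2)] h(2) complex_action_id by metis
  then show ?thesis using sub[OF assms(2), of z] sub[OF h(1), of "complex_action g z"] by auto
qed

section \<open>The cosine coordinates\<close>

definition cosmap :: "complex^'n::{finite,linorder} \<Rightarrow> nat \<Rightarrow> complex" where
  "cosmap z k = (if k = 0 then -1 else if k \<le> CARD('n) then cos (2 * pi * z $ idx k) else 1)"

lemma cosmap_idx:
  "k \<in> {1..CARD('n)} \<Longrightarrow> cosmap (z :: complex^'n::{finite,linorder}) k = cos (2 * pi * z $ idx k)"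
  by (simp add: cosmap_def)

lemma cosmap_surj:
  assumes "x 0 = -1" "\<And>k. k > CARD('n) \<Longrightarrow> x k = 1"
  obtains z where "cosmap (z :: complex^'n::{finite,linorder}) = x"
proof
  define z :: "complex^'n::_" where "z = (\<chi> i. Arccos (x (inv_into {1..CARD('n)} idx i)) / (2 * pi))"
  show "cosmap z = x"
  proof
    fix k
    show "cosmap z k = x k"
    proof (cases "k \<in> {1..CARD('n)}")
      case True
      then show ?thesis using inv_idx[OF True] by (simp add: cosmap_idx z_def)
    next
      case False
      then show ?thesis using assms by (auto simp: cosmap_def)
    qed
  qed
qed

lemma cos_int_shift:
  assumes "r \<in> \<int>"
  shows "cos (z + 2 * of_real pi * of_real r) = (cos z :: complex)"
proof -
  have "complex_of_real r \<in> \<int>" using assms by (auto elim!: Ints_cases)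
  then show ?thesis unfolding complex_cos_eq by (auto intro!: bexI[of _ "complex_of_real r"])
qed

lemma cos_half_shift:
  assumes "r - 1/2 \<in> \<int>"
  shows "cos (z + 2 * of_real pi * of_real r) = (- cos z :: complex)"
proof -
  have "z + 2 * of_real pi * of_real r = (z + of_real pi) + 2 * of_real pi * of_real (r - 1/2)"
    by (simp add: algebra_simps)
  then show ?thesis by (simp only: cos_int_shift[OF assms]) (simp add: cos_add)
qed

section \<open>Coordinate rings of the strata\<close>

definition normal_image :: "('v \<Rightarrow> complex) set \<Rightarrow> 'v set \<Rightarrow> 'v \<Rightarrow> bool" where
  "normal_image A M p \<longleftrightarrow> (\<forall>a\<in>A. \<forall>b\<in>A. (\<exists>x\<in>M. b x \<noteq> 0) \<longrightarrow>
     (\<exists>d c. (\<forall>i<d. c i \<in> A) \<and> (\<forall>x\<in>M. a x ^ d + (\<Sum>i<d. c i x * a x ^ i * b x ^ (d - i)) = 0)) \<longrightarrow>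
     (\<exists>t\<in>A. \<exists>c\<in>A. t p \<noteq> 0 \<and> (\<forall>x\<in>M. t x * a x = b x * c x)))"

text \<open>The coordinate ring of X is read as the ring of restrictions to M of functions in A. The
  map \<rho> picks one point of M for each orbit; it may miss points of M, but functions in A cannot
  tell a missed point from a chosen one. The last assumption says that M is irreducible for A and
  makes the ring a domain.\<close>

locale evaluation =
  fixes \<Lambda> :: "(real^'n::{finite,linorder}) set" and X :: "(complex^'n::_) set set"
    and A :: "('v \<Rightarrow> complex) set" and M :: "'v set" and \<rho> :: "(complex^'n::_) set \<Rightarrow> 'v"
  assumes carrier: "carrier (coordinate_ring \<Lambda> X) = (\<lambda>H. \<lambda>p\<in>X. H (\<rho> p)) ` A"
    and \<rho>: "p \<in> X \<Longrightarrow> \<rho> p \<in> M" and \<rho>_surj: "m \<in> M \<Longrightarrow> \<exists>p\<in>X. \<forall>H\<in>A. H (\<rho> p) = H m"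
    and const: "(\<lambda>_. c) \<in> A" and add: "f \<in> A \<Longrightarrow> g \<in> A \<Longrightarrow> (\<lambda>x. f x + g x) \<in> A"
    and mult: "f \<in> A \<Longrightarrow> g \<in> A \<Longrightarrow> (\<lambda>x. f x * g x) \<in> A"
    and nonempty: "M \<noteq> {}"
    and nonzero: "f \<in> A \<Longrightarrow> g \<in> A \<Longrightarrow> \<exists>x\<in>M. f x \<noteq> 0 \<Longrightarrow> \<exists>x\<in>M. g x \<noteq> 0 \<Longrightarrow> \<exists>x\<in>M. f x * g x \<noteq> 0"
begin

abbreviation "R \<equiv> coordinate_ring \<Lambda> X"

definition r :: "('v \<Rightarrow> complex) \<Rightarrow> (complex^'n::_) set \<Rightarrow> complex" where
  "r H = (\<lambda>p\<in>X. H (\<rho> p))"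

lemma carrier_r: "carrier R = r ` A"
  by (simp add: carrier r_def[abs_def])

lemma r_carrier: "H \<in> A \<Longrightarrow> r H \<in> carrier R"
  by (simp add: carrier_r)

lemma r_mult: "r f \<otimes>\<^bsub>R\<^esub> r g = r (\<lambda>x. f x * g x)"
  by (auto simp: coordinate_ring_def r_def)

lemma r_add: "r f \<oplus>\<^bsub>R\<^esub> r g = r (\<lambda>x. f x + g x)"
  by (auto simp: coordinate_ring_def r_def)

lemma r_one: "\<one>\<^bsub>R\<^esub> = r (\<lambda>_. 1)" and r_zero: "\<zero>\<^bsub>R\<^esub> = r (\<lambda>_. 0)"
  by (auto simp: coordinate_ring_def r_def)

lemma r_eq_iff: "f \<in> A \<Longrightarrow> g \<in> A \<Longrightarrow> r f = r g \<longleftrightarrow> (\<forall>x\<in>M. f x = g x)"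
proof
  assume fg: "f \<in> A" "g \<in> A" "r f = r g"
  show "\<forall>x\<in>M. f x = g x"
  proof
    fix m assume "m \<in> M"
    then obtain p where p: "p \<in> X" "\<forall>H\<in>A. H (\<rho> p) = H m" using \<rho>_surj by blast
    have "f (\<rho> p) = g (\<rho> p)" using fun_cong[OF fg(3), of p] p(1) by (simp add: r_def)
    then show "f m = g m" unfolding p(2)[THEN bspec, OF fg(1)] p(2)[THEN bspec, OF fg(2)] .
  qed
next
  assume "\<forall>x\<in>M. f x = g x"
  then show "r f = r g" using \<rho> by (auto simp: r_def fun_eq_iff restrict_def)
qed

lemma domain_R: "domain R"
proof -
  have cring: "cring R"
  proof (rule cringI)
    show "abelian_group R"
    proof (rule abelian_groupI)
      show "\<exists>y\<in>carrier R. y \<oplus>\<^bsub>R\<^esub> x = \<zero>\<^bsub>R\<^esub>" if "x \<in> carrier R" for x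
      proof -
        obtain f where f: "x = r f" "f \<in> A" using \<open>x \<in> carrier R\<close> carrier_r by blast
        have "(\<lambda>x. (-1) * f x) \<in> A" by (rule mult[OF const f(2)])
        moreover have "r (\<lambda>x. (-1) * f x) \<oplus>\<^bsub>R\<^esub> x = \<zero>\<^bsub>R\<^esub>" unfolding f(1) r_add r_zero by simp
        ultimately show ?thesis using r_carrier by blast
      qed
      show "\<zero>\<^bsub>R\<^esub> \<in> carrier R" unfolding r_zero by (rule r_carrier[OF const])
    qed (auto simp: carrier_r r_add r_zero add_ac intro!: imageI add)
    show "comm_monoid R"
    proof (rule comm_monoidI)
      show "\<one>\<^bsub>R\<^esub> \<in> carrier R" unfolding r_one by (rule r_carrier[OF const])
    qed (auto simp: carrier_r r_mult r_one mult_ac intro!: imageI mult)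
  qed (auto simp: carrier_r r_mult r_add distrib_right)
  show ?thesis
  proof (rule domain.intro[OF cring], unfold_locales)
    show "\<one>\<^bsub>R\<^esub> \<noteq> \<zero>\<^bsub>R\<^esub>" unfolding r_one r_zero r_eq_iff[OF const const] using nonempty by auto
    show "x = \<zero>\<^bsub>R\<^esub> \<or> y = \<zero>\<^bsub>R\<^esub>" if xy: "x \<otimes>\<^bsub>R\<^esub> y = \<zero>\<^bsub>R\<^esub>" "x \<in> carrier R" "y \<in> carrier R" for x y
    proof -
      obtain f g where fg: "x = r f" "f \<in> A" "y = r g" "g \<in> A" using xy(2,3) carrier_r by blast
      have "\<forall>z\<in>M. f z * g z = 0"
        using xy(1) unfolding fg r_mult r_zero r_eq_iff[OF mult[OF fg(2,4)] const] .
      then have "(\<forall>z\<in>M. f z = 0) \<or> (\<forall>z\<in>M. g z = 0)" using nonzero[OF fg(2,4)] by blast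
      then show ?thesis unfolding fg r_zero r_eq_iff[OF fg(2) const] r_eq_iff[OF fg(4) const] .
    qed
  qed
qed

sublocale R: domain R by (rule domain_R)

lemma r_pow: "r f [^]\<^bsub>R\<^esub> (k::nat) = r (\<lambda>x. f x ^ k)"
  by (induction k) (simp_all add: r_one r_mult mult.commute)

lemma sum_A: "(\<And>i. i < (d::nat) \<Longrightarrow> F i \<in> A) \<Longrightarrow> (\<lambda>x. \<Sum>i<d. F i x) \<in> A"
  by (induction d) (auto intro: const add)

lemma r_sum: "(\<And>i. i < d \<Longrightarrow> F i \<in> A) \<Longrightarrow> (\<Oplus>\<^bsub>R\<^esub>i\<in>{..<d::nat}. r (F i)) = r (\<lambda>x. \<Sum>i<d. F i x)"
proof (induction d)
  case 0 show ?case by (simp add: r_zero)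
next
  case (Suc d)
  have "(\<Oplus>\<^bsub>R\<^esub>i\<in>{..<Suc d}. r (F i)) = r (F d) \<oplus>\<^bsub>R\<^esub> (\<Oplus>\<^bsub>R\<^esub>i\<in>{..<d}. r (F i))"
    unfolding lessThan_Suc using Suc.prems by (intro R.finsum_insert) (auto intro!: r_carrier)
  then show ?case using Suc by (simp add: r_add add.commute)
qed

lemma power_A: "f \<in> A \<Longrightarrow> (\<lambda>x. f x ^ (k::nat)) \<in> A"
  by (induction k) (auto intro: const mult)

lemma relation_iff:
  assumes ab: "a \<in> A" "b \<in> A"
  shows "integral_relation R (r a) (r b) \<longleftrightarrow>
    (\<exists>d c. (\<forall>i<d. c i \<in> A) \<and> (\<forall>x\<in>M. a x ^ d + (\<Sum>i<d. c i x * a x ^ i * b x ^ (d - i)) = 0))"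
proof -
  have key: "r a [^]\<^bsub>R\<^esub> d \<oplus>\<^bsub>R\<^esub> (\<Oplus>\<^bsub>R\<^esub>i\<in>{..<d}. r (c i) \<otimes>\<^bsub>R\<^esub> r a [^]\<^bsub>R\<^esub> i \<otimes>\<^bsub>R\<^esub> r b [^]\<^bsub>R\<^esub> (d - i)) = \<zero>\<^bsub>R\<^esub> \<longleftrightarrow>
      (\<forall>x\<in>M. a x ^ d + (\<Sum>i<d. c i x * a x ^ i * b x ^ (d - i)) = 0)"
    if c: "\<And>i. i < d \<Longrightarrow> c i \<in> A" for c and d :: nat
  proof -
    have F: "(\<lambda>x. c i x * a x ^ i * b x ^ (d - i)) \<in> A" if "i < d" for i
      by (intro mult c that power_A ab)
    have "(\<Oplus>\<^bsub>R\<^esub>i\<in>{..<d}. r (\<lambda>x. c i x * a x ^ i * b x ^ (d - i)))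
        = r (\<lambda>x. \<Sum>i<d. c i x * a x ^ i * b x ^ (d - i))"
      by (rule r_sum[of d "\<lambda>i x. c i x * a x ^ i * b x ^ (d - i)"]) (rule F)
    then show ?thesis
      unfolding r_pow r_mult r_zero
      by (simp only: r_add) (rule r_eq_iff[OF add[OF power_A[OF ab(1)] sum_A[of d "\<lambda>i x. c i x * a x ^ i * b x ^ (d - i)", OF F]] const])
  qed
  show ?thesis
  proof
    assume "integral_relation R (r a) (r b)"
    then obtain d :: nat and C where C: "\<And>i. i < d \<Longrightarrow> C i \<in> carrier R"
      "r a [^]\<^bsub>R\<^esub> d \<oplus>\<^bsub>R\<^esub> (\<Oplus>\<^bsub>R\<^esub>i\<in>{..<d}. C i \<otimes>\<^bsub>R\<^esub> r a [^]\<^bsub>R\<^esub> i \<otimes>\<^bsub>R\<^esub> r b [^]\<^bsub>R\<^esub> (d - i)) = \<zero>\<^bsub>R\<^esub>"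
      unfolding integral_relation_def by blast
    have "\<forall>i. \<exists>c. i < d \<longrightarrow> c \<in> A \<and> C i = r c" using C(1) carrier_r by blast
    from choice[OF this] obtain c where c: "\<And>i. i < d \<Longrightarrow> c i \<in> A \<and> C i = r (c i)" by blast
    have "(\<Oplus>\<^bsub>R\<^esub>i\<in>{..<d}. C i \<otimes>\<^bsub>R\<^esub> r a [^]\<^bsub>R\<^esub> i \<otimes>\<^bsub>R\<^esub> r b [^]\<^bsub>R\<^esub> (d - i))
        = (\<Oplus>\<^bsub>R\<^esub>i\<in>{..<d}. r (c i) \<otimes>\<^bsub>R\<^esub> r a [^]\<^bsub>R\<^esub> i \<otimes>\<^bsub>R\<^esub> r b [^]\<^bsub>R\<^esub> (d - i))"
      using c ab by (intro R.finsum_cong') (auto intro!: R.m_closed r_carrier R.nat_pow_closed)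
    then show "\<exists>d c. (\<forall>i<d. c i \<in> A) \<and> (\<forall>x\<in>M. a x ^ d + (\<Sum>i<d. c i x * a x ^ i * b x ^ (d - i)) = 0)"
      using key[of d c] c C(2) by (intro exI[of _ d] exI[of _ c]) simp
  next
    assume "\<exists>d c. (\<forall>i<d. c i \<in> A) \<and> (\<forall>x\<in>M. a x ^ d + (\<Sum>i<d. c i x * a x ^ i * b x ^ (d - i)) = 0)"
    then obtain d c where c: "\<And>i. i < d \<Longrightarrow> c i \<in> A"
      "\<forall>x\<in>M. a x ^ d + (\<Sum>i<d. c i x * a x ^ i * b x ^ (d - i)) = 0" by blast
    then show "integral_relation R (r a) (r b)"
      unfolding integral_relation_def using key[of d c] r_carrier
      by (intro exI[of _ d] exI[of _ "\<lambda>i. r (c i)"]) simp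
  qed
qed

lemma local_ring_integrally_closed_iff:
  assumes p: "p \<in> X"
  shows "integrally_closed_domain (local_ring \<Lambda> X p) \<longleftrightarrow> normal_image A M (\<rho> p)"
proof -
  define S where "S = {f \<in> carrier R. f p \<noteq> 0}"
  have SA: "r f \<in> S \<longleftrightarrow> f (\<rho> p) \<noteq> 0" if "f \<in> A" for f
    using r_carrier[OF that] p by (simp add: S_def r_def)
  interpret multiplicative_set R S
  proof unfold_locales
    show "S \<subseteq> carrier R" by (auto simp: S_def)
    show "\<one>\<^bsub>R\<^esub> \<in> S" unfolding r_one by (simp add: SA const)
    show "\<zero>\<^bsub>R\<^esub> \<notin> S" unfolding r_zero by (simp add: SA const)
    fix s t assume st: "s \<in> S" "t \<in> S"
    then obtain f g where fg: "s = r f" "f \<in> A" "t = r g" "g \<in> A" unfolding S_def carrier_r by blast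
    then show "s \<otimes>\<^bsub>R\<^esub> t \<in> S" using st SA mult[OF fg(2,4)] by (simp add: r_mult)
  qed
  have "(\<exists>t\<in>S. \<exists>c\<in>carrier R. t \<otimes>\<^bsub>R\<^esub> r a = r b \<otimes>\<^bsub>R\<^esub> c) \<longleftrightarrow>
    (\<exists>t\<in>A. \<exists>c\<in>A. t (\<rho> p) \<noteq> 0 \<and> (\<forall>x\<in>M. t x * a x = b x * c x))" if ab: "a \<in> A" "b \<in> A" for a b
  proof -
    have eq: "r t \<otimes>\<^bsub>R\<^esub> r a = r b \<otimes>\<^bsub>R\<^esub> r c \<longleftrightarrow> (\<forall>x\<in>M. t x * a x = b x * c x)" if "t \<in> A" "c \<in> A" for t c
      unfolding r_mult by (rule r_eq_iff) (intro mult ab that)+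
    show ?thesis
    proof
      assume "\<exists>t\<in>S. \<exists>c\<in>carrier R. t \<otimes>\<^bsub>R\<^esub> r a = r b \<otimes>\<^bsub>R\<^esub> c"
      then obtain t c where tc: "t \<in> S" "c \<in> carrier R" "t \<otimes>\<^bsub>R\<^esub> r a = r b \<otimes>\<^bsub>R\<^esub> c" by blast
      then have "t \<in> carrier R" by (simp add: S_def)
      then obtain t' c' where tc': "t = r t'" "t' \<in> A" "c = r c'" "c' \<in> A" using tc(2) carrier_r by blast
      then show "\<exists>t\<in>A. \<exists>c\<in>A. t (\<rho> p) \<noteq> 0 \<and> (\<forall>x\<in>M. t x * a x = b x * c x)"
        using tc SA[OF tc'(2)] eq[OF tc'(2,4)] by blast
    next
      assume "\<exists>t\<in>A. \<exists>c\<in>A. t (\<rho> p) \<noteq> 0 \<and> (\<forall>x\<in>M. t x * a x = b x * c x)"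
      then obtain t c where tc: "t \<in> A" "c \<in> A" "t (\<rho> p) \<noteq> 0" "\<forall>x\<in>M. t x * a x = b x * c x" by blast
      then show "\<exists>t\<in>S. \<exists>c\<in>carrier R. t \<otimes>\<^bsub>R\<^esub> r a = r b \<otimes>\<^bsub>R\<^esub> c"
        using SA[OF tc(1)] r_carrier[OF tc(2)] eq[OF tc(1,2)] by blast
    qed
  qed
  moreover have "r b \<noteq> \<zero>\<^bsub>R\<^esub> \<longleftrightarrow> (\<exists>x\<in>M. b x \<noteq> 0)" if "b \<in> A" for b
    unfolding r_zero r_eq_iff[OF that const] by blast
  moreover have "local_ring \<Lambda> X p = Q" by (simp add: local_ring_def S_def)
  ultimately show ?thesis
    using relation_iff by (simp add: integrally_closed_domain_localization_iff normal_image_def carrier_r)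
qed

theorem normal_variety_iff: "normal_variety \<Lambda> X \<longleftrightarrow> (\<forall>m\<in>M. normal_image A M m)"
proof -
  have "normal_image A M (\<rho> p) = normal_image A M m" if "\<forall>H\<in>A. H (\<rho> p) = H m" for p m
  proof -
    have "(\<exists>t\<in>A. \<exists>c\<in>A. t (\<rho> p) \<noteq> 0 \<and> Q t c) \<longleftrightarrow> (\<exists>t\<in>A. \<exists>c\<in>A. t m \<noteq> 0 \<and> Q t c)" for Q :: "('v \<Rightarrow> complex) \<Rightarrow> ('v \<Rightarrow> complex) \<Rightarrow> bool"
      using that by (metis (no_types, lifting))
    then show ?thesis unfolding normal_image_def by presburger
  qed
  then show ?thesis
    unfolding normal_variety_def using local_ring_integrally_closed_iff \<rho> \<rho>_surj by metis
qed

end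

section \<open>Regular functions on the quotients as symmetric polynomials in the cosines\<close>

lemma cosmap_action:
  fixes g :: "real^'n::{finite,linorder} \<Rightarrow> real^'n::_"
  assumes \<Lambda>: "sign_lattice \<Lambda> E" and g: "g \<in> affine_weyl \<Lambda>"
  obtains \<sigma> e where "\<sigma> permutes {1..CARD('n)}" "e \<in> E"
    "\<And>z. cosmap (complex_action g z) = signed_perm CARD('n) \<sigma> e (cosmap z)"
proof -
  obtain \<tau> s q where g: "g = signed_map \<tau> s q" "bij \<tau>" "signs s" "q \<in> \<Lambda>"
    using g unfolding affine_weyl_eq by blast
  obtain \<sigma> where perm: "\<sigma> permutes {1..CARD('n)}" and idx\<sigma>: "\<And>k. k \<in> {1..CARD('n)} \<Longrightarrow> idx (\<sigma> k) = \<tau> (idx k)"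
    using idx_permutation[OF g(2)] by blast
  obtain e where e: "e \<in> E" "\<And>i w. cos (w + 2 * of_real pi * of_real (q $ i)) = e * (cos w :: complex)"
  proof (cases "\<forall>i. q $ i \<in> \<int>")
    case True
    then show ?thesis using \<Lambda> cos_int_shift by (intro that[of 1]) (auto simp: sign_lattice_def)
  next
    case False
    then have "\<forall>i. q $ i - 1/2 \<in> \<int>" "E = {1, -1}"
      using \<Lambda> g(4) by (auto simp: sign_lattice_def coroot_lattice_eq coweight_lattice_eq)
    then show ?thesis using cos_half_shift by (intro that[of "-1"]) auto
  qed
  have "cosmap (complex_action g z) k = signed_perm CARD('n) \<sigma> e (cosmap z) k" for z k
  proof (cases "k \<in> {1..CARD('n)}")
    case True
    have "cosmap (complex_action g z) k = cos (2 * pi * (of_real (s (idx k)) * z $ \<tau> (idx k)) + 2 * of_real pi * of_real (q $ idx k))"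
      using True unfolding cosmap_idx[OF True] g(1) complex_action_signed_map by (simp add: distrib_left)
    also have "\<dots> = e * cos (2 * pi * (of_real (s (idx k)) * z $ \<tau> (idx k)))" by (rule e(2))
    \<comment> \<open>Cosine is even, so the sign changes of the Weyl group become invisible and
      only its permutations remain.\<close>
    also have "cos (2 * pi * (of_real (s (idx k)) * z $ \<tau> (idx k))) = cos (2 * pi * z $ \<tau> (idx k))"
      using g(3)[unfolded signs_def, rule_format, of "idx k"] by auto
    also have "\<dots> = cosmap z (\<sigma> k)" using idx\<sigma>[OF True] permutes_in_image[OF perm, of k] True by (simp add: cosmap_idx)
    finally show ?thesis using True by (simp add: signed_perm_def)
  next
    case False
    then show ?thesis by (auto simp: signed_perm_def cosmap_def)
  qed
  then show ?thesis by (intro that[OF perm e(1)]) blast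
qed

lemma signed_perm_action:
  assumes \<Lambda>: "sign_lattice (\<Lambda> :: (real^'n::{finite,linorder}) set) E" and \<sigma>: "\<sigma> permutes {1..CARD('n)}" and e: "e \<in> E"
  obtains g where "g \<in> affine_weyl \<Lambda>"
    "\<And>z. cosmap (complex_action g z) = signed_perm CARD('n) \<sigma> e (cosmap z)"
proof -
  let ?inv = "inv_into {1..CARD('n)} idx :: 'n \<Rightarrow> nat"
  define \<tau> :: "'n \<Rightarrow> 'n" where "\<tau> = idx \<circ> \<sigma> \<circ> ?inv"
  define q :: "real^'n::_" where "q = (if e = 1 then 0 else (\<chi> i. 1/2))"
  have "bij \<tau>"
    using bij_betw_trans[OF bij_betw_trans[OF bij_betw_inv_into[OF bij_betw_idx[where 'n = 'n]] permutes_imp_bij[OF \<sigma>]]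
        bij_betw_idx[where 'n = 'n]]
    by (simp only: \<tau>_def comp_assoc)
  moreover have "q \<in> \<Lambda>"
    using \<Lambda> e by (auto simp: q_def sign_lattice_def coroot_lattice_eq coweight_lattice_eq)
  ultimately have g: "signed_map \<tau> (\<lambda>_. 1) q \<in> affine_weyl \<Lambda>"
    unfolding affine_weyl_eq using signs_one by blast
  have q: "cos (w + 2 * of_real pi * of_real (q $ i)) = e * (cos w :: complex)" for w i
  proof (cases "e = 1")
    case False
    then have "e = -1" using \<Lambda> e by (auto simp: sign_lattice_def)
    then show ?thesis using cos_half_shift[of "1/2" w] by (simp add: q_def)
  qed (simp add: q_def)
  have "cosmap (complex_action (signed_map \<tau> (\<lambda>_. 1) q) z) k = signed_perm CARD('n) \<sigma> e (cosmap z) k" for z k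
  proof (cases "k \<in> {1..CARD('n)}")
    case True
    have \<tau>: "\<tau> (idx k) = idx (\<sigma> k)" by (simp only: \<tau>_def comp_apply inv_idx[OF True])
    have \<sigma>k: "\<sigma> k \<in> {1..CARD('n)}" using True permutes_in_image[OF \<sigma>] by blast
    have "cosmap (complex_action (signed_map \<tau> (\<lambda>_. 1) q) z) k
        = cos (2 * pi * z $ idx (\<sigma> k) + 2 * of_real pi * of_real (q $ idx k))"
      unfolding cosmap_idx[OF True] complex_action_signed_map \<tau> by (simp add: distrib_left)
    also have "\<dots> = e * cosmap z (\<sigma> k)" unfolding q cosmap_idx[OF \<sigma>k] ..
    finally show ?thesis using True by (simp add: signed_perm_def)
  next
    case False
    then show ?thesis by (auto simp: signed_perm_def cosmap_def)
  qed
  then show ?thesis by (intro that[OF g]) blast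
qed

text \<open>These are the Chebyshev polynomials, obtained from the recursion that expresses the
  cosine of k w through those of (k - 1) w and (k - 2) w.\<close>

lemma cos_multiple: "\<exists>p. \<forall>w. cos (of_int m * w) = poly p (cos (w :: complex))"
proof -
  have nat: "\<exists>p. \<forall>w. cos (of_nat k * w) = poly p (cos (w :: complex))" for k
  proof (induction k rule: less_induct)
    case (less k)
    show ?case
    proof (cases "k < 2")
      case True
      then consider "k = 0" | "k = 1" by linarith
      then show ?thesis
        by cases (auto intro: exI[of _ 1] exI[of _ "[:0, 1:]"])
    next
      case False
      obtain p q where p: "\<forall>w. cos (of_nat (k - 1) * w) = poly p (cos (w :: complex))"
        and q: "\<forall>w. cos (of_nat (k - 2) * w) = poly q (cos (w :: complex))"
        using less[of "k - 1"] less[of "k - 2"] False by auto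
      have "cos (of_nat k * w) = poly ([:0, 2:] * p - q) (cos w)" for w :: complex
      proof -
        have "of_nat k * w = of_nat (k - 1) * w + w" "of_nat (k - 2) * w = of_nat (k - 1) * w - w"
          using False by (simp_all add: of_nat_diff algebra_simps)
        then have "cos (of_nat k * w) = 2 * cos w * cos (of_nat (k - 1) * w) - cos (of_nat (k - 2) * w)"
          by (simp only: cos_add cos_diff) simp
        then show ?thesis using p q by simp
      qed
      then show ?thesis by blast
    qed
  qed
  obtain p where p: "\<forall>w. cos (of_nat (nat \<bar>m\<bar>) * w) = poly p (cos (w :: complex))" using nat by blast
  have "cos (of_int m * w) = poly p (cos w)" for w :: complex
  proof (cases "m \<ge> 0")
    case True then show ?thesis using p[rule_format, of w] by simp
  next
    case False
    then have "of_nat (nat \<bar>m\<bar>) * w = - (of_int m * w)" by simp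
    then show ?thesis using p[rule_format, of w] by (simp only: cos_minus)
  qed
  then show ?thesis by blast
qed

definition sym_polys :: "nat \<Rightarrow> complex set \<Rightarrow> ((nat \<Rightarrow> complex) \<Rightarrow> complex) set" where
  "sym_polys n E = {f \<in> polyfun {1..n}. \<forall>g\<in>signed_perms n E. \<forall>x. f (g x) = f x}"

lemma sym_polys_action:
  assumes "sign_lattice (\<Lambda> :: (real^'n::{finite,linorder}) set) E" "H \<in> sym_polys CARD('n) E" "g \<in> affine_weyl \<Lambda>"
  shows "H (cosmap (complex_action g z)) = H (cosmap z)"
proof -
  obtain \<sigma> e where "\<sigma> permutes {1..CARD('n)}" "e \<in> E"
    "\<And>z. cosmap (complex_action g z) = signed_perm CARD('n) \<sigma> e (cosmap z)"
    using cosmap_action[OF assms(1,3)] by blast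
  then show ?thesis using assms(2) signed_permI[of \<sigma> "CARD('n)" e E] by (auto simp: sym_polys_def simp del: atLeastAtMost_iff)
qed

text \<open>Expanding the product of the sums \<open>exp (- a) + exp a\<close>, one for each
  coordinate, gives one term for every set of flipped coordinates.\<close>

lemma sum_flips_character:
  fixes z :: "complex^'n::finite"
  shows "(\<Sum>S\<in>Pow UNIV. torus_character \<mu> (\<chi> i. if i \<in> S then - z $ i else z $ i))
    = (\<Prod>i\<in>UNIV. 2 * cos (of_real (\<mu> $ i) * (2 * of_real pi * z $ i)))"
proof -
  let ?a = "\<lambda>i. \<i> * (of_real (\<mu> $ i) * (2 * of_real pi * z $ i))"
  have "torus_character \<mu> (\<chi> i. if i \<in> S then - z $ i else z $ i)
      = (\<Prod>i\<in>S. exp (- ?a i)) * (\<Prod>i\<in>UNIV - S. exp (?a i))" for S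
  proof -
    have "torus_character \<mu> (\<chi> i. if i \<in> S then - z $ i else z $ i) = (\<Prod>i\<in>UNIV. if i \<in> S then exp (- ?a i) else exp (?a i))"
      unfolding torus_character_def sum_distrib_left exp_sum[OF finite]
      by (intro prod.cong) (auto simp: mult_ac)
    also have "\<dots> = (\<Prod>i\<in>UNIV \<inter> S. exp (- ?a i)) * (\<Prod>i\<in>UNIV \<inter> - S. exp (?a i))"
      by (subst prod.If_cases) auto
    finally show ?thesis by (simp add: Compl_eq_Diff_UNIV)
  qed
  then have "(\<Sum>S\<in>Pow UNIV. torus_character \<mu> (\<chi> i. if i \<in> S then - z $ i else z $ i))
      = (\<Prod>i\<in>UNIV. exp (- ?a i) + exp (?a i))"
    by (simp add: prod_add[OF finite])
  also have "\<dots> = (\<Prod>i\<in>UNIV. 2 * cos (of_real (\<mu> $ i) * (2 * of_real pi * z $ i)))"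
    by (intro prod.cong) (auto simp: cos_exp_eq)
  finally show ?thesis .
qed

lemma dual_lattice_integral:
  assumes "sign_lattice \<Lambda> E" "\<mu> \<in> dual_lattice \<Lambda>"
  shows "\<mu> $ i \<in> \<int>"
proof -
  have "axis i 1 \<in> \<Lambda>"
    using assms(1) by (auto simp: sign_lattice_def coroot_lattice_eq coweight_lattice_eq axis_def)
  then have "\<mu> \<bullet> axis i 1 \<in> \<int>" using assms(2) unfolding dual_lattice_def by blast
  then show ?thesis by (simp add: inner_axis)
qed

text \<open>The pullback is invariant under the \<open>2 ^ n\<close> sign changes in the Weyl group.
  Averaging over them turns characters with integral exponents into products of cosines of
  multiples, hence into polynomials in the cosines; invariance of the polynomial H follows because
  the cosines take all values.\<close>

lemma regular_imp_sym_poly: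
  assumes \<Lambda>: "sign_lattice (\<Lambda> :: (real^'n::{finite,linorder}) set) E" and \<phi>: "quotient_regular \<Lambda> \<phi>"
  shows "\<exists>H\<in>sym_polys CARD('n) E. \<forall>z. \<phi> (orbit_of \<Lambda> z) = H (cosmap z)"
proof -
  define f where "f z = \<phi> (orbit_of \<Lambda> z)" for z
  obtain A c where A: "finite A" "A \<subseteq> dual_lattice \<Lambda>" "\<And>z. f z = (\<Sum>\<mu>\<in>A. c \<mu> * torus_character \<mu> z)"
    using \<phi> unfolding quotient_regular_def torus_regular_def f_def by (auto simp: fun_eq_iff)
  have "\<exists>p. \<forall>w. cos (of_real (\<mu> $ i) * w) = poly p (cos (w :: complex))" if "\<mu> \<in> A" for \<mu> i
  proof -
    have "\<mu> $ i \<in> \<int>" using dual_lattice_integral[OF \<Lambda>, of \<mu> i] A(2) that by blast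
    then obtain m where "\<mu> $ i = of_int m" by (auto elim: Ints_cases)
    then show ?thesis using cos_multiple[of m] by simp
  qed
  note ex = this
  define p where "p \<mu> i = (SOME p. \<forall>w. cos (of_real (\<mu> $ i) * w) = poly p (cos (w :: complex)))" for \<mu> :: "real^'n::_" and i
  have p: "cos (of_real (\<mu> $ i) * w) = poly (p \<mu> i) (cos (w :: complex))" if "\<mu> \<in> A" for \<mu> i w
    using someI_ex[OF ex[OF that, of i]] unfolding p_def by blast
  define H where "H x = (\<Sum>\<mu>\<in>A. c \<mu> * (\<Prod>k\<in>{1..CARD('n)}. poly (p \<mu> (idx k)) (x k)))" for x
  have "f z = H (cosmap z)" for z
  proof -
    let ?flip = "\<lambda>S. \<chi> i. if i \<in> S then - z $ i else z $ i"
    have "f (?flip S) = f z" for S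
    proof -
      let ?g = "signed_map id (\<lambda>i. if i \<in> S then -1 else 1) 0 :: real^'n::_ \<Rightarrow> real^'n::_"
      have "signs (\<lambda>i. if i \<in> S then -1 else 1)" by (simp add: signs_def)
      then have "?g \<in> affine_weyl \<Lambda>" unfolding affine_weyl_eq using zero_in_lattice[OF \<Lambda>] bij_id by blast
      moreover have "complex_action ?g z = ?flip S"
        by (simp add: vec_eq_iff complex_action_signed_map)
      ultimately show ?thesis using orbit_of_action[OF \<Lambda>, of ?g z] by (simp add: f_def)
    qed
    then have "of_nat (card (Pow (UNIV :: 'n set))) * f z = (\<Sum>S\<in>Pow UNIV. f (?flip S))" by simp
    also have "\<dots> = (\<Sum>\<mu>\<in>A. c \<mu> * (\<Sum>S\<in>Pow UNIV. torus_character \<mu> (?flip S)))"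
      unfolding A(3) by (subst sum.swap) (simp add: sum_distrib_left)
    also have "\<dots> = (\<Sum>\<mu>\<in>A. 2 ^ CARD('n) * (c \<mu> * (\<Prod>k\<in>{1..CARD('n)}. poly (p \<mu> (idx k)) (cosmap z k))))"
    proof (intro sum.cong refl)
      fix \<mu> assume \<mu>: "\<mu> \<in> A"
      have "(\<Prod>i\<in>UNIV. 2 * cos (of_real (\<mu> $ i) * (2 * of_real pi * z $ i)))
          = 2 ^ CARD('n) * (\<Prod>i\<in>UNIV. poly (p \<mu> i) (cos (2 * of_real pi * z $ i)))"
        by (simp add: prod.distrib p[OF \<mu>])
      also have "(\<Prod>i\<in>UNIV. poly (p \<mu> i) (cos (2 * of_real pi * z $ i)))
          = (\<Prod>k\<in>{1..CARD('n)}. poly (p \<mu> (idx k)) (cos (2 * of_real pi * z $ idx k)))"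
        by (rule prod.reindex_bij_betw[OF bij_betw_idx, symmetric])
      also have "\<dots> = (\<Prod>k\<in>{1..CARD('n)}. poly (p \<mu> (idx k)) (cosmap z k))"
        by (intro prod.cong refl) (simp add: cosmap_idx)
      finally show "c \<mu> * (\<Sum>S\<in>Pow UNIV. torus_character \<mu> (?flip S))
          = 2 ^ CARD('n) * (c \<mu> * (\<Prod>k\<in>{1..CARD('n)}. poly (p \<mu> (idx k)) (cosmap z k)))"
        unfolding sum_flips_character by simp
    qed
    also have "\<dots> = 2 ^ CARD('n) * H (cosmap z)" by (simp add: H_def sum_distrib_left)
    finally show ?thesis by (simp add: card_Pow)
  qed
  note fH = this
  have "(\<lambda>x. poly (p \<mu> (idx k)) (x k)) \<in> polyfun {1..CARD('n)}" if "k \<in> {1..CARD('n)}" for \<mu> k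
    unfolding poly_altdef by (intro polyfun_sum polyfun_mult polyfun_power polyfun.const polyfun_coord that)
  then have Hpoly: "H \<in> polyfun {1..CARD('n)}"
    unfolding H_def[abs_def] by (intro polyfun_sum polyfun_mult polyfun_prod polyfun.const)
  have "H (g x) = H x" if "g \<in> signed_perms CARD('n) E" for g x
  proof -
    obtain \<sigma> e where \<sigma>: "g = signed_perm CARD('n) \<sigma> e" "\<sigma> permutes {1..CARD('n)}" "e \<in> E"
      using \<open>g \<in> signed_perms CARD('n) E\<close> by (rule signed_permE)
    \<comment> \<open>An arbitrary x is given the boundary values outside \<open>{1..n}\<close>,
      which H does not read, in order to lie in the image of \<open>cosmap\<close>.\<close>
    define y where "y k = (if k = 0 then -1 else if k \<le> CARD('n) then x k else 1)" for k
    obtain z :: "complex^'n::_" where z: "cosmap z = y" by (rule cosmap_surj[of y]) (auto simp: y_def)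
    obtain h where h: "h \<in> affine_weyl \<Lambda>" "\<And>z. cosmap (complex_action h z) = g (cosmap z)"
      unfolding \<sigma>(1) using signed_perm_action[OF \<Lambda> \<sigma>(2,3)] by blast
    have xy: "x k = y k" if "k \<in> {1..CARD('n)}" for k using that by (simp add: y_def)
    have gxy: "g x k = g y k" if "k \<in> {1..CARD('n)}" for k
      using that xy[of "\<sigma> k"] permutes_in_image[OF \<sigma>(2), of k] unfolding \<sigma>(1) signed_perm_def by presburger
    have "H (g x) = H (g y)" by (rule polyfun_cong[OF Hpoly gxy])
    also have "\<dots> = f (complex_action h z)" by (simp only: fH h(2) z)
    also have "\<dots> = f z" unfolding f_def by (simp only: orbit_of_action[OF \<Lambda> h(1)])
    also have "\<dots> = H x" unfolding fH z by (rule polyfun_cong[OF Hpoly xy[symmetric]])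
    finally show ?thesis .
  qed
  then have "H \<in> sym_polys CARD('n) E" using Hpoly by (auto simp: sym_polys_def)
  then show ?thesis using fH unfolding f_def by blast
qed

lemma torus_regular_add:
  assumes "torus_regular \<Lambda> f" "torus_regular \<Lambda> g"
  shows "torus_regular \<Lambda> (\<lambda>z. f z + g z)"
proof -
  obtain A c B d where A: "finite A" "A \<subseteq> dual_lattice \<Lambda>" "f = (\<lambda>z. \<Sum>\<mu>\<in>A. c \<mu> * torus_character \<mu> z)"
    and B: "finite B" "B \<subseteq> dual_lattice \<Lambda>" "g = (\<lambda>z. \<Sum>\<mu>\<in>B. d \<mu> * torus_character \<mu> z)"
    using assms unfolding torus_regular_def by blast
  define e where "e \<mu> = (if \<mu> \<in> A then c \<mu> else 0) + (if \<mu> \<in> B then d \<mu> else 0)" for \<mu>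
  have "f z + g z = (\<Sum>\<mu>\<in>A \<union> B. e \<mu> * torus_character \<mu> z)" for z
  proof -
    have "f z = (\<Sum>\<mu>\<in>A \<union> B. (if \<mu> \<in> A then c \<mu> else 0) * torus_character \<mu> z)"
      "g z = (\<Sum>\<mu>\<in>A \<union> B. (if \<mu> \<in> B then d \<mu> else 0) * torus_character \<mu> z)"
      unfolding A(3) B(3) using A(1) B(1) by (auto intro!: sum.mono_neutral_cong_left)
    then show ?thesis by (simp add: e_def distrib_right sum.distrib)
  qed
  then show ?thesis
    unfolding torus_regular_def using A(1,2) B(1,2) by (intro exI[of _ "A \<union> B"] exI[of _ e]) auto
qed

lemma torus_character_add: "torus_character (\<mu> + \<nu>) z = torus_character \<mu> z * torus_character \<nu> z"
  by (simp add: torus_character_def distrib_left distrib_right sum.distrib exp_add)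

lemma torus_regular_character_mult:
  assumes "torus_regular \<Lambda> f" "\<nu> \<in> dual_lattice \<Lambda>"
  shows "torus_regular \<Lambda> (\<lambda>z. a * torus_character \<nu> z * f z)"
proof -
  obtain A c where A: "finite A" "A \<subseteq> dual_lattice \<Lambda>" "f = (\<lambda>z. \<Sum>\<mu>\<in>A. c \<mu> * torus_character \<mu> z)"
    using assms(1) unfolding torus_regular_def by blast
  have "a * torus_character \<nu> z * f z = (\<Sum>\<mu>\<in>(+) \<nu> ` A. (a * c (\<mu> - \<nu>)) * torus_character \<mu> z)" for z
    unfolding A(3) by (subst sum.reindex) (auto simp: inj_on_def torus_character_add sum_distrib_left mult_ac)
  moreover have "(+) \<nu> ` A \<subseteq> dual_lattice \<Lambda>"
    using A(2) assms(2) by (auto simp: dual_lattice_def inner_add_left)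
  ultimately show ?thesis
    unfolding torus_regular_def using A(1) by (intro exI[of _ "(+) \<nu> ` A"] exI[of _ "\<lambda>\<mu>. a * c (\<mu> - \<nu>)"]) auto
qed

lemma polyfun_torus_regular:
  assumes "H \<in> polyfun {1..CARD('n::{finite,linorder})}"
  shows "torus_regular (coroot_lattice :: (real^'n::_) set) (\<lambda>z. H (cosmap z))"
  using assms
proof induction
  case (const c)
  show ?case unfolding torus_regular_def
    by (intro exI[of _ "{0}"] exI[of _ "\<lambda>_. c"]) (auto simp: dual_lattice_def torus_character_def)
next
  case (add f g)
  then show ?case by (intro torus_regular_add)
next
  case (coord_mult f k)
  let ?e = "axis (idx k) 1 :: real^'n::_"
  have mem: "?e \<in> dual_lattice coroot_lattice" "- ?e \<in> dual_lattice coroot_lattice"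
    by (auto simp: dual_lattice_def coroot_lattice_eq inner_axis')
  have char: "torus_character ?e z = exp (\<i> * (2 * of_real pi * z $ idx k))"
    "torus_character (- ?e) z = exp (- (\<i> * (2 * of_real pi * z $ idx k)))" for z
  proof -
    have *: "(\<Sum>j\<in>UNIV. of_real (?e $ j) * z $ j) = z $ idx k"
      by (simp add: axis_def if_distrib[of "\<lambda>x. x * _"] if_distrib[of of_real] cong: if_cong)
    have "(\<Sum>j\<in>UNIV. of_real ((- ?e) $ j) * z $ j) = - z $ idx k"
      using * by (simp add: sum_negf)
    with * show "torus_character ?e z = exp (\<i> * (2 * of_real pi * z $ idx k))"
      "torus_character (- ?e) z = exp (- (\<i> * (2 * of_real pi * z $ idx k)))"
      unfolding torus_character_def by (simp_all only:) (simp_all add: mult_ac)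
  qed
  have "cosmap z k * f (cosmap z) = 1/2 * torus_character ?e z * f (cosmap z) + 1/2 * torus_character (- ?e) z * f (cosmap z)" for z
    unfolding cosmap_idx[OF coord_mult(2)] cos_exp_eq char by (simp add: algebra_simps)
  then show ?case
    using torus_regular_add[OF torus_regular_character_mult[OF coord_mult.IH mem(1), of "1/2"]
      torus_regular_character_mult[OF coord_mult.IH mem(2), of "1/2"]] by simp
qed

text \<open>Averaging over the translation by the half-integral vector kills the characters outside the dual lattice.\<close>

lemma torus_regular_coweight:
  fixes f :: "complex^'n::{finite,linorder} \<Rightarrow> complex"
  assumes "torus_regular coroot_lattice f" and shift: "\<And>z. f (\<chi> i. z $ i + 1/2) = f z"
  shows "torus_regular coweight_lattice f"
proof -
  obtain A c where A: "finite A" "A \<subseteq> dual_lattice coroot_lattice" "f = (\<lambda>z. \<Sum>\<mu>\<in>A. c \<mu> * torus_character \<mu> z)"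
    using assms(1) unfolding torus_regular_def by blast
  define h :: "real^'n::_" where "h = (\<chi> i. 1/2)"
  have int: "\<mu> $ i \<in> \<int>" if "\<mu> \<in> A" for \<mu> i
    using dual_lattice_integral[of coroot_lattice "{1}" \<mu> i] that A(2) by (auto simp: sign_lattice_def)
  define B where "B = {\<mu> \<in> A. \<mu> \<bullet> h \<in> \<int>}"
  have char: "torus_character \<mu> (\<chi> i. z $ i + 1/2) = exp (2 * of_real pi * \<i> * of_real (\<mu> \<bullet> h)) * torus_character \<mu> z" for \<mu> z
    by (simp add: torus_character_def h_def inner_vec_def distrib_left sum.distrib exp_add sum_distrib_left mult_ac)
  have two: "2 * (\<mu> \<bullet> h) \<in> \<int>" if "\<mu> \<in> A" for \<mu>
  proof -
    have "2 * (\<mu> \<bullet> h) = (\<Sum>i\<in>UNIV. \<mu> $ i)" by (simp add: h_def inner_vec_def sum_distrib_left)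
    then show ?thesis using int[OF that] by (simp only: Ints_sum)
  qed
  have val: "1 + exp (2 * of_real pi * \<i> * of_real (\<mu> \<bullet> h)) = (if \<mu> \<in> B then 2 else 0 :: complex)" if \<mu>: "\<mu> \<in> A" for \<mu>
  proof (cases "\<mu> \<bullet> h \<in> \<int>")
    case True
    then obtain m where "\<mu> \<bullet> h = of_int m" by (auto elim: Ints_cases)
    then show ?thesis using True \<mu> exp_integer_2pi[of "of_int m"] by (simp add: B_def mult_ac)
  next
    case False
    obtain m where m: "2 * (\<mu> \<bullet> h) = of_int m" using two[OF \<mu>] by (auto elim: Ints_cases)
    have "odd m"
    proof
      assume "even m"
      then obtain k where "m = 2 * k" by blast
      then have "\<mu> \<bullet> h = of_int k" using m by simp
      then show False using False by (metis Ints_of_int)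
    qed
    then obtain k where "m = 2 * k + 1" by (rule oddE)
    then have "\<mu> \<bullet> h = of_int k + 1/2" using m by simp
    then have "2 * of_real pi * \<i> * of_real (\<mu> \<bullet> h) = 2 * of_int k * of_real pi * \<i> + of_real pi * \<i>"
      by (simp add: algebra_simps)
    then have "exp (2 * of_real pi * \<i> * of_real (\<mu> \<bullet> h)) = exp (2 * of_int k * of_real pi * \<i>) * exp (of_real pi * \<i>)"
      by (simp only: exp_add)
    also have "\<dots> = -1" using exp_integer_2pi[of "of_int k"] exp_pi_i by simp
    finally show ?thesis using False by (simp add: B_def)
  qed
  have "f z = (\<Sum>\<mu>\<in>B. c \<mu> * torus_character \<mu> z)" for z
  proof -
    have "2 * f z = f z + f (\<chi> i. z $ i + 1/2)" using shift by simp
    also have "\<dots> = (\<Sum>\<mu>\<in>A. c \<mu> * ((1 + exp (2 * of_real pi * \<i> * of_real (\<mu> \<bullet> h))) * torus_character \<mu> z))"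
      unfolding A(3) char by (simp add: sum.distrib[symmetric] algebra_simps)
    also have "\<dots> = (\<Sum>\<mu>\<in>A. if \<mu> \<in> B then 2 * (c \<mu> * torus_character \<mu> z) else 0)"
      using val by (intro sum.cong) auto
    also have "\<dots> = 2 * (\<Sum>\<mu>\<in>B. c \<mu> * torus_character \<mu> z)"
      using A(1) by (simp add: sum.inter_filter[symmetric] sum_distrib_left B_def)
    finally show ?thesis by simp
  qed
  moreover have "B \<subseteq> dual_lattice coweight_lattice"
  proof
    fix \<mu> assume \<mu>: "\<mu> \<in> B"
    have "\<mu> \<bullet> q \<in> \<int>" if "q \<in> coweight_lattice" for q
    proof -
      have Z: "\<mu> \<bullet> r \<in> \<int>" if "\<And>i. r $ i \<in> \<int>" for r
        using int \<mu> that by (auto simp: inner_vec_def B_def intro!: Ints_sum Ints_mult)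
      show ?thesis
      proof (cases "\<forall>i. q $ i \<in> \<int>")
        case False
        then have "\<forall>i. q $ i - 1/2 \<in> \<int>" using \<open>q \<in> coweight_lattice\<close> by (auto simp: coweight_lattice_eq)
        then have "\<mu> \<bullet> (q - h) \<in> \<int>" by (intro Z) (simp add: h_def)
        from Ints_add[OF this, of "\<mu> \<bullet> h"] show ?thesis using \<mu> by (simp add: B_def inner_diff_right)
      qed (use Z in blast)
    qed
    then show "\<mu> \<in> dual_lattice coweight_lattice" by (simp add: dual_lattice_def)
  qed
  ultimately show ?thesis
    unfolding torus_regular_def using A(1) by (intro exI[of _ B] exI[of _ c]) (auto simp: B_def)
qed

lemma sym_poly_imp_regular:
  assumes \<Lambda>: "sign_lattice (\<Lambda> :: (real^'n::{finite,linorder}) set) E" and H: "H \<in> sym_polys CARD('n) E"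
  shows "\<exists>\<phi>. quotient_regular \<Lambda> \<phi> \<and> (\<forall>z. \<phi> (orbit_of \<Lambda> z) = H (cosmap z))"
proof -
  define \<phi> where "\<phi> Y = H (cosmap (SOME z. z \<in> Y))" for Y :: "(complex^'n::_) set"
  have \<phi>: "\<phi> (orbit_of \<Lambda> z) = H (cosmap z)" for z
  proof -
    have "complex_action id z \<in> orbit_of \<Lambda> z"
      unfolding orbit_of_def using id_affine_weyl[OF \<Lambda>] by blast
    then have "(SOME w. w \<in> orbit_of \<Lambda> z) \<in> orbit_of \<Lambda> z" by (rule someI)
    then obtain g where "g \<in> affine_weyl \<Lambda>" "(SOME w. w \<in> orbit_of \<Lambda> z) = complex_action g z"
      unfolding orbit_of_def by blast
    then show ?thesis using sym_polys_action[OF \<Lambda> H] by (simp add: \<phi>_def)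
  qed
  have reg: "torus_regular coroot_lattice (\<lambda>z :: complex^'n::_. H (cosmap z))"
    using H by (intro polyfun_torus_regular) (simp add: sym_polys_def)
  have "torus_regular \<Lambda> (\<lambda>z. H (cosmap z))"
  proof (cases "\<Lambda> = coroot_lattice")
    case False
    then have \<Lambda>': "\<Lambda> = coweight_lattice" "E = {1, -1}" using \<Lambda> by (auto simp: sign_lattice_def)
    have "H (cosmap (\<chi> i. z $ i + 1/2)) = H (cosmap z)" for z :: "complex^'n::_"
    proof -
      let ?g = "signed_map id (\<lambda>_. 1) (\<chi> i. 1/2) :: real^'n::_ \<Rightarrow> real^'n::_"
      have "(\<chi> i. 1/2) \<in> \<Lambda>" unfolding \<Lambda>'(1) coweight_lattice_eq by simp
      then have "?g \<in> affine_weyl \<Lambda>" unfolding affine_weyl_eq using bij_id signs_one by blast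
      moreover have "complex_action ?g z = (\<chi> i. z $ i + 1/2)"
        by (simp add: vec_eq_iff complex_action_signed_map)
      ultimately show ?thesis using sym_polys_action[OF \<Lambda> H, of ?g z] by simp
    qed
    then show ?thesis unfolding \<Lambda>'(1) by (rule torus_regular_coweight[OF reg])
  qed (use reg in simp)
  then have "quotient_regular \<Lambda> \<phi>" by (simp add: quotient_regular_def comp_def \<phi>)
  then show ?thesis using \<phi> by blast
qed

lemma complex_action_Re_Im:
  "(\<chi> k. Re (complex_point x v $ k)) = x" "(\<chi> k. Im (complex_point x v $ k)) = v"
  by (simp_all add: complex_point_def)

lemma complexify_image:
  assumes "g \<in> affine_weyl (\<Lambda> :: (real^'n::{finite,linorder}) set)"
  shows "complexify (g ` L) = complex_action g ` complexify L"
proof -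
  obtain \<sigma> s q where g: "g = signed_map \<sigma> s q" using assms unfolding affine_weyl_eq by blast
  have dir: "g (x - y) - g 0 = g x - g y" for x y by (simp add: g vec_eq_iff algebra_simps)
  have action: "complex_action g (complex_point x v) = complex_point (g x) (g v - g 0)" for x v
    by (simp only: complex_action_def Let_def complex_action_Re_Im)
  have "complexify (g ` L) = {complex_point (g x) (g y - g z) | x y z. x \<in> L \<and> y \<in> L \<and> z \<in> L}"
    by (fastforce simp: complexify_def direction_def)
  also have "\<dots> = {complex_action g (complex_point x (y - z)) | x y z. x \<in> L \<and> y \<in> L \<and> z \<in> L}"
    by (simp only: action dir)
  also have "\<dots> = complex_action g ` complexify L"
    by (fastforce simp: complexify_def direction_def)
  finally show ?thesis .
qed

lemma coroot_subset_coweight: "coroot_lattice \<subseteq> (coweight_lattice :: (real^'n::{finite,linorder}) set)"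
  by (auto simp: coroot_lattice_eq coweight_lattice_eq)

lemma affine_weyl_mono: "\<Lambda> \<subseteq> \<Lambda>' \<Longrightarrow> affine_weyl \<Lambda> \<subseteq> affine_weyl \<Lambda>'"
  unfolding affine_weyl_def by blast

text \<open>The element w disappears because it moves points within their orbits, so the stratum is
  the image of L itself. The representative chosen for an orbit is immaterial, since the functions
  in \<open>sym_polys\<close> agree on all points of one orbit.\<close>

lemma stratum_normal_iff:
  fixes \<Lambda> :: "(real^'n::{finite,linorder}) set"
  assumes \<Lambda>: "sign_lattice \<Lambda> E" and w: "w \<in> affine_weyl coroot_lattice"
    and L: "cosmap ` complexify L = M"
    and nonempty: "M \<noteq> {}"
    and nonzero: "\<And>f g. f \<in> polyfun {1..CARD('n)} \<Longrightarrow> g \<in> polyfun {1..CARD('n)} \<Longrightarrow>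
      \<exists>x\<in>M. f x \<noteq> 0 \<Longrightarrow> \<exists>x\<in>M. g x \<noteq> 0 \<Longrightarrow> \<exists>x\<in>M. f x * g x \<noteq> 0"
  shows "normal_variety \<Lambda> (stratum \<Lambda> (w ` L)) \<longleftrightarrow> (\<forall>m\<in>M. normal_image (sym_polys CARD('n) E) M m)"
proof -
  let ?A = "sym_polys CARD('n) E" and ?X = "stratum \<Lambda> (w ` L)"
  have w': "w \<in> affine_weyl \<Lambda>"
    using w affine_weyl_mono[OF coroot_subset_coweight] \<Lambda> unfolding sign_lattice_def by blast
  have X: "?X = orbit_of \<Lambda> ` complexify L"
  proof -
    have "?X = {orbit_of \<Lambda> (complex_action g (complex_action w z)) | g z. g \<in> affine_weyl \<Lambda> \<and> z \<in> complexify L}"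
      unfolding stratum_def complexify_image[OF w] by blast
    also have "\<dots> = {orbit_of \<Lambda> z | g z. g \<in> affine_weyl \<Lambda> \<and> z \<in> complexify L}"
      using orbit_of_action[OF \<Lambda>] w' by metis
    also have "\<dots> = orbit_of \<Lambda> ` complexify L" using w' by blast
    finally show ?thesis .
  qed
  define \<rho> where "\<rho> p = cosmap (SOME z. z \<in> complexify L \<and> p = orbit_of \<Lambda> z)" for p
  have \<rho>: "\<exists>z\<in>complexify L. p = orbit_of \<Lambda> z \<and> \<rho> p = cosmap z" if "p \<in> ?X" for p
  proof -
    have "\<exists>z. z \<in> complexify L \<and> p = orbit_of \<Lambda> z" using that unfolding X by blast
    from someI_ex[OF this] show ?thesis unfolding \<rho>_def by blast
  qed
  have \<rho>_eval: "H (\<rho> (orbit_of \<Lambda> z)) = H (cosmap z)" if H: "H \<in> ?A" and z: "z \<in> complexify L" for H z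
  proof -
    obtain z' where z': "orbit_of \<Lambda> z = orbit_of \<Lambda> z'" "\<rho> (orbit_of \<Lambda> z) = cosmap z'"
      using \<rho>[of "orbit_of \<Lambda> z"] z unfolding X by blast
    have "complex_action id z' \<in> orbit_of \<Lambda> z'" unfolding orbit_of_def using id_affine_weyl[OF \<Lambda>] by blast
    then obtain g where "g \<in> affine_weyl \<Lambda>" "z' = complex_action g z"
      unfolding complex_action_id z'(1)[symmetric] unfolding orbit_of_def by blast
    then show ?thesis using sym_polys_action[OF \<Lambda> H] z'(2) by metis
  qed
  interpret evaluation \<Lambda> ?X ?A M \<rho>
  proof
    have eval: "restrict \<phi> ?X = (\<lambda>p\<in>?X. H (\<rho> p))" if "H \<in> ?A" "\<And>z. \<phi> (orbit_of \<Lambda> z) = H (cosmap z)" for \<phi> H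
      using \<rho>_eval[OF that(1)] that(2) unfolding X by (auto simp: restrict_def fun_eq_iff)
    show "carrier (coordinate_ring \<Lambda> ?X) = (\<lambda>H. \<lambda>p\<in>?X. H (\<rho> p)) ` ?A"
    proof (intro equalityI subsetI)
      fix f assume "f \<in> carrier (coordinate_ring \<Lambda> ?X)"
      then obtain \<phi> where \<phi>: "f = restrict \<phi> ?X" "quotient_regular \<Lambda> \<phi>" by (auto simp: coordinate_ring_def)
      obtain H where "H \<in> ?A" "\<And>z. \<phi> (orbit_of \<Lambda> z) = H (cosmap z)"
        using regular_imp_sym_poly[OF \<Lambda> \<phi>(2)] by blast
      then show "f \<in> (\<lambda>H. \<lambda>p\<in>?X. H (\<rho> p)) ` ?A" unfolding \<phi>(1) using eval by blast
    next
      fix f assume "f \<in> (\<lambda>H. \<lambda>p\<in>?X. H (\<rho> p)) ` ?A"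
      then obtain H where H: "H \<in> ?A" "f = (\<lambda>p\<in>?X. H (\<rho> p))" by blast
      obtain \<phi> where \<phi>: "quotient_regular \<Lambda> \<phi>" "\<And>z. \<phi> (orbit_of \<Lambda> z) = H (cosmap z)"
        using sym_poly_imp_regular[OF \<Lambda> H(1)] by blast
      have "f = restrict \<phi> ?X" unfolding H(2) using eval[OF H(1) \<phi>(2)] by simp
      then show "f \<in> carrier (coordinate_ring \<Lambda> ?X)" using \<phi>(1) by (auto simp: coordinate_ring_def)
    qed
    show "\<rho> p \<in> M" if "p \<in> ?X" for p using \<rho>[OF that] L by blast
    show "\<exists>p\<in>?X. \<forall>H\<in>?A. H (\<rho> p) = H m" if "m \<in> M" for m
      using that \<rho>_eval unfolding X L[symmetric] by blast
    show "(\<lambda>_. c) \<in> ?A" for c by (auto simp: sym_polys_def)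
    show "(\<lambda>x. f x + g x) \<in> ?A" "(\<lambda>x. f x * g x) \<in> ?A" if "f \<in> ?A" "g \<in> ?A" for f g
      using that by (auto simp: sym_polys_def intro: polyfun_mult)
    show "\<exists>x\<in>M. f x * g x \<noteq> 0" if "f \<in> ?A" "g \<in> ?A" "\<exists>x\<in>M. f x \<noteq> 0" "\<exists>x\<in>M. g x \<noteq> 0" for f g
      using nonzero[of f g] that by (simp add: sym_polys_def)
  qed (rule nonempty)
  show ?thesis by (rule normal_variety_iff)
qed

lemma (in alcove_flat) stratum_normal:
  assumes n: "n = CARD('n)" and w: "w \<in> affine_weyl coroot_lattice"
    and L: "cosmap ` complexify (L :: (real^'n::{finite,linorder}) set) = M"
  shows "normal_variety coroot_lattice (stratum coroot_lattice (w ` L)) \<longleftrightarrow> (\<exists>d. balanced d)"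
    and "normal_variety coweight_lattice (stratum coweight_lattice (w ` L)) \<longleftrightarrow>
      (\<exists>d. balanced d) \<and> (\<forall>j\<in>I. n - j \<in> I \<longrightarrow> 2 * j \<noteq> n \<longrightarrow> (\<forall>i\<in>I. n - i \<in> I))"
proof -
  have nonempty: "M \<noteq> {}" using flat_proj_in by blast
  have sp: "sign_lattice coroot_lattice {1}" and psp: "sign_lattice coweight_lattice {1, -1}"
    by (simp_all add: sign_lattice_def)
  note normal_iff = stratum_normal_iff[OF _ w L[unfolded n] nonempty[unfolded n] sp.nonzero_mult_M[unfolded n]]
  have sp_eq: "normal_image (sym_polys n {1}) M m = sp.normal_at m"
    and psp_eq: "normal_image (sym_polys n {1, -1}) M m = psp.normal_at m" for m
    by (simp_all only: normal_image_def sp.normal_at_def psp.normal_at_def sym_polys_def sp.invs_def psp.invs_def)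
  show "normal_variety coroot_lattice (stratum coroot_lattice (w ` L)) \<longleftrightarrow> (\<exists>d. balanced d)"
    unfolding sp_normal_iff[symmetric] sp_eq[symmetric] unfolding n by (rule normal_iff[OF sp])
  show "normal_variety coweight_lattice (stratum coweight_lattice (w ` L)) \<longleftrightarrow>
      (\<exists>d. balanced d) \<and> (\<forall>j\<in>I. n - j \<in> I \<longrightarrow> 2 * j \<noteq> n \<longrightarrow> (\<forall>i\<in>I. n - i \<in> I))"
    unfolding psp_normal_iff[symmetric] psp_eq[symmetric] unfolding n by (rule normal_iff[OF psp])
qed

section \<open>The fundamental alcove\<close>

definition ext :: "real^'n::{finite,linorder} \<Rightarrow> nat \<Rightarrow> real" where
  "ext v k = (if k = 0 then 1/2 else if k \<le> CARD('n) then v $ idx k else 0)"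

text \<open>The barycentric coordinates with respect to the vertices of the alcove. They telescope
  to 1 because the boundary values of \<open>ext\<close> are 1/2 and 0; these are also the values
  whose cosines are -1 and 1.\<close>

definition bary :: "real^'n::{finite,linorder} \<Rightarrow> nat \<Rightarrow> real" where
  "bary v j = 2 * (ext v j - ext v (Suc j))"

lemma ext_simps [simp]:
  "ext (v :: real^'n::{finite,linorder}) 0 = 1/2" "ext (v :: real^'n::_) (Suc CARD('n)) = 0"
  by (simp_all add: ext_def)

lemma ext_idx: "k \<in> {1..CARD('n)} \<Longrightarrow> ext (v :: real^'n::{finite,linorder}) k = v $ idx k"
  by (simp add: ext_def)

lemma ext_eqI:
  fixes v w :: "real^'n::{finite,linorder}"
  assumes "\<And>k. k \<in> {1..CARD('n)} \<Longrightarrow> ext v k = ext w k"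
  shows "v = w"
  unfolding vec_eq_iff
proof
  fix i :: 'n
  obtain k where "k \<in> {1..CARD('n)}" "idx k = i" using idx_surj by blast
  then show "v $ i = w $ i" using assms[of k] ext_idx by metis
qed

lemma ext_affine: "a + b = 1 \<Longrightarrow> ext (a *\<^sub>R v + b *\<^sub>R w) k = a * ext v k + b * ext w k"
  by (simp add: ext_def flip: distrib_right)

lemma bary_affine: "a + b = 1 \<Longrightarrow> bary (a *\<^sub>R v + b *\<^sub>R w) j = a * bary v j + b * bary w j"
  by (simp add: bary_def ext_affine algebra_simps)

lemma sum_bary: "k \<le> CARD('n) \<Longrightarrow> (\<Sum>j\<in>{k..CARD('n)}. bary (v :: real^'n::{finite,linorder}) j) = 2 * ext v k"
proof -
  assume "k \<le> CARD('n)"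
  then have "(\<Sum>j=k..CARD('n). ext v j - ext v (Suc j)) = ext v k - ext v (Suc CARD('n))"
    by (subst sum_Suc_diff[of k "CARD('n)" "\<lambda>j. - ext v j", simplified]) simp_all
  then show ?thesis unfolding bary_def sum_distrib_left[symmetric] by simp
qed

lemma simple_root_inner:
  fixes v :: "real^'n::{finite,linorder}"
  assumes "j \<in> {1..CARD('n)}"
  shows "simple_root j \<bullet> v = (if j < CARD('n) then bary v j / 2 else bary v j)"
  using assms by (auto simp: simple_root_def eps_idx inner_axis' inner_diff_left bary_def ext_def)

lemma highest_root_inner: "highest_root \<bullet> v = 2 * ext v 1"
  by (simp add: highest_root_def eps_idx inner_axis' ext_def Suc_le_eq)

definition corner :: "nat \<Rightarrow> real^'n::{finite,linorder}" where
  "corner i = (\<chi> l. if inv_into {1..CARD('n)} idx l \<le> i then 1/2 else 0)"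

lemma ext_corner: "i \<le> CARD('n) \<Longrightarrow> ext (corner i :: real^'n::{finite,linorder}) k = (if k \<le> i then 1/2 else 0)"
proof (cases "k \<in> {1..CARD('n)}")
  case True
  then show ?thesis using inv_idx[OF True] by (simp add: ext_idx corner_def)
qed (auto simp: ext_def)

lemma bary_eqI:
  fixes v w :: "real^'n::{finite,linorder}"
  assumes "\<And>j. j \<in> {1..CARD('n)} \<Longrightarrow> bary v j = bary w j"
  shows "v = w"
proof (rule ext_eqI)
  fix k assume k: "k \<in> {1..CARD('n)}"
  have "(\<Sum>j\<in>{k..CARD('n)}. bary v j) = (\<Sum>j\<in>{k..CARD('n)}. bary w j)"
    using assms k by (intro sum.cong) auto
  then show "ext v k = ext w k" using k by (simp add: sum_bary)
qed

lemma bary_corner: "i \<le> CARD('n) \<Longrightarrow> bary (corner i :: real^'n::{finite,linorder}) j = (if j = i then 1 else 0)"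
  by (auto simp: bary_def ext_corner)

lemma bary_scale: "j \<noteq> 0 \<Longrightarrow> bary (c *\<^sub>R v) j = c * bary v j"
  by (simp add: bary_def ext_def algebra_simps)

text \<open>The last simple root is the long one, which causes the exception at i = n. The factors 2
  and 1 are at the same time the coefficients of the highest root, so dividing by them leaves
  \<open>corner i\<close> as the vertex in every case.\<close>

lemma fundamental_coweight_corner:
  assumes i: "i \<in> {1..CARD('n)}"
  shows "fundamental_coweight i = (if i < CARD('n) then 2 else 1) *\<^sub>R (corner i :: real^'n::{finite,linorder})"
    (is "_ = ?c *\<^sub>R _")
  unfolding fundamental_coweight_def
proof (rule the_equality)
  show *: "\<forall>j\<in>{1..CARD('n)}. simple_root j \<bullet> (?c *\<^sub>R corner i :: real^'n::_) = (if j = i then 1 else 0)"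
    using i by (auto simp: simple_root_inner bary_corner bary_scale simp del: inner_scaleR_right)
  fix v :: "real^'n::_" assume v: "\<forall>j\<in>{1..CARD('n)}. simple_root j \<bullet> v = (if j = i then 1 else 0)"
  show "v = ?c *\<^sub>R corner i"
  proof (rule bary_eqI)
    fix j assume j: "j \<in> {1..CARD('n)}"
    have "simple_root j \<bullet> v = simple_root j \<bullet> (?c *\<^sub>R corner i :: real^'n::_)"
      using v[rule_format, OF j] *[rule_format, OF j] by (simp only:)
    then show "bary v j = bary (?c *\<^sub>R corner i :: real^'n::_) j"
      unfolding simple_root_inner[OF j] by (simp split: if_splits)
  qed
qed

lemma vertex_corner:
  assumes "i \<le> CARD('n)"
  shows "vertex i = (corner i :: real^'n::{finite,linorder})"
proof (cases "i = 0")
  case True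
  have "(0 :: real^'n::_) = corner 0"
    by (rule ext_eqI) (subst ext_corner, auto simp: ext_def)
  then show ?thesis using True by (simp add: vertex_def)
next
  case False
  then have i: "i \<in> {1..CARD('n)}" using assms by simp
  have "highest_root \<bullet> (corner i :: real^'n::_) = 1"
    unfolding highest_root_inner ext_corner[OF assms] using False by simp
  then show ?thesis
    using False by (simp add: vertex_def fundamental_coweight_corner[OF i])
qed

lemma bary_vertex: "i \<le> CARD('n) \<Longrightarrow> bary (vertex i :: real^'n::{finite,linorder}) j = (if j = i then 1 else 0)"
  by (simp add: vertex_corner bary_corner)

lemma inj_vertex: "inj_on (vertex :: nat \<Rightarrow> real^'n::{finite,linorder}) {0..CARD('n)}"
proof (rule inj_onI)
  fix i j assume ij: "i \<in> {0..CARD('n)}" "j \<in> {0..CARD('n)}" "vertex i = (vertex j :: real^'n::_)"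
  have "bary (vertex j :: real^'n::_) i = 1" unfolding ij(3)[symmetric] using ij(1) by (simp add: bary_vertex)
  then show "i = j" using ij(2) by (simp add: bary_vertex split: if_splits)
qed

lemma bary_expansion: "v = (\<Sum>j\<in>{0..CARD('n)}. bary v j *\<^sub>R (vertex j :: real^'n::{finite,linorder}))"
proof (rule ext_eqI)
  fix k assume k: "k \<in> {1..CARD('n)}"
  have "ext (\<Sum>j\<in>{0..CARD('n)}. bary v j *\<^sub>R (vertex j :: real^'n::_)) k
      = (\<Sum>j\<in>{0..CARD('n)}. bary v j * ext (vertex j :: real^'n::_) k)"
    unfolding ext_idx[OF k] by (simp add: sum_component)
  also have "\<dots> = (\<Sum>j\<in>{0..CARD('n)}. if k \<le> j then bary v j / 2 else 0)"
    by (intro sum.cong) (auto simp: vertex_corner ext_corner)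
  also have "\<dots> = (\<Sum>j\<in>{k..CARD('n)}. bary v j / 2)"
    by (rule sum.mono_neutral_cong_right) auto
  also have "\<dots> = ext v k" using k by (simp add: sum_bary flip: sum_divide_distrib)
  finally show "ext v k = ext (\<Sum>j\<in>{0..CARD('n)}. bary v j *\<^sub>R (vertex j :: real^'n::_)) k" ..
qed

text \<open>Descriptions of the hull of a finite set take weights indexed by points, so the
  barycentric coordinates are transported along the inverse of \<open>vertex\<close>.\<close>

lemma bary_combination:
  fixes v :: "real^'n::{finite,linorder}"
  assumes J: "J \<subseteq> {0..CARD('n)}" and v: "\<forall>i\<in>{0..CARD('n)} - J. bary v i = 0"
  defines "u \<equiv> \<lambda>x. bary v (inv_into {0..CARD('n)} vertex x)"
  shows "sum u (vertex ` J) = 1" "(\<Sum>x\<in>vertex ` J. u x *\<^sub>R x) = v" "j \<in> J \<Longrightarrow> u (vertex j) = bary v j"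
proof -
  have inj: "inj_on (vertex :: nat \<Rightarrow> real^'n::_) J" by (rule inj_on_subset[OF inj_vertex J])
  show u: "u (vertex j) = bary v j" if "j \<in> J" for j
    using inv_into_f_f[OF inj_vertex[where 'n = 'n], of j] J that unfolding u_def by auto
  have "sum u (vertex ` J) = (\<Sum>j\<in>J. bary v j)" unfolding sum.reindex[OF inj] by (simp add: u)
  also have "\<dots> = (\<Sum>j\<in>{0..CARD('n)}. bary v j)" by (rule sum.mono_neutral_left) (use J v in auto)
  finally show "sum u (vertex ` J) = 1" by (simp add: sum_bary)
  have "(\<Sum>x\<in>vertex ` J. u x *\<^sub>R x) = (\<Sum>j\<in>J. bary v j *\<^sub>R vertex j)"
    unfolding sum.reindex[OF inj] by (simp add: u)
  also have "\<dots> = (\<Sum>j\<in>{0..CARD('n)}. bary v j *\<^sub>R vertex j)" by (rule sum.mono_neutral_left) (use J v in auto)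
  finally show "(\<Sum>x\<in>vertex ` J. u x *\<^sub>R x) = v" by (simp flip: bary_expansion)
qed

lemma affine_hull_vertices:
  assumes J: "J \<subseteq> {0..CARD('n)}"
  shows "affine hull (vertex ` J) = {v :: real^'n::{finite,linorder}. \<forall>i\<in>{0..CARD('n)} - J. bary v i = 0}"
proof
  show "affine hull (vertex ` J) \<subseteq> {v :: real^'n::_. \<forall>i\<in>{0..CARD('n)} - J. bary v i = 0}"
    using J by (intro hull_minimal) (auto simp: affine_def bary_affine bary_vertex)
next
  have "finite J" using J finite_subset by blast
  then show "{v :: real^'n::_. \<forall>i\<in>{0..CARD('n)} - J. bary v i = 0} \<subseteq> affine hull (vertex ` J)"
    using bary_combination(1,2)[OF J] by (subst affine_hull_finite) blast+
qed

lemma closed_alcove_eq: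
  "closed_alcove = {v :: real^'n::{finite,linorder}. \<forall>i\<le>CARD('n). bary v i \<ge> 0}"
proof
  show "closed_alcove \<subseteq> {v :: real^'n::_. \<forall>i\<le>CARD('n). bary v i \<ge> 0}"
    unfolding closed_alcove_def
    by (intro hull_minimal) (auto simp: convex_def bary_affine bary_vertex)
next
  show "{v :: real^'n::_. \<forall>i\<le>CARD('n). bary v i \<ge> 0} \<subseteq> closed_alcove"
  proof
    fix v :: "real^'n::_" assume "v \<in> {v. \<forall>i\<le>CARD('n). bary v i \<ge> 0}"
    then show "v \<in> closed_alcove"
      using bary_combination[of "{0..CARD('n)}" v] unfolding closed_alcove_def
      by (subst convex_hull_finite) (auto intro!: exI[of _ "\<lambda>x. bary v (inv_into {0..CARD('n)} vertex x)"])
  qed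
qed

lemma wall_eq:
  assumes "i \<le> CARD('n)"
  shows "wall i = {v :: real^'n::{finite,linorder}. bary v i = 0}"
proof -
  have "{0..CARD('n)} - ({0..CARD('n)} - {i}) = {i}" using assms by auto
  then show ?thesis unfolding wall_def by (subst affine_hull_vertices) auto
qed

lemma vertex_in_wall: "i \<le> CARD('n) \<Longrightarrow> j \<le> CARD('n) \<Longrightarrow> vertex j \<in> (wall i :: (real^'n::{finite,linorder}) set) \<longleftrightarrow> j \<noteq> i"
  by (auto simp: wall_eq bary_vertex)

lemma wall_props:
  assumes "i \<le> CARD('n)"
  shows "affine (wall i :: (real^'n::{finite,linorder}) set)" "closed (wall i :: (real^'n::_) set)"
    "(wall i :: (real^'n::_) set) \<noteq> {}"
proof -
  show "affine (wall i :: (real^'n::_) set)" by (simp add: wall_def)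
  then show "closed (wall i :: (real^'n::_) set)" by (rule affine_closed)
  have "(if i = 0 then 1 else 0) \<le> CARD('n)" "(if i = 0 then 1 else 0) \<noteq> i"
    using zero_less_card_finite[where 'a = 'n] by (auto simp: Suc_le_eq)
  then obtain j where "j \<le> CARD('n)" "j \<noteq> i" by blast
  then show "(wall i :: (real^'n::_) set) \<noteq> {}" using vertex_in_wall assms by blast
qed

lemma wall_reflection_fixed:
  assumes "i \<le> CARD('n)"
  shows "wall_reflection i x = x \<longleftrightarrow> x \<in> (wall i :: (real^'n::{finite,linorder}) set)"
proof -
  have "wall_reflection i x = x \<longleftrightarrow> 2 *\<^sub>R closest_point (wall i) x = 2 *\<^sub>R x"
    by (auto simp: wall_reflection_def diff_eq_eq scaleR_2)
  also have "\<dots> \<longleftrightarrow> closest_point (wall i) x = x" by simp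
  also have "\<dots> \<longleftrightarrow> x \<in> wall i"
    using closest_point_in_set[OF wall_props(2,3)[OF assms]] closest_point_self by metis
  finally show ?thesis .
qed

lemma inj_wall_reflection: "inj_on (wall_reflection :: nat \<Rightarrow> real^'n::{finite,linorder} \<Rightarrow> _) {0..CARD('n)}"
proof (rule inj_onI)
  fix i j assume ij: "i \<in> {0..CARD('n)}" "j \<in> {0..CARD('n)}" "wall_reflection i = (wall_reflection j :: real^'n::_ \<Rightarrow> _)"
  then have "vertex i \<in> (wall i :: (real^'n::_) set) \<longleftrightarrow> vertex i \<in> (wall j :: (real^'n::_) set)"
    by (simp flip: wall_reflection_fixed)
  then show "i = j" using ij(1,2) by (auto simp: vertex_in_wall)
qed

lemma vertices_independent: "\<not> affine_dependent (vertex ` {0..CARD('n)} :: (real^'n::{finite,linorder}) set)"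
proof
  assume "affine_dependent (vertex ` {0..CARD('n)} :: (real^'n::_) set)"
  then obtain i where i: "i \<in> {0..CARD('n)}"
    "(vertex i :: real^'n::_) \<in> affine hull (vertex ` {0..CARD('n)} - {vertex i})"
    unfolding affine_dependent_def by blast
  have "vertex ` {0..CARD('n)} - {vertex i} = (vertex ` ({0..CARD('n)} - {i}) :: (real^'n::_) set)"
    using inj_on_image_set_diff[OF inj_vertex[where 'n = 'n], of "{0..CARD('n)}" "{i}"] i(1) by auto
  then show False using i vertex_in_wall[of i i, where 'n = 'n] by (simp add: wall_def)
qed

text \<open>Faces of a simplex are spanned by subsets of its vertices. Walls are affine, so whether
  one contains F depends only on the affine hull, which passing to the relative interior does not
  change.\<close>

lemma alcove_faceE:
  assumes "alcove_face (F :: (real^'n::{finite,linorder}) set)"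
  obtains I where "I \<subseteq> {0..CARD('n)}" "I \<noteq> {}" "affine hull F = affine hull (vertex ` I)"
    "face_reflections F = wall_reflection ` ({0..CARD('n)} - I)" "face_coreflections F = wall_reflection ` I"
proof -
  obtain T where T: "T face_of closed_alcove" "T \<noteq> {}" "F = rel_interior T"
    using assms unfolding alcove_face_def by blast
  obtain c where c: "c \<subseteq> vertex ` {0..CARD('n)}" "T = convex hull c"
    using T(1) unfolding closed_alcove_def face_of_convex_hull_affine_independent[OF vertices_independent] by blast
  obtain I where I: "I \<subseteq> {0..CARD('n)}" "c = vertex ` I" using c(1) by (auto simp: subset_image_iff)
  have ne: "I \<noteq> {}" using T(2) c(2) I(2) by auto
  have aff: "affine hull F = affine hull (vertex ` I)"
    unfolding T(3) c(2) I(2) by (simp add: rel_interior_same_affine_hull)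
  have sub: "F \<subseteq> wall i \<longleftrightarrow> i \<notin> I" if i: "i \<in> {0..CARD('n)}" for i
  proof -
    have "affine (wall i :: (real^'n::_) set)" using wall_props(1) i by simp
    then have "F \<subseteq> wall i \<longleftrightarrow> affine hull F \<subseteq> wall i" "vertex ` I \<subseteq> (wall i :: (real^'n::_) set) \<longleftrightarrow> affine hull (vertex ` I) \<subseteq> (wall i :: (real^'n::_) set)"
      by (simp_all add: subset_hull)
    then have "F \<subseteq> wall i \<longleftrightarrow> vertex ` I \<subseteq> (wall i :: (real^'n::_) set)" by (simp only: aff)
    also have "\<dots> \<longleftrightarrow> (\<forall>j\<in>I. vertex j \<in> (wall i :: (real^'n::_) set))" by blast
    also have "\<dots> \<longleftrightarrow> (\<forall>j\<in>I. j \<noteq> i)" using vertex_in_wall i I(1) by (intro ball_cong) auto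
    finally show ?thesis by blast
  qed
  have refl: "face_reflections F = wall_reflection ` ({0..CARD('n)} - I)"
    unfolding face_reflections_def using sub by blast
  have "face_coreflections F = wall_reflection ` I"
    unfolding face_coreflections_def simple_reflections_def refl
    using inj_on_image_set_diff[OF inj_wall_reflection[where 'n = 'n], of "{0..CARD('n)}" "{0..CARD('n)} - I"] I(1)
    by (simp add: double_diff)
  then show ?thesis using that I(1) ne aff refl by blast
qed

text \<open>The flat of a face is the common fixed space of the reflections of that face, so
  conjugating these reflections transports the flat.\<close>

lemma affine_hull_fixed:
  assumes I: "I \<subseteq> {0..CARD('n)}"
  shows "affine hull (vertex ` I) =
    {x :: real^'n::{finite,linorder}. \<forall>s\<in>wall_reflection ` ({0..CARD('n)} - I). s x = x}"
  unfolding affine_hull_vertices[OF I] by (auto simp: wall_reflection_fixed wall_eq)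

lemma fixed_conj_set:
  assumes "bij w"
  shows "{x. \<forall>s\<in>conj_set w S. s x = x} = w ` {x. \<forall>s\<in>S. s x = x}"
proof -
  have inv: "inv_into UNIV w (w x) = x" "w (inv_into UNIV w x) = x" for x
    using assms by (simp_all add: bij_is_inj bij_is_surj surj_f_inv_f)
  have "(\<forall>s\<in>conj_set w S. s (w x) = w x) \<longleftrightarrow> (\<forall>s\<in>S. s x = x)" for x
    using bij_is_inj[OF assms] by (simp add: conj_set_def inv inj_eq)
  then have *: "w x \<in> {x. \<forall>s\<in>conj_set w S. s x = x} \<longleftrightarrow> x \<in> {x. \<forall>s\<in>S. s x = x}" for x by simp
  show ?thesis
  proof (intro equalityI subsetI)
    fix x assume "x \<in> {x. \<forall>s\<in>conj_set w S. s x = x}"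
    then have "inv_into UNIV w x \<in> {x. \<forall>s\<in>S. s x = x}" using *[of "inv_into UNIV w x"] inv(2) by simp
    then show "x \<in> w ` {x. \<forall>s\<in>S. s x = x}" by (rule rev_image_eqI) (simp add: inv(2))
  qed (use * in blast)
qed

section \<open>Complexified flats and their images under the cosine\<close>

definition cext :: "complex^'n::{finite,linorder} \<Rightarrow> nat \<Rightarrow> complex" where
  "cext z k = (if k = 0 then 1/2 else if k \<le> CARD('n) then z $ idx k else 0)"

lemma cosmap_cext: "cosmap z k = cos (2 * pi * cext z k)"
  by (simp add: cosmap_def cext_def)

lemma complexify_vertices:
  assumes I: "I \<subseteq> {0..CARD('n)}"
  shows "complexify (affine hull (vertex ` I)) =
    {z :: complex^'n::{finite,linorder}. \<forall>i\<in>{0..CARD('n)} - I. cext z i = cext z (Suc i)}"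
proof -
  have mem: "x \<in> affine hull (vertex ` I) \<longleftrightarrow> (\<forall>i\<in>{0..CARD('n)} - I. ext x i = ext x (Suc i))" for x :: "real^'n::_"
    unfolding affine_hull_vertices[OF I] by (simp add: bary_def)
  show ?thesis
  proof (intro equalityI subsetI)
    fix z :: "complex^'n::_" assume "z \<in> complexify (affine hull (vertex ` I))"
    then obtain x a b where z: "z = complex_point x (a - b)"
      and xab: "x \<in> affine hull (vertex ` I)" "a \<in> affine hull (vertex ` I)" "b \<in> affine hull (vertex ` I)"
      unfolding complexify_def direction_def by blast
    have "cext z k = Complex (ext x k) (ext a k - ext b k)" for k
      by (simp add: z cext_def ext_def complex_point_def complex_eq_iff)
    then show "z \<in> {z. \<forall>i\<in>{0..CARD('n)} - I. cext z i = cext z (Suc i)}"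
      using xab unfolding mem by simp
  next
    fix z :: "complex^'n::_" assume z: "z \<in> {z. \<forall>i\<in>{0..CARD('n)} - I. cext z i = cext z (Suc i)}"
    define x :: "real^'n::_" where "x = (\<chi> i. Re (z $ i))"
    \<comment> \<open>The imaginary part has to be a difference of two points of the flat; a is x
      moved by it.\<close>
    define a :: "real^'n::_" where "a = (\<chi> i. Re (z $ i) + Im (z $ i))"
    have "ext x k = Re (cext z k)" "ext a k = Re (cext z k) + Im (cext z k)" for k
      by (simp_all add: x_def a_def cext_def ext_def)
    then have "x \<in> affine hull (vertex ` I)" "a \<in> affine hull (vertex ` I)" unfolding mem using z by auto
    moreover have "z = complex_point x (a - x)"
      by (simp add: x_def a_def complex_point_def vec_eq_iff complex_eq_iff)
    ultimately show "z \<in> complexify (affine hull (vertex ` I))"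
      unfolding complexify_def direction_def by blast
  qed
qed

text \<open>One branch of the arccosine is applied to every coordinate: equal coordinates get equal
  preimages, and its values \<pi> at -1 and 0 at 1 agree with the boundary values 1/2 and 0 of
  \<open>cext\<close>.\<close>

lemma cosmap_complexify:
  assumes I: "I \<subseteq> {0..CARD('n)}"
  shows "cosmap ` complexify (affine hull (vertex ` I) :: (real^'n::{finite,linorder}) set) = flat CARD('n) I"
  unfolding complexify_vertices[OF I]
proof (intro equalityI subsetI)
  fix y assume "y \<in> cosmap ` {z :: complex^'n::_. \<forall>i\<in>{0..CARD('n)} - I. cext z i = cext z (Suc i)}"
  then show "y \<in> flat CARD('n) I"
    by (auto simp: flat_def cosmap_cext) (auto simp: cext_def)
next
  fix y assume y: "y \<in> flat CARD('n) I"
  then have y01: "y 0 = -1" "\<And>k. k > CARD('n) \<Longrightarrow> y k = 1" by (auto simp: flat_def)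
  define z :: "complex^'n::_" where "z = (\<chi> i. Arccos (y (inv_into {1..CARD('n)} idx i)) / (2 * pi))"
  have z: "cext z k = Arccos (y k) / (2 * pi)" for k
  proof (cases "k \<in> {1..CARD('n)}")
    case True
    then show ?thesis using inv_idx[OF True] by (simp add: cext_def z_def)
  next
    case False
    then consider "k = 0" | "k > CARD('n)" by fastforce
    then show ?thesis by cases (simp_all add: cext_def y01 Arccos_minus1)
  qed
  have "cosmap z = y" by (simp add: fun_eq_iff cosmap_cext z)
  moreover have "\<forall>i\<in>{0..CARD('n)} - I. cext z i = cext z (Suc i)"
  proof
    fix i assume "i \<in> {0..CARD('n)} - I"
    then have "y i = y (Suc i)" using y unfolding flat_def by blast
    then show "cext z i = cext z (Suc i)" by (simp only: z)
  qed
  ultimately show "y \<in> cosmap ` {z :: complex^'n::_. \<forall>i\<in>{0..CARD('n)} - I. cext z i = cext z (Suc i)}" by blast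
qed

section \<open>The stabiliser of the alcove\<close>

text \<open>The nontrivial element of K. Replacing v by 1/2 - v changes the sign of the cosine, so
  in cosine coordinates this is the signed reversal.\<close>

definition alcove_flip :: "real^'n::{finite,linorder} \<Rightarrow> real^'n::_" where
  "alcove_flip v = (\<chi> i. 1/2 - v $ idx (Suc CARD('n) - inv_into {1..CARD('n)} idx i))"

lemma ext_flip:
  fixes v :: "real^'n::{finite,linorder}"
  assumes "k \<le> Suc CARD('n)"
  shows "ext (alcove_flip v) k = 1/2 - ext v (Suc CARD('n) - k)"
proof (cases "k \<in> {1..CARD('n)}")
  case True
  then have "Suc CARD('n) - k \<in> {1..CARD('n)}" by auto
  then show ?thesis using True by (simp only: ext_idx alcove_flip_def vec_lambda_beta inv_idx)
next
  case False
  then have "k = 0 \<or> k = Suc CARD('n)" using assms by auto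
  then show ?thesis by auto
qed

lemma bary_flip:
  fixes v :: "real^'n::{finite,linorder}"
  assumes "j \<le> CARD('n)"
  shows "bary (alcove_flip v) j = bary v (CARD('n) - j)"
proof -
  have "Suc CARD('n) - j = Suc (CARD('n) - j)" using assms by simp
  then show ?thesis using assms by (simp add: bary_def ext_flip)
qed

lemma flip_flip: "alcove_flip (alcove_flip v) = v"
  by (rule bary_eqI) (simp add: bary_flip)

lemma flip_vertex: "i \<le> CARD('n) \<Longrightarrow> alcove_flip (vertex i) = (vertex (CARD('n) - i) :: real^'n::{finite,linorder})"
  by (rule bary_eqI) (auto simp: bary_flip bary_vertex)

lemma flip_signed_map:
  obtains \<sigma> where "bij \<sigma>" "alcove_flip = signed_map \<sigma> (\<lambda>_. -1) (\<chi> i. 1/2 :: real^'n::{finite,linorder})"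
proof -
  let ?inv = "inv_into {1..CARD('n)} idx :: 'n \<Rightarrow> nat"
  define \<sigma> :: "'n \<Rightarrow> 'n" where "\<sigma> = idx \<circ> (\<lambda>k. Suc CARD('n) - k) \<circ> ?inv"
  have "bij_betw (\<lambda>k. Suc CARD('n) - k) {1..CARD('n)} {1..CARD('n)}"
    by (rule bij_betw_byWitness[where f' = "\<lambda>k. Suc CARD('n) - k"]) auto
  from bij_betw_trans[OF bij_betw_trans[OF bij_betw_inv_into[OF bij_betw_idx[where 'n = 'n]] this] bij_betw_idx[where 'n = 'n]]
  have "bij \<sigma>" by (simp only: \<sigma>_def comp_assoc)
  moreover have "alcove_flip = signed_map \<sigma> (\<lambda>_. -1) (\<chi> i. 1/2 :: real^'n::_)"
    by (simp add: fun_eq_iff vec_eq_iff alcove_flip_def \<sigma>_def)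
  ultimately show ?thesis by (rule that)
qed

lemma flip_in_alcove_group: "alcove_flip \<in> (alcove_group :: (real^'n::{finite,linorder} \<Rightarrow> real^'n::_) set)"
proof -
  obtain \<sigma> where \<sigma>: "bij \<sigma>" "alcove_flip = signed_map \<sigma> (\<lambda>_. -1) (\<chi> i. 1/2 :: real^'n::_)" by (rule flip_signed_map)
  have "(\<chi> i. 1/2 :: real^'n::_) \<in> coweight_lattice" by (simp add: coweight_lattice_eq)
  moreover have "signs (\<lambda>_ :: 'n. -1)" by (simp add: signs_def)
  ultimately have "alcove_flip \<in> (affine_weyl coweight_lattice :: (real^'n::_ \<Rightarrow> real^'n::_) set)"
    unfolding affine_weyl_eq \<sigma>(2) using \<sigma>(1) by blast
  moreover have sub: "alcove_flip ` closed_alcove \<subseteq> (closed_alcove :: (real^'n::_) set)"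
    by (auto simp: closed_alcove_eq bary_flip)
  moreover have "closed_alcove \<subseteq> alcove_flip ` (closed_alcove :: (real^'n::_) set)"
    using sub flip_flip by (metis image_eqI image_subset_iff subsetI)
  ultimately show ?thesis unfolding alcove_group_def by blast
qed

lemma id_in_alcove_group: "id \<in> (alcove_group :: (real^'n::{finite,linorder} \<Rightarrow> real^'n::_) set)"
  using id_affine_weyl[of coweight_lattice "{1, -1}"] by (simp add: alcove_group_def sign_lattice_def)

lemma vertex_in_closed_alcove: "i \<le> CARD('n) \<Longrightarrow> vertex i \<in> (closed_alcove :: (real^'n::{finite,linorder}) set)"
  by (simp add: closed_alcove_eq bary_vertex)

lemma alcove_decreasing:
  fixes v :: "real^'n::{finite,linorder}"
  assumes "v \<in> closed_alcove" "k \<le> l" "l \<le> Suc CARD('n)"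
  shows "ext v l \<le> ext v k"
  using assms(2,3)
proof (induction l rule: dec_induct)
  case (step l)
  then have "bary v l \<ge> 0" using assms(1) by (simp add: closed_alcove_eq)
  then show ?case using step by (simp add: bary_def)
qed simp

text \<open>Strict monotonicity gives \<open>k \<le> \<tau> k\<close> for every k, and both sides
  have the same sum, so equality holds throughout.\<close>

lemma strict_mono_permutation_id:
  assumes perm: "\<tau> permutes {1..m::nat}" and mono: "\<And>k l. k \<in> {1..m} \<Longrightarrow> l \<in> {1..m} \<Longrightarrow> k < l \<Longrightarrow> \<tau> k < \<tau> l"
    and k: "k \<in> {1..m}"
  shows "\<tau> k = k"
proof -
  have ge: "k \<in> {1..m} \<longrightarrow> k \<le> \<tau> k" for k
  proof (induction k)
    case (Suc k)
    show ?case
    proof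
      assume k: "Suc k \<in> {1..m}"
      show "Suc k \<le> \<tau> (Suc k)"
      proof (cases "k = 0")
        case True
        then show ?thesis using permutes_in_image[OF perm, of "Suc k"] k by simp
      next
        case False
        then show ?thesis using Suc mono[of k "Suc k"] k by simp
      qed
    qed
  qed simp
  have "(\<Sum>k\<in>{1..m}. k) = (\<Sum>k\<in>{1..m}. \<tau> k)" using sum.permute[OF perm, of "\<lambda>k. k"] by (simp add: comp_def)
  from sum_mono_inv[OF this, of k] show ?thesis using ge k by auto
qed

text \<open>Points of the alcove have decreasing coordinates between 1/2 and 0. The image of the
  last vertex excludes negative signs, and the images of the vertices with index
  \<open>\<tau> l\<close> show that \<tau> is increasing, hence the identity.\<close>

lemma alcove_group_fixing_origin:
  fixes g :: "real^'n::{finite,linorder} \<Rightarrow> real^'n::_"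
  assumes g: "g \<in> affine_weyl coweight_lattice" "g ` closed_alcove \<subseteq> closed_alcove" and "g 0 = 0"
  shows "g = id"
proof -
  obtain \<sigma> s q where gq: "g = signed_map \<sigma> s q" "bij \<sigma>" "signs s"
    using g(1) unfolding affine_weyl_eq by blast
  have "q = g 0" by (simp add: gq(1) vec_eq_iff)
  then have gi: "g x $ i = s i * x $ \<sigma> i" for x i using assms(3) gq(1) by simp
  obtain \<tau> where perm: "\<tau> permutes {1..CARD('n)}" and idx\<tau>: "\<And>k. k \<in> {1..CARD('n)} \<Longrightarrow> idx (\<tau> k) = \<sigma> (idx k)"
    using idx_permutation[OF gq(2)] by blast
  have \<tau>in: "\<tau> k \<in> {1..CARD('n)}" if "k \<in> {1..CARD('n)}" for k using that permutes_in_image[OF perm] by blast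
  have ext_g: "ext (g x) k = s (idx k) * ext x (\<tau> k)" if k: "k \<in> {1..CARD('n)}" for x k
    unfolding ext_idx[OF k] ext_idx[OF \<tau>in[OF k]] gi idx\<tau>[OF k] ..
  have vert: "g (vertex i) \<in> closed_alcove" if "i \<le> CARD('n)" for i
    using g(2) vertex_in_closed_alcove[OF that] by blast
  have s: "s (idx k) = 1" if k: "k \<in> {1..CARD('n)}" for k
  proof -
    have "ext (g (vertex CARD('n))) (Suc CARD('n)) \<le> ext (g (vertex CARD('n))) k"
      using k by (intro alcove_decreasing vert) auto
    then have "0 \<le> s (idx k) * (1/2)"
      using \<tau>in[OF k] by (simp add: ext_g[OF k] vertex_corner ext_corner)
    then show ?thesis using gq(3) unfolding signs_def by (metis mult_minus_left neg_0_le_iff_le not_one_le_zero mult_1 zero_less_divide_1_iff zero_less_numeral not_le)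
  qed
  have "\<tau> k < \<tau> l" if kl: "k \<in> {1..CARD('n)}" "l \<in> {1..CARD('n)}" "k < l" for k l
  proof -
    have "\<tau> l \<le> CARD('n)" using \<tau>in[OF kl(2)] by simp
    then have "ext (g (vertex (\<tau> l))) l \<le> ext (g (vertex (\<tau> l))) k"
      using kl by (intro alcove_decreasing vert) auto
    then have "\<tau> k \<le> \<tau> l"
      using \<open>\<tau> l \<le> CARD('n)\<close> by (simp add: ext_g[OF kl(1)] ext_g[OF kl(2)] s[OF kl(1)] s[OF kl(2)] vertex_corner ext_corner split: if_splits)
    moreover have "\<tau> k \<noteq> \<tau> l" using permutes_inj[OF perm] kl(3) by (auto dest: injD)
    ultimately show ?thesis by simp
  qed
  then have \<tau>: "\<tau> k = k" if "k \<in> {1..CARD('n)}" for k using strict_mono_permutation_id[OF perm] that by blast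
  have "g x = x" for x
    by (rule ext_eqI) (simp only: ext_g s \<tau> mult_1)
  then show ?thesis by (simp add: fun_eq_iff)
qed

text \<open>The image of the origin is a coweight in the alcove, so its coordinates lie between 0
  and 1/2 and are either all 0 or all 1/2. In the second case composing with the flip brings it back
  to the origin.\<close>

lemma alcove_group_eq: "alcove_group = {id, alcove_flip :: real^'n::{finite,linorder} \<Rightarrow> real^'n::_}"
proof (intro equalityI subsetI)
  fix g :: "real^'n::_ \<Rightarrow> real^'n::_" assume "g \<in> alcove_group"
  then have g: "g \<in> affine_weyl coweight_lattice" "g ` closed_alcove = closed_alcove" by (auto simp: alcove_group_def)
  obtain \<sigma> s q where gq: "g = signed_map \<sigma> s q" "q \<in> coweight_lattice" using g(1) unfolding affine_weyl_eq by blast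
  have q: "q = g 0" by (simp add: gq(1) vec_eq_iff)
  have "(0 :: real^'n::_) = vertex 0" by (simp add: vertex_def)
  then have "(0 :: real^'n::_) \<in> closed_alcove" using vertex_in_closed_alcove[of 0, where 'n = 'n] by simp
  then have "q \<in> closed_alcove" unfolding q using g(2) by blast
  then have range: "0 \<le> ext q k" "ext q k \<le> 1/2" if "k \<in> {1..CARD('n)}" for k
    using alcove_decreasing[of q 0 k] alcove_decreasing[of q k "Suc CARD('n)"] that by auto
  have range: "0 \<le> q $ i" "q $ i \<le> 1/2" for i
    using range ext_idx[of _ q] idx_surj[of i] by force+
  show "g \<in> {id, alcove_flip}"
  proof (cases "\<forall>i. q $ i \<in> \<int>")
    case True
    have "q $ i = 0" for i
    proof -
      obtain m where m: "q $ i = of_int m" using True by (auto elim: Ints_cases)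
      have "of_int m \<ge> (0 :: real)" "of_int m < (1 :: real)" using range[of i] unfolding m by linarith+
      then show ?thesis using m by simp
    qed
    then have "g 0 = 0" unfolding q[symmetric] by (simp add: vec_eq_iff)
    then show ?thesis using alcove_group_fixing_origin[OF g(1)] g(2) by blast
  next
    case False
    then have half: "q $ i - 1/2 \<in> \<int>" for i using gq(2) by (auto simp: coweight_lattice_eq)
    have "q $ i = 1/2" for i
    proof -
      obtain m where m: "q $ i - 1/2 = of_int m" using half[of i] by (auto elim: Ints_cases)
      have "of_int m > (-1 :: real)" "of_int m \<le> (0 :: real)" using range[of i] unfolding m[symmetric] by linarith+
      then have "m = 0" by linarith
      then show ?thesis using m by simp
    qed
    then have "alcove_flip (g 0) = 0" unfolding q[symmetric] by (simp add: vec_eq_iff alcove_flip_def)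
    moreover have "alcove_flip \<circ> g \<in> affine_weyl coweight_lattice"
      using flip_in_alcove_group g(1) by (intro affine_weyl_comp[of _ "{1, -1}"]) (auto simp: alcove_group_def sign_lattice_def)
    moreover have "(alcove_flip \<circ> g) ` closed_alcove \<subseteq> closed_alcove"
      using flip_in_alcove_group g(2) by (auto simp: alcove_group_def image_comp[symmetric])
    ultimately have *: "alcove_flip \<circ> g = id" by (intro alcove_group_fixing_origin) simp_all
    have "g = alcove_flip \<circ> (alcove_flip \<circ> g)" by (simp add: fun_eq_iff flip_flip)
    then show ?thesis unfolding * by simp
  qed
qed (use id_in_alcove_group flip_in_alcove_group in blast)

lemma vertex_stabiliser_trivial_iff:
  assumes "j \<le> CARD('n)"
  shows "vertex_stabiliser j = {id :: real^'n::{finite,linorder} \<Rightarrow> real^'n::_} \<longleftrightarrow> 2 * j \<noteq> CARD('n)"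
proof -
  have fixed: "alcove_flip (vertex j :: real^'n::_) = vertex j \<longleftrightarrow> CARD('n) - j = j"
    unfolding flip_vertex[OF assms] using inj_on_eq_iff[OF inj_vertex[where 'n = 'n], of "CARD('n) - j" j] assms by simp
  have "alcove_flip (vertex 0 :: real^'n::_) \<noteq> vertex 0"
    using flip_vertex[of 0, where 'n = 'n] inj_on_eq_iff[OF inj_vertex[where 'n = 'n], of "CARD('n)" 0] by simp
  then have ne: "alcove_flip \<noteq> (id :: real^'n::_ \<Rightarrow> _)" by (metis id_apply)
  have "vertex_stabiliser j = {id :: real^'n::_ \<Rightarrow> real^'n::_} \<longleftrightarrow> alcove_flip (vertex j :: real^'n::_) \<noteq> vertex j"
    unfolding vertex_stabiliser_def alcove_group_eq using ne by auto
  then show ?thesis unfolding fixed using assms by linarith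
qed

lemma dist_signed_map:
  fixes x y :: "real^'n::{finite,linorder}"
  assumes "bij \<sigma>" "signs s"
  shows "dist (signed_map \<sigma> s q x) (signed_map \<sigma> s q y) = dist x y"
proof -
  have "dist (signed_map \<sigma> s q x $ i) (signed_map \<sigma> s q y $ i) = dist (x $ \<sigma> i) (y $ \<sigma> i)" for i
    using assms(2)[unfolded signs_def, rule_format, of i] by (auto simp: dist_real_def)
  then have "dist (signed_map \<sigma> s q x) (signed_map \<sigma> s q y) = sqrt (\<Sum>i\<in>UNIV. (dist (x $ \<sigma> i) (y $ \<sigma> i))\<^sup>2)"
    by (simp only: dist_vec_def L2_set_def)
  also have "\<dots> = dist x y"
    unfolding dist_vec_def L2_set_def using sum.reindex_bij_betw[OF assms(1), of "\<lambda>i. (dist (x $ i) (y $ i))\<^sup>2"] by simp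
  finally show ?thesis .
qed

text \<open>The flip is an affine isometry exchanging the wall i with the wall \<open>n - i\<close>,
  so it carries closest points to closest points and thus conjugates the reflections.\<close>

lemma flip_reflection:
  fixes x :: "real^'n::{finite,linorder}"
  assumes i: "i \<le> CARD('n)"
  shows "alcove_flip (wall_reflection i (alcove_flip x)) = wall_reflection (CARD('n) - i) x"
proof -
  obtain \<sigma> where \<sigma>: "bij \<sigma>" "alcove_flip = signed_map \<sigma> (\<lambda>_. -1) (\<chi> i. 1/2 :: real^'n::_)" by (rule flip_signed_map)
  have "signs (\<lambda>_ :: 'n. -1)" by (simp add: signs_def)
  then have dist: "dist (alcove_flip y) (alcove_flip z) = dist y z" for y z :: "real^'n::_"
    unfolding \<sigma>(2) by (rule dist_signed_map[OF \<sigma>(1)])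
  have aff: "alcove_flip (2 *\<^sub>R y - z) = 2 *\<^sub>R alcove_flip y - alcove_flip z" for y z :: "real^'n::_"
    by (simp add: vec_eq_iff alcove_flip_def)
  have wall: "alcove_flip y \<in> wall (CARD('n) - i) \<longleftrightarrow> y \<in> wall i" for y :: "real^'n::_"
    using i by (simp add: wall_eq bary_flip)
  let ?c = "closest_point (wall i) (alcove_flip x)"
  have i': "CARD('n) - i \<le> CARD('n)" by simp
  have "alcove_flip ?c = closest_point (wall (CARD('n) - i)) x"
  proof (rule closest_point_unique)
    show "convex (wall (CARD('n) - i) :: (real^'n::_) set)" using wall_props(1)[OF i'] by (rule affine_imp_convex)
    show "closed (wall (CARD('n) - i) :: (real^'n::_) set)" by (rule wall_props(2)[OF i'])
    show "alcove_flip ?c \<in> wall (CARD('n) - i)"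
      unfolding wall by (rule closest_point_in_set[OF wall_props(2,3)[OF i]])
    show "\<forall>z\<in>wall (CARD('n) - i). dist x (alcove_flip ?c) \<le> dist x z"
    proof
      fix z :: "real^'n::_" assume "z \<in> wall (CARD('n) - i)"
      then have "alcove_flip z \<in> wall i" using wall[of "alcove_flip z"] by (simp only: flip_flip)
      then have "dist (alcove_flip x) ?c \<le> dist (alcove_flip x) (alcove_flip z)"
        by (rule closest_point_le[OF wall_props(2)[OF i]])
      then show "dist x (alcove_flip ?c) \<le> dist x z"
        using dist[of "alcove_flip x" ?c] dist[of x z] by (simp only: flip_flip)
    qed
  qed
  then show ?thesis by (simp add: wall_reflection_def aff flip_flip)
qed

lemma conj_set_flip:
  assumes "I \<subseteq> {0..CARD('n)}"
  shows "conj_set alcove_flip (wall_reflection ` I) =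
    (wall_reflection ` (\<lambda>i. CARD('n) - i) ` I :: (real^'n::{finite,linorder} \<Rightarrow> real^'n::_) set)"
proof -
  have "inv_into UNIV alcove_flip = (alcove_flip :: real^'n::_ \<Rightarrow> _)"
    using flip_flip by (intro inv_equality) auto
  then have "alcove_flip \<circ> wall_reflection i \<circ> inv_into UNIV alcove_flip = (wall_reflection (CARD('n) - i) :: real^'n::_ \<Rightarrow> _)"
    if "i \<in> I" for i
    using flip_reflection that assms by (force simp: fun_eq_iff)
  then show ?thesis unfolding conj_set_def image_image by (rule image_cong[OF refl])
qed

text \<open>The identity of K satisfies the condition trivially, so only the flip counts. It acts on
  indices by reversal and fixes the vertex j exactly when \<open>2 * j = n\<close>.\<close>

lemma alcove_group_condition:
  assumes I: "I \<subseteq> {0..CARD('n)}"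
  defines "C \<equiv> wall_reflection ` I :: (real^'n::{finite,linorder} \<Rightarrow> real^'n::_) set"
  shows "(\<forall>j\<in>{0..CARD('n)}. \<forall>k\<in>alcove_group.
      vertex_stabiliser j = {id :: real^'n::_ \<Rightarrow> real^'n::_} \<and> wall_reflection j \<in> C \<inter> conj_set k C \<longrightarrow> conj_set k C = C) \<longleftrightarrow>
    (\<forall>j\<in>I. CARD('n) - j \<in> I \<longrightarrow> 2 * j \<noteq> CARD('n) \<longrightarrow> (\<forall>i\<in>I. CARD('n) - i \<in> I))"
proof -
  let ?r = "\<lambda>i. CARD('n) - i"
  have rI: "?r ` I \<subseteq> {0..CARD('n)}" by auto
  have rr: "?r (?r i) = i" if "i \<in> I" for i using that I by auto
  have id: "conj_set id C = C" by (simp add: conj_set_def)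
  have memC: "wall_reflection j \<in> (wall_reflection ` J :: (real^'n::_ \<Rightarrow> real^'n::_) set) \<longleftrightarrow> j \<in> J"
    if "j \<in> {0..CARD('n)}" "J \<subseteq> {0..CARD('n)}" for j J
    by (rule inj_on_image_mem_iff[OF inj_wall_reflection[where 'n = 'n] that])
  have mem_r: "j \<in> ?r ` I \<longleftrightarrow> ?r j \<in> I" if "j \<in> {0..CARD('n)}" for j
  proof
    assume "?r j \<in> I"
    then show "j \<in> ?r ` I" by (rule rev_image_eqI) (use that in simp)
  qed (use rr in auto)
  have eq: "conj_set alcove_flip C = C \<longleftrightarrow> (\<forall>i\<in>I. ?r i \<in> I)"
  proof -
    have "conj_set alcove_flip C = C \<longleftrightarrow> ?r ` I = I"
      unfolding C_def conj_set_flip[OF I] by (rule inj_on_image_eq_iff[OF inj_wall_reflection[where 'n = 'n] rI I])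
    also have "\<dots> \<longleftrightarrow> (\<forall>i\<in>I. ?r i \<in> I)" using rr by (auto intro: rev_image_eqI)
    finally show ?thesis .
  qed
  have "(\<forall>k\<in>alcove_group. vertex_stabiliser j = {id :: real^'n::_ \<Rightarrow> real^'n::_} \<and>
      wall_reflection j \<in> C \<inter> conj_set k C \<longrightarrow> conj_set k C = C) \<longleftrightarrow>
      (2 * j \<noteq> CARD('n) \<and> j \<in> I \<and> ?r j \<in> I \<longrightarrow> (\<forall>i\<in>I. ?r i \<in> I))" if j: "j \<in> {0..CARD('n)}" for j
  proof -
    have "j \<le> CARD('n)" using j by simp
    then have "vertex_stabiliser j = {id :: real^'n::_ \<Rightarrow> real^'n::_} \<longleftrightarrow> 2 * j \<noteq> CARD('n)"
      by (rule vertex_stabiliser_trivial_iff)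
    moreover have "wall_reflection j \<in> C \<inter> conj_set alcove_flip C \<longleftrightarrow> j \<in> I \<and> ?r j \<in> I"
      unfolding C_def conj_set_flip[OF I] Int_iff memC[OF j I] memC[OF j rI] mem_r[OF j] ..
    ultimately show ?thesis unfolding alcove_group_eq ball_simps using id eq by simp
  qed
  then show ?thesis using I by (auto 0 3)
qed

theorem proposition9p10:
  fixes F F' L :: "(real^'n::{finite,linorder}) set"
  assumes "CARD('n) \<ge> 2"
    and "alcove_face F"
    and "alcove_face F'" and "face_reflections F' \<in> coxeter_class (face_reflections F)"
    and "L = affine hull F'"
  shows "normal_variety coweight_lattice (stratum coweight_lattice L) \<longleftrightarrow>
     normal_variety coroot_lattice (stratum coroot_lattice L) \<and>
     (\<forall>j\<in>{0..CARD('n)}. \<forall>k\<in>alcove_group.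
        vertex_stabiliser j = {id :: real^'n::_ \<Rightarrow> real^'n::_} \<and>
        wall_reflection j \<in> face_coreflections F \<inter> conj_set k (face_coreflections F) \<longrightarrow>
        conj_set k (face_coreflections F) = face_coreflections F)"
proof -
  obtain I where FI: "I \<subseteq> {0..CARD('n)}" "I \<noteq> {}"
    "face_reflections F = wall_reflection ` ({0..CARD('n)} - I)" "face_coreflections F = wall_reflection ` I"
    using alcove_faceE[OF assms(2)] by metis
  obtain J where J: "J \<subseteq> {0..CARD('n)}" "affine hull F' = affine hull (vertex ` J)"
    "face_reflections F' = wall_reflection ` ({0..CARD('n)} - J)"
    using alcove_faceE[OF assms(3)] by metis
  obtain w where w: "w \<in> affine_weyl coroot_lattice" "face_reflections F' = conj_set w (face_reflections F)"
    using assms(4) unfolding coxeter_class_def by blast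
  have "bij w"
    using affine_weyl_inverse[of coroot_lattice "{1}", OF _ w(1)] by (auto simp: sign_lattice_def intro: o_bij)
  \<comment> \<open>Both flats are the fixed spaces of their reflections, and conjugation by w moves
    one fixed space to the other.\<close>
  have L: "L = w ` (affine hull (vertex ` I))"
    unfolding assms(5) J(2) affine_hull_fixed[OF J(1)] J(3)[symmetric] w(2) fixed_conj_set[OF \<open>bij w\<close>]
    unfolding FI(3) affine_hull_fixed[OF FI(1)] ..
  interpret alcove_flat "CARD('n)" I by unfold_locales (rule FI)+
  note normal = stratum_normal[OF refl w(1) cosmap_complexify[OF FI(1)]]
  show ?thesis unfolding L normal FI(4) alcove_group_condition[OF FI(1)] ..
qed

end
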